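(* Let $\mathbb{K}$ be a local field, $G$ be a Lie group over $\mathbb{K}$ and $\alpha$ be an analytic automorphism of $G$. Then the following conditions are equivalent: (a) $\alpha$ is expansive; (b) $\beta:=L(\alpha)\colon L(G)\to L(G)$ is expansive; (c) $1\notin R(\beta)$. If $\alpha$ is expansive, then $L(G)$ is a nilpotent Lie algebra.
   Context: A local field is a totally disconnected, locally compact, non-discrete topological field $\mathbb{K}$ (of any characteristic); $|\cdot|$ denotes an absolute value on $\mathbb{K}$ defining its topology, and also its unique extension to an absolute value on an algebraic closure $\overline{\mathbb{K}}$. Lie groups over $\mathbb{K}$ are analytic and finite-dimensional; analytic automorphisms are group automorphisms that are analytic together with their inverse. $L(G)=T_1(G)$ is the Lie algebra of $G$ (a finite-dimensional $\mathbb{K}$-vector space with its usual topology, regarded as a topological group under addition when speaking of expansiveness), and $L(\alpha)$ is the Lie algebra automorphism induced by $\alpha$ (its tangent map at $1$). For a $\mathbb{K}$-linear automorphism $\beta$ of a finite-dimensional $\mathbb{K}$-vector space, $R(\beta)$ is the set of all absolute values $|\lambda|$ of zeros $\lambda\in\overline{\mathbb{K}}$ of the characteristic polynomial of $\beta$. An automorphism $\alpha$ of a topological group $G$ is expansive if $\bigcap_{n\in\mathbb{Z}}\alpha^n(U)$ is the trivial subgroup for some identity neighbourhood $U\subseteq G$. *)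

theory Defs
  imports
    "HOL-Analysis.Analysis"
    "HOL-Algebra.Algebraic_Closure_Type"
    "HOL-Library.Function_Algebras"
    "Jordan_Normal_Form.Char_Poly"
begin

section \<open>Local fields and absolute values\<close>

class local_field = Fields.field + topological_group_add + topological_semigroup_mult
    + t2_space + perfect_space +
  assumes tendsto_inverse_local_field: "a \<noteq> 0 \<Longrightarrow> (inverse \<longlongrightarrow> inverse a) (at a)"
    and locally_compact_local_field: "\<exists>U K. open U \<and> compact K \<and> a \<in> U \<and> U \<subseteq> K"
    and totally_disconnected_local_field: "connected S \<Longrightarrow> \<exists>a. S \<subseteq> {a}"

definition absolute_value :: "('a::Fields.field \<Rightarrow> real) \<Rightarrow> bool" where
  "absolute_value v \<longleftrightarrow>
     (\<forall>x. 0 \<le> v x) \<and> (\<forall>x. v x = 0 \<longleftrightarrow> x = 0) \<and>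
     (\<forall>x y. v (x * y) = v x * v y) \<and> (\<forall>x y. v (x + y) \<le> v x + v y)"

definition defines_topology :: "('k::local_field \<Rightarrow> real) \<Rightarrow> bool" where
  "defines_topology v \<longleftrightarrow>
     (\<forall>U. open U \<longleftrightarrow> (\<forall>x\<in>U. \<exists>e>0. \<forall>y. v (y - x) < e \<longrightarrow> y \<in> U))"


section \<open>Analytic maps between open subsets of coordinate spaces\<close>

text \<open>Vectors are functions on the naturals vanishing from index n on, so that the
  dimension is a term and may be 0. The topology is induced by the product topology
  of the function type; addition of functions is pointwise.\<close>

definition coord_space :: "nat \<Rightarrow> (nat \<Rightarrow> 'k::zero) set" where
  "coord_space n = {x. \<forall>i\<ge>n. x i = 0}"

abbreviation coord_top :: "nat \<Rightarrow> (nat \<Rightarrow> 'k::{zero,topological_space}) topology" where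
  "coord_top n \<equiv> top_of_set (coord_space n)"

definition append_coords :: "nat \<Rightarrow> (nat \<Rightarrow> 'k) \<Rightarrow> (nat \<Rightarrow> 'k) \<Rightarrow> nat \<Rightarrow> 'k" where
  "append_coords n x y = (\<lambda>i. if i < n then x i else y (i - n))"

text \<open>Multi-indices of length n are the elements of \<^term>\<open>coord_space n :: (nat \<Rightarrow> nat) set\<close>;
  the power series are summed unconditionally.\<close>

definition analytic_between ::
  "nat \<Rightarrow> nat \<Rightarrow> ((nat \<Rightarrow> 'k::local_field) \<Rightarrow> nat \<Rightarrow> 'k) \<Rightarrow> (nat \<Rightarrow> 'k) set \<Rightarrow> bool" where
  "analytic_between n m f U \<longleftrightarrow>
     openin (coord_top n) U \<and> f ` U \<subseteq> coord_space m \<and>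
     (\<forall>p\<in>U. \<forall>i<m. \<exists>a :: (nat \<Rightarrow> nat) \<Rightarrow> 'k. \<exists>V. open V \<and> p \<in> V \<and>
        (\<forall>x \<in> U \<inter> V.
           ((\<lambda>\<alpha>. a \<alpha> * (\<Prod>j<n. (x j - p j) ^ \<alpha> j)) has_sum f x i) (coord_space n)))"

text \<open>The directional derivative \<open>d f(x, v) = lim (f (x + s v) - f x) / s\<close> as \<open>s\<close> tends
  to 0, taken coordinatewise; for fixed \<open>x\<close> it is the differential of an analytic map.\<close>

definition differential ::
  "((nat \<Rightarrow> 'k::local_field) \<Rightarrow> nat \<Rightarrow> 'k) \<Rightarrow> (nat \<Rightarrow> 'k) \<Rightarrow> (nat \<Rightarrow> 'k) \<Rightarrow> nat \<Rightarrow> 'k" where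
  "differential f x v =
     (\<lambda>i. Lim (at 0) (\<lambda>s. (f (\<lambda>j. x j + s * v j) i - f x i) / s))"


section \<open>Analytic manifolds, tangent spaces and tangent maps\<close>

text \<open>A chart is its domain together with its coordinate map, whose values
  outside the domain are irrelevant.\<close>

type_synonym ('p, 'k) chart = "'p set \<times> ('p \<Rightarrow> nat \<Rightarrow> 'k)"

definition chart_inv :: "('p, 'k) chart \<Rightarrow> (nat \<Rightarrow> 'k) \<Rightarrow> 'p" where
  "chart_inv c = inv_into (fst c) (snd c)"

definition charts_at :: "('p, 'k) chart set \<Rightarrow> 'p \<Rightarrow> ('p, 'k) chart set" where
  "charts_at A p = {c \<in> A. p \<in> fst c}"

text \<open>The atlas is not required to be maximal: any atlas determines a maximal one.\<close>

definition analytic_manifold ::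
  "nat \<Rightarrow> 'p topology \<Rightarrow> ('p, 'k::local_field) chart set \<Rightarrow> bool" where
  "analytic_manifold n T A \<longleftrightarrow>
     Hausdorff_space T \<and>
     (\<forall>c\<in>A. openin T (fst c) \<and> openin (coord_top n) (snd c ` fst c) \<and>
        homeomorphic_map (subtopology T (fst c)) (top_of_set (snd c ` fst c)) (snd c)) \<and>
     (\<Union>c\<in>A. fst c) = topspace T \<and>
     (\<forall>c\<in>A. \<forall>d\<in>A.
        analytic_between n n (snd d \<circ> chart_inv c) (snd c ` (fst c \<inter> fst d)))"

definition product_atlas ::
  "nat \<Rightarrow> ('p, 'k) chart set \<Rightarrow> ('q, 'k) chart set \<Rightarrow> ('p \<times> 'q, 'k) chart set" where
  "product_atlas n A B =
     (\<lambda>(c, d). (fst c \<times> fst d, \<lambda>(p, q). append_coords n (snd c p) (snd d q))) ` (A \<times> B)"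

definition analytic_map ::
  "nat \<Rightarrow> 'p topology \<Rightarrow> ('p, 'k::local_field) chart set \<Rightarrow>
   nat \<Rightarrow> 'q topology \<Rightarrow> ('q, 'k) chart set \<Rightarrow> ('p \<Rightarrow> 'q) \<Rightarrow> bool" where
  "analytic_map n T A m S B f \<longleftrightarrow>
     continuous_map T S f \<and>
     (\<forall>c\<in>A. \<forall>d\<in>B.
        analytic_between n m (snd d \<circ> f \<circ> chart_inv c) (snd c ` (fst c \<inter> f -` fst d)))"

text \<open>A tangent vector at p is a family of coordinate vectors, one for each chart around p,
  which transforms by the differentials of the chart changes; by convention the family is
  zero at all other pairs. Vector space operations are pointwise, and
  the product topology of the function type induces the usual topology, because each
  coordinate map \<open>t \<mapsto> t c\<close> is a linear homeomorphism onto the coordinate space.\<close>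

type_synonym ('p, 'k) tangent = "('p, 'k) chart \<Rightarrow> nat \<Rightarrow> 'k"

definition tangent_space ::
  "nat \<Rightarrow> ('p, 'k::local_field) chart set \<Rightarrow> 'p \<Rightarrow> ('p, 'k) tangent set" where
  "tangent_space n A p =
     {t. (\<forall>c. c \<notin> charts_at A p \<longrightarrow> t c = 0) \<and>
         (\<forall>c\<in>charts_at A p. t c \<in> coord_space n) \<and>
         (\<forall>c\<in>charts_at A p. \<forall>d\<in>charts_at A p.
            t d = differential (snd d \<circ> chart_inv c) (snd c p) (t c))}"

definition tangent_scale :: "'k::times \<Rightarrow> ('p, 'k) tangent \<Rightarrow> ('p, 'k) tangent" where
  "tangent_scale a t = (\<lambda>c i. a * t c i)"

lemma vector_space_tangent_scale:
  "vector_space (tangent_scale :: 'k::Fields.field \<Rightarrow> ('p, 'k) tangent \<Rightarrow> ('p, 'k) tangent)"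
  by unfold_locales (auto simp: tangent_scale_def fun_eq_iff algebra_simps)

text \<open>The result does not depend on the chart chosen around p.\<close>

definition tangent_map ::
  "('p, 'k::local_field) chart set \<Rightarrow> ('q, 'k) chart set \<Rightarrow> 'p \<Rightarrow> ('p \<Rightarrow> 'q) \<Rightarrow>
   ('p, 'k) tangent \<Rightarrow> ('q, 'k) tangent" where
  "tangent_map A B p f t =
     (let c = (SOME c. c \<in> charts_at A p) in
      (\<lambda>d. if d \<in> charts_at B (f p)
           then differential (snd d \<circ> f \<circ> chart_inv c) (snd c p) (t c) else 0))"

text \<open>In a chart, vector fields \<open>\<xi>\<close> and \<open>\<eta>\<close> are vector valued functions of the coordinates and
  \<open>[\<xi>, \<eta>] = d\<eta>(\<xi>) - d\<xi>(\<eta>)\<close>.\<close>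

definition vector_field_in_chart ::
  "('p \<Rightarrow> ('p, 'k) tangent) \<Rightarrow> ('p, 'k) chart \<Rightarrow> (nat \<Rightarrow> 'k) \<Rightarrow> nat \<Rightarrow> 'k" where
  "vector_field_in_chart \<xi> c u = \<xi> (chart_inv c u) c"

definition vector_field_bracket ::
  "('p, 'k::local_field) chart set \<Rightarrow> ('p \<Rightarrow> ('p, 'k) tangent) \<Rightarrow>
   ('p \<Rightarrow> ('p, 'k) tangent) \<Rightarrow> 'p \<Rightarrow> ('p, 'k) tangent" where
  "vector_field_bracket A \<xi> \<eta> p =
     (\<lambda>c. if c \<in> charts_at A p
          then differential (vector_field_in_chart \<eta> c) (snd c p) (\<xi> p c)
             - differential (vector_field_in_chart \<xi> c) (snd c p) (\<eta> p c)
          else 0)"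


section \<open>Lie groups, their Lie algebras, and analytic automorphisms\<close>

definition lie_group ::
  "('g, 'm) monoid_scheme \<Rightarrow> nat \<Rightarrow> 'g topology \<Rightarrow> ('g, 'k::local_field) chart set \<Rightarrow> bool" where
  "lie_group G n T A \<longleftrightarrow>
     Group.group G \<and> topspace T = carrier G \<and> analytic_manifold n T A \<and>
     analytic_map (n + n) (prod_topology T T) (product_atlas n A A) n T A
       (\<lambda>(x, y). x \<otimes>\<^bsub>G\<^esub> y) \<and>
     analytic_map n T A n T A (\<lambda>x. inv\<^bsub>G\<^esub> x)"

definition analytic_automorphism ::
  "('g, 'm) monoid_scheme \<Rightarrow> nat \<Rightarrow> 'g topology \<Rightarrow> ('g, 'k::local_field) chart set \<Rightarrow>
   ('g \<Rightarrow> 'g) \<Rightarrow> bool" where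
  "analytic_automorphism G n T A f \<longleftrightarrow>
     f \<in> iso G G \<and> analytic_map n T A n T A f \<and>
     analytic_map n T A n T A (inv_into (carrier G) f)"

definition lie_algebra ::
  "('g, 'm) monoid_scheme \<Rightarrow> nat \<Rightarrow> ('g, 'k::local_field) chart set \<Rightarrow> ('g, 'k) tangent set" where
  "lie_algebra G n A = tangent_space n A \<one>\<^bsub>G\<^esub>"

definition left_invariant_field ::
  "('g, 'm) monoid_scheme \<Rightarrow> ('g, 'k::local_field) chart set \<Rightarrow> ('g, 'k) tangent \<Rightarrow>
   'g \<Rightarrow> ('g, 'k) tangent" where
  "left_invariant_field G A x g = tangent_map A A \<one>\<^bsub>G\<^esub> (\<lambda>h. g \<otimes>\<^bsub>G\<^esub> h) x"

definition lie_bracket ::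
  "('g, 'm) monoid_scheme \<Rightarrow> ('g, 'k::local_field) chart set \<Rightarrow>
   ('g, 'k) tangent \<Rightarrow> ('g, 'k) tangent \<Rightarrow> ('g, 'k) tangent" where
  "lie_bracket G A x y =
     vector_field_bracket A (left_invariant_field G A x) (left_invariant_field G A y) \<one>\<^bsub>G\<^esub>"

definition lie_map ::
  "('g, 'm) monoid_scheme \<Rightarrow> ('g, 'k::local_field) chart set \<Rightarrow> ('g \<Rightarrow> 'g) \<Rightarrow>
   ('g, 'k) tangent \<Rightarrow> ('g, 'k) tangent" where
  "lie_map G A f = tangent_map A A \<one>\<^bsub>G\<^esub> f"

primrec lower_central_series ::
  "('k::comm_ring_1 \<Rightarrow> 'v::ab_group_add \<Rightarrow> 'v) \<Rightarrow> 'v set \<Rightarrow> ('v \<Rightarrow> 'v \<Rightarrow> 'v) \<Rightarrow> nat \<Rightarrow> 'v set" where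
  "lower_central_series s L br 0 = L"
| "lower_central_series s L br (Suc k) =
     module.span s {br x y | x y. x \<in> L \<and> y \<in> lower_central_series s L br k}"

definition nilpotent_lie_algebra ::
  "('k::comm_ring_1 \<Rightarrow> 'v::ab_group_add \<Rightarrow> 'v) \<Rightarrow> 'v set \<Rightarrow> ('v \<Rightarrow> 'v \<Rightarrow> 'v) \<Rightarrow> bool" where
  "nilpotent_lie_algebra s L br \<longleftrightarrow> (\<exists>k. lower_central_series s L br k = {0})"


section \<open>Expansive automorphisms\<close>

definition int_iterate :: "'a set \<Rightarrow> ('a \<Rightarrow> 'a) \<Rightarrow> int \<Rightarrow> 'a \<Rightarrow> 'a" where
  "int_iterate S f k = (if 0 \<le> k then f ^^ nat k else inv_into S f ^^ nat (- k))"

definition expansive ::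
  "('g, 'm) monoid_scheme \<Rightarrow> 'g topology \<Rightarrow> ('g \<Rightarrow> 'g) \<Rightarrow> bool" where
  "expansive G T f \<longleftrightarrow>
     (\<exists>U \<subseteq> carrier G. (\<exists>V. openin T V \<and> \<one>\<^bsub>G\<^esub> \<in> V \<and> V \<subseteq> U) \<and>
        (\<Inter>k::int. int_iterate (carrier G) f k ` U) = {\<one>\<^bsub>G\<^esub>})"

definition additive_group :: "'v::ab_group_add set \<Rightarrow> 'v monoid" where
  "additive_group V = \<lparr>carrier = V, monoid.mult = (+), one = 0\<rparr>"


section \<open>Characteristic polynomials of linear maps and absolute values of their zeros\<close>

definition ordered_basis ::
  "('k::Fields.field \<Rightarrow> 'v::ab_group_add \<Rightarrow> 'v) \<Rightarrow> 'v set \<Rightarrow> nat \<Rightarrow> (nat \<Rightarrow> 'v) \<Rightarrow> bool" where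
  "ordered_basis s V n b \<longleftrightarrow>
     inj_on b {..<n} \<and> \<not> module.dependent s (b ` {..<n}) \<and> module.span s (b ` {..<n}) = V"

definition matrix_wrt ::
  "('k::Fields.field \<Rightarrow> 'v::ab_group_add \<Rightarrow> 'v) \<Rightarrow> nat \<Rightarrow> (nat \<Rightarrow> 'v) \<Rightarrow> ('v \<Rightarrow> 'v) \<Rightarrow> 'k mat" where
  "matrix_wrt s n b f =
     mat n n (\<lambda>(i, j). module.representation s (b ` {..<n}) (f (b j)) (b i))"

text \<open>Similar matrices have the same characteristic polynomial, so there is exactly one
  such polynomial for a linear endomorphism of a finite-dimensional space V.\<close>

definition linear_char_poly ::
  "('k::Fields.field \<Rightarrow> 'v::ab_group_add \<Rightarrow> 'v) \<Rightarrow> 'v set \<Rightarrow> ('v \<Rightarrow> 'v) \<Rightarrow> 'k poly" where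
  "linear_char_poly s V f =
     (THE p. \<exists>n b. ordered_basis s V n b \<and> p = char_poly (matrix_wrt s n b f))"

text \<open>The parameter w is the absolute value on the algebraic closure.\<close>

definition root_abs_values ::
  "('k::Fields.field alg_closure \<Rightarrow> real) \<Rightarrow> ('k \<Rightarrow> 'v::ab_group_add \<Rightarrow> 'v) \<Rightarrow> 'v set \<Rightarrow>
   ('v \<Rightarrow> 'v) \<Rightarrow> real set" where
  "root_abs_values w s V f =
     w ` {z. poly (map_poly to_ac (linear_char_poly s V f)) z = 0}"

end

(*
  In a chart around 1 the automorphism is strictly differentiable at the fixed point, with linear
  part the matrix M of L(alpha). Expansiveness of alpha and of L(alpha) is equivalent to the
  absence of small nontrivial two-sided orbits, and so depends only on M: if 1 is not the absolute
  value of an eigenvalue, a bounded pseudo-orbit of M is controlled by its defect, and the defect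
  of a small orbit is a small multiple of its size; if 1 is such an absolute value, M has a nonzero
  bounded two-sided orbit, which a compactness argument perturbs to orbits of the nonlinear map.

  For the nilpotency, the coordinate space is spanned by the vectors x whose orbit under M has size
  O(r^k) over all integers k for some r > 0. By equivariance, the bracket of growth rates r and
  r' has growth rate r r', and only finitely many rates are realised. If the rate 1 is not
  among them, each such vector is ad-nilpotent, and Jacobson's theorem on weakly closed sets of
  nilpotent operators applies. The Jacobi identity and the equivariance of the bracket come from
  the Hall-Witt identity for commutators of small group elements.
*)
theory Submission
  imports Defs
begin

text \<open>Eigenvalues lie in \<open>'k alg_closure\<close>, which need not be locally compact.
  Orbits attached to them are therefore built over the closure and brought back by a linear
  functional with values in the ground field, bounded on the finite-dimensional span of the
  coordinates that occur. Jordan blocks do not spoil the rates: recursions are estimated by maxima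
  instead of sums, so a generalised eigenvector grows like r^k without polynomial factors. The same
  principle bounds solutions of inhomogeneous linear recursions independently of the length of the
  time window, even when 1 is the absolute value of an eigenvalue; this uniformity is what allows
  the passage to orbits over all integers. The vectors with a growth rate form a set that spans and
  is closed under the bracket but is not in general a subspace, which is why weakly closed sets
  appear instead of Lie algebras of nilpotent operators. Brackets are compared with commutators
  through the bilinear term of the multiplication in a chart; the comparison has errors of higher
  order, and scaling the arguments to 0 turns approximate identities into exact ones.\<close>

instance local_field \<subseteq> topological_ab_group_add ..

section \<open>Ultrametric absolute values\<close>

locale ultrametric =
  fixes v :: "'a::Fields.field \<Rightarrow> real"
  assumes absolute_value: "absolute_value v"
    and ultra: "v (x + y) \<le> max (v x) (v y)"
begin

lemma nonneg [simp]: "0 \<le> v x"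
  and zero_iff [simp]: "v x = 0 \<longleftrightarrow> x = 0"
  and mult: "v (x * y) = v x * v y"
  using absolute_value by (auto simp: absolute_value_def)

lemma zero [simp]: "v 0 = 0" by simp

lemma pos_iff [simp]: "0 < v x \<longleftrightarrow> x \<noteq> 0"
  using nonneg[of x] zero_iff[of x] by linarith

lemma one [simp]: "v 1 = 1"
  using mult[of 1 1] zero_iff[of 1] by simp

lemma minus [simp]: "v (- x) = v x"
proof -
  have "v (-1) * v (-1) = 1" using mult[of "-1" "-1"] by simp
  hence "v (-1) = 1" using nonneg[of "-1"]
    by (metis abs_of_nonneg power2_eq_square power2_eq_1_iff abs_neg_one abs_one)
  thus ?thesis using mult[of "-1" x] by simp
qed

lemma ultra_diff: "v (x - y) \<le> max (v x) (v y)"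
  using ultra[of x "- y"] by simp

lemma inverse: "v (inverse x) = inverse (v x)"
proof (cases "x = 0")
  case False
  hence "v x * v (inverse x) = 1" by (simp flip: mult)
  thus ?thesis using False by (simp add: field_simps)
qed simp

lemma divide: "v (x / y) = v x / v y"
  by (simp add: divide_inverse mult inverse)

lemma power: "v (x ^ k) = v x ^ k"
  by (induction k) (auto simp: mult)

lemma power_int: "v (x powi k) = v x powi k"
  by (simp add: power_int_def power inverse)

lemma prod: "v (prod f A) = (\<Prod>i\<in>A. v (f i))"
  by (induction A rule: infinite_finite_induct) (auto simp: mult)

lemma sum_le:
  assumes "0 \<le> C" "\<And>i. i \<in> A \<Longrightarrow> v (f i) \<le> C" shows "v (sum f A) \<le> C"
  using assms(2)
proof (induction A rule: infinite_finite_induct)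
  case (insert x F)
  thus ?case using ultra[of "f x" "sum f F"] by (auto intro: order_trans)
qed (use assms(1) in auto)

lemma eq_of_less:
  assumes "v x < v y" shows "v (x + y) = v y"
proof -
  have "v y \<le> max (v (x + y)) (v x)" using ultra_diff[of "x + y" x] by simp
  thus ?thesis using assms ultra[of x y] by linarith
qed

end

text \<open>The binomial theorem gives \<open>v (x + y) ^ k \<le> real (k + 1) * M ^ k\<close> with
  \<open>M\<close> the larger of the two values. The linear factor is negligible against k-th
  powers, so \<open>v (x + y)\<close> cannot exceed \<open>M\<close>.\<close>

lemma ultrametric_of_bounded_nat:
  fixes v :: "'a::Fields.field \<Rightarrow> real"
  assumes av: "absolute_value v" and nat: "\<And>k::nat. v (of_nat k) \<le> 1"
  shows "ultrametric v"
proof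
  show "absolute_value v" by (rule av)
  fix x y
  have nonneg: "0 \<le> v z" and mult: "v (z * z') = v z * v z'"
    and tri: "v (z + z') \<le> v z + v z'" for z z'
    using av by (auto simp: absolute_value_def)
  have v0: "v 0 = 0" using av by (auto simp: absolute_value_def)
  have v1: "v 1 = 1" using mult[of 1 1] av by (auto simp: absolute_value_def)
  have pow: "v (z ^ k) = v z ^ k" for z k by (induction k) (auto simp: mult v1)
  have tsum: "v (sum f A) \<le> (\<Sum>a\<in>A. v (f a))" if "finite A" for f and A :: "nat set"
    using that by (induction A rule: finite_induct) (auto simp: v0 intro: order_trans[OF tri])
  define M where "M = max (v x) (v y)"
  have M0: "0 \<le> M" using nonneg[of x] by (auto simp: M_def)
  have bound: "v (x + y) ^ k \<le> real (k + 1) * M ^ k" for k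
  proof -
    have "v (x + y) ^ k = v (\<Sum>i\<le>k. of_nat (k choose i) * x ^ i * y ^ (k - i))"
      by (simp add: binomial_ring flip: pow)
    also have "\<dots> \<le> (\<Sum>i\<le>k. v (of_nat (k choose i) * x ^ i * y ^ (k - i)))"
      by (rule tsum) simp
    also have "\<dots> \<le> (\<Sum>i\<le>k. M ^ k)"
    proof (rule sum_mono)
      fix i assume "i \<in> {..k}"
      hence "M ^ k = M ^ i * M ^ (k - i)" by (simp flip: power_add)
      moreover have "v (of_nat (k choose i)) * (v x ^ i * v y ^ (k - i)) \<le> 1 * (M ^ i * M ^ (k - i))"
        by (intro mult_mono nat power_mono) (auto simp: M_def nonneg zero_le_mult_iff M0[unfolded M_def])
      ultimately show "v (of_nat (k choose i) * x ^ i * y ^ (k - i)) \<le> M ^ k"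
        by (simp add: mult pow mult.assoc)
    qed
    finally show ?thesis by simp
  qed
  show "v (x + y) \<le> max (v x) (v y)"
  proof (rule ccontr)
    assume "\<not> ?thesis"
    hence less: "M < v (x + y)" unfolding M_def by linarith
    show False
    proof (cases "M = 0")
      case True
      thus ?thesis using bound[of 1] less by simp
    next
      case False
      hence Mpos: "M > 0" using M0 by simp
      define q where "q = v (x + y) / M"
      have q: "q > 1" using less Mpos by (simp add: q_def)
      have "q ^ k \<le> real (k + 1)" for k
        using bound[of k] Mpos by (simp add: q_def power_divide divide_simps)
      moreover have "(\<lambda>k. real (k + 1) / q ^ k) \<longlonglongrightarrow> 0"
        using q by real_asymp
      hence "eventually (\<lambda>k. real (k + 1) / q ^ k < 1) sequentially"
        by (rule order_tendstoD) simp
      then obtain k where "real (k + 1) / q ^ k < 1" by (auto simp: eventually_sequentially)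
      hence "real (k + 1) < q ^ k" using q by (simp add: divide_simps split: if_splits)
      ultimately show False by (meson not_le)
    qed
  qed
qed

section \<open>The topology of a local field\<close>

lemma compact_finite_cover:
  assumes "compact W" "\<And>x. x \<in> W \<Longrightarrow> open (B x) \<and> x \<in> B x"
  shows "\<exists>D\<subseteq>W. finite D \<and> W \<subseteq> (\<Union>x\<in>D. B x)"
proof (rule compactE_image[OF assms(1), of W B])
  show "W \<subseteq> (\<Union>x\<in>W. B x)" using assms(2) by blast
qed (use assms(2) in blast)+

lemma Hausdorff_space_t2: "Hausdorff_space (euclidean :: 'a::t2_space topology)"
  unfolding Hausdorff_space_def disjnt_def using hausdorff by auto

section \<open>Quasi-components of compact Hausdorff spaces and compact open neighbourhoods\<close>

lemma quasi_component_eq_Inter: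
  assumes "x \<in> topspace S"
  shows "quasi_component_of_set S x = \<Inter>{F. closedin S F \<and> openin S F \<and> x \<in> F}"
proof (intro equalityI subsetI)
  fix y assume y: "y \<in> \<Inter>{F. closedin S F \<and> openin S F \<and> x \<in> F}"
  have "x \<in> T" if "closedin S T" "openin S T" "y \<in> T" for T
  proof (rule ccontr)
    assume "x \<notin> T"
    hence "y \<in> topspace S - T" using y that assms by (auto intro!: closedin_diff openin_diff)
    thus False using that by blast
  qed
  moreover have "y \<in> topspace S" using y assms by blast
  moreover have "y \<in> T" if "closedin S T" "openin S T" "x \<in> T" for T
    using y that by blast
  ultimately show "y \<in> quasi_component_of_set S x"
    using assms unfolding quasi_component_of_def mem_Collect_eq by metis
qed (auto simp: quasi_component_of_def)

text \<open>A clopen part \<open>T\<close> of \<open>Q\<close> that contains \<open>x\<close> and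
  its complement in \<open>Q\<close> have disjoint open neighbourhoods \<open>U\<close> and
  \<open>V\<close>. Compactness gives a clopen set \<open>F\<close> around \<open>x\<close> inside
  \<open>U \<union> V\<close>; then \<open>F \<inter> U\<close> is clopen as well and must contain
  \<open>Q\<close>.\<close>

lemma connected_quasi_component_compact:
  fixes C :: "'a::t2_space set"
  assumes "compact C" "x \<in> C"
  shows "connected (quasi_component_of_set (top_of_set C) x)"
proof -
  define XX where "XX = top_of_set C"
  define Q where "Q = quasi_component_of_set XX x"
  have QC: "Q \<subseteq> C" unfolding Q_def XX_def quasi_component_of_def by auto
  have xQ: "x \<in> Q" using assms by (simp add: Q_def XX_def)
  have "closedin XX Q" unfolding Q_def by (rule closedin_quasi_component_of)
  hence cQ: "compact Q" using assms(1) unfolding XX_def by (metis closedin_compact)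
  have hd: "Hausdorff_space XX" unfolding XX_def by (intro Hausdorff_space_subtopology Hausdorff_space_t2)
  have main: "T = Q" if T: "openin (top_of_set Q) T" "closedin (top_of_set Q) T" "x \<in> T" for T
  proof -
    have cT: "compact T" using T cQ by (metis closedin_compact)
    have TQ: "T \<subseteq> Q" using T(1) by (rule openin_imp_subset)
    have "closedin (top_of_set Q) (Q - T)" using T(1) by (simp add: openin_closedin_eq)
    hence cT': "compact (Q - T)" using cQ by (metis closedin_compact)
    have "compactin XX T" "compactin XX (Q - T)"
      using cT cT' TQ QC by (auto simp: XX_def compactin_subtopology)
    then obtain U V where UV: "openin XX U" "openin XX V" "T \<subseteq> U" "Q - T \<subseteq> V" "disjnt U V"
      using Hausdorff_space_compact_separation[OF hd, of T "Q - T"] by (auto simp: disjnt_def)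
    define FF where "FF = {F. closedin XX F \<and> openin XX F \<and> x \<in> F}"
    have Q: "Q = \<Inter>FF"
      using assms unfolding Q_def FF_def by (intro quasi_component_eq_Inter) (simp add: XX_def)
    have "closedin XX (C - (U \<union> V))" using UV unfolding XX_def by (metis openin_Un closedin_diff closedin_self)
    hence cD: "compact (C - (U \<union> V))" using assms(1) unfolding XX_def by (metis closedin_compact)
    have "\<exists>FF'\<subseteq>FF. finite FF' \<and> (C - (U \<union> V)) \<inter> \<Inter>FF' = {}"
    proof (rule ccontr)
      assume neg: "\<not> ?thesis"
      have "(C - (U \<union> V)) \<inter> \<Inter>FF \<noteq> {}"
      proof (rule compact_imp_fip)
        show "compact (C - (U \<union> V))" by (rule cD)
        show "closed F" if "F \<in> FF" for F
        proof -
          have "closedin (top_of_set C) F" using that by (auto simp: FF_def XX_def)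
          thus ?thesis using assms(1) closedin_compact compact_imp_closed by blast
        qed
        show "(C - (U \<union> V)) \<inter> \<Inter>FF' \<noteq> {}" if "finite FF'" "FF' \<subseteq> FF" for FF'
          using neg that by blast
      qed
      thus False using Q UV by auto
    qed
    then obtain FF' where F': "FF' \<subseteq> FF" "finite FF'" "(C - (U \<union> V)) \<inter> \<Inter>FF' = {}" by blast
    define F where "F = \<Inter>(insert C FF')"
    have cC: "C \<in> FF" using assms by (auto simp: FF_def XX_def)
    have "closedin XX F" unfolding F_def using F' cC by (intro closedin_Inter) (auto simp: FF_def)
    have "openin XX F" unfolding F_def using F' cC by (intro openin_Inter) (auto simp: FF_def)
    have FUV: "F \<subseteq> U \<union> V" using F' by (auto simp: F_def)
    \<comment> \<open>The two descriptions show that this set is both open and closed.\<close>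
    have "F \<inter> U = F - V" using FUV UV(5) by (auto simp: disjnt_def)
    hence "closedin XX (F \<inter> U)" using \<open>closedin XX F\<close> UV(2) by (simp add: closedin_diff)
    moreover have "openin XX (F \<inter> U)" using \<open>openin XX F\<close> UV(1) by blast
    moreover have "x \<in> F \<inter> U" using T(3) UV(3) cC F' by (auto simp: F_def FF_def)
    ultimately have "F \<inter> U \<in> FF" by (auto simp: FF_def)
    hence "Q \<subseteq> U" using Q by auto
    thus "T = Q" using UV(4,5) TQ by (auto simp: disjnt_def)
  qed
  have "connected Q"
    unfolding connected_clopen
  proof (intro allI impI, elim conjE)
    fix T assume T: "openin (top_of_set Q) T" "closedin (top_of_set Q) T"
    show "T = {} \<or> T = Q"
    proof (cases "x \<in> T")
      case True thus ?thesis using main T by blast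
    next
      case False
      have "openin (top_of_set Q) (Q - T)" using T(2) by (simp add: closedin_def)
      moreover have "closedin (top_of_set Q) (Q - T)" using T(1) by (simp add: openin_closedin_eq)
      ultimately have "Q - T = Q" using main[of "Q - T"] False xQ by blast
      thus ?thesis using openin_imp_subset[OF T(1)] by auto
    qed
  qed
  thus ?thesis by (simp add: Q_def XX_def)
qed

text \<open>Total disconnectedness reduces the quasi-component of \<open>x\<close> in a compact
  neighbourhood \<open>C\<close> to \<open>x\<close> itself. Hence finitely many clopen subsets of
  \<open>C\<close> around \<open>x\<close> already have their intersection inside the open set
  \<open>U\<close>, and such an intersection is open in the whole field, not only in
  \<open>C\<close>.\<close>

lemma local_field_compact_open:
  fixes x :: "'k::local_field"
  obtains W where "open W" "compact W" "x \<in> W"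
proof -
  obtain U C where UC: "open U" "compact C" "x \<in> U" "U \<subseteq> C"
    using locally_compact_local_field by metis
  define XX where "XX = top_of_set C"
  define FF where "FF = {F. closedin XX F \<and> openin XX F \<and> x \<in> F}"
  have cC: "C \<in> FF" using UC by (auto simp: FF_def XX_def)
  obtain a where "quasi_component_of_set XX x \<subseteq> {a}"
    using totally_disconnected_local_field[OF connected_quasi_component_compact[of C x]] UC
    unfolding XX_def by blast
  moreover have "x \<in> quasi_component_of_set XX x" using UC by (auto simp: XX_def)
  moreover have "quasi_component_of_set XX x = \<Inter>FF"
    using UC unfolding FF_def by (intro quasi_component_eq_Inter) (auto simp: XX_def)
  ultimately have F: "\<Inter>FF = {x}" by blast
  have "\<exists>FF'\<subseteq>FF. finite FF' \<and> (C - U) \<inter> \<Inter>FF' = {}"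
  proof (rule ccontr)
    assume neg: "\<not> ?thesis"
    have "(C - U) \<inter> \<Inter>FF \<noteq> {}"
    proof (rule compact_imp_fip)
      show "compact (C - U)" using UC by (simp add: compact_diff)
      show "closed F" if "F \<in> FF" for F
      proof -
        have "closedin (top_of_set C) F" using that by (auto simp: FF_def XX_def)
        thus ?thesis using UC(2) closedin_compact compact_imp_closed by blast
      qed
      show "(C - U) \<inter> \<Inter>FF' \<noteq> {}" if "finite FF'" "FF' \<subseteq> FF" for FF'
        using neg that by blast
    qed
    thus False using F UC by auto
  qed
  then obtain FF' where F': "FF' \<subseteq> FF" "finite FF'" "(C - U) \<inter> \<Inter>FF' = {}" by blast
  define W where "W = \<Inter>(insert C FF')"
  have "closedin XX W" unfolding W_def using F' cC by (intro closedin_Inter) (auto simp: FF_def)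
  hence cW: "compact W" using UC(2) unfolding XX_def by (metis closedin_compact)
  have "openin XX W" unfolding W_def using F' cC by (intro openin_Inter) (auto simp: FF_def)
  then obtain W' where W': "open W'" "W = C \<inter> W'" unfolding XX_def by (auto simp: openin_open)
  have "W \<subseteq> U" using F' by (auto simp: W_def)
  hence "W = U \<inter> W'" using W' UC by auto
  hence "open W" using W' UC by auto
  moreover have "x \<in> W" using F' cC UC by (auto simp: W_def FF_def)
  ultimately show ?thesis using cW that by blast
qed

lemma abs_val_diff_le:
  assumes "absolute_value v" shows "v x \<le> v y + v (x - y)"
proof -
  have "v (y + (x - y)) \<le> v y + v (x - y)" using assms unfolding absolute_value_def by blast
  thus ?thesis by simp
qed

text \<open>A compact open set \<open>W\<close> around 0 is stable under adding any sufficiently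
  small \<open>h\<close>, so all integer multiples of one such \<open>h \<noteq> 0\<close> stay in
  \<open>W\<close>. As \<open>v\<close> is bounded on \<open>W\<close>, it is bounded on the
  integers; a value above 1 would have unbounded powers.\<close>

lemma local_field_ultrametric:
  fixes v :: "'k::local_field \<Rightarrow> real"
  assumes av: "absolute_value v" and dt: "defines_topology v"
  shows "ultrametric v"
proof (rule ultrametric_of_bounded_nat[OF av])
  have nonneg: "0 \<le> v z" and mult: "v (z * z') = v z * v z'"
    and tri: "v (z + z') \<le> v z + v z'" and zi: "v z = 0 \<longleftrightarrow> z = 0" for z z'
    using av by (auto simp: absolute_value_def)
  have v1: "v 1 = 1" using mult[of 1 1] zi[of 1] by simp
  have pow: "v (z ^ k) = v z ^ k" for z k by (induction k) (auto simp: mult v1)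
  have vd: "v x \<le> v y + v (x - y)" for x y by (rule abs_val_diff_le[OF av])
  have ball: "open {y. v (y - x) < e}" for x e
    unfolding dt[unfolded defines_topology_def, rule_format]
  proof (intro ballI)
    fix z assume z: "z \<in> {y. v (y - x) < e}"
    have "v (y - x) < e" if "v (y - z) < e - v (z - x)" for y
      using tri[of "y - z" "z - x"] that by simp
    thus "\<exists>d>0. \<forall>y. v (y - z) < d \<longrightarrow> y \<in> {y. v (y - x) < e}"
      using z by (intro exI[of _ "e - v (z - x)"]) auto
  qed
  obtain W :: "'k set" where W: "open W" "compact W" "0 \<in> W" by (rule local_field_compact_open)
  have op: "open U \<longleftrightarrow> (\<forall>x\<in>U. \<exists>e>0. \<forall>y. v (y - x) < e \<longrightarrow> y \<in> U)" for U
    using dt by (auto simp: defines_topology_def)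
  have "\<forall>x\<in>W. \<exists>e>0. \<forall>y. v (y - x) < e \<longrightarrow> y \<in> W" using W op by blast
  then obtain e where e: "\<And>x. x \<in> W \<Longrightarrow> e x > 0" "\<And>x y. x \<in> W \<Longrightarrow> v (y - x) < e x \<Longrightarrow> y \<in> W"
    by metis
  have "\<exists>D\<subseteq>W. finite D \<and> W \<subseteq> (\<Union>x\<in>D. {y. v (y - x) < e x / 2})"
    using e(1) zi[of 0] by (intro compact_finite_cover[OF W(2)] conjI ball) simp
  then obtain D where D: "D \<subseteq> W" "finite D" "W \<subseteq> (\<Union>x\<in>D. {y. v (y - x) < e x / 2})"
    by blast
  \<comment> \<open>A Lebesgue number of the cover: halving the radii leaves room for a further
    displacement of size less than \<open>d\<close>. The entry 1 keeps the set nonempty in any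
    case.\<close>
  define d where "d = Min (insert 1 ((\<lambda>x. e x / 2) ` D))"
  have dpos: "d > 0" unfolding d_def using D e(1) by (subst Min_gr_iff) auto
  have dle: "d \<le> e x / 2" if "x \<in> D" for x unfolding d_def using D that by (intro Min_le) auto
  have step: "w + h \<in> W" if wW: "w \<in> W" and hd: "v h < d" for w h
  proof -
    obtain x where x: "x \<in> D" "v (w - x) < e x / 2" using D(3) wW by auto
    have "v (w + h - x) < e x"
      using tri[of "w - x" h] x hd dle[OF x(1)] by (simp add: algebra_simps)
    thus ?thesis using e(2) x(1) D(1) by blast
  qed
  have multi: "of_nat k * h \<in> W" if "v h < d" for k h
    
  proof (induction k)
    case (Suc k) thus ?case using step[OF Suc that] by (simp add: algebra_simps)
  qed (use W(3) in simp)
  \<comment> \<open>Otherwise a ball would consist of 0 alone, contrary to non-discreteness.\<close>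
  have "\<exists>h. h \<noteq> 0 \<and> v h < d"
  proof (rule ccontr)
    assume "\<not> ?thesis"
    hence "{0} = {y. v (y - 0) < d}" using dpos zi[of 0] by auto
    hence "open {0::'k}" using ball[of 0 d] by simp
    thus False using not_open_singleton by blast
  qed
  then obtain h where h: "h \<noteq> 0" "v h < d" by blast
  obtain R where R: "\<And>x. x \<in> W \<Longrightarrow> v x \<le> R"
  proof -
    have "\<exists>D\<subseteq>W. finite D \<and> W \<subseteq> (\<Union>x\<in>D. {y. v (y - x) < 1})"
    using zi[of 0] by (intro compact_finite_cover[OF W(2)] conjI ball) simp
  then obtain E where E: "E \<subseteq> W" "finite E" "W \<subseteq> (\<Union>x\<in>E. {y. v (y - x) < 1})"
    by blast
    have "v y \<le> Max (insert 0 (v ` E)) + 1" if yW: "y \<in> W" for y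
    proof -
      obtain x where x: "x \<in> E" "v (y - x) < 1" using E yW by auto
      moreover have "v x \<le> Max (insert 0 (v ` E))" using x E by (intro Max_ge) auto
      ultimately show ?thesis using vd[of y x] by linarith
    qed
    thus ?thesis using that by blast
  qed
  have b: "v (of_nat k) \<le> R / v h" for k
    using R[OF multi[OF h(2), of k]] h(1) zi[of h] nonneg[of h] by (simp add: mult field_simps)
  show "v (of_nat k) \<le> 1" for k :: nat
  proof (rule ccontr)
    assume "\<not> v (of_nat k) \<le> 1"
    then obtain m where "R / v h < v (of_nat k) ^ m" using real_arch_pow[of "v (of_nat k)" "R / v h"] by auto
    also have "\<dots> = v (of_nat (k ^ m))" by (simp add: pow)
    finally show False using b[of "k ^ m"] by simp
  qed
qed

section \<open>Coordinate vectors and matrices\<close>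

definition vscale :: "'a::times \<Rightarrow> (nat \<Rightarrow> 'a) \<Rightarrow> nat \<Rightarrow> 'a" where
  "vscale a x = (\<lambda>i. a * x i)"

definition unit_coord :: "nat \<Rightarrow> nat \<Rightarrow> 'a::zero_neq_one" where
  "unit_coord j = (\<lambda>i. if i = j then 1 else 0)"

text \<open>Matrices are functions of two indices, of which only the entries below \<open>n\<close>
  count. This keeps the dimension a term, and the value is cut off at \<open>n\<close> so that every
  image lies in \<open>coord_space n\<close>.\<close>

definition mat_app :: "nat \<Rightarrow> (nat \<Rightarrow> nat \<Rightarrow> 'a::semiring_0) \<Rightarrow> (nat \<Rightarrow> 'a) \<Rightarrow> nat \<Rightarrow> 'a" where
  "mat_app n M x = (\<lambda>i. if i < n then \<Sum>j<n. M i j * x j else 0)"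

lemma sum_fun_apply: "sum f A i = (\<Sum>a\<in>A. f a i)"
  for f :: "'b \<Rightarrow> 'c \<Rightarrow> 'd::comm_monoid_add"
  by (induction A rule: infinite_finite_induct) auto

interpretation vscale: vector_space "vscale :: 'a::Fields.field \<Rightarrow> _"
  by unfold_locales (auto simp: vscale_def fun_eq_iff algebra_simps)

lemma vscale_apply: "vscale a x i = a * x i"
  by (simp add: vscale_def)

lemmas vec_apply = vscale_apply plus_fun_apply zero_fun_apply minus_apply uminus_apply

(* As simp rules these would turn vectors occurring as arguments into abstractions. *)
declare plus_fun_apply [simp del] zero_fun_apply [simp del] minus_apply [simp del] uminus_apply [simp del]

lemma coord_space_zero [simp]: "0 \<in> coord_space n"
  and coord_space_add: "x \<in> coord_space n \<Longrightarrow> y \<in> coord_space n \<Longrightarrow> x + y \<in> coord_space n"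
  and coord_space_vscale: "x \<in> coord_space n \<Longrightarrow> vscale a x \<in> coord_space n"
  and coord_space_unit: "j < n \<Longrightarrow> unit_coord j \<in> coord_space n"
  and coord_space_mat_app [simp]: "mat_app n M z \<in> coord_space n"
  for x y :: "nat \<Rightarrow> 'a::Fields.field"
  by (auto simp: coord_space_def unit_coord_def mat_app_def vec_apply)

lemma coord_space_diff: "x \<in> coord_space n \<Longrightarrow> y \<in> coord_space n \<Longrightarrow> x - y \<in> coord_space n"
  for x y :: "nat \<Rightarrow> 'a::Fields.field"
  by (auto simp: coord_space_def vec_apply)

lemma coord_space_sum: "(\<And>a. a \<in> A \<Longrightarrow> f a \<in> coord_space n) \<Longrightarrow> sum f A \<in> coord_space n"
  for f :: "'b \<Rightarrow> nat \<Rightarrow> 'a::Fields.field"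
  by (auto simp: coord_space_def sum_fun_apply)

lemma subspace_coord_space: "vscale.subspace (coord_space n)"
  by (auto simp: vscale.subspace_def coord_space_add coord_space_vscale)

lemma coord_space_eqI:
  "x \<in> coord_space n \<Longrightarrow> y \<in> coord_space n \<Longrightarrow> (\<And>i. i < n \<Longrightarrow> x i = y i) \<Longrightarrow> x = y"
  by (auto simp: coord_space_def fun_eq_iff vec_apply) (metis not_le)

lemma coord_space_expand:
  fixes x :: "nat \<Rightarrow> 'a::Fields.field"
  assumes "x \<in> coord_space n" shows "x = (\<Sum>j<n. vscale (x j) (unit_coord j))"
proof (rule coord_space_eqI[OF assms])
  show "(\<Sum>j<n. vscale (x j) (unit_coord j)) \<in> coord_space n"
    by (intro coord_space_sum coord_space_vscale coord_space_unit) simp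
  fix i assume "i < n"
  thus "x i = (\<Sum>j<n. vscale (x j) (unit_coord j)) i"
    by (simp add: sum_fun_apply vec_apply unit_coord_def if_distrib[of "\<lambda>t. _ * t"] cong: if_cong)
qed

locale linear_op =
  fixes f :: "(nat \<Rightarrow> 'a::Fields.field) \<Rightarrow> nat \<Rightarrow> 'a"
  assumes add: "f (x + y) = f x + f y" and scale: "f (vscale a x) = vscale a (f x)"
begin

lemma zero [simp]: "f 0 = 0"
  using add[of 0 0] by simp

lemma minus: "f (- x) = - f x"
  using add[of x "- x"] by (simp add: eq_neg_iff_add_eq_0 add.commute)

lemma diff: "f (x - y) = f x - f y"
  using add[of x "- y"] minus[of y] by simp

lemma sum: "f (sum g A) = (\<Sum>a\<in>A. f (g a))"
  by (induction A rule: infinite_finite_induct) (simp_all add: add)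

end

lemma linear_op_mat_app: "linear_op (mat_app n M)"
  by unfold_locales
    (auto simp: mat_app_def fun_eq_iff vec_apply algebra_simps sum.distrib sum_distrib_left)

interpretation mat_app: linear_op "mat_app n M" for n M
  by (rule linear_op_mat_app)

lemma mat_app_unit:
  fixes M :: "nat \<Rightarrow> nat \<Rightarrow> 'a::Fields.field"
  shows "j < n \<Longrightarrow> mat_app n M (unit_coord j) = (\<lambda>i. if i < n then M i j else 0)"
  by (auto simp: mat_app_def unit_coord_def fun_eq_iff if_distrib[of "\<lambda>t. _ * t"] sum.delta cong: if_cong)

section \<open>The maximum norm on coordinate vectors\<close>

context ultrametric
begin

text \<open>The entry 0 gives the value 0 for \<open>n = 0\<close>. Coordinates from
  \<open>n\<close> on are ignored, so this is a norm on \<open>coord_space n\<close> and only a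
  seminorm on all functions.\<close>

definition nrm :: "nat \<Rightarrow> (nat \<Rightarrow> 'a) \<Rightarrow> real" where
  "nrm n x = Max (insert 0 ((\<lambda>i. v (x i)) ` {..<n}))"

lemma nrm_le_iff: "nrm n x \<le> r \<longleftrightarrow> 0 \<le> r \<and> (\<forall>i<n. v (x i) \<le> r)"
  unfolding nrm_def by (subst Max_le_iff) auto

lemma nrm_less_iff: "nrm n x < r \<longleftrightarrow> 0 < r \<and> (\<forall>i<n. v (x i) < r)"
  unfolding nrm_def by (subst Max_less_iff) auto

lemma nrm_nonneg [simp]: "0 \<le> nrm n x"
  unfolding nrm_def by (intro Max_ge) auto

lemma le_nrm: "i < n \<Longrightarrow> v (x i) \<le> nrm n x"
  using nrm_le_iff by blast

lemma nrm_zero [simp]: "nrm n 0 = 0"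
  by (rule antisym) (auto simp: nrm_le_iff vec_apply)

lemma nrm_add: "nrm n (x + y) \<le> max (nrm n x) (nrm n y)"
  unfolding nrm_le_iff
proof safe
  fix i assume "i < n"
  thus "v ((x + y) i) \<le> max (nrm n x) (nrm n y)"
    using ultra[of "x i" "y i"] le_nrm[of i n x] le_nrm[of i n y] by (auto simp: vec_apply)
qed (simp add: le_max_iff_disj)

lemma nrm_minus [simp]: "nrm n (- x) = nrm n x"
  by (simp add: nrm_def vec_apply)

lemma nrm_diff: "nrm n (x - y) \<le> max (nrm n x) (nrm n y)"
  using nrm_add[of n x "- y"] by simp

lemma nrm_minus_commute: "nrm n (x - y) = nrm n (y - x)"
  using nrm_minus[of n "x - y"] by simp

lemma nrm_add_le: "nrm n x \<le> r \<Longrightarrow> nrm n y \<le> r \<Longrightarrow> nrm n (x + y) \<le> r"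
  using nrm_add[of n x y] by linarith

lemma nrm_diff_le: "nrm n x \<le> r \<Longrightarrow> nrm n y \<le> r \<Longrightarrow> nrm n (x - y) \<le> r"
  using nrm_diff[of n x y] by linarith

lemma nrm_sum_le: "0 \<le> r \<Longrightarrow> (\<And>a. a \<in> A \<Longrightarrow> nrm n (f a) \<le> r) \<Longrightarrow> nrm n (sum f A) \<le> r"
  by (induction A rule: infinite_finite_induct) (auto intro!: nrm_add_le)

lemma nrm_scale [simp]: "nrm n (vscale a x) = v a * nrm n x"
proof (cases "a = 0")
  case False
  show ?thesis
  proof (rule antisym)
    show "nrm n (vscale a x) \<le> v a * nrm n x"
      by (auto simp: nrm_le_iff mult vec_apply intro!: mult_left_mono le_nrm)
    have "v (x i) \<le> nrm n (vscale a x) / v a" if "i < n" for i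
      using le_nrm[OF that, of "vscale a x"] False by (simp add: mult field_simps vec_apply)
    hence "nrm n x \<le> nrm n (vscale a x) / v a" by (auto simp: nrm_le_iff)
    thus "v a * nrm n x \<le> nrm n (vscale a x)" using False by (simp add: field_simps)
  qed
qed (simp add: vscale_def flip: zero_fun_def)

lemma nrm_eq_0: "x \<in> coord_space n \<Longrightarrow> nrm n x = 0 \<longleftrightarrow> x = 0"
proof
  assume x: "x \<in> coord_space n" "nrm n x = 0"
  have "x i = 0" if "i < n" for i
    using le_nrm[OF that, of x] x(2) nonneg[of "x i"] zero_iff[of "x i"] by linarith
  thus "x = 0" using x(1) by (auto simp: coord_space_def fun_eq_iff vec_apply) (metis not_le)
qed simp

text \<open>In an ultrametric triangle the two longest sides agree. This is how approximate orbits
  are shown to be nonzero and how the size of an inverse is determined.\<close>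

lemma nrm_eq_of_less: "nrm n x < nrm n y \<Longrightarrow> nrm n (x + y) = nrm n y"
proof -
  assume "nrm n x < nrm n y"
  moreover have "nrm n y \<le> max (nrm n (x + y)) (nrm n x)" using nrm_diff[of n "x + y" x] by simp
  ultimately show ?thesis using nrm_add[of n x y] by linarith
qed

lemma nrm_diff_eq_of_less: "nrm n (x - y) < nrm n y \<Longrightarrow> nrm n x = nrm n y"
  using nrm_eq_of_less[of n "x - y" y] by simp

lemma mat_app_bounded: "\<exists>C\<ge>0. \<forall>x. nrm n (mat_app n M x) \<le> C * nrm n x"
proof -
  define C where "C = Max (insert 0 ((\<lambda>(i, j). v (M i j)) ` ({..<n} \<times> {..<n})))"
  have C0: "0 \<le> C" unfolding C_def by (intro Max_ge) auto
  have C: "v (M i j) \<le> C" if "i < n" "j < n" for i j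
    unfolding C_def using that by (intro Max_ge) auto
  have "nrm n (mat_app n M x) \<le> C * nrm n x" for x
    using C0 C by (auto simp: nrm_le_iff mat_app_def mult intro!: sum_le mult_mono le_nrm)
  thus ?thesis using C0 by blast
qed

end

section \<open>Polynomials of linear operators\<close>

text \<open>The operator product of the factors \<open>f - l\<close> for \<open>l\<close> in the
  list, where the head acts first. In this form a split annihilating polynomial is accessible to
  induction on its factors.\<close>

primrec lprod :: "((nat \<Rightarrow> 'a::Fields.field) \<Rightarrow> nat \<Rightarrow> 'a) \<Rightarrow> 'a list \<Rightarrow> (nat \<Rightarrow> 'a) \<Rightarrow> nat \<Rightarrow> 'a" where
  "lprod f [] x = x"
| "lprod f (l # ls) x = lprod f ls (f x - vscale l x)"

definition peval :: "((nat \<Rightarrow> 'a::Fields.field) \<Rightarrow> nat \<Rightarrow> 'a) \<Rightarrow> 'a poly \<Rightarrow> (nat \<Rightarrow> 'a) \<Rightarrow> nat \<Rightarrow> 'a" where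
  "peval f p x = (\<Sum>i\<le>Polynomial.degree p. vscale (Polynomial.coeff p i) ((f ^^ i) x))"

context linear_op
begin

lemma linear_op_lprod: "linear_op (lprod f ls)"
proof (induction ls)
  case (Cons l ls)
  interpret L: linear_op "lprod f ls" by (rule Cons)
  show ?case
    by unfold_locales (simp_all add: add scale L.add[symmetric] L.scale[symmetric] algebra_simps
        vscale.scale_right_distrib vscale.scale_right_diff_distrib vscale.scale_left_commute)
qed (unfold_locales, simp_all)

lemma lprod_commute: "lprod f ls (f x) = f (lprod f ls x)"
proof (induction ls arbitrary: x)
  case (Cons l ls)
  show ?case using Cons[of "f x - vscale l x"] by (simp add: diff scale)
qed simp

lemma lprod_factor: "lprod f ls (f x - vscale l x) = f (lprod f ls x) - vscale l (lprod f ls x)"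
proof -
  interpret L: linear_op "lprod f ls" by (rule linear_op_lprod)
  show ?thesis by (simp add: L.diff L.scale lprod_commute)
qed

lemma lprod_zero [simp]: "lprod f ls 0 = 0"
proof -
  interpret L: linear_op "lprod f ls" by (rule linear_op_lprod)
  show ?thesis by simp
qed

lemma peval_altdef: "Polynomial.degree p \<le> N \<Longrightarrow> peval f p x = (\<Sum>i\<le>N. vscale (Polynomial.coeff p i) ((f ^^ i) x))"
  unfolding peval_def by (rule sum.mono_neutral_left) (auto simp: coeff_eq_0)

lemma peval_add: "peval f (p + q) x = peval f p x + peval f q x"
proof -
  define N where "N = max (Polynomial.degree p) (Polynomial.degree q)"
  have "Polynomial.degree (p + q) \<le> N" by (simp add: N_def degree_add_le_max)
  thus ?thesis by (simp add: peval_altdef[of _ N] N_def vscale.scale_left_distrib sum.distrib)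
qed

lemma peval_zero [simp]: "peval f 0 x = 0"
  by (simp add: peval_def)

lemma peval_smult: "peval f (Polynomial.smult a p) x = vscale a (peval f p x)"
  by (simp add: peval_altdef[of _ "Polynomial.degree p"] degree_smult_le vscale.scale_sum_right)

lemma peval_pCons: "peval f (pCons a p) x = vscale a x + peval f p (f x)"
proof -
  have "Polynomial.degree (pCons a p) \<le> Suc (Polynomial.degree p)" by simp
  hence "peval f (pCons a p) x = (\<Sum>i\<le>Suc (Polynomial.degree p). vscale (Polynomial.coeff (pCons a p) i) ((f ^^ i) x))"
    by (rule peval_altdef)
  also have "\<dots> = vscale a x + peval f p (f x)"
    unfolding peval_def by (subst sum.atMost_Suc_shift) (simp add: funpow_swap1)
  finally show ?thesis .
qed

lemma linear_op_peval: "linear_op (peval f p)"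
proof (induction p)
  case (pCons a p)
  interpret L: linear_op "peval f p" by (rule pCons)
  show ?case
    by unfold_locales (simp_all add: peval_pCons add scale L.add L.scale vscale.scale_right_distrib
        vscale.scale_left_commute)
qed (unfold_locales, auto)

lemma peval_mult: "peval f (p * q) x = peval f q (peval f p x)"
proof (induction p arbitrary: x)
  case 0
  interpret L: linear_op "peval f q" by (rule linear_op_peval)
  show ?case by simp
next
  case (pCons a p)
  interpret L: linear_op "peval f q" by (rule linear_op_peval)
  show ?case using pCons by (simp add: peval_add peval_smult peval_pCons L.add L.scale)
qed

lemma peval_linear: "peval f [:- l, 1:] x = f x - vscale l x"
  by (simp add: peval_pCons)

lemma peval_prod_linear: "peval f (\<Prod>l\<leftarrow>ls. [:- l, 1:]) x = lprod f ls x"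
proof (induction ls arbitrary: x)
  case Nil
  show ?case by (simp add: peval_pCons one_pCons)
next
  case (Cons l ls)
  thus ?case by (simp only: list.map prod_list.Cons peval_mult peval_linear lprod.simps)
qed

lemma peval_sum: "peval f (sum p A) x = (\<Sum>a\<in>A. peval f (p a) x)"
  by (induction A rule: infinite_finite_induct) (auto simp: peval_add)

end

text \<open>With \<open>B\<close> the adjugate of the characteristic matrix, \<open>CM * B\<close>
  is the scalar matrix of the characteristic polynomial. When polynomial entries are read as
  operators, the k-th column of \<open>CM\<close> applied to the unit vectors gives the image of the
  k-th unit vector minus its expansion, hence 0, and multiplication by \<open>B\<close> transfers
  this to \<open>chi\<close>.\<close>

lemma Cayley_Hamilton_mat_app:
  fixes M :: "nat \<Rightarrow> nat \<Rightarrow> 'a::Fields.field"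
  assumes "x \<in> coord_space n"
  shows "peval (mat_app n M) (char_poly (mat n n (\<lambda>(i, j). M i j))) x = 0"
proof -
  define f where "f = mat_app n M"
  interpret f: linear_op f unfolding f_def by (rule linear_op_mat_app)
  define A where "A = mat n n (\<lambda>(i, j). M i j)"
  define CM where "CM = char_poly_matrix A"
  define B where "B = adj_mat CM"
  define chi where "chi = char_poly A"
  have CM: "CM \<in> carrier_mat n n" unfolding CM_def A_def by simp
  have B: "B \<in> carrier_mat n n" and CB: "CM * B = chi \<cdot>\<^sub>m 1\<^sub>m n"
    using adj_mat[OF CM] by (auto simp: B_def chi_def char_poly_def CM_def)
  have CM_entry: "CM $$ (i, k) = (if i = k then [:0, 1:] else 0) + [: - M i k :]" if "i < n" "k < n" for i k
    using that by (auto simp: CM_def char_poly_matrix_def A_def)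
  have entry: "(\<Sum>k<n. CM $$ (i, k) * B $$ (k, j)) = (if i = j then chi else 0)" if "i < n" "j < n" for i j
  proof -
    have "(CM * B) $$ (i, j) = (\<Sum>k<n. CM $$ (i, k) * B $$ (k, j))"
      using that CM B by (auto simp: scalar_prod_def lessThan_atLeast0 intro!: sum.cong)
    thus ?thesis using that by (cases "i = j") (simp_all add: CB)
  qed
  have col: "(\<Sum>i<n. peval f (CM $$ (i, k)) (unit_coord i)) = 0" if k: "k < n" for k
  proof -
    have "(\<Sum>i<n. peval f (CM $$ (i, k)) (unit_coord i)) =
        (\<Sum>i<n. (if i = k then f (unit_coord i) else 0) - vscale (M i k) (unit_coord i))"
      using k by (intro sum.cong) (auto simp: CM_entry f.peval_add f.peval_pCons)
    also have "\<dots> = f (unit_coord k) - (\<Sum>i<n. vscale (f (unit_coord k) i) (unit_coord i))"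
      using k by (simp add: sum_subtractf f_def mat_app_unit)
    also have "\<dots> = 0"
      using coord_space_expand[of "f (unit_coord k)" n] by (simp add: f_def)
    finally show ?thesis .
  qed
  have unit: "peval f chi (unit_coord j) = 0" if j: "j < n" for j
  proof -
    have "peval f chi (unit_coord j) = (\<Sum>i<n. peval f (if i = j then chi else 0) (unit_coord i))"
      using j by (simp add: if_distrib[of "peval f"] if_distribR cong: if_cong)
    also have "\<dots> = (\<Sum>i<n. \<Sum>k<n. peval f (B $$ (k, j)) (peval f (CM $$ (i, k)) (unit_coord i)))"
      using j by (intro sum.cong refl, subst entry[symmetric]) (auto simp: f.peval_sum f.peval_mult)
    also have "\<dots> = (\<Sum>k<n. \<Sum>i<n. peval f (B $$ (k, j)) (peval f (CM $$ (i, k)) (unit_coord i)))"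
      by (rule sum.swap)
    also have "\<dots> = (\<Sum>k<n. peval f (B $$ (k, j)) (\<Sum>i<n. peval f (CM $$ (i, k)) (unit_coord i)))"
      by (simp add: linear_op.sum[OF f.linear_op_peval])
    also have "\<dots> = 0" by (simp add: col linear_op.zero[OF f.linear_op_peval])
    finally show ?thesis .
  qed
  have "peval f chi x = (\<Sum>j<n. vscale (x j) (peval f chi (unit_coord j)))"
    by (subst coord_space_expand[OF assms])
      (simp add: linear_op.sum[OF f.linear_op_peval] linear_op.scale[OF f.linear_op_peval])
  also have "\<dots> = 0" by (simp add: unit)
  finally show ?thesis by (simp add: f_def chi_def A_def)
qed

section \<open>Orbits of linear maps and growth rates\<close>

lemma ex_bi_orbit:
  fixes F :: "int \<Rightarrow> 'b \<Rightarrow> 'b"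
  assumes surj: "\<And>k y. \<exists>z. F k z = y"
  shows "\<exists>c. c 0 = x \<and> (\<forall>k. c (k + 1) = F k (c k))"
proof -
  obtain B where B: "\<And>k y. F k (B k y) = y" using surj by metis
  define fw where "fw = rec_nat x (\<lambda>j y. F (int j) y)"
  \<comment> \<open>The step from time \<open>- int j\<close> back to \<open>- int j - 1\<close>
    chooses a preimage under the map with index \<open>- int j - 1\<close>, which is the one that
    leads forward again.\<close>
  define bw where "bw = rec_nat x (\<lambda>j y. B (- int j - 1) y)"
  define c where "c = (\<lambda>k. if 0 \<le> k then fw (nat k) else bw (nat (- k)))"
  have "c (k + 1) = F k (c k)" for k
  proof (cases "0 \<le> k")
    case True
    hence "nat (k + 1) = Suc (nat k)" by simp
    thus ?thesis using True by (simp add: c_def fw_def)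
  next
    case False
    hence n: "nat (- k) = Suc (nat (- k - 1))" by simp
    have "F k (c k) = bw (nat (- k - 1))"
      using False B[of k] unfolding c_def n bw_def by simp
    also have "\<dots> = c (k + 1)"
    proof (cases "k = -1")
      case True thus ?thesis by (simp add: c_def fw_def bw_def)
    next
      case kn: False
      hence "nat (- k - 1) = nat (- (k + 1))" by simp
      thus ?thesis using kn False by (simp add: c_def)
    qed
    finally show ?thesis by simp
  qed
  moreover have "c 0 = x" by (simp add: c_def fw_def)
  ultimately show ?thesis by blast
qed

lemma int_bi_induct [case_names base step1 step2]:
  assumes "P (0::int)" "\<And>k. 0 \<le> k \<Longrightarrow> P k \<Longrightarrow> P (k + 1)" "\<And>k. k < 0 \<Longrightarrow> P (k + 1) \<Longrightarrow> P k"
  shows "P k"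
proof (induction k rule: int_induct[of _ 0])
  case (step2 i) thus ?case using assms(3)[of "i - 1"] by simp
qed (use assms in auto)

text \<open>The supremum \<open>s\<close> satisfies \<open>s \<le> max (q * s) D\<close>, which for
  \<open>q < 1\<close> leaves only \<open>s \<le> D\<close>. The a priori bound \<open>B\<close>,
  absent from the conclusion, makes the supremum finite and so excludes growing solutions.\<close>

lemma bounded_contraction_le:
  fixes a :: "'b \<Rightarrow> real"
  assumes bdd: "\<And>k. a k \<le> B" and nn: "\<And>k. 0 \<le> a k" and q: "0 \<le> q" "q < 1" and D: "0 \<le> D"
    and step: "\<And>s. (\<And>k. a k \<le> s) \<Longrightarrow> (\<And>k. a k \<le> max (q * s) D)"
  shows "a k \<le> D"
proof -
  define s where "s = (SUP k. a k)"
  have le: "a k \<le> s" for k unfolding s_def by (rule cSUP_upper) (use bdd in \<open>auto intro!: bdd_aboveI\<close>)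
  have "s \<le> max (q * s) D" unfolding s_def
    by (rule cSUP_least) (use step[OF le] in \<open>auto simp: s_def\<close>)
  moreover have "0 \<le> s" using nn[of k] le[of k] by linarith
  ultimately have "s \<le> D" using q D mult_strict_right_mono[of q 1 s] by (cases "s = 0") (auto simp: le_max_iff_disj)
  thus ?thesis using le[of k] by linarith
qed

text \<open>An additive decomposition into generalised eigenspaces of equal absolute value; the
  equation \<open>(f - l) x' = y\<close> is solved inside the space killed by the factors \<open>ms\<close>
  for a number \<open>l\<close> not in \<open>ms\<close>.\<close>

context linear_op
begin

lemma lprod_solve:
  assumes "lprod f ms y = 0" "l \<notin> set ms"
  shows "\<exists>x. lprod f ms x = 0 \<and> f x - vscale l x = y"
  using assms
proof (induction ms arbitrary: y)
  case Nil thus ?case by (intro exI[of _ 0]) simp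
next
  case (Cons m ms)
  then obtain x' where x': "lprod f ms x' = 0" "f x' - vscale l x' = f y - vscale m y" by auto
  \<comment> \<open>From \<open>(f - l) x' = (f - m) y\<close> follows
    \<open>(f - l) (x' - y) = (l - m) y\<close>, so a multiple of the difference is the
    solution.\<close>
  define z where "z = x' - y"
  define x where "x = vscale (inverse (l - m)) z"
  interpret L: linear_op "lprod f ms" by (rule linear_op_lprod)
  have ml: "l - m \<noteq> 0" using Cons.prems by simp
  have scaled: "f x - vscale a x = vscale (inverse (l - m)) (f z - vscale a z)" for a
    by (simp add: x_def scale vscale.scale_right_diff_distrib mult.commute)
  have "f z - vscale l z = vscale (l - m) y"
    using x'(2) by (simp add: z_def diff vscale.scale_right_diff_distrib vscale.scale_left_diff_distrib algebra_simps)
  hence "f x - vscale l x = y" using ml by (simp add: scaled)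
  moreover have "lprod f (m # ms) x = 0"
  proof -
    have "lprod f ms (f y - vscale m y) = 0" using Cons.prems by simp
    moreover have "lprod f ms (f x' - vscale m x') = 0" by (simp add: lprod_factor x')
    moreover have "f z - vscale m z = (f x' - vscale m x') - (f y - vscale m y)"
      by (simp add: z_def diff vscale.scale_right_diff_distrib algebra_simps)
    ultimately have "lprod f ms (f z - vscale m z) = 0" by (simp only: L.diff) simp
    thus ?thesis by (simp add: scaled L.scale)
  qed
  ultimately show ?case by blast
qed

lemma decompose_by_value:
  fixes w :: "'a \<Rightarrow> real"
  assumes "lprod f ls x = 0"
  shows "\<exists>y. x = (\<Sum>\<rho>\<in>w ` set ls. y \<rho>) \<and>
     (\<forall>\<rho>\<in>w ` set ls. \<exists>ms. (\<forall>m\<in>set ms. m \<in> set ls \<and> w m = \<rho>) \<and> lprod f ms (y \<rho>) = 0)"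
  using assms
proof (induction ls arbitrary: x)
  case Nil thus ?case by simp
next
  case (Cons l ls)
  let ?S = "w ` set ls"
  obtain y where y: "f x - vscale l x = (\<Sum>\<rho>\<in>?S. y \<rho>)"
    and "\<And>\<rho>. \<rho> \<in> ?S \<Longrightarrow> \<exists>ms. (\<forall>m\<in>set ms. m \<in> set ls \<and> w m = \<rho>) \<and> lprod f ms (y \<rho>) = 0"
    using Cons.IH[of "f x - vscale l x"] Cons.prems by auto
  then obtain ms where ms: "\<And>\<rho> m. \<rho> \<in> ?S \<Longrightarrow> m \<in> set (ms \<rho>) \<Longrightarrow> m \<in> set ls \<and> w m = \<rho>"
      "\<And>\<rho>. \<rho> \<in> ?S \<Longrightarrow> lprod f (ms \<rho>) (y \<rho>) = 0" by metis
  have "\<exists>x'. lprod f (ms \<rho>) x' = 0 \<and> f x' - vscale l x' = y \<rho>" if "\<rho> \<in> ?S - {w l}" for \<rho>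
  proof (rule lprod_solve)
    show "lprod f (ms \<rho>) (y \<rho>) = 0" using ms(2) that by blast
    show "l \<notin> set (ms \<rho>)"
    proof
      assume "l \<in> set (ms \<rho>)"
      moreover have "\<rho> \<in> ?S" "\<rho> \<noteq> w l" using that by auto
      ultimately show False using ms(1)[of \<rho> l] by metis
    qed
  qed
  then obtain x' where x': "\<And>\<rho>. \<rho> \<in> ?S - {w l} \<Longrightarrow> lprod f (ms \<rho>) (x' \<rho>) = 0"
    "\<And>\<rho>. \<rho> \<in> ?S - {w l} \<Longrightarrow> f (x' \<rho>) - vscale l (x' \<rho>) = y \<rho>" by metis
  \<comment> \<open>The parts of \<open>(f - l) x\<close> with values other than \<open>w l\<close>
    have been lifted through \<open>f - l\<close>. After subtracting the lifts only the part of
    value \<open>w l\<close> remains, and there the factor \<open>l\<close> is added to the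
    list.\<close>
  define x0 where "x0 = x - (\<Sum>\<rho>\<in>?S - {w l}. x' \<rho>)"
  have "f x0 - vscale l x0 = (f x - vscale l x) - (\<Sum>\<rho>\<in>?S - {w l}. f (x' \<rho>) - vscale l (x' \<rho>))"
    by (simp add: x0_def diff sum vscale.scale_right_diff_distrib vscale.scale_sum_right sum_subtractf)
  also have "\<dots> = (\<Sum>\<rho>\<in>?S. y \<rho>) - (\<Sum>\<rho>\<in>?S - {w l}. y \<rho>)"
    using x'(2) y by simp
  also have "\<dots> = (\<Sum>\<rho>\<in>?S \<inter> {w l}. y \<rho>)"
    by (subst sum.Int_Diff[of ?S _ "{w l}"]) simp_all
  finally have x0: "f x0 - vscale l x0 = (\<Sum>\<rho>\<in>?S \<inter> {w l}. y \<rho>)" .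
  define z where "z = (\<lambda>\<rho>. if \<rho> = w l then x0 else x' \<rho>)"
  have "x = (\<Sum>\<rho>\<in>insert (w l) (?S - {w l}). z \<rho>)"
    by (subst sum.insert) (auto simp: z_def x0_def intro!: sum.cong)
  hence "x = (\<Sum>\<rho>\<in>w ` set (l # ls). z \<rho>)" by (simp add: insert_Diff_single)
  moreover have "\<exists>ms. (\<forall>m\<in>set ms. m \<in> set (l # ls) \<and> w m = \<rho>) \<and> lprod f ms (z \<rho>) = 0"
    if "\<rho> \<in> w ` set (l # ls)" for \<rho>
  proof (cases "\<rho> = w l")
    case False
    hence \<rho>: "\<rho> \<in> ?S - {w l}" using that by auto
    have "\<forall>m\<in>set (ms \<rho>). m \<in> set (l # ls) \<and> w m = \<rho>" using ms(1)[of \<rho>] \<rho> by (metis DiffD1 list.set_intros(2))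
    moreover have "lprod f (ms \<rho>) (z \<rho>) = 0" using x'(1)[OF \<rho>] False by (simp add: z_def)
    ultimately show ?thesis by blast
  next
    case True
    show ?thesis
    proof (cases "w l \<in> ?S")
      case True': True
      hence "f x0 - vscale l x0 = y (w l)" using x0 by (simp add: Int_absorb1)
      hence "lprod f (l # ms (w l)) (z \<rho>) = 0" using True ms(2)[OF True'] by (simp add: z_def)
      moreover have "\<forall>m\<in>set (l # ms (w l)). m \<in> set (l # ls) \<and> w m = \<rho>"
        using ms(1)[OF True'] True by (metis list.set_intros set_ConsD)
      ultimately show ?thesis by blast
    next
      case False
      hence "f x0 - vscale l x0 = 0" using x0 by simp
      thus ?thesis using True by (intro exI[of _ "[l]"]) (auto simp: z_def)
    qed
  qed
  ultimately show ?case by (intro exI[of _ z]) blast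
qed

end

context ultrametric
begin

text \<open>The orbit is built by \<open>c (k + 1) = m c k + c' k\<close>, where \<open>c'\<close>
  is the orbit of \<open>(f - m) x\<close> for the shorter list. Multiplication by \<open>m\<close>
  scales the norm by exactly \<rho>, so this recursion preserves the bound
  \<open>C * \<rho> powi k\<close> in both directions; the maximum replaces the sum that would
  otherwise produce powers of \<open>k\<close>.\<close>

lemma orbit_of_equal_value:
  assumes "linear_op f" "0 < \<rho>" "\<And>m. m \<in> set ms \<Longrightarrow> v m = \<rho>" "lprod f ms x = 0"
  shows "\<exists>c C. c 0 = x \<and> (\<forall>k::int. c (k + 1) = f (c k)) \<and> (\<forall>k. nrm n (c k) \<le> C * \<rho> powi k)"
  using assms(3,4)
proof (induction ms arbitrary: x)
  interpret linear_op f by fact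
  case Nil
  thus ?case by (intro exI[of _ "\<lambda>_. 0"] exI[of _ 0]) simp
next
  interpret linear_op f by fact
  case (Cons m ms)
  obtain c' C' where c': "c' 0 = f x - vscale m x" "\<And>k. c' (k + 1) = f (c' k)"
    "\<And>k. nrm n (c' k) \<le> C' * \<rho> powi k" using Cons.IH[of "f x - vscale m x"] Cons.prems by auto
  have m: "v m = \<rho>" "m \<noteq> 0" using Cons.prems(1)[of m] \<open>0 < \<rho>\<close> by auto
  \<comment> \<open>Backward steps invert the scalar \<open>m\<close>, not \<open>f\<close>; that
    the result is an orbit of \<open>f\<close> is checked in \<open>diff_c\<close>.\<close>
  have "\<exists>z. vscale m z + c' k = y" for k y
    using m by (intro exI[of _ "vscale (inverse m) (y - c' k)"]) simp
  then obtain c where c: "c 0 = x" "\<And>k. c (k + 1) = vscale m (c k) + c' k"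
    using ex_bi_orbit[of "\<lambda>k z. vscale m z + c' k" x] by auto
  have diff_c: "f (c k) - vscale m (c k) = c' k" for k
  proof (induction k rule: int_bi_induct)
    case base thus ?case by (simp add: c c')
  next
    case (step1 k)
    have "f (c (k + 1)) - vscale m (c (k + 1)) = vscale m (f (c k) - vscale m (c k)) + f (c' k) - vscale m (c' k)"
      by (simp add: c add scale vscale.scale_right_distrib vscale.scale_right_diff_distrib)
    thus ?case using step1 c'(2)[of k] by simp
  next
    case (step2 k)
    have "vscale m (f (c k) - vscale m (c k)) = f (c (k + 1)) - vscale m (c (k + 1)) - f (c' k) + vscale m (c' k)"
      by (simp add: c add scale vscale.scale_right_distrib vscale.scale_right_diff_distrib)
    hence "vscale m (f (c k) - vscale m (c k)) = vscale m (c' k)" using step2 c'(2)[of k] by simp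
    thus ?case using m by simp
  qed
  define C where "C = max (nrm n x) (C' / \<rho>)"
  have "C' / \<rho> \<le> C" by (simp add: C_def)
  hence C': "C' \<le> C * \<rho>" using \<open>0 < \<rho>\<close> by (simp add: pos_divide_le_eq)
  have C0: "nrm n x \<le> C" by (simp add: C_def)
  have shift: "\<rho> powi (k + 1) = \<rho> * \<rho> powi k" for k using \<open>0 < \<rho>\<close> by (simp add: power_int_add_1')
  have "nrm n (c k) \<le> C * \<rho> powi k" for k
  proof (induction k rule: int_bi_induct)
    case base thus ?case by (simp add: c C0)
  next
    case (step1 k)
    have "v m * nrm n (c k) \<le> C * \<rho> powi (k + 1)"
      using mult_left_mono[OF step1(2), of \<rho>] \<open>0 < \<rho>\<close> by (simp add: m shift mult_ac)
    moreover have "nrm n (c' k) \<le> C * \<rho> powi (k + 1)"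
      using order_trans[OF c'(3)[of k] mult_right_mono[OF C', of "\<rho> powi k"]] \<open>0 < \<rho>\<close>
      by (simp add: shift mult.assoc)
    ultimately show ?case unfolding c by (intro nrm_add_le) simp_all
  next
    case (step2 k)
    have "vscale m (c k) = c (k + 1) - c' k" by (simp add: c)
    moreover have "nrm n (c' k) \<le> C * \<rho> powi (k + 1)"
      using order_trans[OF c'(3)[of k] mult_right_mono[OF C', of "\<rho> powi k"]] \<open>0 < \<rho>\<close>
      by (simp add: shift mult.assoc)
    ultimately have "nrm n (vscale m (c k)) \<le> C * \<rho> powi (k + 1)"
      using nrm_diff_le[OF step2(2), of "c' k"] by simp
    hence "\<rho> * nrm n (c k) \<le> \<rho> * (C * \<rho> powi k)" by (simp add: m shift mult_ac)
    thus ?case using \<open>0 < \<rho>\<close> by simp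
  qed
  moreover have "c (k + 1) = f (c k)" for k using diff_c[of k] c(2)[of k] by (simp add: algebra_simps)
  ultimately show ?case using c(1) by blast
qed

text \<open>After division by \<open>\<tau> powi k\<close> the recursion contracts with factor
  \<open>v l / \<tau>\<close> forwards if \<open>v l < \<tau>\<close>, and with factor
  \<open>\<tau> / v l\<close> backwards if \<open>v l > \<tau>\<close>. Either way a bounded
  solution is controlled by the inhomogeneous term.\<close>

lemma scalar_pseudo_orbit_bound:
  fixes x g :: "int \<Rightarrow> nat \<Rightarrow> 'a"
  assumes \<tau>: "0 < \<tau>" and l: "v l \<noteq> \<tau>" and rec: "\<And>k. x (k + 1) = vscale l (x k) + g k"
    and bdd: "\<And>k. nrm n (x k) \<le> B * \<tau> powi k" and g: "\<And>k. nrm n (g k) \<le> D * \<tau> powi k"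
    and D: "0 \<le> D"
  shows "nrm n (x k) \<le> D / \<tau> * \<tau> powi k"
proof -
  have pk: "0 < \<tau> powi k" for k using \<tau> by simp
  have shift: "\<tau> powi (k + 1) = \<tau> * \<tau> powi k" for k using \<tau> by (simp add: power_int_add_1')
  define a where "a = (\<lambda>k. nrm n (x k) / \<tau> powi k)"
  have ax: "nrm n (x k) = a k * \<tau> powi k" for k using \<tau> by (simp add: a_def)
  have mx: "max (b * p) (d * p) = max b d * p" if "0 < p" for b d p :: real
    using that by (simp add: max_def)
  have aB: "a k \<le> B" and a0: "0 \<le> a k" for k using bdd[of k] pk[of k] by (simp_all add: a_def field_simps)
  have main: "a k \<le> D / \<tau>"
  proof (cases "v l < \<tau>")
    case True
    show ?thesis
    proof (rule bounded_contraction_le[OF aB a0, of "v l / \<tau>"])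
      show "v l / \<tau> < 1" "0 \<le> v l / \<tau>" "0 \<le> D / \<tau>" using True \<tau> D by simp_all
      fix s k assume s: "\<And>k. a k \<le> s"
      have "nrm n (x (k - 1 + 1)) \<le> max (v l * nrm n (x (k - 1))) (nrm n (g (k - 1)))"
        unfolding rec using nrm_add by (metis nrm_scale)
      also have "\<dots> \<le> max (v l * s * \<tau> powi (k - 1)) (D * \<tau> powi (k - 1))"
        using s[of "k - 1"] pk[of "k - 1"] g[of "k - 1"]
        by (intro max.mono) (auto simp: ax mult.assoc intro!: mult_left_mono)
      also have "\<dots> = max (v l * s) D * \<tau> powi (k - 1)" by (rule mx[OF pk])
      also have "\<tau> powi (k - 1) = \<tau> powi k / \<tau>" using \<tau> shift[of "k - 1"] by simp
      finally have "a k \<le> max (v l * s) D / \<tau>" using pk[of k] by (simp add: a_def field_simps)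
      also have "\<dots> = max (v l / \<tau> * s) (D / \<tau>)" using \<tau> by (simp add: max_divide_distrib_right)
      finally show "a k \<le> max (v l / \<tau> * s) (D / \<tau>)" .
    qed
  next
    case False
    hence l: "\<tau> < v l" using l by simp
    have l0: "0 < v l" using l \<tau> by linarith
    show ?thesis
    proof (rule bounded_contraction_le[OF aB a0, of "\<tau> / v l"])
      show "\<tau> / v l < 1" "0 \<le> \<tau> / v l" "0 \<le> D / \<tau>" using l \<tau> l0 D by simp_all
      fix s k assume s: "\<And>k. a k \<le> s"
      have "vscale l (x k) = x (k + 1) - g k" by (simp add: rec)
      hence "v l * nrm n (x k) \<le> max (nrm n (x (k + 1))) (nrm n (g k))"
        by (metis nrm_scale nrm_diff)
      also have "\<dots> \<le> max (s * \<tau> powi (k + 1)) (D * \<tau> powi k)"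
        using s[of "k + 1"] pk[of "k + 1"] g[of k] by (intro max.mono) (auto simp: ax)
      also have "\<dots> = max (\<tau> * s * \<tau> powi k) (D * \<tau> powi k)"
        unfolding shift by (simp add: mult_ac)
      also have "\<dots> = max (\<tau> * s) D * \<tau> powi k" by (rule mx[OF pk])
      finally have "v l * a k \<le> max (\<tau> * s) D" using pk[of k] by (simp add: a_def field_simps)
      hence "a k \<le> max (\<tau> * s) D / v l" using l0 by (simp add: field_simps)
      also have "\<dots> = max (\<tau> / v l * s) (D / v l)" using l0 by (simp add: max_divide_distrib_right)
      also have "\<dots> \<le> max (\<tau> / v l * s) (D / \<tau>)"
        using l l0 \<tau> D by (intro max.mono divide_left_mono mult_pos_pos) auto
      finally show "a k \<le> max (\<tau> / v l * s) (D / \<tau>)" .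
    qed
  qed
  thus ?thesis unfolding ax using pk[of k] by (intro mult_right_mono) auto
qed

text \<open>Reducing the factors one by one, each step is a scalar recursion whose coefficient has
  absolute value different from \<open>\<tau>\<close>.\<close>

lemma pseudo_orbit_bound:
  assumes f: "linear_op f" and \<tau>: "0 < \<tau>"
    and Cf: "\<And>x. nrm n (f x) \<le> Cf * nrm n x"
    and ls: "\<And>l. l \<in> set ls \<Longrightarrow> v l \<noteq> \<tau>"
  shows "\<exists>C\<ge>0. \<forall>x r B e. 0 \<le> e \<longrightarrow> (\<forall>k::int. x (k + 1) = f (x k) + r k \<and> lprod f ls (x k) = 0 \<and>
      nrm n (x k) \<le> B * \<tau> powi k \<and> nrm n (r k) \<le> e * \<tau> powi k) \<longrightarrow>
      (\<forall>k. nrm n (x k) \<le> C * e * \<tau> powi k)"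
    (is "\<exists>C\<ge>0. ?P ls C")
  using ls
proof (induction ls)
  case Nil
  show ?case by (intro exI[of _ 0]) auto
next
  case (Cons l ls)
  interpret linear_op f by fact
  have "\<exists>C\<ge>0. ?P ls C" using Cons by simp
  then obtain C' where C'0: "0 \<le> C'" and IH: "?P ls C'" by blast
  define c where "c = max \<bar>Cf\<bar> (v l)"
  have c0: "0 \<le> c" by (simp add: c_def)
  have cb: "nrm n (f y - vscale l y) \<le> c * t" if "nrm n y \<le> t" for y t
  proof (rule nrm_diff_le)
    have t: "0 \<le> t" using that nrm_nonneg[of n y] by linarith
    have "nrm n (f y) \<le> Cf * nrm n y" by (rule Cf)
    also have "\<dots> \<le> c * t" using that t by (intro mult_mono) (auto simp: c_def)
    finally show "nrm n (f y) \<le> c * t" .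
    show "nrm n (vscale l y) \<le> c * t" using that t c0 unfolding nrm_scale by (intro mult_mono) (auto simp: c_def)
  qed
  \<comment> \<open>The constant \<open>C' * c\<close> bounds \<open>y\<close> through the shorter
    list, and the 1 accounts for the summand \<open>r\<close> in
    \<open>x (k + 1) = l x k + (y k + r k)\<close>.\<close>
  define D where "D = max (C' * c) 1"
  have D: "0 \<le> D" "C' * c \<le> D" "1 \<le> D" by (simp_all add: D_def le_max_iff_disj)
  have pk: "0 < \<tau> powi k" for k using \<tau> by simp
  have "?P (l # ls) (D / \<tau>)"
  proof (intro allI impI)
    fix x r B e k
    assume e: "0 \<le> e" and x: "\<forall>k::int. x (k + 1) = f (x k) + r k \<and> lprod f (l # ls) (x k) = 0 \<and>
      nrm n (x k) \<le> B * \<tau> powi k \<and> nrm n (r k) \<le> e * \<tau> powi k"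
    \<comment> \<open>Applying \<open>f - l\<close> yields a pseudo-orbit annihilated by the
      remaining factors, with defect \<open>(f - l) (r k)\<close>.\<close>
    define y where "y = (\<lambda>k. f (x k) - vscale l (x k))"
    define r' where "r' = (\<lambda>k. f (r k) - vscale l (r k))"
    have "y (k + 1) = f (y k) + r' k \<and> lprod f ls (y k) = 0 \<and>
          nrm n (y k) \<le> (c * B) * \<tau> powi k \<and> nrm n (r' k) \<le> (c * e) * \<tau> powi k" for k
    proof -
      have "y (k + 1) = f (y k) + r' k"
        using x by (simp add: y_def r'_def diff add scale vscale.scale_right_distrib)
      moreover have "nrm n (y k) \<le> (c * B) * \<tau> powi k" using cb[of "x k" "B * \<tau> powi k"] x
        by (simp add: y_def mult.assoc)
      moreover have "nrm n (r' k) \<le> (c * e) * \<tau> powi k" using cb[of "r k" "e * \<tau> powi k"] x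
        by (simp add: r'_def mult.assoc)
      ultimately show ?thesis using x by (simp add: y_def)
    qed
    hence yk: "\<forall>k. nrm n (y k) \<le> C' * (c * e) * \<tau> powi k"
      using IH c0 e by (metis mult_nonneg_nonneg)
    have "nrm n (y k + r k) \<le> D * e * \<tau> powi k" for k
    proof (rule nrm_add_le)
      have "C' * c * e * \<tau> powi k \<le> D * e * \<tau> powi k"
        using D e pk[of k] by (intro mult_right_mono) auto
      thus "nrm n (y k) \<le> D * e * \<tau> powi k" using yk by (simp add: mult.assoc) (meson order_trans)
      have "1 * e * \<tau> powi k \<le> D * e * \<tau> powi k"
        using D e pk[of k] by (intro mult_right_mono) auto
      thus "nrm n (r k) \<le> D * e * \<tau> powi k" using x by simp (meson order_trans)
    qed
    moreover have "x (k + 1) = vscale l (x k) + (y k + r k)" for k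
      using x by (simp add: y_def)
    ultimately have "nrm n (x k) \<le> D * e / \<tau> * \<tau> powi k"
      using x D e Cons.prems[of l] by (intro scalar_pseudo_orbit_bound[OF \<tau>, of l x "\<lambda>k. y k + r k" n B]) auto
    thus "nrm n (x k) \<le> D / \<tau> * e * \<tau> powi k" by simp
  qed
  moreover have "0 \<le> D / \<tau>" using \<tau> D by simp
  ultimately show ?case by blast
qed

end

section \<open>Compactness in coordinate spaces\<close>

lemma compact_PiE_UNIV:
  fixes S :: "'i \<Rightarrow> 'b::topological_space set"
  assumes "\<And>i. compact (S i)" shows "compact (Pi UNIV S)"
proof -
  have "compactin (product_topology (\<lambda>i. euclidean) UNIV) (PiE UNIV S)"
    using assms by (simp add: compactin_PiE)
  thus ?thesis by (simp add: euclidean_product_topology PiE_UNIV_domain)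
qed

lemma open_coord_preimage: "open U \<Longrightarrow> open {x :: 'i \<Rightarrow> 'b::topological_space. x i \<in> U}"
  using open_vimage[of U "\<lambda>x. x i"] continuous_on_product_coordinates[where i=i] by (simp add: vimage_def)

locale lf =
  fixes v :: "'k::local_field \<Rightarrow> real"
  assumes abs_val: "absolute_value v" and def_top: "defines_topology v"
begin

sublocale ultrametric v
  by (rule local_field_ultrametric[OF abs_val def_top])

lemma open_iff: "open U \<longleftrightarrow> (\<forall>x\<in>U. \<exists>e>0. \<forall>y. v (y - x) < e \<longrightarrow> y \<in> U)"
  using def_top by (auto simp: defines_topology_def)

lemma ultra3: "v (x - z) \<le> max (v (x - y)) (v (y - z))"
  using ultra[of "x - y" "y - z"] by simp

lemma open_ball: "open {y. v (y - x) < e}"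
  unfolding open_iff
proof (intro ballI)
  fix z assume z: "z \<in> {y. v (y - x) < e}"
  have "v (y - x) < e" if "v (y - z) < e" for y
    using ultra3[of y x z] that z by (simp add: le_max_iff_disj) linarith
  moreover have "0 < e" using z order.strict_trans1[OF nonneg[of "z - x"]] by simp
  ultimately show "\<exists>d>0. \<forall>y. v (y - z) < d \<longrightarrow> y \<in> {y. v (y - x) < e}" by auto
qed

text \<open>Away from 0 the absolute value is locally constant, so an estimate is made only at
  0.\<close>

lemma open_eball: "open {y. v y * a < e}"
  unfolding open_iff
proof (intro ballI)
  fix z assume z: "z \<in> {y. v y * a < e}"
  show "\<exists>d>0. \<forall>y. v (y - z) < d \<longrightarrow> y \<in> {y. v y * a < e}"
  proof (cases "z = 0")
    case False
    have "v y = v z" if "v (y - z) < v z" for y using eq_of_less[OF that] by simp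
    thus ?thesis using z False by (metis (mono_tags, lifting) mem_Collect_eq pos_iff)
  next
    case True
    hence e: "0 < e" using z by simp
    have "v y * a < e" if y: "v y < e / (\<bar>a\<bar> + 1)" for y
    proof -
      have "v y * a \<le> v y * (\<bar>a\<bar> + 1)" by (intro mult_left_mono) auto
      also have "\<dots> < e" using y by (simp add: pos_less_divide_eq)
      finally show ?thesis .
    qed
    thus ?thesis using True e by (intro exI[of _ "e / (\<bar>a\<bar> + 1)"]) auto
  qed
qed

lemma open_ball_compl: "open {y. e < v y}"
  unfolding open_iff
proof (intro ballI)
  fix z assume z: "z \<in> {y. e < v y}"
  show "\<exists>d>0. \<forall>y. v (y - z) < d \<longrightarrow> y \<in> {y. e < v y}"
  proof (cases "z = 0")
    case False
    have "v y = v z" if "v (y - z) < v z" for y using eq_of_less[OF that] by simp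
    thus ?thesis using z False by (metis (mono_tags, lifting) mem_Collect_eq pos_iff)
  next
    case True
    hence "e < v y" for y using z order.strict_trans2[OF _ nonneg[of y]] by simp
    thus ?thesis by (intro exI[of _ 1]) simp
  qed
qed

lemma ex_small: assumes "0 < e" shows "\<exists>x. x \<noteq> 0 \<and> v x < e"
proof (rule ccontr)
  assume "\<not> ?thesis"
  hence "{0} = {y. v (y - 0) < e}" using assms by auto
  hence "open {0::'k}" using open_ball[of 0 e] by simp
  thus False using not_open_singleton by blast
qed

lemma ex_large: "\<exists>x. r < v x"
proof -
  have "0 < inverse (\<bar>r\<bar> + 1)" by (simp add: add_nonneg_pos)
  from ex_small[OF this] obtain x where x: "x \<noteq> 0" "v x < inverse (\<bar>r\<bar> + 1)" by blast
  hence "inverse (inverse (\<bar>r\<bar> + 1)) < inverse (v x)" by (intro less_imp_inverse_less) auto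
  thus ?thesis by (intro exI[of _ "inverse x"]) (auto simp: inverse)
qed

text \<open>Division by a scalar of large absolute value moves the ball into a compact neighbourhood
  of 0.\<close>

lemma compact_ball: "compact {x. v x \<le> r}"
proof -
  obtain W :: "'k set" where W: "open W" "compact W" "0 \<in> W" by (rule local_field_compact_open)
  then obtain e where e: "e > 0" "\<And>y. v (y - 0) < e \<Longrightarrow> y \<in> W" using open_iff by meson
  obtain a where a: "max r 1 / e < v a" using ex_large by blast
  have a0: "a \<noteq> 0"
  proof
    assume "a = 0"
    moreover have "0 < max r 1 / e" using e by simp
    ultimately show False using a by simp
  qed
  have "compact ((\<lambda>x. a * x) ` W)"
    by (rule compact_continuous_image[OF _ W(2)]) (auto intro!: continuous_intros)
  moreover have "closed {x. v x \<le> r}" using open_ball_compl[of r] by (simp add: closed_def Compl_eq not_le)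
  moreover have "{x. v x \<le> r} \<subseteq> (\<lambda>x. a * x) ` W"
  proof
    fix x assume x: "x \<in> {x. v x \<le> r}"
    have "r < e * v a" using a e by (simp add: field_simps)
    hence "v (x / a) < e" using x a0 by (simp add: divide pos_divide_less_eq)
    hence "x / a \<in> W" using e by simp
    thus "x \<in> (\<lambda>x. a * x) ` W" using a0 by (intro image_eqI[of _ _ "x / a"]) auto
  qed
  ultimately show ?thesis by (metis compact_Int_closed inf.absorb2)
qed

lemma compact_cball_coord: "compact {x \<in> coord_space n. nrm n x \<le> r}"
proof (cases "0 \<le> r")
  case True
  have "{x \<in> coord_space n. nrm n x \<le> r} = Pi UNIV (\<lambda>i. if i < n then {x. v x \<le> r} else {0})"
    (is "?A = ?B")
  proof (intro equalityI subsetI)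
    fix x assume "x \<in> ?A"
    thus "x \<in> ?B" by (simp add: nrm_le_iff coord_space_def Pi_iff)
  next
    fix x assume x: "x \<in> ?B"
    have "x i \<in> (if i < n then {x. v x \<le> r} else {0})" for i using x by (rule PiE_mem[of _ UNIV, unfolded PiE_UNIV_domain]) simp
    hence "(i < n \<longrightarrow> v (x i) \<le> r) \<and> (n \<le> i \<longrightarrow> x i = 0)" for i by (metis leD mem_Collect_eq singletonD)
    thus "x \<in> ?A" using True by (simp add: nrm_le_iff coord_space_def)
  qed
  thus ?thesis by (auto intro!: compact_PiE_UNIV simp: compact_ball)
next
  case False
  hence "{x \<in> coord_space n. nrm n x \<le> r} = {}" using order_trans[OF nrm_nonneg] by blast
  thus ?thesis by (simp only: compact_empty)
qed

lemma compact_cball_seq: "compact {x :: 'i \<Rightarrow> nat \<Rightarrow> 'k. \<forall>i. x i \<in> coord_space n \<and> nrm n (x i) \<le> r}"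
  using compact_PiE_UNIV[of "\<lambda>i::'i. {x \<in> coord_space n. nrm n x \<le> r}"] compact_cball_coord
  by (simp add: Pi_def)

lemma open_coord_ball1: "open {x :: 'i \<Rightarrow> 'k. v (x i - a) < e}"
  using open_coord_preimage[OF open_ball[of a e], of i] by simp

lemma open_coord_ball: "open {x. nrm n (x - p) < e}"
proof -
  have "{x. nrm n (x - p) < e} = (if 0 < e then (\<Inter>i\<in>{..<n}. {x. v (x i - p i) < e}) else {})"
    using nrm_nonneg[of n] by (auto simp: nrm_less_iff vec_apply)
  thus ?thesis by (auto intro!: open_INT open_coord_ball1)
qed

text \<open>A basic open set of the product topology is a product of open sets, and on
  \<open>coord_space n\<close> all coordinates from \<open>n\<close> on are 0, so the least of the
  radii at the first \<open>n\<close> coordinates suffices.\<close>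

lemma open_contains_coord_ball:
  assumes "open W" "p \<in> W" "p \<in> coord_space n"
  shows "\<exists>e>0. \<forall>x\<in>coord_space n. nrm n (x - p) < e \<longrightarrow> x \<in> W"
proof -
  have "openin (product_topology (\<lambda>i. euclidean) UNIV) W" using assms(1) by (simp add: euclidean_product_topology)
  then obtain Y where Y: "p \<in> PiE UNIV Y" "\<And>i. open (Y i)" "finite {i. Y i \<noteq> UNIV}" "PiE UNIV Y \<subseteq> W"
    using product_topology_open_contains_basis[of "\<lambda>i. euclidean" UNIV W p] assms(2) by auto
  have "\<exists>e>0. \<forall>y. v (y - p i) < e \<longrightarrow> y \<in> Y i" for i
    using Y(1,2) open_iff[of "Y i"] by auto
  then obtain e where e: "\<And>i. e i > 0" "\<And>i y. v (y - p i) < e i \<Longrightarrow> y \<in> Y i" by metis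
  define d where "d = Min (insert 1 (e ` {..<n}))"
  have "d > 0" unfolding d_def using e(1) by (subst Min_gr_iff) auto
  moreover have "x \<in> W" if x: "x \<in> coord_space n" "nrm n (x - p) < d" for x
  proof -
    have "x i \<in> Y i" for i
    proof (cases "i < n")
      case True
      hence "d \<le> e i" unfolding d_def by (intro Min_le) auto
      thus ?thesis using x(2) True by (intro e(2)) (auto simp: nrm_less_iff vec_apply)
    next
      case False
      hence "x i = p i" using x assms(3) by (simp add: coord_space_def)
      thus ?thesis using Y(1) by auto
    qed
    thus ?thesis using Y(4) by auto
  qed
  ultimately show ?thesis by blast
qed

lemma tendsto_iff_v: "(f \<longlongrightarrow> l) F \<longleftrightarrow> (\<forall>e>0. eventually (\<lambda>x. v (f x - l) < e) F)"
proof (intro iffI allI impI)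
  fix e :: real assume "(f \<longlongrightarrow> l) F" "e > 0"
  thus "eventually (\<lambda>x. v (f x - l) < e) F"
    by (drule_tac topological_tendstoD[OF _ open_ball[of l e]]) auto
next
  assume *: "\<forall>e>0. eventually (\<lambda>x. v (f x - l) < e) F"
  show "(f \<longlongrightarrow> l) F"
  proof (rule topological_tendstoI)
    fix S assume "open S" "l \<in> S"
    then obtain e where "e > 0" "\<And>y. v (y - l) < e \<Longrightarrow> y \<in> S" using open_iff by meson
    thus "eventually (\<lambda>x. f x \<in> S) F" using *[rule_format, of e] eventually_mono[of "\<lambda>x. v (f x - l) < e" F "\<lambda>x. f x \<in> S"] by blast
  qed
qed

lemma eventually_at_0: "eventually P (at (0::'k)) \<longleftrightarrow> (\<exists>d>0. \<forall>s. s \<noteq> 0 \<and> v s < d \<longrightarrow> P s)"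
proof
  assume "eventually P (at (0::'k))"
  then obtain S where "open S" "0 \<in> S" "\<And>s. s \<in> S \<Longrightarrow> s \<noteq> 0 \<Longrightarrow> P s"
    by (auto simp: eventually_at_topological)
  thus "\<exists>d>0. \<forall>s. s \<noteq> 0 \<and> v s < d \<longrightarrow> P s" using open_iff[of S] by fastforce
next
  assume "\<exists>d>0. \<forall>s. s \<noteq> 0 \<and> v s < d \<longrightarrow> P s"
  then obtain d where "d > 0" "\<And>s. s \<noteq> 0 \<Longrightarrow> v s < d \<Longrightarrow> P s" by blast
  thus "eventually P (at (0::'k))" unfolding eventually_at_topological
    using open_ball[of 0 d] by (intro exI[of _ "{y. v (y - 0) < d}"]) auto
qed

end

section \<open>Descent from the algebraic closure\<close>

interpretation ac: vector_space "\<lambda>(a::'k::Fields.field) x. to_ac a * x"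
  by unfold_locales (auto simp: algebra_simps)

interpretation ac_pair: vector_space_pair "\<lambda>(a::'k::Fields.field) x. to_ac a * x" "(*) :: 'k \<Rightarrow> _"
  by unfold_locales (auto simp: algebra_simps)

definition ac_mat :: "(nat \<Rightarrow> nat \<Rightarrow> 'k::Fields.field) \<Rightarrow> nat \<Rightarrow> nat \<Rightarrow> 'k alg_closure" where
  "ac_mat M = (\<lambda>i j. to_ac (M i j))"

locale lfw = lf v for v :: "'k::local_field \<Rightarrow> real" +
  fixes w :: "'k alg_closure \<Rightarrow> real"
  assumes w_abs_val: "absolute_value w" and w_to_ac: "\<And>x. w (to_ac x) = v x"
begin

lemma ultrametric_w: "ultrametric w"
proof (rule ultrametric_of_bounded_nat[OF w_abs_val])
  fix k :: nat
  have "v (of_nat k) \<le> 1"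
  proof (induction k)
    case (Suc k) thus ?case using ultra[of 1 "of_nat k"] by simp
  qed simp
  thus "w (of_nat k) \<le> 1" using w_to_ac[of "of_nat k"] by simp
qed

sublocale W: ultrametric w
  by (rule ultrametric_w)

text \<open>Equivalence of norms on a finite-dimensional space over a locally compact field. The
  function \<open>N\<close> is positive and, being ultrametric, locally constant on the compact unit
  sphere, so it has a positive lower bound there; the general case follows by scaling.\<close>

lemma independent_norm_bound:
  fixes b :: "nat \<Rightarrow> 'k alg_closure"
  assumes "inj_on b {..<m}" "ac.independent (b ` {..<m})"
  shows "\<exists>d>0. \<forall>c\<in>coord_space m. d * nrm m c \<le> w (\<Sum>i<m. to_ac (c i) * b i)"
proof -
  define N where "N = (\<lambda>c. w (\<Sum>i<m. to_ac (c i) * b i))"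
  define S where "S = {c \<in> coord_space m. nrm m c = 1}"
  have scale: "N (vscale a c) = v a * N c" for a c
  proof -
    have "(\<Sum>i<m. to_ac (vscale a c i) * b i) = to_ac a * (\<Sum>i<m. to_ac (c i) * b i)"
      unfolding sum_distrib_left by (intro sum.cong refl) (simp only: vscale_apply to_ac_mult mult.assoc)
    thus ?thesis unfolding N_def by (simp only: W.mult w_to_ac)
  qed
  have pos: "0 < N c" if "c \<in> S" for c
  proof (rule ccontr)
    assume "\<not> 0 < N c"
    hence 0: "(\<Sum>i<m. to_ac (c i) * b i) = 0" by (simp add: N_def)
    have "(\<Sum>x\<in>b ` {..<m}. to_ac (c (inv_into {..<m} b x)) * x) = 0"
      using 0 assms(1) by (subst sum.reindex) (auto simp: inv_into_f_f)
    hence "c (inv_into {..<m} b (b i)) = 0" if "i < m" for i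
      using ac.independentD[OF assms(2), of "b ` {..<m}" "\<lambda>x. c (inv_into {..<m} b x)" "b i"] that by auto
    hence "c i = 0" if "i < m" for i using assms(1) that by (simp add: inv_into_f_f)
    hence "nrm m c \<le> 0" by (auto simp: nrm_le_iff)
    thus False using that by (simp add: S_def)
  qed
  \<comment> \<open>On this neighbourhood the difference \<open>d - c\<close> has value below
    \<open>N c\<close>, so that \<open>N d = N c\<close>.\<close>
  define B where "B = (\<lambda>c. {d. \<forall>i<m. v (d i - c i) * w (b i) < N c})"
  have "open (B c)" for c
  proof -
    have "B c = (\<Inter>i\<in>{..<m}. {d. v (d i - c i) * w (b i) < N c})" by (auto simp: B_def)
    moreover have "open {d :: nat \<Rightarrow> 'k. v (d i - c i) * w (b i) < N c}" for i
    proof -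
      have "open ((\<lambda>y. y - c i) -` {y. v y * w (b i) < N c})"
        by (intro open_vimage open_eball continuous_intros)
      from open_coord_preimage[OF this, of i] show ?thesis by simp
    qed
    ultimately show ?thesis by (simp add: open_INT)
  qed
  moreover have "c \<in> B c" if "c \<in> S" for c using pos[OF that] by (auto simp: B_def)
  moreover have "compact S"
  proof -
    have "S = {c \<in> coord_space m. nrm m c \<le> 1} - {c. nrm m (c - 0) < 1}" by (auto simp: S_def)
    thus ?thesis using compact_diff[OF compact_cball_coord open_coord_ball, of m 1 m 0 1] by simp
  qed
  ultimately obtain D where D: "D \<subseteq> S" "finite D" "S \<subseteq> (\<Union>c\<in>D. B c)"
    using compact_finite_cover[of S B] by blast
  have N_eq: "N d = N c" if "d \<in> B c" "0 < N c" for c d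
  proof -
    have "N (d - c) < N c"
    proof -
      have "w (\<Sum>i<m. to_ac ((d - c) i) * b i) \<le> Max (insert 0 ((\<lambda>i. v (d i - c i) * w (b i)) ` {..<m}))"
        by (rule W.sum_le) (auto simp: vec_apply W.mult simp del: to_ac_diff simp add: w_to_ac intro!: Max_ge)
      also have "\<dots> < N c" using that by (subst Max_less_iff) (auto simp: B_def)
      finally show ?thesis by (simp add: N_def)
    qed
    moreover have "(\<Sum>i<m. to_ac ((d - c) i) * b i) + (\<Sum>i<m. to_ac (c i) * b i) = (\<Sum>i<m. to_ac (d i) * b i)"
      by (simp add: vec_apply algebra_simps flip: sum.distrib)
    ultimately show ?thesis unfolding N_def using W.eq_of_less by metis
  qed
  define \<delta> where "\<delta> = Min (insert 1 (N ` D))"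
  have \<delta>: "0 < \<delta>" unfolding \<delta>_def using D pos by (subst Min_gr_iff) auto
  have \<delta>S: "\<delta> \<le> N c" if "c \<in> S" for c
  proof -
    have "c \<in> (\<Union>d\<in>D. B d)" using D(3) that by blast
    then obtain d where d: "d \<in> D" "c \<in> B d" by blast
    hence "N c = N d" using N_eq pos D(1) by blast
    thus ?thesis unfolding \<delta>_def using d(1) D(2) by (intro Min_le) auto
  qed
  have "\<delta> * nrm m c \<le> N c" if c: "c \<in> coord_space m" for c
  proof (cases "c = 0")
    case True
    thus ?thesis by (simp add: N_def)
  next
    case False
    hence n0: "nrm m c \<noteq> 0" using c by (simp add: nrm_eq_0)
    have "nrm m c \<in> insert 0 ((\<lambda>i. v (c i)) ` {..<m})" unfolding nrm_def by (rule Max_in) auto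
    then obtain i where i: "i < m" "nrm m c = v (c i)" using n0 by auto
    \<comment> \<open>Norms are values of \<open>v\<close>: dividing by a coordinate of maximal
      value lands exactly on the unit sphere.\<close>
    hence "vscale (inverse (c i)) c \<in> S" using c n0 by (auto simp: S_def coord_space_vscale inverse)
    hence "\<delta> \<le> N (vscale (inverse (c i)) c)" by (rule \<delta>S)
    also have "\<dots> = N c / nrm m c" using i by (simp add: scale inverse divide_inverse mult.commute)
    finally show ?thesis using n0 nrm_nonneg[of m c] by (simp add: field_simps)
  qed
  thus ?thesis using \<delta> unfolding N_def by blast
qed

text \<open>A basis of the span of \<open>E\<close> containing \<open>e\<close> gives a coordinate
  functional, which is bounded on that span by the equivalence of norms. Boundedness is claimed only
  there, since the closure may have infinite dimension over the ground field.\<close>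

lemma bounded_functional:
  fixes E :: "'k alg_closure set"
  assumes "finite E" "e \<in> E" "e \<noteq> 0"
  shows "\<exists>(h :: 'k alg_closure \<Rightarrow> 'k) C. (\<forall>x y. h (x + y) = h x + h y) \<and> (\<forall>a x. h (to_ac a * x) = a * h x) \<and>
    h e = 1 \<and> (\<forall>x\<in>ac.span E. v (h x) \<le> C * w x)"
proof -
  have "ac.independent {e}" using assms(3) by (simp add: ac.independent_insert)
  then obtain B where B: "{e} \<subseteq> B" "B \<subseteq> E" "ac.independent B" "E \<subseteq> ac.span B"
    using ac.maximal_independent_subset_extend[of "{e}" E] assms by auto
  have fB: "finite B" using B(2) assms(1) by (rule finite_subset)
  obtain h where h: "Vector_Spaces.linear (\<lambda>a x. to_ac a * x) (*) h" "\<forall>x\<in>B. h x = (if x = e then 1 else 0)"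
    using ac_pair.linear_independent_extend[OF B(3), of "\<lambda>x. if x = e then 1 else 0"] by blast
  interpret h: Vector_Spaces.linear "\<lambda>a x. to_ac a * x" "(*)" h by (rule h)
  obtain b where b: "bij_betw b {..<card B} B" using fB by (metis ex_bij_betw_nat_finite atLeast0LessThan)
  define m where "m = card B"
  have bB: "b ` {..<m} = B" "inj_on b {..<m}" using b by (auto simp: bij_betw_def m_def)
  obtain d where d: "d > 0" "\<forall>c\<in>coord_space m. d * nrm m c \<le> w (\<Sum>i<m. to_ac (c i) * b i)"
    using independent_norm_bound[of b m] B(3) bB by auto
  obtain i0 where i0: "i0 < m" "b i0 = e" using B(1) bB(1) by auto
  have "v (h x) \<le> inverse d * w x" if "x \<in> ac.span E" for x
  proof -
    have "ac.span E \<subseteq> ac.span B" using B(4) by (simp add: ac.span_minimal)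
    hence "x \<in> ac.span B" using that by blast
    then obtain u where u: "x = (\<Sum>y\<in>B. to_ac (u y) * y)" using ac.span_finite[OF fB] by auto
    define c where "c = (\<lambda>i. if i < m then u (b i) else 0)"
    have c: "c \<in> coord_space m" by (simp add: c_def coord_space_def)
    have x: "x = (\<Sum>i<m. to_ac (c i) * b i)"
      unfolding u bB(1)[symmetric] using bB(2) by (subst sum.reindex) (auto simp: c_def)
    have hb: "h (b i) = (if i = i0 then 1 else 0)" if "i < m" for i
    proof -
      have "b i \<in> B" using bB(1) that by blast
      moreover have "b i = e \<longleftrightarrow> i = i0" using inj_on_eq_iff[OF bB(2), of i i0] that i0 by simp
      ultimately show ?thesis using h(2) by simp
    qed
    have "h x = (\<Sum>i<m. c i * h (b i))" unfolding x by (simp add: h.sum h.scale)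
    also have "\<dots> = (\<Sum>i<m. if i = i0 then c i else 0)"
      by (intro sum.cong refl) (simp add: hb)
    also have "\<dots> = c i0" using i0 by simp
    finally have "v (h x) \<le> nrm m c" using le_nrm[OF i0(1), of c] by simp
    moreover have "d * nrm m c \<le> w x" using d(2) c x by simp
    ultimately show ?thesis using d(1) by (simp add: field_simps) (meson mult_left_mono order_trans less_imp_le)
  qed
  moreover have "h e = 1" using h(2) B(1) by auto
  moreover have "\<forall>x y. h (x + y) = h x + h y" "\<forall>a x. h (to_ac a * x) = a * h x"
    by (auto simp: h.add h.scale)
  ultimately show ?thesis by blast
qed

text \<open>The matrices \<open>M\<close> and \<open>N\<close> have entries in the ground field.
  Hence the coordinates of the whole orbit, backwards by means of \<open>N\<close>, stay in the span
  of \<open>E\<close>, where \<open>h\<close> is bounded, and \<open>h\<close> commutes with the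
  matrix. One \<open>h\<close> serves all orbits starting in \<open>E\<close>, so that it can be
  applied to a sum of several.\<close>

lemma descend_orbits:
  fixes M N :: "nat \<Rightarrow> nat \<Rightarrow> 'k"
  assumes E: "finite E" "e \<in> E" "e \<noteq> 0"
    and NM: "\<And>x. x \<in> coord_space n \<Longrightarrow> mat_app n (ac_mat N) (mat_app n (ac_mat M) x) = x"
  shows "\<exists>h :: 'k alg_closure \<Rightarrow> 'k. (\<forall>x y. h (x + y) = h x + h y) \<and> (\<forall>a x. h (to_ac a * x) = a * h x) \<and> h e = 1 \<and>
    (\<forall>c C \<rho>. 0 < \<rho> \<longrightarrow> (\<forall>i<n. c 0 i \<in> E) \<longrightarrow>
       (\<forall>k::int. c (k + 1) = mat_app n (ac_mat M) (c k) \<and> W.nrm n (c k) \<le> C * \<rho> powi k) \<longrightarrow>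
       (\<exists>C'. \<forall>k. (\<lambda>i. h (c (k + 1) i)) = mat_app n M (\<lambda>i. h (c k i)) \<and> nrm n (\<lambda>i. h (c k i)) \<le> C' * \<rho> powi k))"
proof -
  obtain h :: "'k alg_closure \<Rightarrow> 'k" and D where h: "\<And>x y. h (x + y) = h x + h y" "\<And>a x. h (to_ac a * x) = a * h x"
    "h e = 1" "\<And>x. x \<in> ac.span E \<Longrightarrow> v (h x) \<le> D * w x" using bounded_functional[OF E] by blast
  have "h 0 + 0 = h 0 + h 0" using h(1)[of 0 0] by (simp only: add_0_right)
  hence h0: "h 0 = 0" by (simp only: add_left_cancel)
  have hsum: "h (\<Sum>i\<in>A. f i) = (\<Sum>i\<in>A. h (f i))" for f and A :: "nat set"
    by (induction A rule: infinite_finite_induct) (auto simp: h h0)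
  have span_mat: "mat_app n (ac_mat L) x i \<in> ac.span E" if "\<forall>i<n. x i \<in> ac.span E" for L x i
    using that by (auto simp: mat_app_def ac_mat_def ac.span_zero intro!: ac.span_sum ac.span_scale)
  have "\<exists>C'. \<forall>k. (\<lambda>i. h (c (k + 1) i)) = mat_app n M (\<lambda>i. h (c k i)) \<and> nrm n (\<lambda>i. h (c k i)) \<le> C' * \<rho> powi k"
    if rho: "0 < \<rho>" and c0: "\<forall>i<n. c 0 i \<in> E" and c: "\<forall>k::int. c (k + 1) = mat_app n (ac_mat M) (c k) \<and> W.nrm n (c k) \<le> C * \<rho> powi k"
    for c C \<rho>
  proof -
    have cc: "c k \<in> coord_space n" for k
    proof -
      have "c (k - 1 + 1) = mat_app n (ac_mat M) (c (k - 1))" using c by blast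
      thus ?thesis by simp
    qed
    have bk: "c k = mat_app n (ac_mat N) (c (k + 1))" for k using c NM[OF cc] by simp
    have span: "\<forall>i<n. c k i \<in> ac.span E" for k
    proof (induction k rule: int_bi_induct)
      case base thus ?case using c0 by (simp add: ac.span_base)
    next
      case (step1 k) thus ?case using span_mat[of "c k" M] c by simp
    next
      case (step2 k) thus ?case using span_mat[of "c (k + 1)" N] bk[of k] by simp
    qed
    have "(\<lambda>i. h (c (k + 1) i)) = mat_app n M (\<lambda>i. h (c k i))" for k
      using c by (auto simp: mat_app_def ac_mat_def hsum h h0)
    moreover have "nrm n (\<lambda>i. h (c k i)) \<le> \<bar>D\<bar> * C * \<rho> powi k" for k
    proof -
      have C: "W.nrm n (c k) \<le> C * \<rho> powi k" using c by blast
      have C0: "0 \<le> C * \<rho> powi k" using W.nrm_nonneg[of n "c k"] C by linarith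
      have "v (h (c k i)) \<le> \<bar>D\<bar> * C * \<rho> powi k" if "i < n" for i
      proof -
        have "v (h (c k i)) \<le> D * w (c k i)" using span[of k] that h(4) by blast
        also have "\<dots> \<le> \<bar>D\<bar> * (C * \<rho> powi k)"
          using C0 order_trans[OF W.le_nrm[OF that, of "c k"] C] by (intro mult_mono) auto
        finally show ?thesis by (simp add: mult.assoc)
      qed
      thus ?thesis using C0 by (auto simp: nrm_le_iff mult.assoc)
    qed
    ultimately show ?thesis by blast
  qed
  thus ?thesis using h by blast
qed

end

section \<open>The spectrum and its growth spaces\<close>

definition roots :: "nat \<Rightarrow> (nat \<Rightarrow> nat \<Rightarrow> 'k::Fields.field) \<Rightarrow> 'k alg_closure set" where
  "roots n M = {z. poly (map_poly to_ac (char_poly (mat n n (\<lambda>(i, j). M i j)))) z = 0}"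

lemma comm_ring_hom_to_ac: "comm_ring_hom (to_ac :: 'k::Fields.field \<Rightarrow> _)"
  by unfold_locales auto

lemma char_poly_ac_mat:
  "map_poly to_ac (char_poly (mat n n (\<lambda>(i, j). M i j))) = char_poly (mat n n (\<lambda>(i, j). ac_mat M i j))"
proof -
  have "map_mat to_ac (mat n n (\<lambda>(i, j). M i j)) = mat n n (\<lambda>(i, j). ac_mat M i j)"
    by (auto simp: ac_mat_def)
  thus ?thesis
    using comm_ring_hom.char_poly_hom[OF comm_ring_hom_to_ac, of "mat n n (\<lambda>(i, j). M i j)" n] by simp
qed

lemma roots_eigenvector:
  assumes "z \<in> roots n M"
  shows "\<exists>x\<in>coord_space n. x \<noteq> 0 \<and> mat_app n (ac_mat M) x = vscale z x"
proof -
  define A where "A = mat n n (\<lambda>(i, j). ac_mat M i j)"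
  have A: "A \<in> carrier_mat n n" by (simp add: A_def)
  have "eigenvalue A z" using assms eigenvalue_root_char_poly[OF A]
    by (simp add: roots_def char_poly_ac_mat A_def)
  then obtain y where y: "y \<in> carrier_vec n" "y \<noteq> 0\<^sub>v n" "A *\<^sub>v y = z \<cdot>\<^sub>v y"
    using A by (auto simp: eigenvalue_def eigenvector_def)
  define x where "x = (\<lambda>i. if i < n then vec_index y i else 0)"
  have "x \<in> coord_space n" by (simp add: x_def coord_space_def)
  moreover have "x \<noteq> 0"
  proof
    assume "x = 0"
    hence "x i = 0" for i by (simp add: vec_apply)
    hence "vec_index y i = 0" if "i < n" for i using that by (metis x_def)
    hence "y = 0\<^sub>v n" using y(1) by (intro eq_vecI) auto
    thus False using y(2) by simp
  qed
  moreover have "mat_app n (ac_mat M) x i = vscale z x i" for i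
  proof (cases "i < n")
    case True
    have "vec_index (A *\<^sub>v y) i = (\<Sum>j<n. ac_mat M i j * vec_index y j)"
      using True y(1) by (auto simp: A_def scalar_prod_def lessThan_atLeast0 intro!: sum.cong)
    thus ?thesis using y(1) True unfolding y(3) by (simp add: mat_app_def x_def vec_apply)
  qed (simp add: mat_app_def x_def vec_apply)
  ultimately show ?thesis by blast
qed

text \<open>Cayley-Hamilton over the closure, where the characteristic polynomial splits; the list
  repeats roots according to multiplicity.\<close>

lemma roots_annihilate:
  fixes M :: "nat \<Rightarrow> nat \<Rightarrow> 'k::Fields.field"
  shows "\<exists>ls. set ls = roots n M \<and> (\<forall>x\<in>coord_space n. lprod (mat_app n (ac_mat M)) ls x = 0)"
proof -
  define p where "p = char_poly (mat n n (\<lambda>(i, j). ac_mat M i j))"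
  have monic: "Polynomial.lead_coeff p = 1" unfolding p_def using degree_monic_char_poly[of "mat n n (\<lambda>(i, j). ac_mat M i j)" n] by simp
  then obtain B where "p = Polynomial.smult 1 (\<Prod>x\<in>#B. [:- x, 1:])"
    using alg_closed_imp_factorization[of p] by fastforce
  moreover obtain ls where "mset ls = B" by (metis ex_mset)
  ultimately have p: "p = (\<Prod>l\<leftarrow>ls. [:- l, 1:])" by (simp flip: prod_mset_prod_list)
  have "roots n M = {z. poly p z = 0}" by (simp add: roots_def char_poly_ac_mat p_def)
  also have "\<dots> = set ls" unfolding p by (induction ls) auto
  finally have "set ls = roots n M" by simp
  moreover have "lprod (mat_app n (ac_mat M)) ls x = 0" if "x \<in> coord_space n" for x
    using Cayley_Hamilton_mat_app[OF that, of "ac_mat M"] by (simp add: mat_app.peval_prod_linear p flip: p_def)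
  ultimately show ?thesis by blast
qed

lemma finite_roots [simp]: "finite (roots n M)"
  using roots_annihilate[of n M] by (metis List.finite_set)

lemma mat_app_to_ac: "mat_app n (ac_mat M) (\<lambda>i. to_ac (x i)) = (\<lambda>i. to_ac (mat_app n M x i))"
  by (auto simp: mat_app_def ac_mat_def to_ac_sum)

lemma ac_mat_inverse:
  fixes M N :: "nat \<Rightarrow> nat \<Rightarrow> 'k::Fields.field"
  assumes "\<And>x. x \<in> coord_space n \<Longrightarrow> mat_app n N (mat_app n M x) = x" and x: "x \<in> coord_space n"
  shows "mat_app n (ac_mat N) (mat_app n (ac_mat M) x) = x"
proof -
  have u: "unit_coord j = (\<lambda>i. to_ac (unit_coord j i))" for j :: nat
    by (auto simp: unit_coord_def)
  have e: "mat_app n (ac_mat N) (mat_app n (ac_mat M) (unit_coord j)) = unit_coord j" if "j < n" for j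
    using assms(1)[OF coord_space_unit[OF that]] by (subst (1 2) u) (simp add: mat_app_to_ac)
  have "mat_app n (ac_mat N) (mat_app n (ac_mat M) (\<Sum>j<n. vscale (x j) (unit_coord j))) =
      (\<Sum>j<n. vscale (x j) (unit_coord j))"
    by (simp add: mat_app.sum mat_app.scale e)
  thus ?thesis using coord_space_expand[OF x] by simp
qed

section \<open>Vectors of a given growth rate and inhomogeneous recursions\<close>

context ultrametric
begin

definition growth :: "nat \<Rightarrow> (nat \<Rightarrow> nat \<Rightarrow> 'a) \<Rightarrow> real \<Rightarrow> (nat \<Rightarrow> 'a) set" where
  "growth n M \<rho> = {x. \<exists>c C. c 0 = x \<and> (\<forall>k::int. c (k + 1) = mat_app n M (c k) \<and> nrm n (c k) \<le> C * \<rho> powi k)}"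

lemma orbit_in_coord_space:
  assumes "\<forall>k::int. c (k + 1) = mat_app n M (c k)" shows "c k \<in> coord_space n"
proof -
  have "c (k - 1 + 1) = mat_app n M (c (k - 1))" using assms by blast
  thus ?thesis by simp
qed

lemma growth_subset: "growth n M \<rho> \<subseteq> coord_space n"
  unfolding growth_def using orbit_in_coord_space[of _ n M 0] by blast

text \<open>An impulse at time \<open>j\<close> is answered by a shifted copy of the orbit
  \<open>c\<close>, after \<open>j\<close> if \<rho> \<le> 1, and with opposite sign up to time
  \<open>j\<close> if \<rho> > 1; both choices use only times at which the copy is at most
  \<open>C\<close>. Superposition costs a maximum, not a sum, so the bound does not depend on the
  window \<open>W\<close>.\<close>

lemma orbit_solve:
  fixes c :: "int \<Rightarrow> nat \<Rightarrow> 'a" and g :: "int \<Rightarrow> 'a"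
  assumes f: "linear_op f" and c: "\<And>k. c (k + 1) = f (c k)" "\<And>k. nrm n (c k) \<le> C * \<rho> powi k"
    and \<rho>: "0 < \<rho>" and g: "\<And>k. v (g k) \<le> D" and W: "finite W"
  shows "\<exists>u. \<forall>k. u (k + 1) = f (u k) + (if k \<in> W then vscale (g k) (c 0) else 0) \<and> nrm n (u k) \<le> C * D"
proof -
  interpret linear_op f by fact
  have D0: "0 \<le> D" using g[of 0] nonneg[of "g 0"] by linarith
  have C0: "0 \<le> C" using order_trans[OF nrm_nonneg c(2)[of 0]] by simp
  have small: "nrm n (vscale (g j) (c i)) \<le> C * D" if "\<rho> powi i \<le> 1" for i j
  proof -
    have "C * \<rho> powi i \<le> C * 1" using that C0 by (intro mult_left_mono) auto
    hence "nrm n (c i) \<le> C" using c(2)[of i] by simp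
    hence "v (g j) * nrm n (c i) \<le> D * C" using g[of j] D0 by (intro mult_mono) auto
    thus ?thesis by (simp add: mult.commute)
  qed
  have shift: "f (c (k - 1 - j)) = c (k - j)" for k j using c(1)[of "k - 1 - j"] by simp
  show ?thesis
  proof (cases "\<rho> \<le> 1")
    case True
    define u where "u = (\<lambda>k. \<Sum>j\<in>{j\<in>W. j < k}. vscale (g j) (c (k - 1 - j)))"
    have "u (k + 1) = f (u k) + (if k \<in> W then vscale (g k) (c 0) else 0)" for k
    proof -
      have "{j\<in>W. j < k + 1} = {j\<in>W. j < k} \<union> (if k \<in> W then {k} else {})"
        by (auto simp: order_le_less)
      hence "u (k + 1) = (\<Sum>j\<in>{j\<in>W. j < k}. vscale (g j) (c (k - j))) + (if k \<in> W then vscale (g k) (c 0) else 0)"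
        using W by (auto simp: u_def sum.union_disjoint)
      thus ?thesis by (simp add: u_def sum scale shift)
    qed
    moreover have "nrm n (u k) \<le> C * D" for k unfolding u_def
    proof (rule nrm_sum_le)
      fix j assume "j \<in> {j\<in>W. j < k}"
      hence "\<rho> powi (k - 1 - j) \<le> 1" using True \<rho> by (simp add: power_int_def power_le_one)
      thus "nrm n (vscale (g j) (c (k - 1 - j))) \<le> C * D" by (rule small)
    qed (use C0 D0 in simp)
    ultimately show ?thesis by blast
  next
    case False
    define u where "u = (\<lambda>k. - (\<Sum>j\<in>{j\<in>W. k \<le> j}. vscale (g j) (c (k - 1 - j))))"
    have "u (k + 1) = f (u k) + (if k \<in> W then vscale (g k) (c 0) else 0)" for k
    proof -
      have "{j\<in>W. k \<le> j} = {j\<in>W. k + 1 \<le> j} \<union> (if k \<in> W then {k} else {})"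
        by (auto simp: order_le_less)
      moreover have "f (u k) = - (\<Sum>j\<in>{j\<in>W. k \<le> j}. vscale (g j) (c (k - j)))"
        by (simp add: u_def minus sum scale shift)
      ultimately have "f (u k) = - ((\<Sum>j\<in>{j\<in>W. k + 1 \<le> j}. vscale (g j) (c (k - j))) + (if k \<in> W then vscale (g k) (c 0) else 0))"
        using W by (auto simp: sum.union_disjoint)
      thus ?thesis by (simp add: u_def)
    qed
    moreover have "nrm n (u k) \<le> C * D" for k unfolding u_def nrm_minus
    proof (rule nrm_sum_le)
      fix j assume "j \<in> {j\<in>W. k \<le> j}"
      hence "\<rho> powi (k - 1 - j) \<le> 1" using False by (simp add: power_int_def power_le_one inverse_le_1_iff)
      thus "nrm n (vscale (g j) (c (k - 1 - j))) \<le> C * D" by (rule small)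
    qed (use C0 D0 in simp)
    ultimately show ?thesis by blast
  qed
qed

end

context lfw
begin

definition R :: "nat \<Rightarrow> (nat \<Rightarrow> nat \<Rightarrow> 'k) \<Rightarrow> real set" where
  "R n M = w ` roots n M"

lemma finite_R [simp]: "finite (R n M)"
  by (simp add: R_def)

lemma nrm_to_ac: "W.nrm n (\<lambda>i. to_ac (x i)) = nrm n x"
  by (simp add: W.nrm_def nrm_def w_to_ac)

lemma R_pos:
  assumes NM: "\<And>x. x \<in> coord_space n \<Longrightarrow> mat_app n N (mat_app n M x) = x" and "\<rho> \<in> R n M"
  shows "0 < \<rho>"
proof -
  obtain z where z: "z \<in> roots n M" "\<rho> = w z" using assms by (auto simp: R_def)
  obtain x where x: "x \<in> coord_space n" "x \<noteq> 0" "mat_app n (ac_mat M) x = vscale z x"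
    using roots_eigenvector[OF z(1)] by blast
  have "z \<noteq> 0"
  proof
    assume "z = 0"
    hence "mat_app n (ac_mat M) x = 0" using x(3) by simp
    thus False using ac_mat_inverse[OF NM x(1)] x(2) by simp
  qed
  thus ?thesis using z by simp
qed

text \<open>The embedding into the closure preserves norms and commutes with the matrix, so the
  bound over the closure, where the annihilating polynomial splits, carries over to the ground
  field.\<close>

lemma pseudo_orbit_le:
  assumes "0 < \<tau>" "\<tau> \<notin> R n M"
  shows "\<exists>C\<ge>0. \<forall>x r B e. 0 \<le> e \<longrightarrow> (\<forall>k::int. x (k + 1) = mat_app n M (x k) + r k \<and> x k \<in> coord_space n \<and>
      nrm n (x k) \<le> B * \<tau> powi k \<and> nrm n (r k) \<le> e * \<tau> powi k) \<longrightarrow>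
      (\<forall>k. nrm n (x k) \<le> C * e * \<tau> powi k)"
proof -
  obtain ls where ls: "set ls = roots n M" "\<And>x. x \<in> coord_space n \<Longrightarrow> lprod (mat_app n (ac_mat M)) ls x = 0"
    using roots_annihilate[of n M] by blast
  obtain Cf where Cf: "\<And>x. W.nrm n (mat_app n (ac_mat M) x) \<le> Cf * W.nrm n x"
    using W.mat_app_bounded[of n "ac_mat M"] by blast
  have "\<exists>C\<ge>0. \<forall>x r B e. 0 \<le> e \<longrightarrow> (\<forall>k::int. x (k + 1) = mat_app n (ac_mat M) (x k) + r k \<and>
      lprod (mat_app n (ac_mat M)) ls (x k) = 0 \<and>
      W.nrm n (x k) \<le> B * \<tau> powi k \<and> W.nrm n (r k) \<le> e * \<tau> powi k) \<longrightarrow>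
      (\<forall>k. W.nrm n (x k) \<le> C * e * \<tau> powi k)"
    using assms ls(1) by (intro W.pseudo_orbit_bound[OF linear_op_mat_app _ Cf]) (auto simp: R_def)
  then obtain C where C: "0 \<le> C" "\<forall>x r B e. 0 \<le> e \<longrightarrow> (\<forall>k::int. x (k + 1) = mat_app n (ac_mat M) (x k) + r k \<and>
      lprod (mat_app n (ac_mat M)) ls (x k) = 0 \<and>
      W.nrm n (x k) \<le> B * \<tau> powi k \<and> W.nrm n (r k) \<le> e * \<tau> powi k) \<longrightarrow>
      (\<forall>k. W.nrm n (x k) \<le> C * e * \<tau> powi k)" by blast
  have "nrm n (x k) \<le> C * e * \<tau> powi k"
    if e: "0 \<le> e" and x: "\<forall>k::int. x (k + 1) = mat_app n M (x k) + r k \<and> x k \<in> coord_space n \<and>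
      nrm n (x k) \<le> B * \<tau> powi k \<and> nrm n (r k) \<le> e * \<tau> powi k" for x r B e k
  proof -
    have "W.nrm n (\<lambda>i. to_ac (x k i)) \<le> C * e * \<tau> powi k"
    proof (rule C(2)[rule_format, OF e, of "\<lambda>k i. to_ac (x k i)" "\<lambda>k i. to_ac (r k i)" B])
      fix k
      have "(\<lambda>i. to_ac (x (k + 1) i)) = (\<lambda>i. to_ac (mat_app n M (x k) i)) + (\<lambda>i. to_ac (r k i))"
        using x by (auto simp: fun_eq_iff vec_apply)
      moreover have "(\<lambda>i. to_ac (x k i)) \<in> coord_space n" using x by (auto simp: coord_space_def)
      ultimately show "(\<lambda>i. to_ac (x (k + 1) i)) = mat_app n (ac_mat M) (\<lambda>i. to_ac (x k i)) + (\<lambda>i. to_ac (r k i)) \<and>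
        lprod (mat_app n (ac_mat M)) ls (\<lambda>i. to_ac (x k i)) = 0 \<and>
        W.nrm n (\<lambda>i. to_ac (x k i)) \<le> B * \<tau> powi k \<and> W.nrm n (\<lambda>i. to_ac (r k i)) \<le> e * \<tau> powi k"
        using x ls(2) by (simp add: nrm_to_ac mat_app_to_ac)
    qed
    thus ?thesis by (simp add: nrm_to_ac)
  qed
  thus ?thesis using C(1) by blast
qed

text \<open>An orbit is a pseudo-orbit with defect 0, so the bound for pseudo-orbits annihilates
  it.\<close>

lemma growth_trivial:
  assumes "0 < \<rho>" "\<rho> \<notin> R n M" "x \<in> growth n M \<rho>" shows "x = 0"
proof -
  obtain c B where c: "c 0 = x" "\<forall>k::int. c (k + 1) = mat_app n M (c k) \<and> nrm n (c k) \<le> B * \<rho> powi k"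
    using assms(3) by (auto simp: growth_def)
  have cc: "c k \<in> coord_space n" for k using orbit_in_coord_space c(2) by blast
  obtain C where "\<forall>x r B e. 0 \<le> e \<longrightarrow> (\<forall>k::int. x (k + 1) = mat_app n M (x k) + r k \<and> x k \<in> coord_space n \<and>
      nrm n (x k) \<le> B * \<rho> powi k \<and> nrm n (r k) \<le> e * \<rho> powi k) \<longrightarrow>
      (\<forall>k. nrm n (x k) \<le> C * e * \<rho> powi k)" using pseudo_orbit_le[OF assms(1,2)] by blast
  from this[rule_format, of 0 c "\<lambda>_. 0" B 0] have "nrm n (c 0) \<le> 0" using c(2) cc by simp
  hence "nrm n (c 0) = 0" using nrm_nonneg[of n "c 0"] by linarith
  thus ?thesis using cc[of 0] c(1) by (simp add: nrm_eq_0)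
qed

text \<open>The decomposition and the orbits are found over the closure and mapped down by one
  functional \<open>h\<close>. As \<open>h 1 = 1\<close>, it fixes the coordinates of
  \<open>x\<close>, so the images of the summands still add up to \<open>x\<close>.\<close>

lemma growth_decomposition:
  assumes NM: "\<And>x. x \<in> coord_space n \<Longrightarrow> mat_app n N (mat_app n M x) = x" and x: "x \<in> coord_space n"
  shows "\<exists>y. x = (\<Sum>\<rho>\<in>R n M. y \<rho>) \<and> (\<forall>\<rho>\<in>R n M. y \<rho> \<in> growth n M \<rho>)"
proof -
  define f where "f = mat_app n (ac_mat M)"
  interpret f: linear_op f unfolding f_def by (rule linear_op_mat_app)
  obtain ls where ls: "set ls = roots n M" "\<And>x. x \<in> coord_space n \<Longrightarrow> lprod f ls x = 0"
    using roots_annihilate[of n M] f_def by blast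
  have R: "R n M = w ` set ls" by (simp add: R_def ls)
  define x' where "x' = (\<lambda>i. to_ac (x i))"
  have x': "x' \<in> coord_space n" using x by (auto simp: x'_def coord_space_def)
  obtain y where y: "x' = (\<Sum>\<rho>\<in>R n M. y \<rho>)"
    and "\<And>\<rho>. \<rho> \<in> R n M \<Longrightarrow> \<exists>ms. (\<forall>m\<in>set ms. m \<in> set ls \<and> w m = \<rho>) \<and> lprod f ms (y \<rho>) = 0"
    using f.decompose_by_value[OF ls(2)[OF x'], of w] unfolding R by blast
  then obtain ms where ms: "\<And>\<rho>. \<rho> \<in> R n M \<Longrightarrow> (\<forall>m\<in>set (ms \<rho>). w m = \<rho>) \<and> lprod f (ms \<rho>) (y \<rho>) = 0"
    by metis
  have "\<exists>c C. c 0 = y \<rho> \<and> (\<forall>k::int. c (k + 1) = f (c k)) \<and> (\<forall>k. W.nrm n (c k) \<le> C * \<rho> powi k)"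
    if "\<rho> \<in> R n M" for \<rho>
    using ms[OF that] R_pos[OF NM that] by (intro W.orbit_of_equal_value[OF f.linear_op_axioms, of _ "ms \<rho>"]) auto
  then obtain c C where c: "\<And>\<rho>. \<rho> \<in> R n M \<Longrightarrow> c \<rho> 0 = y \<rho>"
    "\<And>\<rho> k. \<rho> \<in> R n M \<Longrightarrow> c \<rho> ((k::int) + 1) = f (c \<rho> k) \<and> W.nrm n (c \<rho> k) \<le> C \<rho> * \<rho> powi k" by metis
  define E where "E = insert 1 ((\<lambda>(\<rho>, i). y \<rho> i) ` (R n M \<times> {..<n}))"
  have E: "finite E" "1 \<in> E" by (auto simp: E_def)
  obtain h :: "'k alg_closure \<Rightarrow> 'k" where h: "\<And>x y. h (x + y) = h x + h y" "\<And>a x. h (to_ac a * x) = a * h x" "h 1 = 1"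
    and hc: "\<And>c C \<rho>. 0 < \<rho> \<Longrightarrow> (\<forall>i<n. c 0 i \<in> E) \<Longrightarrow>
       (\<forall>k::int. c (k + 1) = mat_app n (ac_mat M) (c k) \<and> W.nrm n (c k) \<le> C * \<rho> powi k) \<Longrightarrow>
       (\<exists>C'. \<forall>k. (\<lambda>i. h (c (k + 1) i)) = mat_app n M (\<lambda>i. h (c k i)) \<and> nrm n (\<lambda>i. h (c k i)) \<le> C' * \<rho> powi k)"
    using descend_orbits[OF E(1,2) one_neq_zero ac_mat_inverse[OF NM]] by blast
  have h0: "h 0 = 0" using h(2)[of 0 0] by simp
  have hsum: "h (\<Sum>\<rho>\<in>S. q \<rho>) = (\<Sum>\<rho>\<in>S. h (q \<rho>))" for q and S :: "real set"
    by (induction S rule: infinite_finite_induct) (auto simp: h h0)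
  define y' where "y' = (\<lambda>\<rho> i. h (y \<rho> i))"
  have "h (to_ac a) = a" for a using h(2)[of a 1] h(3) by simp
  hence "x i = (\<Sum>\<rho>\<in>R n M. y' \<rho>) i" for i
    using arg_cong[OF fun_cong[OF y, of i], of h] by (simp add: x'_def sum_fun_apply hsum y'_def)
  hence "x = (\<Sum>\<rho>\<in>R n M. y' \<rho>)" by blast
  moreover have "y' \<rho> \<in> growth n M \<rho>" if \<rho>: "\<rho> \<in> R n M" for \<rho>
  proof -
    have "\<forall>i<n. c \<rho> 0 i \<in> E" using c(1)[OF \<rho>] \<rho> by (auto simp: E_def)
    moreover have "\<forall>k::int. c \<rho> (k + 1) = mat_app n (ac_mat M) (c \<rho> k) \<and> W.nrm n (c \<rho> k) \<le> C \<rho> * \<rho> powi k"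
      using c(2)[OF \<rho>] by (simp add: f_def)
    ultimately obtain C' where "\<forall>k. (\<lambda>i. h (c \<rho> (k + 1) i)) = mat_app n M (\<lambda>i. h (c \<rho> k i)) \<and>
        nrm n (\<lambda>i. h (c \<rho> k i)) \<le> C' * \<rho> powi k"
      using hc[OF R_pos[OF NM \<rho>], of "c \<rho>" "C \<rho>"] by blast
    thus ?thesis unfolding growth_def y'_def using c(1)[OF \<rho>]
      by (intro CollectI exI[of _ "\<lambda>k i. h (c \<rho> k i)"] exI[of _ C']) simp
  qed
  ultimately show ?thesis by blast
qed

text \<open>An eigenvector for \<open>w z = 1\<close> has the bounded orbit \<open>z powi k\<close>
  times \<open>x\<close>. The functional is normalised at a nonzero coordinate of \<open>x\<close>,
  which keeps the descended orbit from vanishing at time 0.\<close>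

lemma ex_bounded_orbit:
  assumes NM: "\<And>x. x \<in> coord_space n \<Longrightarrow> mat_app n N (mat_app n M x) = x" and 1: "1 \<in> R n M"
  shows "\<exists>c C. c 0 \<noteq> 0 \<and> (\<forall>k::int. c (k + 1) = mat_app n M (c k) \<and> nrm n (c k) \<le> C)"
proof -
  obtain z where z: "z \<in> roots n M" "w z = 1" using 1 by (auto simp: R_def)
  obtain x where x: "x \<in> coord_space n" "x \<noteq> 0" "mat_app n (ac_mat M) x = vscale z x"
    using roots_eigenvector[OF z(1)] by blast
  obtain i0 where i0: "x i0 \<noteq> 0" using x(2) by (auto simp: fun_eq_iff vec_apply)
  hence i0n: "i0 < n" using x(1) by (auto simp: coord_space_def not_less[symmetric])
  have z0: "z \<noteq> 0" using z(2) by auto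
  define E where "E = x ` {..<n}"
  have E: "finite E" "x i0 \<in> E" using i0n by (auto simp: E_def)
  define c where "c = (\<lambda>k::int. vscale (z powi k) x)"
  have cb: "\<forall>k::int. c (k + 1) = mat_app n (ac_mat M) (c k) \<and> W.nrm n (c k) \<le> W.nrm n x * 1 powi k"
    using z z0 by (simp add: c_def mat_app.scale x(3) power_int_add_1 W.power_int)
  have cE: "\<forall>i<n. c 0 i \<in> E" by (simp add: c_def E_def vec_apply)
  obtain h :: "'k alg_closure \<Rightarrow> 'k" where h1: "h (x i0) = 1"
    and hc: "\<And>c C \<rho>. 0 < \<rho> \<Longrightarrow> (\<forall>i<n. c 0 i \<in> E) \<Longrightarrow>
       (\<forall>k::int. c (k + 1) = mat_app n (ac_mat M) (c k) \<and> W.nrm n (c k) \<le> C * \<rho> powi k) \<Longrightarrow>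
       (\<exists>C'. \<forall>k. (\<lambda>i. h (c (k + 1) i)) = mat_app n M (\<lambda>i. h (c k i)) \<and> nrm n (\<lambda>i. h (c k i)) \<le> C' * \<rho> powi k)"
    using descend_orbits[OF E i0 ac_mat_inverse[OF NM]] by blast
  have "(0::real) < 1" by simp
  from hc[OF this cE cb] obtain C' where
    C': "\<forall>k. (\<lambda>i. h (c (k + 1) i)) = mat_app n M (\<lambda>i. h (c k i)) \<and> nrm n (\<lambda>i. h (c k i)) \<le> C' * 1 powi k"
    by blast
  have "h (c 0 i0) = 1" using h1 by (simp add: c_def vec_apply)
  hence "(\<lambda>i. h (c 0 i)) i0 \<noteq> 0 i0" by (simp add: vec_apply)
  hence "(\<lambda>i. h (c 0 i)) \<noteq> 0" by metis
  thus ?thesis using C' by (intro exI[of _ "\<lambda>k i. h (c k i)"] exI[of _ C']) simp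
qed

text \<open>The right-hand side is expanded in unit vectors and these in vectors with a growth rate,
  to which \<open>orbit_solve\<close> applies, the rate 1 included. The constant is chosen before
  the window \<open>W\<close>; the compactness argument for nonlinear orbits rests on this
  uniformity.\<close>

lemma solve_window:
  assumes NM: "\<And>x. x \<in> coord_space n \<Longrightarrow> mat_app n N (mat_app n M x) = x"
  shows "\<exists>C\<ge>0. \<forall>g D W. finite W \<longrightarrow> (\<forall>k::int. g k \<in> coord_space n \<and> nrm n (g k) \<le> D) \<longrightarrow>
    (\<exists>u. \<forall>k. u (k + 1) = mat_app n M (u k) + (if k \<in> W then g k else 0) \<and> nrm n (u k) \<le> C * D)"
proof -
  have "\<exists>y. unit_coord j = (\<Sum>\<rho>\<in>R n M. y \<rho>) \<and> (\<forall>\<rho>\<in>R n M. y \<rho> \<in> growth n M \<rho>)" if "j < n" for j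
    using growth_decomposition[OF NM coord_space_unit[OF that]] .
  then obtain y where y: "\<And>j. j < n \<Longrightarrow> unit_coord j = (\<Sum>\<rho>\<in>R n M. y j \<rho>)"
      "\<And>j \<rho>. j < n \<Longrightarrow> \<rho> \<in> R n M \<Longrightarrow> y j \<rho> \<in> growth n M \<rho>" by metis
  then obtain c B where c: "\<And>j \<rho>. j < n \<Longrightarrow> \<rho> \<in> R n M \<Longrightarrow> c j \<rho> 0 = y j \<rho> \<and>
      (\<forall>k::int. c j \<rho> (k + 1) = mat_app n M (c j \<rho> k) \<and> nrm n (c j \<rho> k) \<le> B j \<rho> * \<rho> powi k)"
    unfolding growth_def mem_Collect_eq by metis
  define C where "C = Max (insert 0 ((\<lambda>(j, \<rho>). B j \<rho>) ` ({..<n} \<times> R n M)))"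
  have C0: "0 \<le> C" unfolding C_def by (rule Max_ge) auto
  have BC: "B j \<rho> \<le> C" if "j < n" "\<rho> \<in> R n M" for j \<rho>
    unfolding C_def using that by (intro Max_ge) auto
  have "\<exists>u. \<forall>k. u (k + 1) = mat_app n M (u k) + (if k \<in> W then g k else 0) \<and> nrm n (u k) \<le> C * D"
    if W: "finite W" and g: "\<forall>k::int. g k \<in> coord_space n \<and> nrm n (g k) \<le> D" for g D W
  proof -
    have D0: "0 \<le> D" using g nrm_nonneg[of n "g 0"] by (metis order_trans)
    have "\<exists>u. \<forall>k. u (k + 1) = mat_app n M (u k) + (if k \<in> W then vscale (g k j) (c j \<rho> 0) else 0) \<and> nrm n (u k) \<le> B j \<rho> * D"
      if "j < n" "\<rho> \<in> R n M" for j \<rho>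
      using c[OF that] R_pos[OF NM that(2)] W g le_nrm[OF that(1)]
      by (intro orbit_solve[OF linear_op_mat_app, of _ n M _ _ \<rho>]) (auto intro: order_trans)
    then obtain u where u: "\<And>j \<rho> k. j < n \<Longrightarrow> \<rho> \<in> R n M \<Longrightarrow> u j \<rho> (k + 1) = mat_app n M (u j \<rho> k) +
        (if k \<in> W then vscale (g k j) (c j \<rho> 0) else 0) \<and> nrm n (u j \<rho> k) \<le> B j \<rho> * D" by metis
    define U where "U = (\<lambda>k. \<Sum>j<n. \<Sum>\<rho>\<in>R n M. u j \<rho> k)"
    have "U (k + 1) = mat_app n M (U k) + (if k \<in> W then g k else 0)" for k
    proof -
      have "U (k + 1) = mat_app n M (U k) + (\<Sum>j<n. \<Sum>\<rho>\<in>R n M. if k \<in> W then vscale (g k j) (c j \<rho> 0) else 0)"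
        unfolding U_def mat_app.sum sum.distrib[symmetric] using u by (intro sum.cong refl) auto
      also have "(\<Sum>j<n. \<Sum>\<rho>\<in>R n M. if k \<in> W then vscale (g k j) (c j \<rho> 0) else 0) = (if k \<in> W then g k else 0)"
      proof (cases "k \<in> W")
        case True
        have "(\<Sum>j<n. \<Sum>\<rho>\<in>R n M. vscale (g k j) (c j \<rho> 0)) = (\<Sum>j<n. vscale (g k j) (unit_coord j))"
          by (intro sum.cong refl) (simp add: c y(1) vscale.scale_sum_right)
        also have "\<dots> = g k" using coord_space_expand[of "g k" n] g by simp
        finally show ?thesis using True by simp
      qed simp
      finally show ?thesis .
    qed
    moreover have "nrm n (U k) \<le> C * D" for k unfolding U_def
    proof (intro nrm_sum_le)
      fix j \<rho> assume "j \<in> {..<n}" "\<rho> \<in> R n M"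
      thus "nrm n (u j \<rho> k) \<le> C * D" using u[of j \<rho> k] BC[of j \<rho>] D0 by (auto intro: order_trans mult_right_mono)
    qed (use C0 D0 in simp_all)
    ultimately show ?thesis by blast
  qed
  thus ?thesis using C0 by blast
qed

end

section \<open>Nilpotency of weakly closed Lie sets\<close>

text \<open>Jacobson's form of Engel's theorem for the adjoint action, in the dual form that
  a nonzero quotient of invariant subspaces is not equal to its image.\<close>

locale lie_bracket_space = vector_space s
  for s :: "'a::Fields.field \<Rightarrow> 'b::ab_group_add \<Rightarrow> 'b" +
  fixes L :: "'b set" and br :: "'b \<Rightarrow> 'b \<Rightarrow> 'b" and L0 :: "'b set"
  assumes subspace_L: "subspace L" and finite_gen: "finite L0" "L \<subseteq> span L0"
    and br_closed: "x \<in> L \<Longrightarrow> y \<in> L \<Longrightarrow> br x y \<in> L"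
    and br_add_left: "x \<in> L \<Longrightarrow> x' \<in> L \<Longrightarrow> y \<in> L \<Longrightarrow> br (x + x') y = br x y + br x' y"
    and br_add_right: "x \<in> L \<Longrightarrow> y \<in> L \<Longrightarrow> y' \<in> L \<Longrightarrow> br x (y + y') = br x y + br x y'"
    and br_scale_left: "x \<in> L \<Longrightarrow> y \<in> L \<Longrightarrow> br (s a x) y = s a (br x y)"
    and br_scale_right: "x \<in> L \<Longrightarrow> y \<in> L \<Longrightarrow> br x (s a y) = s a (br x y)"
    and br_self: "x \<in> L \<Longrightarrow> br x x = 0"
    and br_anti: "x \<in> L \<Longrightarrow> y \<in> L \<Longrightarrow> br x y = - br y x"
    and jacobi: "x \<in> L \<Longrightarrow> y \<in> L \<Longrightarrow> z \<in> L \<Longrightarrow> br x (br y z) = br (br x y) z + br y (br x z)"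
begin

definition brs :: "'b set \<Rightarrow> 'b set \<Rightarrow> 'b set" where
  "brs A B = span {br x y | x y. x \<in> A \<and> y \<in> B}"

lemma span_subset_L: "A \<subseteq> L \<Longrightarrow> span A \<subseteq> L"
  using subspace_L by (rule span_minimal[rotated])

lemma brs_subset_L: "A \<subseteq> L \<Longrightarrow> B \<subseteq> L \<Longrightarrow> brs A B \<subseteq> L"
  unfolding brs_def by (rule span_subset_L) (auto intro: br_closed)

lemma br_zero_right: "x \<in> L \<Longrightarrow> br x 0 = 0"
  using br_scale_right[of x x 0] by simp

lemma br_zero_left: "x \<in> L \<Longrightarrow> br 0 x = 0"
  using br_scale_left[of x x 0] by simp

lemma br_span_right:
  assumes "x \<in> L" "A \<subseteq> L" "subspace V" "\<And>y. y \<in> A \<Longrightarrow> br x y \<in> V" "y \<in> span A"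
  shows "br x y \<in> V"
proof -
  have "y \<in> L \<and> br x y \<in> V"
    using assms(5)
  proof (induction rule: span_induct_alt)
    case base
    show ?case using assms(1,3) subspace_L by (simp add: br_zero_right subspace_0)
  next
    case (step c y z)
    have "y \<in> L" using assms(2) step by blast
    moreover from this have "br x (s c y + z) = s c (br x y) + br x z"
      using assms(1) step subspace_L by (simp add: br_add_right br_scale_right subspace_scale)
    ultimately show ?case using assms(3,4) step subspace_L by (simp add: subspace_add subspace_scale)
  qed
  thus ?thesis by blast
qed

lemma br_span_left:
  assumes "y \<in> L" "A \<subseteq> L" "subspace V" "\<And>x. x \<in> A \<Longrightarrow> br x y \<in> V" "x \<in> span A"
  shows "br x y \<in> V"
proof -
  have "br y x \<in> V"
  proof (rule br_span_right[OF assms(1,2,3) _ assms(5)])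
    fix x' assume "x' \<in> A"
    thus "br y x' \<in> V" using br_anti[of y x'] assms(1,2,3,4) by (auto simp: subspace_neg)
  qed
  moreover have "x \<in> L" using assms(5) span_subset_L[OF assms(2)] by blast
  ultimately show ?thesis using br_anti[of x y] assms(1,3) by (simp add: subspace_neg)
qed

text \<open>A basis of the smaller span is enlarged by a vector outside it and then extended to a
  basis of the larger span. Membership in \<open>L\<close> makes these bases finite, as the ambient
  space need not be finite-dimensional.\<close>

lemma dim_less:
  assumes "A \<subseteq> L" "B \<subseteq> L" "span A \<subseteq> span B" "span A \<noteq> span B"
  shows "dim A < dim B"
proof -
  obtain C where C: "C \<subseteq> span A" "independent C" "span A \<subseteq> span C" "card C = dim (span A)"
    using basis_exists[of "span A"] by metis
  have "C \<subseteq> L" using C(1) span_subset_L[OF assms(1)] by blast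
  hence fC: "finite C" using independent_span_bound[OF finite_gen(1) C(2)] finite_gen(2) by blast
  obtain x where x: "x \<in> B" "x \<notin> span A" using assms(3,4) span_minimal[of B "span A"] by blast
  have "span C \<subseteq> span A" using C(1) by (simp add: span_minimal)
  hence ic: "independent (insert x C)" using C(2) x(2) by (auto simp: independent_insert)
  obtain D where D: "insert x C \<subseteq> D" "D \<subseteq> span B" "independent D" "span B \<subseteq> span D"
    using maximal_independent_subset_extend[of "insert x C" "span B"] ic C(1) assms(3) x(1)
    by (metis insert_subset span_base subset_trans)
  have "D \<subseteq> L" using D(2) span_subset_L[OF assms(2)] by blast
  hence fD: "finite D" using independent_span_bound[OF finite_gen(1) D(3)] finite_gen(2) by blast
  have "dim B = card D" using D by (metis dim_span basis_card_eq_dim)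
  moreover have "dim A = card C" using C(4) by simp
  moreover have "x \<notin> C" using x(2) C(1) by blast
  hence "card C < card (insert x C)" using fC by simp
  moreover have "card (insert x C) \<le> card D" using D(1) fD by (rule card_mono[rotated])
  ultimately show ?thesis by linarith
qed

definition ad_nilpotent :: "'b \<Rightarrow> bool" where
  "ad_nilpotent x \<longleftrightarrow> (\<exists>k. \<forall>y\<in>L. (br x ^^ k) y = 0)"

text \<open>A sum of subspaces is written as the span of a union.\<close>

theorem Engel_Jacobson:
  assumes "W \<subseteq> L" "\<And>x y. x \<in> W \<Longrightarrow> y \<in> W \<Longrightarrow> br x y \<in> W" "\<And>x. x \<in> W \<Longrightarrow> ad_nilpotent x"
    and "subspace U" "subspace V" "U \<subset> V" "V \<subseteq> L"
    and "\<And>x u. x \<in> W \<Longrightarrow> u \<in> U \<Longrightarrow> br x u \<in> U" "\<And>x u. x \<in> W \<Longrightarrow> u \<in> V \<Longrightarrow> br x u \<in> V"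
  shows "span (U \<union> brs W V) \<noteq> V"
  using assms
proof (induction "dim W" arbitrary: W U V rule: less_induct)
  case less
  note W = less.prems(1,2,3) and UV = less.prems(4,5,6,7) and inv = less.prems(8,9)
  show ?case
  proof (cases "span W = {0}")
    case True
    have "brs W V \<subseteq> {0}" unfolding brs_def
    proof (rule span_minimal)
      have "W \<subseteq> {0}" using True span_superset[of W] by blast
      thus "{br x y |x y. x \<in> W \<and> y \<in> V} \<subseteq> {0}" using UV(4) by (auto simp: br_zero_left subset_eq)
    qed (simp add: subspace_def)
    hence "U \<union> brs W V \<subseteq> U" using UV(1) subspace_0 by blast
    hence "span (U \<union> brs W V) \<subseteq> U" using UV(1) by (rule span_minimal)
    thus ?thesis using UV(3) by blast
  next
    case False
    \<comment> \<open>A weakly closed subset \<open>H\<close> of \<open>W\<close> with properly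
      smaller span is chosen with maximal dimension. The induction hypothesis is applied to
      \<open>H\<close> twice: on a quotient of subspaces of \<open>span W\<close>, and on the given
      quotient of \<open>V\<close> by \<open>U\<close>.\<close>
    define P where "P = (\<lambda>H. H \<subseteq> W \<and> (\<forall>x\<in>H. \<forall>y\<in>H. br x y \<in> H) \<and> span H \<noteq> span W)"
    have "P {}" using False by (simp add: P_def)
    moreover have "dim H < Suc (dim W)" if "P H" for H
    proof -
      have "H \<subseteq> W" "span H \<noteq> span W" using that by (auto simp: P_def)
      hence "dim H < dim W" using W(1) by (intro dim_less span_mono) auto
      thus ?thesis by simp
    qed
    ultimately obtain H where H: "P H" "\<And>H'. P H' \<Longrightarrow> dim H' \<le> dim H"
      using ex_has_greatest_nat[of P "{}" dim "Suc (dim W)"] by blast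
    have HW: "H \<subseteq> W" and Hc: "\<And>x y. x \<in> H \<Longrightarrow> y \<in> H \<Longrightarrow> br x y \<in> H" and Hs: "span H \<noteq> span W"
      using H(1) by (auto simp: P_def)
    have HL: "H \<subseteq> L" using HW W(1) by blast
    have sHW: "span H \<subseteq> span W" using HW by (rule span_mono)
    have dim: "dim H < dim W" by (rule dim_less[OF HL W(1) sHW Hs])
    have sWL: "span W \<subseteq> L" using W(1) by (rule span_subset_L)
    have sHL: "span H \<subseteq> L" using HL by (rule span_subset_L)
    have HH: "br h y \<in> span H" if "h \<in> H" "y \<in> span H" for h y
      using that HL by (intro br_span_right[OF _ HL _ _ that(2)]) (auto intro: Hc span_base)
    have HWW: "br h y \<in> span W" if "h \<in> H" "y \<in> span W" for h y
    proof (rule br_span_right[OF _ W(1) _ _ that(2)])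
      show "h \<in> L" using that HL by blast
      show "br h z \<in> span W" if "z \<in> W" for z using that \<open>h \<in> H\<close> HW W(2) by (blast intro: span_base)
    qed simp
    \<comment> \<open>Among the \<open>H\<close>-invariant spaces between \<open>span H\<close> and
      \<open>span W\<close> that contain an element of \<open>W\<close> outside
      \<open>span H\<close>, one of least dimension is taken, in order to find such an element that
      normalises \<open>span H\<close>.\<close>
    define Q where "Q = (\<lambda>V'. subspace V' \<and> span H \<subseteq> V' \<and> V' \<subseteq> span W \<and> (\<forall>h\<in>H. \<forall>y\<in>V'. br h y \<in> V') \<and> \<not> V' \<inter> W \<subseteq> span H)"
    have "Q (span W)"
    proof -
      have "\<not> W \<subseteq> span H" using Hs sHW span_minimal[of W "span H"] by (metis subset_antisym subspace_span)
      thus ?thesis unfolding Q_def using sHW HWW span_superset[of W] by (metis inf.absorb2 subset_refl subspace_span)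
    qed
    then obtain V' where V': "Q V'" "\<And>V''. Q V'' \<Longrightarrow> dim V' \<le> dim V''"
      using ex_has_least_nat[of Q "span W" dim] by blast
    have V'L: "V' \<subseteq> L" using V'(1) sWL by (auto simp: Q_def)
    have V'sub: "subspace V'" "span H \<subseteq> V'" "\<And>h y. h \<in> H \<Longrightarrow> y \<in> V' \<Longrightarrow> br h y \<in> V'"
      using V'(1) by (auto simp: Q_def)
    \<comment> \<open>By the induction hypothesis for \<open>V'\<close> modulo
      \<open>span H\<close>, the space \<open>span H + [H, V']\<close> is properly smaller than
      \<open>V'\<close>. Minimality then puts its elements from \<open>W\<close> into
      \<open>span H\<close>, so every element of \<open>V' \<inter> W\<close> is moved by
      \<open>H\<close> into \<open>span H\<close>.\<close>
    define V2 where "V2 = span (span H \<union> brs H V')"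
    have "V2 \<noteq> V'" unfolding V2_def
    proof (rule less.hyps[OF dim HL Hc])
      show "ad_nilpotent x" if "x \<in> H" for x using that HW W(3) by blast
      show "span H \<subset> V'" using V'(1) by (auto simp: Q_def)
    qed (use V'L V'sub HH in auto)
    have brsV': "brs H V' \<subseteq> V'" unfolding brs_def using V'sub by (intro span_minimal) auto
    have V2V': "V2 \<subseteq> V'" unfolding V2_def using V'sub brsV' by (intro span_minimal) auto
    have br_V2: "br h y \<in> V2" if "h \<in> H" "y \<in> V'" for h y
      unfolding V2_def brs_def using that by (intro span_base UnI2) (auto intro: span_base)
    have "\<not> Q V2"
    proof
      assume "Q V2"
      hence "dim V' \<le> dim V2" by (rule V'(2))
      moreover have "dim V2 < dim V'"
        using \<open>V2 \<noteq> V'\<close> V2V' V'sub(1) V'L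
        by (intro dim_less) (auto simp: V2_def span_eq_iff[THEN iffD2])
      ultimately show False by simp
    qed
    moreover have "subspace V2" "span H \<subseteq> V2" "V2 \<subseteq> span W" "\<forall>h\<in>H. \<forall>y\<in>V2. br h y \<in> V2"
      using V2V' br_V2 V'(1) by (auto simp: V2_def Q_def intro: span_base)
    ultimately have V2W: "V2 \<inter> W \<subseteq> span H" by (auto simp: Q_def)
    obtain x where x: "x \<in> V'" "x \<in> W" "x \<notin> span H" using V'(1) by (auto simp: Q_def)
    have xL: "x \<in> L" using x W by blast
    have brx: "br h x \<in> span H" if "h \<in> H" for h
      using V2W br_V2[OF that x(1)] W(2)[of h x] that HW x(2) by blast
    have brx': "br x h \<in> span H" if "h \<in> H" for h
      using brx[OF that] br_anti[of x h] that HL xL by (auto simp: subspace_neg)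
    \<comment> \<open>by maximality of \<open>H\<close>, the elements of \<open>H\<close> and \<open>x\<close> span everything\<close>
    define H' where "H' = W \<inter> span (insert x H)"
    have iL: "insert x H \<subseteq> L" using xL HL by blast
    have siL: "span (insert x H) \<subseteq> L" using iL by (rule span_subset_L)
    have br_ins: "br y z \<in> span H" if y: "y \<in> span (insert x H)" and z: "z \<in> span (insert x H)" for y z
    proof (rule br_span_left[OF _ iL _ _ y])
      show "z \<in> L" using z siL by blast
      fix y' assume y': "y' \<in> insert x H"
      show "br y' z \<in> span H"
      proof (rule br_span_right[OF _ iL _ _ z])
        show "y' \<in> L" using y' iL by blast
        fix z' assume "z' \<in> insert x H"
        thus "br y' z' \<in> span H"
          using y' brx brx' Hc br_self[OF xL] by (auto intro: span_base simp: span_zero)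
      qed simp
    qed simp
    have H'c: "br y z \<in> H'" if "y \<in> H'" "z \<in> H'" for y z
    proof -
      have "br y z \<in> span H" using that by (intro br_ins) (auto simp: H'_def)
      moreover have "span H \<subseteq> span (insert x H)" by (rule span_mono) blast
      ultimately show ?thesis using that W(2) by (auto simp: H'_def)
    qed
    have insH': "insert x H \<subseteq> H'" using x(2) HW span_superset[of "insert x H"] by (auto simp: H'_def)
    have "dim H < dim H'"
    proof (rule dim_less[OF HL])
      show "H' \<subseteq> L" using W(1) by (auto simp: H'_def)
      show "span H \<subseteq> span H'" using insH' by (intro span_mono) auto
      show "span H \<noteq> span H'" using x(3) insH' span_superset[of H'] by blast
    qed
    hence "\<not> P H'" using H(2)[of H'] by linarith
    hence "span H' = span W" using H'c by (auto simp: P_def H'_def)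
    moreover have "span H' \<subseteq> span (insert x H)" by (intro span_minimal) (auto simp: H'_def)
    ultimately have Wins: "W \<subseteq> span (insert x H)" using span_superset[of W] by blast
    \<comment> \<open>The second use of the induction hypothesis, for \<open>H\<close> on
      \<open>V\<close> modulo \<open>U\<close>. It remains to show that adding \<open>[x, V]\<close>
      to this proper subspace cannot fill \<open>V\<close>, since \<open>br x\<close> is
      nilpotent.\<close>
    define A where "A = span (U \<union> brs H V)"
    have AV: "A \<noteq> V" unfolding A_def
    proof (rule less.hyps[OF dim HL Hc])
      show "ad_nilpotent x" if "x \<in> H" for x using that HW W(3) by blast
    qed (use UV inv HW in auto)
    have sA: "subspace A" by (simp add: A_def)
    have UA: "U \<subseteq> A" unfolding A_def using span_superset[of "U \<union> brs H V"] by blast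
    have brHV: "br h y \<in> A" if "h \<in> H" "y \<in> V" for h y
    proof -
      have "br h y \<in> brs H V" unfolding brs_def using that by (auto intro: span_base)
      thus ?thesis unfolding A_def by (auto intro: span_base)
    qed
    have "brs H V \<subseteq> V" unfolding brs_def using inv(2) HW UV(2) by (intro span_minimal) auto
    hence A_V: "A \<subseteq> V" unfolding A_def using UV(2,3) by (intro span_minimal) auto
    have AL: "A \<subseteq> L" using A_V UV(4) by blast
    have xV: "br x y \<in> V" if "y \<in> V" for y using inv(2) x(2) that by blast
    \<comment> \<open>By the Jacobi identity, since \<open>br x\<close> maps \<open>H\<close> into
      \<open>span H\<close>.\<close>
    have xA: "br x a \<in> A" if a: "a \<in> A" for a
    proof -
      have *: "br x (br h y) \<in> A" if "h \<in> H" "y \<in> V" for h y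
      proof -
        have hL: "h \<in> L" and yL: "y \<in> L" using that HL UV(4) by auto
        have "br (br x h) y \<in> A"
          by (rule br_span_left[OF yL HL sA _ brx'[OF that(1)]]) (use brHV that(2) in blast)
        moreover have "br h (br x y) \<in> A" using brHV that xV by blast
        ultimately show ?thesis using jacobi[OF xL hL yL] sA by (simp add: subspace_add)
      qed
      have **: "br x y \<in> A" if "y \<in> brs H V" for y
      proof (rule br_span_right[OF xL _ sA _ that[unfolded brs_def]])
        show "{br x y |x y. x \<in> H \<and> y \<in> V} \<subseteq> L" using br_closed HL UV(4) by auto
      qed (use * in auto)
      show ?thesis
      proof (rule br_span_right[OF xL _ sA _ a[unfolded A_def]])
        show "U \<union> brs H V \<subseteq> L" using AL UA \<open>brs H V \<subseteq> V\<close> UV(4) by blast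
      qed (use ** inv(1) x(2) UA in auto)
    qed
    show ?thesis
    proof
      assume eq: "span (U \<union> brs W V) = V"
      define S where "S = {a + br x y | a y. a \<in> A \<and> y \<in> V}"
      have sS: "subspace S"
      proof (rule subspaceI)
        have "0 + br x 0 \<in> S" unfolding S_def using sA UV(2) subspace_0 by blast
        thus "0 \<in> S" using xL by (simp add: br_zero_right)
      next
        fix p q assume "p \<in> S" "q \<in> S"
        then obtain a y a' y' where *: "p = a + br x y" "q = a' + br x y'" "a \<in> A" "a' \<in> A" "y \<in> V" "y' \<in> V"
          by (auto simp: S_def)
        have "br x (y + y') = br x y + br x y'" using * xL UV(4) by (intro br_add_right) auto
        hence "p + q = (a + a') + br x (y + y')" using * by (simp add: algebra_simps)
        thus "p + q \<in> S" unfolding S_def using * sA UV(2) subspace_add by blast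
      next
        fix c p assume "p \<in> S"
        then obtain a y where *: "p = a + br x y" "a \<in> A" "y \<in> V" by (auto simp: S_def)
        have "br x (s c y) = s c (br x y)" using * xL UV(4) by (intro br_scale_right) auto
        hence "s c p = s c a + br x (s c y)" using * by (simp add: scale_right_distrib)
        thus "s c p \<in> S" unfolding S_def using * sA UV(2) subspace_scale by blast
      qed
      have AS: "A \<subseteq> S"
      proof
        fix a assume "a \<in> A"
        hence "a + br x 0 \<in> S" unfolding S_def using UV(2) subspace_0 by blast
        thus "a \<in> S" using xL by (simp add: br_zero_right)
      qed
      have xS: "br x y \<in> S" if "y \<in> V" for y
      proof -
        have "0 + br x y \<in> S" unfolding S_def using sA subspace_0 that by blast
        thus ?thesis by simp
      qed
      have "brs W V \<subseteq> S" unfolding brs_def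
      proof (rule span_minimal[OF _ sS], safe)
        fix z y assume z: "z \<in> W" and y: "y \<in> V"
        show "br z y \<in> S"
          by (rule br_span_left[OF _ iL sS]) (use z y UV(4) Wins xS AS brHV in auto)
      qed
      hence VS: "V \<subseteq> S" using eq UA AS sS span_minimal[of "U \<union> brs W V" S] by blast
      \<comment> \<open>Iterating \<open>V = A + [x, V]\<close> with the invariance of
        \<open>A\<close> gives \<open>V = A + (br x ^^ k) V\<close>; for a suitable \<open>k\<close>
        the last term is 0.\<close>
      have *: "\<exists>a\<in>A. \<exists>y'\<in>V. y = a + (br x ^^ k) y'" if "y \<in> V" for k y
        using that
      proof (induction k arbitrary: y)
        case 0
        thus ?case using sA subspace_0 by (intro bexI[of _ 0] bexI[of _ y]) auto
      next
        case (Suc k)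
        obtain a y1 where 1: "y = a + br x y1" "a \<in> A" "y1 \<in> V" using VS Suc.prems by (auto simp: S_def)
        obtain a1 y2 where 2: "y1 = a1 + (br x ^^ k) y2" "a1 \<in> A" "y2 \<in> V" using Suc.IH[OF 1(3)] by blast
        have "(br x ^^ k) y2 \<in> V" for k using 2(3) by (induction k) (auto intro: xV)
        hence "br x y1 = br x a1 + (br x ^^ Suc k) y2"
          unfolding 2(1) using 2(2) xL AL UV(4) by (subst br_add_right) auto
        hence "y = (a + br x a1) + (br x ^^ Suc k) y2" using 1 by (simp add: algebra_simps)
        moreover have "a + br x a1 \<in> A" using 1 2 xA sA by (simp add: subspace_add)
        ultimately show ?case using 2(3) by blast
      qed
      obtain k where "\<forall>y\<in>L. (br x ^^ k) y = 0" using W(3)[OF x(2)] by (auto simp: ad_nilpotent_def)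
      hence "V \<subseteq> A" using *[of _ k] UV(4) by fastforce
      thus False using AV A_V by blast
    qed
  qed
qed

text \<open>As \<open>W\<close> spans \<open>L\<close>, the bracket of \<open>L\<close> with a term
  of the series equals the bracket of \<open>W\<close> with it, which by
  \<open>Engel_Jacobson\<close> with \<open>U = {0}\<close> is not the whole term unless the term is
  0. So the dimensions drop strictly.\<close>

theorem lower_central_series_vanishes:
  assumes W: "W \<subseteq> L" "span W = L" "\<And>x y. x \<in> W \<Longrightarrow> y \<in> W \<Longrightarrow> br x y \<in> W" "\<And>x. x \<in> W \<Longrightarrow> ad_nilpotent x"
  shows "\<exists>k. lower_central_series s L br k = {0}"
proof -
  define C where "C = lower_central_series s L br"
  have C0: "C 0 = L" and CS: "C (Suc k) = brs L (C k)" for k by (simp_all add: C_def brs_def)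
  have C: "subspace (C k) \<and> C k \<subseteq> L \<and> brs L (C k) \<subseteq> C k" for k
  proof (induction k)
    case 0 thus ?case using subspace_L brs_subset_L by (simp add: C0)
  next
    case (Suc k)
    have "brs L (brs L (C k)) \<subseteq> brs L (C k)"
      using Suc unfolding brs_def[of L "C k"] by (subst brs_def, intro span_mono) (auto simp: brs_def)
    thus ?case using Suc by (auto simp: CS brs_def)
  qed
  have less: "dim (C (Suc k)) < dim (C k)" if "C k \<noteq> {0}" for k
  proof (rule dim_less)
    have ne: "span ({0} \<union> brs W (C k)) \<noteq> C k"
    proof (rule Engel_Jacobson[OF W(1,3,4)])
      show "{0} \<subset> C k" using that C[of k] subspace_0 by blast
      show "br x u \<in> C k" if "x \<in> W" "u \<in> C k" for x u
      proof -
        have "br x u \<in> brs L (C k)" unfolding brs_def using that W(1) by (auto intro: span_base)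
        thus ?thesis using C[of k] by blast
      qed
    qed (use C W(1) in \<open>auto simp: br_zero_right subset_eq\<close>)
    have "brs L (C k) \<subseteq> brs W (C k)" unfolding brs_def[of L]
    proof (rule span_minimal, safe)
      fix x y assume x: "x \<in> L" and y: "y \<in> C k"
      show "br x y \<in> brs W (C k)"
        by (rule br_span_left[OF _ W(1)]) (use x y C[of k] W(2) in \<open>auto simp: brs_def intro: span_base\<close>)
    qed (simp add: brs_def)
    moreover have "brs W (C k) \<subseteq> brs L (C k)" unfolding brs_def using W(1) by (intro span_mono) auto
    ultimately have "brs L (C k) = brs W (C k)" by blast
    moreover have "span ({0} \<union> brs W (C k)) = brs W (C k)" by (simp add: brs_def)
    ultimately have "brs L (C k) \<noteq> C k" using ne by metis
    thus "span (C (Suc k)) \<noteq> span (C k)" using C[of k] C[of "Suc k"] by (simp add: CS span_eq_iff[THEN iffD2])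
    show "span (C (Suc k)) \<subseteq> span (C k)" using C[of k] by (intro span_mono) (simp add: CS)
  qed (use C in auto)
  have "\<exists>k. C k = {0}"
  proof (rule ccontr)
    assume "\<not> ?thesis"
    hence "dim (C k) + k \<le> dim (C 0)" for k
    proof (induction k)
      case (Suc k) thus ?case using less[of k] by fastforce
    qed simp
    from this[of "Suc (dim (C 0))"] show False by simp
  qed
  thus ?thesis by (simp add: C_def)
qed

end

section \<open>Orbits of strictly differentiable maps near a fixed point\<close>

text \<open>If every point had a neighbourhood avoided by a tail of the sequence, finitely many of
  these neighbourhoods would cover \<open>P\<close>, and a common tail would have no place in
  \<open>P\<close>.\<close>

lemma compact_cluster_point:
  fixes x :: "nat \<Rightarrow> 'a::topological_space"
  assumes "compact P" "\<And>m. x m \<in> P"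
  shows "\<exists>y\<in>P. \<forall>U. open U \<and> y \<in> U \<longrightarrow> (\<forall>m0. \<exists>m\<ge>m0. x m \<in> U)"
proof (rule ccontr)
  assume "\<not> ?thesis"
  hence "\<forall>y\<in>P. \<exists>p. open (fst p) \<and> y \<in> fst p \<and> (\<forall>m\<ge>snd p. x m \<notin> fst p)" by simp
  from bchoice[OF this] obtain p where
    p: "\<forall>y\<in>P. open (fst (p y)) \<and> y \<in> fst (p y) \<and> (\<forall>m\<ge>snd (p y). x m \<notin> fst (p y))" by blast
  define U where "U = (\<lambda>y. fst (p y))"
  define m0 where "m0 = (\<lambda>y. snd (p y))"
  have U: "\<And>y. y \<in> P \<Longrightarrow> open (U y) \<and> y \<in> U y" "\<And>y m. y \<in> P \<Longrightarrow> m \<ge> m0 y \<Longrightarrow> x m \<notin> U y"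
    using p by (auto simp: U_def m0_def)
  obtain D where D: "D \<subseteq> P" "finite D" "P \<subseteq> (\<Union>y\<in>D. U y)"
    using compact_finite_cover[OF assms(1), of U] U(1) by blast
  define m where "m = Max (insert 0 (m0 ` D))"
  have "x m \<in> (\<Union>y\<in>D. U y)" using assms(2) D(3) by blast
  then obtain y where "y \<in> D" "x m \<in> U y" by blast
  moreover from this have "m0 y \<le> m" unfolding m_def using D(2) by (intro Max_ge) auto
  ultimately show False using U(2) D(1) by blast
qed

context lfw
begin

text \<open>Strict differentiability at the fixed point 0 with derivative \<open>M\<close>.
  Membership of the values in \<open>coord_space n\<close> is part of it, because
  \<open>nrm n\<close> sees only the first \<open>n\<close> coordinates.\<close>

definition strict_diff :: "nat \<Rightarrow> (nat \<Rightarrow> nat \<Rightarrow> 'k) \<Rightarrow> ((nat \<Rightarrow> 'k) \<Rightarrow> nat \<Rightarrow> 'k) \<Rightarrow> bool" where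
  "strict_diff n M f \<longleftrightarrow> f 0 = 0 \<and> (\<forall>e>0. \<exists>d>0. \<forall>x\<in>coord_space n. \<forall>y\<in>coord_space n. nrm n x < d \<longrightarrow> nrm n y < d \<longrightarrow>
     f x \<in> coord_space n \<and> nrm n (f x - f y - mat_app n M (x - y)) \<le> e * nrm n (x - y))"

lemma strict_diff_mat_app: "strict_diff n M (mat_app n M)"
  unfolding strict_diff_def by (auto simp: mat_app.diff intro!: exI[of _ 1])

lemma expansive_near_fixed_point:
  assumes f: "strict_diff n M f" and R: "1 \<notin> R n M"
  shows "\<exists>d>0. \<forall>x. (\<forall>k::int. x k \<in> coord_space n \<and> nrm n (x k) < d \<and> x (k + 1) = f (x k)) \<longrightarrow> (\<forall>k. x k = 0)"
proof -
  have "(0::real) < 1" by simp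
  then obtain C where C: "0 \<le> C" "\<forall>x r B e. 0 \<le> e \<longrightarrow> (\<forall>k::int. x (k + 1) = mat_app n M (x k) + r k \<and> x k \<in> coord_space n \<and>
      nrm n (x k) \<le> B * 1 powi k \<and> nrm n (r k) \<le> e * 1 powi k) \<longrightarrow> (\<forall>k. nrm n (x k) \<le> C * e * 1 powi k)"
    using pseudo_orbit_le[OF _ R] by blast
  \<comment> \<open>Chosen so that \<open>C * e \<le> 1 / 2\<close>: bounding an orbit by its own
    defect then improves any bound by a factor 2.\<close>
  define e where "e = 1 / (2 * (C + 1))"
  have e: "0 < e" "C * e \<le> 1 / 2" using C(1) by (auto simp: e_def field_simps)
  obtain d where d: "d > 0" "\<forall>x\<in>coord_space n. \<forall>y\<in>coord_space n. nrm n x < d \<longrightarrow> nrm n y < d \<longrightarrow>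
     f x \<in> coord_space n \<and> nrm n (f x - f y - mat_app n M (x - y)) \<le> e * nrm n (x - y)"
    using f e(1) by (auto simp: strict_diff_def)
  have "x k = 0" if x: "\<forall>k::int. x k \<in> coord_space n \<and> nrm n (x k) < d \<and> x (k + 1) = f (x k)" for x k
  proof -
    define r where "r = (\<lambda>k. f (x k) - mat_app n M (x k))"
    have r: "nrm n (r k) \<le> e * nrm n (x k)" for k
      using d(2)[rule_format, of "x k" 0] x d(1) f by (simp add: r_def strict_diff_def)
    have step: "nrm n (x k) \<le> max (1 / 2 * B) 0" if B: "\<And>k. nrm n (x k) \<le> B" for B k
    proof -
      have B0: "0 \<le> B" using B[of 0] nrm_nonneg[of n "x 0"] by linarith
      have "nrm n (r k) \<le> e * B" for k
        using r[of k] mult_left_mono[OF B[of k], of e] e(1) by linarith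
      hence "nrm n (x k) \<le> C * (e * B)"
        using C(2)[rule_format, of "e * B" x r B k] e(1) B0 B x by (simp add: r_def)
      also have "\<dots> \<le> 1 / 2 * B" using mult_right_mono[OF e(2) B0] by (simp add: mult.assoc)
      finally show ?thesis by simp
    qed
    have "nrm n (x k) \<le> d" for k using x less_imp_le by blast
    hence "nrm n (x k) \<le> 0"
      by (rule bounded_contraction_le[where q = "1 / 2" and B = d]) (use step in auto)
    hence "nrm n (x k) = 0" using nrm_nonneg[of n "x k"] by linarith
    thus ?thesis using x by (simp add: nrm_eq_0)
  qed
  thus ?thesis using d(1) by blast
qed

text \<open>A bounded linear orbit, scaled down, is corrected on a finite window by Newton steps
  with the fixed derivative \<open>M\<close>; the corrections stay below the size of the orbit at
  time 0. Windows growing to all integers and a cluster point in a compact product give an exact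
  orbit.\<close>

lemma small_orbits_near_fixed_point:
  assumes NM: "\<And>x. x \<in> coord_space n \<Longrightarrow> mat_app n N (mat_app n M x) = x"
    and f: "strict_diff n M f" and R: "1 \<in> R n M" and "0 < d0"
  shows "\<exists>x. (\<forall>k::int. x k \<in> coord_space n \<and> nrm n (x k) < d0 \<and> x (k + 1) = f (x k)) \<and> x 0 \<noteq> 0"
proof -
  obtain c B where c: "c 0 \<noteq> 0" "\<forall>k::int. c (k + 1) = mat_app n M (c k) \<and> nrm n (c k) \<le> B"
    using ex_bounded_orbit[OF NM R] by blast
  have cc: "c k \<in> coord_space n" for k using orbit_in_coord_space c(2) by blast
  have c0: "0 < nrm n (c 0)" using c(1) cc[of 0] nrm_nonneg[of n "c 0"] nrm_eq_0[of "c 0" n] by linarith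
  have B: "nrm n (c 0) \<le> B" "0 < B" using c(2) c0 by (auto intro: order.strict_trans2)
  obtain C' where C': "0 \<le> C'" "\<forall>g D W. finite W \<longrightarrow> (\<forall>k::int. g k \<in> coord_space n \<and> nrm n (g k) \<le> D) \<longrightarrow>
    (\<exists>u. \<forall>k. u (k + 1) = mat_app n M (u k) + (if k \<in> W then g k else 0) \<and> nrm n (u k) \<le> C' * D)"
    using solve_window[OF NM] by blast
  define C where "C = max C' 1"
  have C: "0 < C" "C' \<le> C" "1 \<le> C" by (auto simp: C_def)
  \<comment> \<open>Two demands meet here: \<open>C * e \<le> 1 / 2\<close> makes each correction
    halve the defect, and \<open>C * e * B\<close> is half of \<open>nrm n (c 0)\<close>, so that
    the total correction, estimated by a maximum, stays smaller than the orbit at time 0.\<close>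
  define e where "e = nrm n (c 0) / (2 * C * B)"
  have e0: "0 < e" using c0 C B by (simp add: e_def)
  have CeB: "C * e * B = nrm n (c 0) / 2" using C(1) B(2) by (simp add: e_def)
  have Ce: "C * e \<le> 1 / 2"
  proof -
    have "C * e = nrm n (c 0) / B / 2" using C(1) by (simp add: e_def)
    also have "\<dots> \<le> 1 / 2" using B by (intro divide_right_mono) (auto simp: pos_divide_le_eq)
    finally show ?thesis .
  qed
  obtain d' where d': "d' > 0" "\<forall>x\<in>coord_space n. \<forall>y\<in>coord_space n. nrm n x < d' \<longrightarrow> nrm n y < d' \<longrightarrow>
     f x \<in> coord_space n \<and> nrm n (f x - f y - mat_app n M (x - y)) \<le> e * nrm n (x - y)"
    using f e0 by (auto simp: strict_diff_def)
  define d where "d = min d0 d'"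
  have d: "0 < d" "d \<le> d0" using d' assms(4) by (auto simp: d_def)
  have sd: "f x \<in> coord_space n" "nrm n (f x - f y - mat_app n M (x - y)) \<le> e * nrm n (x - y)"
    if "x \<in> coord_space n" "y \<in> coord_space n" "nrm n x < d" "nrm n y < d" for x y
    using d'(2) that by (auto simp: d_def)
  have f0: "f 0 = 0" using f by (simp add: strict_diff_def)
  \<comment> \<open>The linear orbit is scaled into the ball of radius \<open>d\<close>, in which
    the strict estimate holds; \<open>D\<close> bounds the scaled orbit.\<close>
  obtain a where a: "a \<noteq> 0" "v a < d / B" using ex_small[of "d / B"] d(1) B(2) by auto
  define D where "D = v a * B"
  have D: "0 < D" "D < d" using a B(2) by (auto simp: D_def pos_less_divide_eq)
  define z where "z = (\<lambda>k. vscale a (c k))"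
  have z: "z (k + 1) = mat_app n M (z k)" "z k \<in> coord_space n" "nrm n (z k) \<le> D" for k
    using c(2) cc by (auto simp: z_def mat_app.scale coord_space_vscale D_def intro!: mult_left_mono)
  have CeD: "C * e * D < nrm n (z 0)"
  proof -
    have "C * e * D = v a * (C * e * B)" by (simp add: D_def)
    also have "\<dots> = v a * (nrm n (c 0) / 2)" by (simp only: CeB)
    also have "\<dots> < v a * nrm n (c 0)" using a(1) c0 by (intro mult_strict_left_mono) auto
    finally show ?thesis by (simp add: z_def)
  qed
  have CeD': "C * e * D \<le> D" using Ce D(1) mult_right_mono[of "C * e" 1 D] by simp
  have near: "nrm n x \<le> D" if "nrm n (x - z k) \<le> C * e * D" for x k
  proof -
    have "nrm n (x - z k + z k) \<le> D" using that CeD' z(3)[of k] by (intro nrm_add_le) auto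
    thus ?thesis by simp
  qed
  \<comment> \<open>successive corrections of the linear orbit \<open>z\<close>, halving the defect on the window \<open>W\<close>\<close>
  have approx: "\<exists>x. \<forall>k. x k \<in> coord_space n \<and> nrm n (x k - z k) \<le> C * e * D \<and>
      (k \<in> W \<longrightarrow> nrm n (x (k + 1) - f (x k)) \<le> (1 / 2) ^ m * (e * D))" if W: "finite W" for W m
  proof (induction m)
    case 0
    have "nrm n (z (k + 1) - f (z k)) \<le> e * D" for k
    proof -
      have "nrm n (f (z k) - f 0 - mat_app n M (z k - 0)) \<le> e * nrm n (z k - 0)"
        using z D d(1) by (intro sd) (auto intro: order.strict_trans1)
      hence "nrm n (z (k + 1) - f (z k)) \<le> e * nrm n (z k)"
        by (simp add: f0 z(1) nrm_minus_commute)
      also have "\<dots> \<le> e * D" using z(3) e0 by (intro mult_left_mono) auto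
      finally show ?thesis .
    qed
    thus ?case using z C(1) e0 D(1) by (intro exI[of _ z]) auto
  next
    case (Suc m)
    then obtain x where x: "\<And>k. x k \<in> coord_space n" "\<And>k. nrm n (x k - z k) \<le> C * e * D"
      "\<And>k. k \<in> W \<Longrightarrow> nrm n (x (k + 1) - f (x k)) \<le> (1 / 2) ^ m * (e * D)" by blast
    define t where "t = (1 / 2) ^ m * (e * D)"
    have t: "0 \<le> t" "t \<le> e * D" using e0 D(1) by (auto simp: t_def power_le_one mult_left_le_one_le)
    define g where "g = (\<lambda>k. if k \<in> W then f (x k) - x (k + 1) else 0)"
    have xd: "nrm n (x k) < d" for k using near[OF x(2)[of k]] D(2) by linarith
    have fx: "f (x k) \<in> coord_space n" for k using sd(1)[of "x k" 0] x(1) xd d(1) by simp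
    have "g k \<in> coord_space n \<and> nrm n (g k) \<le> t" for k
      using x(1,3) fx t by (auto simp: g_def coord_space_diff nrm_minus_commute t_def[symmetric])
    then obtain u where u: "\<And>k. u (k + 1) = mat_app n M (u k) + (if k \<in> W then g k else 0)" "\<And>k. nrm n (u k) \<le> C' * t"
      using C'(2)[rule_format, OF W, of g t] by blast
    have uc: "u k \<in> coord_space n" for k
    proof -
      have "u (k - 1 + 1) \<in> coord_space n" unfolding u(1)
        using x(1) fx by (intro coord_space_add) (auto simp: g_def coord_space_diff)
      thus ?thesis by simp
    qed
    have ut: "nrm n (u k) \<le> C * t" for k using u(2)[of k] mult_right_mono[OF C(2) t(1)] by linarith
    have uD: "nrm n (u k) \<le> C * e * D" for k
      using order_trans[OF ut[of k] mult_left_mono[OF t(2), of C]] C(1) by (simp add: mult.assoc)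
    define x' where "x' = (\<lambda>k. x k + u k)"
    have x'c: "x' k \<in> coord_space n" for k by (simp add: x'_def x(1) uc coord_space_add)
    have x'z: "nrm n (x' k - z k) \<le> C * e * D" for k
      using nrm_add_le[OF x(2)[of k] uD[of k]] by (simp add: x'_def algebra_simps)
    have x'd: "nrm n (x' k) < d" for k using near[OF x'z[of k]] D(2) by linarith
    have "nrm n (x' (k + 1) - f (x' k)) \<le> (1 / 2) ^ Suc m * (e * D)" if k: "k \<in> W" for k
    proof -
      have "x' (k + 1) - f (x' k) = - (f (x' k) - f (x k) - mat_app n M (x' k - x k))"
        using k by (simp add: x'_def u(1) g_def)
      hence "nrm n (x' (k + 1) - f (x' k)) = nrm n (f (x' k) - f (x k) - mat_app n M (x' k - x k))"
        by (simp only: nrm_minus)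
      also have "\<dots> \<le> e * nrm n (x' k - x k)" by (intro sd x'c x(1) x'd xd)
      also have "\<dots> \<le> e * (C * t)" using ut[of k] e0 by (intro mult_left_mono) (auto simp: x'_def)
      also have "\<dots> \<le> 1 / 2 * t" using mult_right_mono[OF Ce t(1)] by (simp add: mult_ac)
      finally show ?thesis by (simp add: t_def)
    qed
    thus ?case using x'c x'z by blast
  qed
  have "\<exists>x. \<forall>k. x k \<in> coord_space n \<and> nrm n (x k - z k) \<le> C * e * D \<and>
      (k \<in> {- int m..int m} \<longrightarrow> nrm n (x (k + 1) - f (x k)) \<le> (1 / 2) ^ m * (e * D))" for m
    by (rule approx) simp
  then obtain x where x: "\<And>m k. x m k \<in> coord_space n" "\<And>m k. nrm n (x m k - z k) \<le> C * e * D"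
     "\<And>m k. k \<in> {- int m..int m} \<Longrightarrow> nrm n (x m (k + 1) - f (x m k)) \<le> (1 / 2) ^ m * (e * D)" by metis
  \<comment> \<open>Compact as a product of compact balls. A neighbourhood in the product controls
    finitely many times, which is enough since the orbit equation at \<open>k\<close> involves only
    \<open>k\<close> and \<open>k + 1\<close>.\<close>
  define P where "P = {x :: int \<Rightarrow> nat \<Rightarrow> 'k. \<forall>k. x k \<in> coord_space n \<and> nrm n (x k) \<le> D}"
  have "compact P" unfolding P_def by (rule compact_cball_seq)
  moreover have "x m \<in> P" for m using x(1)[of m] near[OF x(2)[of m]] by (simp add: P_def)
  ultimately obtain y where y: "y \<in> P" "\<forall>U. open U \<and> y \<in> U \<longrightarrow> (\<forall>m0. \<exists>m\<ge>m0. x m \<in> U)"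
    using compact_cluster_point by blast
  have yP: "y k \<in> coord_space n" "nrm n (y k) < d" for k using y(1) D(2) by (auto simp: P_def intro: order.strict_trans1)
  have approx_y: "\<exists>m\<ge>m0. nrm n (x m k - y k) < \<eta> \<and> nrm n (x m (k + 1) - y (k + 1)) < \<eta>"
    if "0 < \<eta>" for \<eta> k m0
  proof -
    define U where "U = {q. q k \<in> {p. nrm n (p - y k) < \<eta>}} \<inter> {q. q (k + 1) \<in> {p. nrm n (p - y (k + 1)) < \<eta>}}"
    have "open U" unfolding U_def by (intro open_Int open_coord_preimage open_coord_ball)
    moreover have "y \<in> U" using that by (simp add: U_def)
    ultimately obtain m where "m \<ge> m0" "x m \<in> U" using y(2) by blast
    thus ?thesis by (auto simp: U_def)
  qed
  obtain Cf where Cf: "0 \<le> Cf" "\<And>x. nrm n (mat_app n M x) \<le> Cf * nrm n x" using mat_app_bounded by blast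
  have "y (k + 1) = f (y k)" for k
  proof -
    define q where "q = nrm n (y (k + 1) - f (y k))"
    define K where "K = 1 + Cf + e"
    have K: "0 < K" "1 \<le> K" "Cf \<le> K" "e \<le> K" using Cf(1) e0 by (auto simp: K_def)
    have "q \<le> K * \<eta>" if \<eta>: "0 < \<eta>" for \<eta>
    proof -
      obtain m1 where m1: "(1 / 2) ^ m1 * (e * D) < \<eta>"
      proof -
        obtain m1 where "(1 / 2 :: real) ^ m1 < \<eta> / (e * D)"
          using real_arch_pow_inv[of "\<eta> / (e * D)" "1 / 2"] \<eta> e0 D(1) by auto
        thus ?thesis using that e0 D(1) by (simp add: pos_less_divide_eq)
      qed
      obtain m where m: "m \<ge> max m1 (nat \<bar>k\<bar>)" "nrm n (x m k - y k) < \<eta>" "nrm n (x m (k + 1) - y (k + 1)) < \<eta>"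
        using approx_y[OF \<eta>] by blast
      have K\<eta>: "\<eta> \<le> K * \<eta>" using mult_right_mono[OF K(2), of \<eta>] \<eta> by simp
      have 1: "nrm n (y (k + 1) - x m (k + 1)) \<le> K * \<eta>"
        using m(3) K\<eta> by (simp add: nrm_minus_commute)
      have 2: "nrm n (x m (k + 1) - f (x m k)) \<le> K * \<eta>"
      proof -
        have "nrm n (x m (k + 1) - f (x m k)) \<le> (1 / 2) ^ m * (e * D)" using m(1) by (intro x(3)) auto
        also have "\<dots> \<le> (1 / 2) ^ m1 * (e * D)" using m(1) e0 D(1)
          by (intro mult_right_mono power_decreasing) auto
        finally show ?thesis using m1 K\<eta> by linarith
      qed
      have xd: "nrm n (x m k) < d" using near[OF x(2)[of m k]] D(2) by linarith
      have small: "nrm n (x m k - y k) \<le> \<eta>" using m(2) by simp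
      have "nrm n (f (x m k) - f (y k) - mat_app n M (x m k - y k)) \<le> K * \<eta>"
        using sd(2)[OF x(1)[of m k] yP(1)[of k] xd yP(2)] mult_mono[OF K(4) small] K(1) by simp
      moreover have "nrm n (mat_app n M (x m k - y k)) \<le> K * \<eta>"
        using Cf(2)[of "x m k - y k"] mult_mono[OF K(3) small] K(1) by simp
      ultimately have 3: "nrm n (f (x m k) - f (y k)) \<le> K * \<eta>"
        using nrm_add_le[of n "f (x m k) - f (y k) - mat_app n M (x m k - y k)" "K * \<eta>" "mat_app n M (x m k - y k)"] by simp
      \<comment> \<open>The three parts are the distance of \<open>y\<close> from an approximation
        at time \<open>k + 1\<close>, the defect of the approximation, and the variation of
        \<open>f\<close> at time \<open>k\<close>.\<close>
      have "q = nrm n ((y (k + 1) - x m (k + 1)) + ((x m (k + 1) - f (x m k)) + (f (x m k) - f (y k))))"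
        by (simp add: q_def)
      also have "\<dots> \<le> K * \<eta>" using 1 2 3 by (intro nrm_add_le)
      finally show ?thesis .
    qed
    from this have "q / K \<le> 0 + \<eta>" if "0 < \<eta>" for \<eta>
      using that K(1) by (simp add: pos_divide_le_eq mult.commute[of \<eta>])
    hence "q / K \<le> 0" by (rule field_le_epsilon)
    hence "q \<le> 0" using K(1) by (simp add: divide_le_0_iff)
    hence "q = 0" by (intro antisym) (simp_all add: q_def)
    moreover have "y (k + 1) - f (y k) \<in> coord_space n"
      using yP sd(1)[of "y k" 0] d(1) by (intro coord_space_diff) auto
    ultimately show ?thesis by (simp add: q_def nrm_eq_0)
  qed
  \<comment> \<open>Each approximation has exactly the norm of \<open>z 0\<close> at time 0, as it
    differs from \<open>z 0\<close> by less than that norm; this survives in the limit.\<close>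
  moreover have "y 0 \<noteq> 0"
  proof
    assume y0: "y 0 = 0"
    obtain m where "nrm n (x m 0 - y 0) < nrm n (z 0)"
      using approx_y[of "nrm n (z 0)" 0 0] c0 a(1) by (auto simp: z_def)
    moreover have "nrm n (x m 0 - z 0) < nrm n (z 0)" using x(2)[of m 0] CeD by linarith
    hence "nrm n (x m 0) = nrm n (z 0)" by (rule nrm_diff_eq_of_less)
    ultimately show False using y0 by simp
  qed
  moreover have "y k \<in> coord_space n \<and> nrm n (y k) < d0" for k using yP[of k] d(2) by linarith
  ultimately show ?thesis by blast
qed

end

section \<open>Analytic maps are strictly differentiable\<close>

definition monomial :: "nat \<Rightarrow> (nat \<Rightarrow> nat) \<Rightarrow> (nat \<Rightarrow> 'a::Fields.field) \<Rightarrow> 'a" where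
  "monomial n \<alpha> h = (\<Prod>j<n. h j ^ \<alpha> j)"

definition deg :: "nat \<Rightarrow> (nat \<Rightarrow> nat) \<Rightarrow> nat" where
  "deg n \<alpha> = (\<Sum>j<n. \<alpha> j)"

definition unit_index :: "nat \<Rightarrow> nat \<Rightarrow> nat" where
  "unit_index j = (\<lambda>i. if i = j then 1 else 0)"

definition jac :: "((nat \<Rightarrow> 'k::local_field) \<Rightarrow> nat \<Rightarrow> 'k) \<Rightarrow> (nat \<Rightarrow> 'k) \<Rightarrow> nat \<Rightarrow> nat \<Rightarrow> 'k" where
  "jac f p = (\<lambda>i j. differential f p (unit_coord j) i)"

lemma unit_index_coord_space: "j < n \<Longrightarrow> unit_index j \<in> coord_space n"
  by (auto simp: unit_index_def coord_space_def)

lemma monomial_unit_index: "j < n \<Longrightarrow> monomial n (unit_index j) h = h j"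
  unfolding monomial_def unit_index_def
  by (subst prod.mono_neutral_right[of _ "{j}"]) auto

lemma monomial_zero: "deg n \<alpha> = 0 \<Longrightarrow> monomial n \<alpha> h = 1"
  by (simp add: monomial_def deg_def)

lemma mult_le_of_le_max:
  fixes x :: real
  assumes "x \<le> max a b" "a * t \<le> r" "b * t \<le> r" "0 \<le> t" shows "x * t \<le> r"
proof (cases "a \<le> b")
  case True
  thus ?thesis using assms mult_right_mono[of x b t] by (simp add: max_def)
next
  case False
  thus ?thesis using assms mult_right_mono[of x a t] by (simp add: max_def)
qed

lemma deg_one:
  assumes "\<alpha> \<in> coord_space n" "deg n \<alpha> = 1" shows "\<exists>j<n. \<alpha> = unit_index j"
proof -
  have "\<exists>j<n. \<alpha> j \<noteq> 0"
  proof (rule ccontr)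
    assume "\<not> ?thesis"
    hence "deg n \<alpha> = 0" by (simp add: deg_def)
    thus False using assms(2) by simp
  qed
  then obtain j where j: "j < n" "\<alpha> j \<noteq> 0" by blast
  have "deg n \<alpha> = \<alpha> j + (\<Sum>i\<in>{..<n} - {j}. \<alpha> i)" unfolding deg_def using j(1) by (subst sum.remove[of _ j]) auto
  hence 1: "\<alpha> j = 1" "(\<Sum>i\<in>{..<n} - {j}. \<alpha> i) = 0" using assms(2) j(2) by linarith+
  have 0: "\<alpha> i = 0" if "i < n" "i \<noteq> j" for i using 1(2) that by simp
  have "\<alpha> i = unit_index j i" for i
    using assms(1) 0[of i] 1(1) by (cases "i < n") (auto simp: unit_index_def coord_space_def)
  thus ?thesis using j(1) by blast
qed

section \<open>Differences of monomials\<close>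

context ultrametric
begin

lemma monomial_le:
  assumes "0 \<le> t" "\<And>j. j < n \<Longrightarrow> v (h j) \<le> t" shows "v (monomial n \<alpha> h) \<le> t ^ deg n \<alpha>"
proof -
  have "v (monomial n \<alpha> h) = (\<Prod>j<n. v (h j) ^ \<alpha> j)" by (simp add: monomial_def prod power)
  also have "\<dots> \<le> (\<Prod>j<n. t ^ \<alpha> j)" using assms by (intro prod_mono) (auto intro: power_mono)
  finally show ?thesis by (simp add: deg_def power_sum)
qed

text \<open>The factor \<open>x - y\<close> splits off and leaves degree \<open>k - 1\<close>.
  Multiplying both sides by \<open>t\<close> avoids an exception at \<open>k = 0\<close>.\<close>

lemma power_diff_le:
  assumes t: "v x \<le> t" "v y \<le> t" shows "v (x ^ k - y ^ k) * t \<le> v (x - y) * t ^ k"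
proof (induction k)
  case 0 thus ?case by simp
next
  case (Suc k)
  have t0: "0 \<le> t" using t nonneg[of x] by linarith
  have "x ^ Suc k - y ^ Suc k = x * (x ^ k - y ^ k) + (x - y) * y ^ k" by (simp add: algebra_simps)
  hence "v (x ^ Suc k - y ^ Suc k) \<le> max (v x * v (x ^ k - y ^ k)) (v (x - y) * v y ^ k)"
    by (metis ultra mult power)
  moreover have "v x * v (x ^ k - y ^ k) * t \<le> v (x - y) * t ^ Suc k"
  proof -
    have "v x * (v (x ^ k - y ^ k) * t) \<le> t * (v (x - y) * t ^ k)"
      using t t0 by (intro mult_mono[OF _ Suc]) auto
    thus ?thesis by (simp add: mult_ac)
  qed
  moreover have "v (x - y) * v y ^ k * t \<le> v (x - y) * t ^ Suc k"
  proof -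
    have "v (x - y) * (v y ^ k * t) \<le> v (x - y) * (t ^ k * t)"
      using t t0 by (intro mult_left_mono mult_right_mono power_mono) auto
    thus ?thesis by (simp add: mult_ac)
  qed
  ultimately show ?case using t0 by (rule mult_le_of_le_max)
qed

lemma monomial_diff_le:
  assumes "\<And>j. j < n \<Longrightarrow> v (h j) \<le> t" "\<And>j. j < n \<Longrightarrow> v (h' j) \<le> t" "0 \<le> t"
    "\<And>j. j < n \<Longrightarrow> v (h j - h' j) \<le> \<delta>" "0 \<le> \<delta>"
  shows "v (monomial n \<alpha> h - monomial n \<alpha> h') * t \<le> \<delta> * t ^ deg n \<alpha>"
  using assms
proof (induction n)
  case 0 thus ?case by (simp add: monomial_def deg_def)
next
  case (Suc n)
  define P P' where "P = monomial n \<alpha> h" and "P' = monomial n \<alpha> h'"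
  have IH: "v (P - P') * t \<le> \<delta> * t ^ deg n \<alpha>" unfolding P_def P'_def using Suc by simp
  have P': "v P' \<le> t ^ deg n \<alpha>" unfolding P'_def using Suc.prems by (intro monomial_le) auto
  have h: "v (h n) \<le> t" "v (h' n) \<le> t" "v (h n - h' n) \<le> \<delta>" using Suc.prems by auto
  have "monomial (Suc n) \<alpha> h - monomial (Suc n) \<alpha> h' =
      (P - P') * h n ^ \<alpha> n + P' * (h n ^ \<alpha> n - h' n ^ \<alpha> n)"
    by (simp add: monomial_def P_def P'_def algebra_simps)
  hence "v (monomial (Suc n) \<alpha> h - monomial (Suc n) \<alpha> h') \<le>
      max (v (P - P') * v (h n) ^ \<alpha> n) (v P' * v (h n ^ \<alpha> n - h' n ^ \<alpha> n))"
    by (metis ultra mult power)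
  moreover have "v (P - P') * v (h n) ^ \<alpha> n * t \<le> \<delta> * t ^ deg (Suc n) \<alpha>"
  proof -
    have "(v (P - P') * t) * v (h n) ^ \<alpha> n \<le> (\<delta> * t ^ deg n \<alpha>) * t ^ \<alpha> n"
      using h Suc.prems by (intro mult_mono[OF IH] power_mono) auto
    thus ?thesis by (simp add: deg_def power_add mult_ac)
  qed
  moreover have "v P' * v (h n ^ \<alpha> n - h' n ^ \<alpha> n) * t \<le> \<delta> * t ^ deg (Suc n) \<alpha>"
  proof -
    have "v (h n ^ \<alpha> n - h' n ^ \<alpha> n) * t \<le> \<delta> * t ^ \<alpha> n"
      using power_diff_le[OF h(1,2), of "\<alpha> n"] mult_right_mono[OF h(3), of "t ^ \<alpha> n"] Suc.prems(3) by simp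
    hence "v P' * (v (h n ^ \<alpha> n - h' n ^ \<alpha> n) * t) \<le> t ^ deg n \<alpha> * (\<delta> * t ^ \<alpha> n)"
      using P' Suc.prems by (rule_tac mult_mono) auto
    thus ?thesis by (simp add: deg_def power_add mult_ac)
  qed
  ultimately show ?case using Suc.prems(3) by (rule mult_le_of_le_max)
qed

end

section \<open>Power series: coefficient bounds and difference estimates\<close>

context lf
begin

lemma has_sum_le:
  assumes "(f has_sum s) A" "\<And>a. a \<in> A \<Longrightarrow> v (f a) \<le> C" "0 \<le> C"
  shows "v s \<le> C"
proof (rule field_le_epsilon)
  fix e :: real assume e: "0 < e"
  have "eventually (\<lambda>F. v (sum f F - s) < e) (finite_subsets_at_top A)"
    using assms(1) e by (simp add: has_sum_def tendsto_iff_v)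
  then obtain F where "finite F" "F \<subseteq> A" "v (sum f F - s) < e"
    unfolding eventually_finite_subsets_at_top by (metis order_refl)
  moreover from this have "v (sum f F) \<le> C" using assms(2,3) by (intro sum_le) auto
  moreover have "v s \<le> max (v (sum f F)) (v (sum f F - s))" using ultra_diff[of "sum f F" "sum f F - s"] by simp
  ultimately show "v s \<le> C + e" using e assms(3) by linarith
qed

text \<open>Outside a suitable finite set every term is the difference of two partial sums close to
  \<open>s\<close>.\<close>

lemma has_sum_terms_bounded:
  assumes "(f has_sum s) A" shows "\<exists>B\<ge>0. \<forall>a\<in>A. v (f a) \<le> B"
proof -
  have "eventually (\<lambda>F. v (sum f F - s) < 1) (finite_subsets_at_top A)"
    using assms by (simp add: has_sum_def tendsto_iff_v)
  then obtain F where F: "finite F" "F \<subseteq> A" "\<And>F'. finite F' \<Longrightarrow> F \<subseteq> F' \<Longrightarrow> F' \<subseteq> A \<Longrightarrow> v (sum f F' - s) < 1"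
    unfolding eventually_finite_subsets_at_top by metis
  define B where "B = Max (insert 1 ((\<lambda>a. v (f a)) ` F))"
  have "1 \<le> B" unfolding B_def using F(1) by (intro Max_ge) auto
  moreover have "v (f a) \<le> B" if "a \<in> A" for a
  proof (cases "a \<in> F")
    case True thus ?thesis unfolding B_def using F(1) by (intro Max_ge) auto
  next
    case False
    have "f a = (sum f (insert a F) - s) - (sum f F - s)" using False F(1) by simp
    hence "v (f a) \<le> max (v (sum f (insert a F) - s)) (v (sum f F - s))" by (metis ultra_diff)
    moreover have "v (sum f (insert a F) - s) < 1" "v (sum f F - s) < 1" by (intro F(3); use F(1,2) that in blast)+
    ultimately show ?thesis using \<open>1 \<le> B\<close> by linarith
  qed
  ultimately show ?thesis by (intro exI[of _ B]) auto
qed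

lemma has_sum_diff_lf:
  fixes f g :: "'b \<Rightarrow> 'k"
  assumes "(f has_sum a) A" "(g has_sum b) A" shows "((\<lambda>x. f x - g x) has_sum (a - b)) A"
  using has_sum_add[OF assms(1) has_sum_uminusI[OF assms(2)]] by simp

text \<open>One ball serves all components, and the coefficients satisfy Cauchy estimates: at a
  point whose first \<open>n\<close> coordinates all equal a scalar of value \<open>d\<close>, the
  monomials have the values \<open>d ^ deg n \<alpha>\<close>, while the terms of a summable family
  are bounded.\<close>

lemma analytic_expansion:
  assumes "analytic_between n m f U" "p \<in> U"
  shows "\<exists>d B a. 0 < d \<and> 0 \<le> B \<and> (\<forall>i<m. \<forall>\<alpha>\<in>coord_space n. v (a i \<alpha>) * d ^ deg n \<alpha> \<le> B) \<and>
    (\<forall>h\<in>coord_space n. nrm n h \<le> d \<longrightarrow> p + h \<in> U \<and>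
       (\<forall>i<m. ((\<lambda>\<alpha>. a i \<alpha> * monomial n \<alpha> h) has_sum f (p + h) i) (coord_space n)))"
proof -
  have U: "openin (coord_top n) U" using assms(1) by (simp add: analytic_between_def)
  then obtain W where W: "open W" "U = coord_space n \<inter> W" by (auto simp: openin_open)
  have p: "p \<in> coord_space n" using W assms(2) by blast
  obtain e0 where e0: "e0 > 0" "\<And>x. x \<in> coord_space n \<Longrightarrow> nrm n (x - p) < e0 \<Longrightarrow> x \<in> W"
    using open_contains_coord_ball[OF W(1) _ p] W(2) assms(2) by blast
  define Q where "Q = (\<lambda>i e a. e > 0 \<and> (\<forall>x\<in>U. nrm n (x - p) < e \<longrightarrow>
      ((\<lambda>\<alpha>. a \<alpha> * (\<Prod>j<n. (x j - p j) ^ \<alpha> j)) has_sum f x i) (coord_space n)))"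
  have "\<exists>e a. Q i e a" if i: "i < m" for i
  proof -
    obtain a V where V: "open V" "p \<in> V" "\<forall>x \<in> U \<inter> V.
           ((\<lambda>\<alpha>. a \<alpha> * (\<Prod>j<n. (x j - p j) ^ \<alpha> j)) has_sum f x i) (coord_space n)"
      using assms i by (simp add: analytic_between_def) blast
    obtain e where "e > 0" "\<And>x. x \<in> coord_space n \<Longrightarrow> nrm n (x - p) < e \<Longrightarrow> x \<in> V"
      using open_contains_coord_ball[OF V(1,2) p] by blast
    thus ?thesis using V(3) W(2) unfolding Q_def by (intro exI[of _ e] exI[of _ a]) auto
  qed
  then obtain e a where Q: "\<And>i. i < m \<Longrightarrow> Q i (e i) (a i)" by metis
  have e: "\<And>i. i < m \<Longrightarrow> e i > 0" "\<And>i x. i < m \<Longrightarrow> x \<in> U \<Longrightarrow> nrm n (x - p) < e i \<Longrightarrow>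
      ((\<lambda>\<alpha>. a i \<alpha> * (\<Prod>j<n. (x j - p j) ^ \<alpha> j)) has_sum f x i) (coord_space n)" using Q by (auto simp: Q_def)
  define e1 where "e1 = Min (insert e0 (e ` {..<m}))"
  have e1: "e1 > 0" "e1 \<le> e0" "\<And>i. i < m \<Longrightarrow> e1 \<le> e i"
    unfolding e1_def using e0(1) e(1) by (subst Min_gr_iff, auto)
  \<comment> \<open>The radius must be the value of a scalar, so that such a test point
    exists.\<close>
  obtain c where c: "c \<noteq> 0" "v c < e1" using ex_small[OF e1(1)] by blast
  define d where "d = v c"
  have d: "0 < d" "d < e1" using c by (auto simp: d_def)
  have exp: "p + h \<in> U \<and> (\<forall>i<m. ((\<lambda>\<alpha>. a i \<alpha> * monomial n \<alpha> h) has_sum f (p + h) i) (coord_space n))"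
    if h: "h \<in> coord_space n" "nrm n h \<le> d" for h
  proof -
    have hp: "p + h \<in> coord_space n" using p h(1) by (rule coord_space_add)
    have "nrm n (p + h - p) < e0" using h(2) d(2) e1(2) by simp
    hence U': "p + h \<in> U" using e0(2)[OF hp] hp W(2) by blast
    moreover have "((\<lambda>\<alpha>. a i \<alpha> * monomial n \<alpha> h) has_sum f (p + h) i) (coord_space n)" if "i < m" for i
    proof -
      have "nrm n (p + h - p) < e i" using h(2) d(2) e1(3)[OF that] by simp
      from e(2)[OF that U' this] show ?thesis by (simp add: monomial_def vec_apply)
    qed
    ultimately show ?thesis by blast
  qed
  define h where "h = (\<lambda>j. if j < n then c else 0)"
  have h: "h \<in> coord_space n" "nrm n h \<le> d" by (auto simp: h_def coord_space_def nrm_le_iff d_def)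
  have mh: "v (monomial n \<alpha> h) = d ^ deg n \<alpha>" for \<alpha>
    by (simp add: monomial_def h_def prod power deg_def power_sum d_def)
  have "\<exists>B\<ge>0. \<forall>\<alpha>\<in>coord_space n. v (a i \<alpha> * monomial n \<alpha> h) \<le> B" if "i < m" for i
    using has_sum_terms_bounded exp[OF h] that by blast
  then obtain B where B: "\<And>i. i < m \<Longrightarrow> B i \<ge> 0" "\<And>i \<alpha>. i < m \<Longrightarrow> \<alpha> \<in> coord_space n \<Longrightarrow> v (a i \<alpha> * monomial n \<alpha> h) \<le> B i"
    by metis
  define B' where "B' = Max (insert 0 (B ` {..<m}))"
  have B': "0 \<le> B'" "\<And>i. i < m \<Longrightarrow> B i \<le> B'" unfolding B'_def by (auto intro!: Max_ge)
  have "v (a i \<alpha>) * d ^ deg n \<alpha> \<le> B'" if "i < m" "\<alpha> \<in> coord_space n" for i \<alpha>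
    using B(2)[OF that] B'(2)[OF that(1)] by (simp add: mult mh)
  thus ?thesis using d(1) B'(1) exp by blast
qed

text \<open>Constant terms cancel in the difference, and the terms of degree 1 form the linear part.
  In the remaining degrees a monomial difference contributes \<open>nrm n (h - h')\<close> and at
  least one factor \<open>t\<close>; the Cauchy estimates turn the other powers into
  \<open>C = B / d ^ 2\<close>.\<close>

lemma analytic_strict_estimate:
  assumes "analytic_between n m f U" "p \<in> U"
  shows "\<exists>d C J. 0 < d \<and> 0 \<le> C \<and> (\<forall>h\<in>coord_space n. nrm n h \<le> d \<longrightarrow> p + h \<in> U) \<and>
    (\<forall>t h h' i. 0 < t \<longrightarrow> t \<le> d \<longrightarrow> h \<in> coord_space n \<longrightarrow> h' \<in> coord_space n \<longrightarrow> nrm n h \<le> t \<longrightarrow> nrm n h' \<le> t \<longrightarrow> i < m \<longrightarrow>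
      v (f (p + h) i - f (p + h') i - (\<Sum>j<n. J i j * (h j - h' j))) \<le> C * t * nrm n (h - h'))"
proof -
  obtain d B a where d: "0 < d" and B: "0 \<le> B" "\<And>i \<alpha>. i < m \<Longrightarrow> \<alpha> \<in> coord_space n \<Longrightarrow> v (a i \<alpha>) * d ^ deg n \<alpha> \<le> B"
    and ex: "\<And>h. h \<in> coord_space n \<Longrightarrow> nrm n h \<le> d \<Longrightarrow> p + h \<in> U \<and>
       (\<forall>i<m. ((\<lambda>\<alpha>. a i \<alpha> * monomial n \<alpha> h) has_sum f (p + h) i) (coord_space n))"
    using analytic_expansion[OF assms] by blast
  define J where "J = (\<lambda>i j. a i (unit_index j))"
  define C where "C = B / d ^ 2"
  have C: "0 \<le> C" using B(1) by (simp add: C_def)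
  have "v (f (p + h) i - f (p + h') i - (\<Sum>j<n. J i j * (h j - h' j))) \<le> C * t * nrm n (h - h')"
    if t: "0 < t" "t \<le> d" and h: "h \<in> coord_space n" "h' \<in> coord_space n" "nrm n h \<le> t" "nrm n h' \<le> t" and i: "i < m"
    for t h h' i
  proof -
    define \<delta> where "\<delta> = nrm n (h - h')"
    define g where "g = (\<lambda>\<alpha>. a i \<alpha> * monomial n \<alpha> h - a i \<alpha> * monomial n \<alpha> h')"
    define E where "E = unit_index ` {..<n}"
    have EC: "E \<subseteq> coord_space n" unfolding E_def using unit_index_coord_space by blast
    have "(g has_sum (f (p + h) i - f (p + h') i)) (coord_space n)"
      unfolding g_def using ex[of h] ex[of h'] h t i by (intro has_sum_diff_lf) auto
    moreover have "((\<lambda>\<alpha>. if \<alpha> \<in> E then g \<alpha> else 0) has_sum (\<Sum>j<n. J i j * (h j - h' j))) (coord_space n)"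
    proof (rule has_sum_finite_neutralI[of E])
      have inj: "inj_on unit_index {..<n}" by (auto simp: inj_on_def unit_index_def fun_eq_iff)
      have "(\<Sum>\<alpha>\<in>E. if \<alpha> \<in> E then g \<alpha> else 0) = (\<Sum>j<n. g (unit_index j))"
        unfolding E_def by (subst sum.reindex[OF inj]) (auto intro!: sum.cong)
      also have "\<dots> = (\<Sum>j<n. J i j * (h j - h' j))"
        by (intro sum.cong refl) (simp add: g_def J_def monomial_unit_index algebra_simps)
      finally show "(\<Sum>j<n. J i j * (h j - h' j)) = (\<Sum>\<alpha>\<in>E. if \<alpha> \<in> E then g \<alpha> else 0)" by simp
    qed (use EC in \<open>auto simp: E_def\<close>)
    ultimately have hs: "((\<lambda>\<alpha>. g \<alpha> - (if \<alpha> \<in> E then g \<alpha> else 0)) has_sum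
        (f (p + h) i - f (p + h') i - (\<Sum>j<n. J i j * (h j - h' j)))) (coord_space n)"
      by (rule has_sum_diff_lf)
    have "v (g \<alpha> - (if \<alpha> \<in> E then g \<alpha> else 0)) \<le> C * t * \<delta>" if \<alpha>: "\<alpha> \<in> coord_space n" for \<alpha>
    proof (cases "\<alpha> \<in> E")
      case True
      thus ?thesis using C t by (simp add: \<delta>_def)
    next
      case False
      have g: "g \<alpha> = a i \<alpha> * (monomial n \<alpha> h - monomial n \<alpha> h')" by (simp add: g_def algebra_simps)
      show ?thesis
      proof (cases "deg n \<alpha> = 0")
        case True
        thus ?thesis using C t False by (simp add: g monomial_zero \<delta>_def)
      next
        case d0: False
        have d1: "deg n \<alpha> \<noteq> 1" using deg_one[OF \<alpha>] False by (auto simp: E_def)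
        then obtain s where s: "deg n \<alpha> = s + 2" using d0 by (metis One_nat_def add_2_eq_Suc' not0_implies_Suc)
        define q where "q = v (monomial n \<alpha> h - monomial n \<alpha> h')"
        have "q * t \<le> \<delta> * t ^ deg n \<alpha>" unfolding q_def \<delta>_def
        proof (rule monomial_diff_le)
          fix j assume j: "j < n"
          show "v (h j) \<le> t" "v (h' j) \<le> t" using le_nrm[OF j, of h] le_nrm[OF j, of h'] h by linarith+
          show "v (h j - h' j) \<le> nrm n (h - h')" using le_nrm[OF j, of "h - h'"] by (simp add: vec_apply)
        qed (use t in auto)
        hence q: "q \<le> \<delta> * t * t ^ s" using t(1) by (simp add: s power2_eq_square)
        also have "\<dots> \<le> \<delta> * t * d ^ s" using t by (intro mult_left_mono power_mono) (auto simp: \<delta>_def)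
        finally have "v (a i \<alpha>) * q \<le> v (a i \<alpha>) * (\<delta> * t * d ^ s)" by (intro mult_left_mono) auto
        also have "\<dots> = (v (a i \<alpha>) * d ^ deg n \<alpha>) * (\<delta> * t) / d ^ 2"
          using d by (simp add: s power_add power2_eq_square mult_ac)
        also have "\<dots> \<le> B * (\<delta> * t) / d ^ 2"
          using B(2)[OF i \<alpha>] t d by (intro divide_right_mono mult_right_mono) (auto simp: \<delta>_def)
        finally show ?thesis using False by (simp add: g mult q_def C_def mult_ac)
      qed
    qed
    thus ?thesis using has_sum_le[OF hs, of "C * t * \<delta>"] C t by (simp add: \<delta>_def)
  qed
  thus ?thesis using d C ex by blast
qed

text \<open>Dividing the strict estimate by \<open>s\<close> leaves an error of order
  \<open>v s\<close>, so the limit is the linear part of the power series. Since \<open>jac\<close>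
  is defined through \<open>differential\<close>, the estimate can then be restated with a matrix
  that does not depend on the choice of an expansion.\<close>

lemma differential_limit:
  fixes f :: "(nat \<Rightarrow> 'k) \<Rightarrow> nat \<Rightarrow> 'k"
  assumes "analytic_between n m f U" "p \<in> U" "y \<in> coord_space n"
  shows "((\<lambda>s. (f (\<lambda>j. p j + s * y j) i - f p i) / s) \<longlongrightarrow> differential f p y i) (at 0)"
    and "m \<le> i \<Longrightarrow> differential f p y i = 0"
    and "i < m \<Longrightarrow> differential f p y i = (\<Sum>j<n. jac f p i j * y j)"
    and "\<exists>d C. 0 < d \<and> 0 \<le> C \<and> (\<forall>h\<in>coord_space n. nrm n h \<le> d \<longrightarrow> p + h \<in> U) \<and>
    (\<forall>t h h' i. 0 < t \<longrightarrow> t \<le> d \<longrightarrow> h \<in> coord_space n \<longrightarrow> h' \<in> coord_space n \<longrightarrow> nrm n h \<le> t \<longrightarrow> nrm n h' \<le> t \<longrightarrow> i < m \<longrightarrow>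
      v (f (p + h) i - f (p + h') i - (\<Sum>j<n. jac f p i j * (h j - h' j))) \<le> C * t * nrm n (h - h'))"
proof -
  have pU: "p \<in> coord_space n" using assms(1,2) by (auto simp: analytic_between_def dest: openin_imp_subset)
  obtain d C J where d: "0 < d" and C: "0 \<le> C" and U: "\<And>h. h \<in> coord_space n \<Longrightarrow> nrm n h \<le> d \<Longrightarrow> p + h \<in> U"
    and est: "\<And>t h h' i. 0 < t \<Longrightarrow> t \<le> d \<Longrightarrow> h \<in> coord_space n \<Longrightarrow> h' \<in> coord_space n \<Longrightarrow> nrm n h \<le> t \<Longrightarrow> nrm n h' \<le> t \<Longrightarrow> i < m \<Longrightarrow>
      v (f (p + h) i - f (p + h') i - (\<Sum>j<n. J i j * (h j - h' j))) \<le> C * t * nrm n (h - h')"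
    using analytic_strict_estimate[OF assms(1,2)] by blast
  have fU: "f ` U \<subseteq> coord_space m" using assms(1) by (simp add: analytic_between_def)
  have lim: "((\<lambda>s. (f (\<lambda>j. p j + s * y j) i - f p i) / s) \<longlongrightarrow> (if i < m then \<Sum>j<n. J i j * y j else 0)) (at 0)"
    if y: "y \<in> coord_space n" for y i
    unfolding tendsto_iff_v
  proof (intro allI impI)
    fix e :: real assume e: "0 < e"
    define K where "K = C * nrm n y * nrm n y + 1"
    have K: "0 < K" using C by (simp add: K_def add_nonneg_pos)
    define r where "r = min (d / (nrm n y + 1)) (e / K)"
    have n1: "0 < nrm n y + 1" by (simp add: add_nonneg_pos)
    have r: "0 < r" using d e K n1 by (simp add: r_def)
    have "v ((f (\<lambda>j. p j + s * y j) i - f p i) / s - (if i < m then \<Sum>j<n. J i j * y j else 0)) < e"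
      if s: "s \<noteq> 0" "v s < r" for s
    proof -
      define h where "h = vscale s y"
      have h: "h \<in> coord_space n" "nrm n h = v s * nrm n y" using y by (auto simp: h_def coord_space_vscale)
      have hd: "v s * (nrm n y + 1) \<le> d" using s(2) n1 by (simp add: r_def pos_less_divide_eq less_imp_le)
      have hd': "nrm n h \<le> v s * (nrm n y + 1)" using h(2) by (simp add: algebra_simps)
      have ph: "(\<lambda>j. p j + s * y j) = p + h" by (auto simp: h_def vec_apply)
      have phU: "p + h \<in> U" using U[OF h(1)] hd hd' by linarith
      show ?thesis
      proof (cases "i < m")
        case False
        hence "f (p + h) i = 0" "f p i = 0" using fU phU assms(2) by (auto simp: coord_space_def image_subset_iff)
        thus ?thesis using False e by (simp add: ph)
      next
        case True
        show ?thesis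
        proof (cases "nrm n y = 0")
          case y0: True
          hence "y = 0" using nrm_eq_0[OF y] by simp
          hence "h = 0" by (simp add: h_def)
          thus ?thesis using e \<open>y = 0\<close> by (simp add: ph vec_apply)
        next
          case False
          hence "0 < nrm n y" using nrm_nonneg[of n y] by linarith
          hence t: "0 < nrm n h" using h(2) s(1) by (simp add: zero_less_mult_iff)
          have "v (f (p + h) i - f (p + 0) i - (\<Sum>j<n. J i j * (h j - 0 j))) \<le> C * nrm n h * nrm n (h - 0)"
            using t hd hd' h by (intro est True) auto
          hence 1: "v (f (p + h) i - f p i - s * (\<Sum>j<n. J i j * y j)) \<le> C * nrm n h * nrm n h"
            by (simp add: h_def vec_apply sum_distrib_left mult_ac)
          have "v ((f (p + h) i - f p i) / s - (\<Sum>j<n. J i j * y j)) = v (f (p + h) i - f p i - s * (\<Sum>j<n. J i j * y j)) / v s"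
            using s(1) by (simp add: field_simps flip: divide)
          also have "\<dots> \<le> C * nrm n h * nrm n h / v s" using 1 by (intro divide_right_mono) auto
          also have "\<dots> = v s * (C * nrm n y * nrm n y)" using s(1) by (simp add: h(2))
          also have "\<dots> \<le> v s * K" by (intro mult_left_mono) (auto simp: K_def)
          also have "\<dots> < e" using s(2) K by (simp add: r_def pos_less_divide_eq)
          finally show ?thesis using True by (simp add: ph)
        qed
      qed
    qed
    thus "eventually (\<lambda>s. v ((f (\<lambda>j. p j + s * y j) i - f p i) / s - (if i < m then \<Sum>j<n. J i j * y j else 0)) < e) (at 0)"
      unfolding eventually_at_0 using r by blast
  qed
  have eq: "differential f p y i = (if i < m then \<Sum>j<n. J i j * y j else 0)" if "y \<in> coord_space n" for y i
    unfolding differential_def by (rule tendsto_Lim[OF _ lim[OF that]]) simp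
  show "((\<lambda>s. (f (\<lambda>j. p j + s * y j) i - f p i) / s) \<longlongrightarrow> differential f p y i) (at 0)"
    using lim[OF assms(3)] by (simp add: eq[OF assms(3)])
  show "m \<le> i \<Longrightarrow> differential f p y i = 0" by (simp add: eq[OF assms(3)])
  have jac: "jac f p i j = J i j" if "i < m" "j < n" for i j
    unfolding jac_def using eq[OF coord_space_unit[OF that(2)]] that
    by (simp add: unit_coord_def if_distrib[of "\<lambda>t. _ * t"] cong: if_cong)
  show "i < m \<Longrightarrow> differential f p y i = (\<Sum>j<n. jac f p i j * y j)"
    by (simp add: eq[OF assms(3)] jac)
  have "(\<Sum>j<n. jac f p i j * (h j - h' j)) = (\<Sum>j<n. J i j * (h j - h' j))" if "i < m" for i h h'
    using that by (simp add: jac)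
  thus "\<exists>d C. 0 < d \<and> 0 \<le> C \<and> (\<forall>h\<in>coord_space n. nrm n h \<le> d \<longrightarrow> p + h \<in> U) \<and>
    (\<forall>t h h' i. 0 < t \<longrightarrow> t \<le> d \<longrightarrow> h \<in> coord_space n \<longrightarrow> h' \<in> coord_space n \<longrightarrow> nrm n h \<le> t \<longrightarrow> nrm n h' \<le> t \<longrightarrow> i < m \<longrightarrow>
      v (f (p + h) i - f (p + h') i - (\<Sum>j<n. jac f p i j * (h j - h' j))) \<le> C * t * nrm n (h - h'))"
    using d C U est by (intro exI[of _ d] exI[of _ C]) simp
qed

text \<open>The mixed second difference of an analytic map of two groups of variables. Its summands are
  products of a difference in the first and a difference in the second variables.\<close>

lemma analytic_mixed_difference:
  assumes "analytic_between (n + n) m f U" "append_coords n p q \<in> U" "p \<in> coord_space n" "q \<in> coord_space n"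
  shows "\<exists>d C b. 0 < d \<and> 0 \<le> C \<and>
    (\<forall>x y. x \<in> coord_space n \<longrightarrow> y \<in> coord_space n \<longrightarrow> nrm n x \<le> d \<longrightarrow> nrm n y \<le> d \<longrightarrow>
      append_coords n (p + x) (q + y) \<in> U \<and>
      (\<forall>i<m. v (f (append_coords n (p + x) (q + y)) i - f (append_coords n (p + x) q) i
        - f (append_coords n p (q + y)) i + f (append_coords n p q) i - (\<Sum>l<n. \<Sum>j<n. b i l j * (x l * y j)))
        \<le> C * nrm n x * nrm n y * max (nrm n x) (nrm n y)))"
proof -
  define P where "P = append_coords n p q"
  obtain d B a where d: "0 < d" and B: "0 \<le> B" "\<And>i \<alpha>. i < m \<Longrightarrow> \<alpha> \<in> coord_space (n + n) \<Longrightarrow> v (a i \<alpha>) * d ^ deg (n + n) \<alpha> \<le> B"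
    and ex: "\<And>h. h \<in> coord_space (n + n) \<Longrightarrow> nrm (n + n) h \<le> d \<Longrightarrow> P + h \<in> U \<and>
       (\<forall>i<m. ((\<lambda>\<alpha>. a i \<alpha> * monomial (n + n) \<alpha> h) has_sum f (P + h) i) (coord_space (n + n)))"
    using analytic_expansion[OF assms(1,2)] unfolding P_def by blast
  define b where "b = (\<lambda>i l j. a i (\<lambda>t. unit_index l t + unit_index (n + j) t))"
  \<comment> \<open>After the bilinear terms are removed, every term that contributes has degree at
    least 3, which is where the exponent comes from.\<close>
  define C where "C = B / d ^ 3"
  have C: "0 \<le> C" using B(1) d by (simp add: C_def)
  have app_add: "append_coords n (p + x) (q + y) = P + append_coords n x y" for x y
    by (auto simp: append_coords_def P_def vec_apply fun_eq_iff)
  have app_coord: "append_coords n x y \<in> coord_space (n + n)" if "x \<in> coord_space n" "y \<in> coord_space n" for x y :: "nat \<Rightarrow> 'k"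
    using that by (auto simp: append_coords_def coord_space_def)
  have app_nrm: "nrm (n + n) (append_coords n x y) \<le> d" if "nrm n x \<le> d" "nrm n y \<le> d" for x y
    using that by (auto simp: nrm_le_iff append_coords_def)
  define hi where "hi = (\<lambda>(\<alpha> :: nat \<Rightarrow> nat) j. \<alpha> (n + j))"
  have mono_app: "monomial (n + n) \<alpha> (append_coords n x y) = monomial n \<alpha> x * monomial n (hi \<alpha>) y"
    for \<alpha> and x y :: "nat \<Rightarrow> 'k"
  proof -
    have prod_split: "(\<Prod>j<n + k. g j) = (\<Prod>j<n. g j) * (\<Prod>j<k. g (n + j))" for g :: "nat \<Rightarrow> 'k" and k
      by (induction k) (auto simp: mult.assoc)
    show ?thesis unfolding monomial_def prod_split by (simp add: append_coords_def hi_def)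
  qed
  have deg_app: "deg (n + n) \<alpha> = deg n \<alpha> + deg n (hi \<alpha>)" for \<alpha>
  proof -
    have "(\<Sum>j<n + k. g j) = (\<Sum>j<n. g j) + (\<Sum>j<k. g (n + j))" for g :: "nat \<Rightarrow> nat" and k
      by (induction k) auto
    thus ?thesis by (simp add: deg_def hi_def)
  qed
  have main: "v (f (append_coords n (p + x) (q + y)) i - f (append_coords n (p + x) q) i
        - f (append_coords n p (q + y)) i + f (append_coords n p q) i - (\<Sum>l<n. \<Sum>j<n. b i l j * (x l * y j)))
        \<le> C * nrm n x * nrm n y * max (nrm n x) (nrm n y)"
    if x: "x \<in> coord_space n" "nrm n x \<le> d" and y: "y \<in> coord_space n" "nrm n y \<le> d" and i: "i < m" for x y i
  proof -
    define xx yy where "xx = nrm n x" and "yy = nrm n y"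
    have XY: "0 \<le> xx" "xx \<le> d" "0 \<le> yy" "yy \<le> d" using x y by (auto simp: xx_def yy_def)
    define g where "g = (\<lambda>\<alpha>. a i \<alpha> * ((monomial n \<alpha> x - monomial n \<alpha> 0) * (monomial n (hi \<alpha>) y - monomial n (hi \<alpha>) 0)))"
    \<comment> \<open>The multi-indices of degree 1 in each group of variables; they carry the
      bilinear part.\<close>
    define E where "E = (\<lambda>(l, j) t. unit_index l t + unit_index (n + j) t) ` ({..<n} \<times> {..<n})"
    have EC: "E \<subseteq> coord_space (n + n)" by (auto simp: E_def unit_index_def coord_space_def)
    have hs: "((\<lambda>\<alpha>. a i \<alpha> * (monomial n \<alpha> x' * monomial n (hi \<alpha>) y')) has_sum f (append_coords n (p + x') (q + y')) i) (coord_space (n + n))"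
      if "x' \<in> coord_space n" "nrm n x' \<le> d" "y' \<in> coord_space n" "nrm n y' \<le> d" for x' y'
      using ex[OF app_coord app_nrm, of x' y'] that i by (simp add: app_add mono_app)
    have "((\<lambda>\<alpha>. (a i \<alpha> * (monomial n \<alpha> x * monomial n (hi \<alpha>) y) - a i \<alpha> * (monomial n \<alpha> x * monomial n (hi \<alpha>) 0))
        - (a i \<alpha> * (monomial n \<alpha> 0 * monomial n (hi \<alpha>) y) - a i \<alpha> * (monomial n \<alpha> 0 * monomial n (hi \<alpha>) 0))) has_sum
        ((f (append_coords n (p + x) (q + y)) i - f (append_coords n (p + x) (q + 0)) i)
        - (f (append_coords n (p + 0) (q + y)) i - f (append_coords n (p + 0) (q + 0)) i))) (coord_space (n + n))"
      using x y d by (intro has_sum_diff_lf hs) auto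
    moreover have "(a i \<alpha> * (monomial n \<alpha> x * monomial n (hi \<alpha>) y) - a i \<alpha> * (monomial n \<alpha> x * monomial n (hi \<alpha>) 0))
        - (a i \<alpha> * (monomial n \<alpha> 0 * monomial n (hi \<alpha>) y) - a i \<alpha> * (monomial n \<alpha> 0 * monomial n (hi \<alpha>) 0)) = g \<alpha>" for \<alpha>
      by (simp add: g_def algebra_simps)
    ultimately have "(g has_sum (f (append_coords n (p + x) (q + y)) i - f (append_coords n (p + x) q) i
        - f (append_coords n p (q + y)) i + f (append_coords n p q) i)) (coord_space (n + n))"
      by (simp add: algebra_simps)
    moreover have "((\<lambda>\<alpha>. if \<alpha> \<in> E then g \<alpha> else 0) has_sum (\<Sum>l<n. \<Sum>j<n. b i l j * (x l * y j))) (coord_space (n + n))"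
    proof (rule has_sum_finite_neutralI[of E])
      define u where "u = (\<lambda>(l, j) t. unit_index l t + unit_index (n + j) t)"
      have u1: "monomial n (u (l, j)) z = z l" "monomial n (hi (u (l, j))) z = z j" if "l < n" "j < n" for l j z
      proof -
        have "monomial n (u (l, j)) z = monomial n (unit_index l) z"
          unfolding monomial_def by (intro prod.cong refl) (auto simp: u_def unit_index_def)
        thus "monomial n (u (l, j)) z = z l" using that by (simp add: monomial_unit_index)
        have "monomial n (hi (u (l, j))) z = monomial n (unit_index j) z"
          unfolding monomial_def hi_def using that by (intro prod.cong refl) (auto simp: u_def unit_index_def)
        thus "monomial n (hi (u (l, j))) z = z j" using that by (simp add: monomial_unit_index)
      qed
      have bu: "b i l j = a i (u (l, j))" for l j by (simp add: b_def u_def)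
      have inj: "inj_on u ({..<n} \<times> {..<n})"
      proof (rule inj_onI, clarsimp)
        fix l j l' j' assume *: "l < n" "j < n" "l' < n" "j' < n" "u (l, j) = u (l', j')"
        have "u (l, j) l = 1" "u (l', j') l = (if l = l' then 1 else 0)"
          "u (l, j) (n + j) = 1" "u (l', j') (n + j) = (if j = j' then 1 else 0)"
          using *(1-4) by (simp_all add: u_def unit_index_def)
        thus "l = l' \<and> j = j'" using *(5) by (metis zero_neq_one)
      qed
      have "(\<Sum>\<alpha>\<in>E. if \<alpha> \<in> E then g \<alpha> else 0) = (\<Sum>\<alpha>\<in>u ` ({..<n} \<times> {..<n}). g \<alpha>)"
        unfolding E_def u_def by (intro sum.cong refl) simp
      also have "\<dots> = (\<Sum>(l, j)\<in>{..<n} \<times> {..<n}. b i l j * (x l * y j))"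
        by (subst sum.reindex[OF inj], intro sum.cong refl) (clarsimp simp: g_def u1 vec_apply bu)
      finally show "(\<Sum>l<n. \<Sum>j<n. b i l j * (x l * y j)) = (\<Sum>\<alpha>\<in>E. if \<alpha> \<in> E then g \<alpha> else 0)"
        by (simp add: sum.cartesian_product)
    qed (use EC in \<open>auto simp: E_def\<close>)
    ultimately have rest: "((\<lambda>\<alpha>. g \<alpha> - (if \<alpha> \<in> E then g \<alpha> else 0)) has_sum
       (f (append_coords n (p + x) (q + y)) i - f (append_coords n (p + x) q) i
        - f (append_coords n p (q + y)) i + f (append_coords n p q) i - (\<Sum>l<n. \<Sum>j<n. b i l j * (x l * y j)))) (coord_space (n + n))"
      by (rule has_sum_diff_lf)
    have mono0: "v (monomial n \<alpha> z - monomial n \<alpha> 0) \<le> (if deg n \<alpha> = 0 then 0 else nrm n z ^ deg n \<alpha>)" for \<alpha> z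
    proof (cases "deg n \<alpha> = 0")
      case False
      have "v (monomial n \<alpha> z) \<le> nrm n z ^ deg n \<alpha>" by (intro monomial_le) (auto intro: le_nrm)
      moreover have "v (monomial n \<alpha> 0) \<le> 0 ^ deg n \<alpha>" by (rule monomial_le) (auto simp: vec_apply)
      hence "v (monomial n \<alpha> 0) \<le> 0" using False by (simp add: power_0_left)
      hence "v (monomial n \<alpha> 0) \<le> nrm n z ^ deg n \<alpha>" by (rule order_trans) simp
      ultimately show ?thesis using ultra_diff[of "monomial n \<alpha> z" "monomial n \<alpha> 0"] False by simp
    qed (simp add: monomial_zero)
    have "v (g \<alpha> - (if \<alpha> \<in> E then g \<alpha> else 0)) \<le> C * xx * yy * max xx yy" if \<alpha>: "\<alpha> \<in> coord_space (n + n)" for \<alpha>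
    proof (cases "\<alpha> \<in> E \<or> deg n \<alpha> = 0 \<or> deg n (hi \<alpha>) = 0")
      case True
      thus ?thesis using C XY by (auto simp: g_def monomial_zero le_max_iff_disj)
    next
      case False
      have d1: "\<not> (deg n \<alpha> = 1 \<and> deg n (hi \<alpha>) = 1)"
      proof
        assume *: "deg n \<alpha> = 1 \<and> deg n (hi \<alpha>) = 1"
        define lo where "lo = (\<lambda>t. if t < n then \<alpha> t else 0)"
        have "deg n lo = 1" using * by (simp add: deg_def lo_def)
        then obtain l where l: "l < n" "lo = unit_index l" using deg_one[of lo n] by (auto simp: lo_def coord_space_def)
        have "hi \<alpha> \<in> coord_space n" using \<alpha> by (auto simp: hi_def coord_space_def)
        then obtain j where j: "j < n" "hi \<alpha> = unit_index j" using deg_one[of "hi \<alpha>" n] * by blast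
        have "\<alpha> t = unit_index l t + unit_index (n + j) t" for t
        proof (cases "t < n")
          case True
          thus ?thesis using fun_cong[OF l(2), of t] by (simp add: lo_def unit_index_def)
        next
          case False
          thus ?thesis using fun_cong[OF j(2), of "t - n"] l(1) by (auto simp: hi_def unit_index_def)
        qed
        hence "\<alpha> = (\<lambda>(l, j) t. unit_index l t + unit_index (n + j) t) (l, j)" by auto
        hence "\<alpha> \<in> E" unfolding E_def using l(1) j(1) by blast
        thus False using False by simp
      qed
      define s1 s2 where "s1 = deg n \<alpha> - 1" and "s2 = deg n (hi \<alpha>) - 1"
      have s: "deg n \<alpha> = Suc s1" "deg n (hi \<alpha>) = Suc s2" using False by (auto simp: s1_def s2_def)
      have s12: "s1 + s2 \<noteq> 0" using d1 s by auto
      \<comment> \<open>At least one of the excess degrees is positive: one factor is kept as the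
        maximum, the others are bounded by \<open>d\<close>. The extra \<open>d\<close> on the left
        balances the degrees.\<close>
      have pw: "xx ^ s1 * yy ^ s2 * d \<le> max xx yy * d ^ (s1 + s2)"
      proof (cases s1)
        case 0
        then obtain s where s': "s2 = Suc s" using s12 by (cases s2) auto
        have "yy * yy ^ s * d \<le> max xx yy * d ^ s * d"
          using XY d by (intro mult_right_mono mult_mono power_mono) auto
        thus ?thesis by (simp add: 0 s' mult_ac)
      next
        case (Suc s)
        have "xx * xx ^ s * yy ^ s2 * d \<le> max xx yy * d ^ s * d ^ s2 * d"
          using XY d by (intro mult_right_mono mult_mono power_mono) auto
        thus ?thesis by (simp add: Suc power_add mult_ac)
      qed
      have "v (g \<alpha>) \<le> v (a i \<alpha>) * (xx ^ Suc s1 * yy ^ Suc s2)"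
        unfolding g_def mult using mono0[of \<alpha> x] mono0[of "hi \<alpha>" y] XY
        by (intro mult_left_mono mult_mono) (auto simp: s xx_def yy_def)
      also have "\<dots> = v (a i \<alpha>) * xx * yy * (xx ^ s1 * yy ^ s2 * d) / d" using d by simp
      also have "\<dots> \<le> v (a i \<alpha>) * xx * yy * (max xx yy * d ^ (s1 + s2)) / d"
        using pw XY d by (intro divide_right_mono mult_left_mono) auto
      also have "\<dots> = (v (a i \<alpha>) * d ^ deg (n + n) \<alpha>) * (xx * yy * max xx yy) / d ^ 3"
        using d by (simp add: deg_app s power_add power3_eq_cube mult_ac)
      also have "\<dots> \<le> B * (xx * yy * max xx yy) / d ^ 3"
        using B(2)[OF i \<alpha>] XY d by (intro divide_right_mono mult_right_mono) (auto simp: le_max_iff_disj)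
      finally show ?thesis using False by (simp add: C_def mult_ac)
    qed
    thus ?thesis using has_sum_le[OF rest, of "C * xx * yy * max xx yy"] C XY unfolding xx_def[symmetric] yy_def[symmetric]
      by (auto simp: le_max_iff_disj)
  qed
  have "append_coords n (p + x) (q + y) \<in> U" if "x \<in> coord_space n" "nrm n x \<le> d" "y \<in> coord_space n" "nrm n y \<le> d" for x y
    using ex[OF app_coord app_nrm] that by (simp add: app_add)
  thus ?thesis using d C main by blast
qed

end

section \<open>Commutators in ultrametric coordinates of a local group\<close>

definition comm :: "('g, 'm) monoid_scheme \<Rightarrow> 'g \<Rightarrow> 'g \<Rightarrow> 'g" where
  "comm G x y = x \<otimes>\<^bsub>G\<^esub> y \<otimes>\<^bsub>G\<^esub> inv\<^bsub>G\<^esub> x \<otimes>\<^bsub>G\<^esub> inv\<^bsub>G\<^esub> y"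

context Group.group
begin

lemma inv_mult_cancel_left: "x \<in> carrier G \<Longrightarrow> y \<in> carrier G \<Longrightarrow> inv x \<otimes> (x \<otimes> y) = y"
  and mult_inv_cancel_left: "x \<in> carrier G \<Longrightarrow> y \<in> carrier G \<Longrightarrow> x \<otimes> (inv x \<otimes> y) = y"
  by (simp_all flip: m_assoc)

lemma comm_mult: "x \<in> carrier G \<Longrightarrow> y \<in> carrier G \<Longrightarrow> comm G x y \<otimes> (y \<otimes> x) = x \<otimes> y"
  by (simp add: comm_def m_assoc inv_mult_cancel_left)

text \<open>The conjugate of \<open>z\<close> by \<open>y\<close> is written as
  \<open>comm G y z \<otimes> z\<close>. In this form the identity involves only commutators and
  products, to which the coordinate estimates in a subgroup apply.\<close>

lemma Hall_Witt:
  assumes "x \<in> carrier G" "y \<in> carrier G" "z \<in> carrier G"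
  shows "comm G (comm G x y) (comm G y z \<otimes> z) \<otimes> comm G (comm G y z) (comm G z x \<otimes> x) \<otimes>
    comm G (comm G z x) (comm G x y \<otimes> y) = \<one>"
  using assms by (simp add: comm_def inv_mult_group m_assoc inv_mult_cancel_left mult_inv_cancel_left)

end

definition bil_form :: "nat \<Rightarrow> (nat \<Rightarrow> nat \<Rightarrow> nat \<Rightarrow> 'k) \<Rightarrow> (nat \<Rightarrow> 'k) \<Rightarrow> (nat \<Rightarrow> 'k) \<Rightarrow> nat \<Rightarrow> 'k::Fields.field" where
  "bil_form n b x y = (\<lambda>i. if i < n then \<Sum>l<n. \<Sum>j<n. b i l j * (x l * y j) else 0)"

lemma bil_form_linear:
  "bil_form n b (x + x') y = bil_form n b x y + bil_form n b x' y"
  "bil_form n b x (y + y') = bil_form n b x y + bil_form n b x y'"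
  "bil_form n b (vscale a x) y = vscale a (bil_form n b x y)"
  "bil_form n b x (vscale a y) = vscale a (bil_form n b x y)"
  by (auto simp: bil_form_def vec_apply fun_eq_iff algebra_simps sum.distrib sum_distrib_left)

lemma bil_form_zero [simp]: "bil_form n b 0 y = 0" "bil_form n b x 0 = 0"
  by (auto simp: bil_form_def vec_apply fun_eq_iff)

lemma coord_space_bil_form [simp]: "bil_form n b x y \<in> coord_space n"
  by (auto simp: bil_form_def coord_space_def)

lemma (in ultrametric) bil_form_le:
  assumes "\<And>i l j. v (b i l j) \<le> K" "0 \<le> K" shows "nrm n (bil_form n b x y) \<le> K * (nrm n x * nrm n y)"
proof -
  have "v (b i l j * (x l * y j)) \<le> K * (nrm n x * nrm n y)" if "l < n" "j < n" for i l j
  proof -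
    have "v (x l) * v (y j) \<le> nrm n x * nrm n y" using that by (intro mult_mono le_nrm) auto
    hence "v (b i l j) * (v (x l) * v (y j)) \<le> K * (nrm n x * nrm n y)" by (rule mult_mono[OF assms(1)]) (auto simp: assms(2))
    thus ?thesis by (simp add: mult)
  qed
  thus ?thesis using assms(2) by (auto simp: nrm_le_iff bil_form_def intro!: sum_le)
qed

text \<open>The coordinates are scaled so that the structure constants and the error terms have
  constant 1.\<close>

locale local_lie = lf v + Group.group G
  for v :: "'k::local_field \<Rightarrow> real" and G :: "('g, 'm) monoid_scheme" (structure) +
  fixes n :: nat and H :: "'g set" and \<kappa> :: "'g \<Rightarrow> nat \<Rightarrow> 'k" and b :: "nat \<Rightarrow> nat \<Rightarrow> nat \<Rightarrow> 'k"
  assumes subgroup_H: "subgroup H G"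
    and bij: "bij_betw \<kappa> H {h \<in> coord_space n. nrm n h < 1}"
    and \<kappa>_one: "\<kappa> \<one> = 0"
    and b_le: "\<And>i l j. v (b i l j) \<le> 1"
    and \<kappa>_mult: "\<And>g h. g \<in> H \<Longrightarrow> h \<in> H \<Longrightarrow>
       nrm n (\<kappa> (g \<otimes> h) - \<kappa> g - \<kappa> h - bil_form n b (\<kappa> g) (\<kappa> h))
         \<le> nrm n (\<kappa> g) * nrm n (\<kappa> h) * max (nrm n (\<kappa> g)) (nrm n (\<kappa> h))"
begin

abbreviation bil :: "(nat \<Rightarrow> 'k) \<Rightarrow> (nat \<Rightarrow> 'k) \<Rightarrow> nat \<Rightarrow> 'k" where "bil \<equiv> bil_form n b"

text \<open>The antisymmetrisation of the bilinear term of the multiplication, which is the leading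
  term of the commutator.\<close>

definition br :: "(nat \<Rightarrow> 'k) \<Rightarrow> (nat \<Rightarrow> 'k) \<Rightarrow> nat \<Rightarrow> 'k" where
  "br x y = bil x y - bil y x"

abbreviation N :: "'g \<Rightarrow> real" where "N g \<equiv> nrm n (\<kappa> g)"

lemma br_linear:
  "br (x + x') y = br x y + br x' y" "br x (y + y') = br x y + br x y'"
  "br (vscale a x) y = vscale a (br x y)" "br x (vscale a y) = vscale a (br x y)"
  by (simp_all add: br_def bil_form_linear vscale.scale_right_diff_distrib)

lemma br_self: "br x x = 0" and br_anti: "br x y = - br y x"
  by (simp_all add: br_def)

lemma br_minus: "br (- x) y = - br x y" "br x (- y) = - br x y"
  using br_linear(3)[of "- 1" x y] br_linear(4)[of x "- 1" y] by simp_all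

lemma br_diff: "br (x - x') y = br x y - br x' y" "br x (y - y') = br x y - br x y'"
  using br_linear(1)[of x "- x'" y] br_linear(2)[of x y "- y'"] by (simp_all add: br_minus)

lemma br_coord: "br x y \<in> coord_space n"
  unfolding br_def by (intro coord_space_diff coord_space_bil_form)

lemma bil_le: "nrm n (bil x y) \<le> nrm n x * nrm n y"
  using bil_form_le[of b 1 n x y] b_le by simp

lemma br_le: "nrm n (br x y) \<le> nrm n x * nrm n y"
  unfolding br_def using nrm_diff_le[OF bil_le[of x y]] bil_le[of y x] by (simp add: mult.commute)

lemma br_le': "nrm n x \<le> r \<Longrightarrow> nrm n y \<le> s \<Longrightarrow> nrm n (br x y) \<le> r * s"
  using br_le[of x y] mult_mono[of "nrm n x" r "nrm n y" s] nrm_nonneg[of n x] nrm_nonneg[of n y]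
  by linarith

lemma H_carrier: "g \<in> H \<Longrightarrow> g \<in> carrier G"
  using subgroup_H by (rule subgroup.mem_carrier)

lemma H_closed: "\<one> \<in> H" "g \<in> H \<Longrightarrow> h \<in> H \<Longrightarrow> g \<otimes> h \<in> H" "g \<in> H \<Longrightarrow> inv g \<in> H"
  using subgroup_H by (auto simp: subgroup.one_closed subgroup.m_closed subgroup.m_inv_closed)

lemma comm_H: "g \<in> H \<Longrightarrow> h \<in> H \<Longrightarrow> comm G g h \<in> H"
  by (simp add: comm_def H_closed)

lemma N_less: "g \<in> H \<Longrightarrow> N g < 1" and \<kappa>_coord: "g \<in> H \<Longrightarrow> \<kappa> g \<in> coord_space n"
  using bij by (auto simp: bij_betw_def)

lemma ex_\<kappa>: "x \<in> coord_space n \<Longrightarrow> nrm n x < 1 \<Longrightarrow> \<exists>g\<in>H. \<kappa> g = x"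
  using bij unfolding bij_betw_def by (metis (mono_tags, lifting) imageE mem_Collect_eq)

lemma mult_le_t: "0 \<le> a \<Longrightarrow> a \<le> 1 \<Longrightarrow> 0 \<le> (c::real) \<Longrightarrow> a * c \<le> c"
  using mult_right_mono[of a 1 c] by simp

lemma \<kappa>_mult2:
  assumes "g \<in> H" "h \<in> H" shows "nrm n (\<kappa> (g \<otimes> h) - \<kappa> g - \<kappa> h - bil (\<kappa> g) (\<kappa> h)) \<le> N g * N h * max (N g) (N h)"
  by (rule \<kappa>_mult[OF assms])

lemma \<kappa>_mult1:
  assumes "g \<in> H" "h \<in> H" shows "nrm n (\<kappa> (g \<otimes> h) - (\<kappa> g + \<kappa> h)) \<le> N g * N h"
proof -
  have "N g * N h * max (N g) (N h) \<le> N g * N h * 1"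
    using N_less[OF assms(1)] N_less[OF assms(2)] by (intro mult_left_mono) auto
  hence "nrm n (\<kappa> (g \<otimes> h) - \<kappa> g - \<kappa> h - bil (\<kappa> g) (\<kappa> h)) \<le> N g * N h"
    using \<kappa>_mult2[OF assms] by linarith
  from nrm_add_le[OF this bil_le] show ?thesis by (simp add: algebra_simps)
qed

lemma N_mult_le:
  assumes "g \<in> H" "h \<in> H" "N g \<le> t" "N h \<le> t" shows "N (g \<otimes> h) \<le> t"
proof -
  have "N g * N h \<le> t"
    using mult_le_t[of "N g" "N h"] N_less[OF assms(1)] assms(4) by simp
  hence "nrm n (\<kappa> (g \<otimes> h) - (\<kappa> g + \<kappa> h)) \<le> t" using \<kappa>_mult1[OF assms(1,2)] by linarith
  from nrm_add_le[OF this nrm_add_le[OF assms(3,4)]] show ?thesis by simp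
qed

text \<open>From \<open>comm G g h \<otimes> (h \<otimes> g) = g \<otimes> h\<close> the coordinate
  of the commutator is \<open>D - E\<close>, with \<open>D\<close> the difference of the two
  products and \<open>E\<close> the defect of additivity. As \<open>E\<close> is smaller than the
  commutator itself by the factor \<open>N m < 1\<close>, it cannot dominate, so the bound for
  \<open>D\<close> prevails; this bound in turn makes \<open>E\<close> of third order.\<close>

lemma commutator_estimate:
  assumes g: "g \<in> H" and h: "h \<in> H" and t: "N g \<le> t" "N h \<le> t"
  shows "N (comm G g h) \<le> N g * N h"
    and "nrm n (\<kappa> (comm G g h) - br (\<kappa> g) (\<kappa> h)) \<le> N g * N h * t"
proof -
  define c m where "c = comm G g h" and "m = h \<otimes> g"
  have cH: "c \<in> H" and mH: "m \<in> H" using g h by (auto simp: c_def m_def comm_H H_closed)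
  have t0: "0 \<le> t" using t(1) nrm_nonneg[of n "\<kappa> g"] by linarith
  have cm: "c \<otimes> m = g \<otimes> h" unfolding c_def m_def using g h by (simp add: comm_mult H_carrier)
  define D where "D = \<kappa> (g \<otimes> h) - \<kappa> m"
  define E where "E = \<kappa> (c \<otimes> m) - (\<kappa> c + \<kappa> m)"
  have c: "\<kappa> c = D - E" unfolding D_def E_def cm by simp
  have E: "nrm n E \<le> N c * N m" unfolding E_def by (rule \<kappa>_mult1[OF cH mH])
  have m: "N m \<le> t" "N m < 1" unfolding m_def using N_mult_le[OF h g t(2,1)] N_less[OF mH] by (auto simp: m_def)
  have gh: "N g * N h * max (N g) (N h) \<le> N g * N h * t" using t by (intro mult_left_mono) auto
  have Dbr: "nrm n (D - br (\<kappa> g) (\<kappa> h)) \<le> N g * N h * t"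
  proof -
    have "nrm n (\<kappa> (g \<otimes> h) - \<kappa> g - \<kappa> h - bil (\<kappa> g) (\<kappa> h)) \<le> N g * N h * t"
      using \<kappa>_mult2[OF g h] gh by linarith
    moreover have "nrm n (\<kappa> m - \<kappa> h - \<kappa> g - bil (\<kappa> h) (\<kappa> g)) \<le> N g * N h * t"
      using \<kappa>_mult2[OF h g] gh by (simp add: m_def mult.commute max.commute)
    ultimately have "nrm n ((\<kappa> (g \<otimes> h) - \<kappa> g - \<kappa> h - bil (\<kappa> g) (\<kappa> h)) -
        (\<kappa> m - \<kappa> h - \<kappa> g - bil (\<kappa> h) (\<kappa> g))) \<le> N g * N h * t" by (rule nrm_diff_le)
    thus ?thesis by (simp add: D_def br_def algebra_simps)
  qed
  have D: "nrm n D \<le> N g * N h"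
  proof -
    define s where "s = max (N g) (N h)"
    have s: "N g \<le> s" "N h \<le> s" "s \<le> 1" using N_less[OF g] N_less[OF h] by (auto simp: s_def)
    have "nrm n (\<kappa> (g \<otimes> h) - (\<kappa> g + \<kappa> h)) \<le> N g * N h" by (rule \<kappa>_mult1[OF g h])
    moreover have "nrm n (\<kappa> m - (\<kappa> h + \<kappa> g)) \<le> N g * N h"
      using \<kappa>_mult1[OF h g] by (simp add: m_def mult.commute)
    ultimately have "nrm n ((\<kappa> (g \<otimes> h) - (\<kappa> g + \<kappa> h)) - (\<kappa> m - (\<kappa> h + \<kappa> g))) \<le> N g * N h"
      by (rule nrm_diff_le)
    thus ?thesis by (simp add: D_def algebra_simps)
  qed
  have "N c \<le> N g * N h"
  proof (rule ccontr)
    assume neg: "\<not> ?thesis"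
    hence pos: "0 < N c" using mult_nonneg_nonneg[of "N g" "N h"] by (simp add: not_le) (meson le_less_trans nrm_nonneg mult_nonneg_nonneg)
    have "N c * N m < N c * 1" using pos m(2) by (intro mult_strict_left_mono) auto
    hence "nrm n E < N c" using E by linarith
    moreover have "N c \<le> max (nrm n D) (nrm n E)" unfolding c by (rule nrm_diff)
    ultimately show False using D neg by linarith
  qed
  thus "N (comm G g h) \<le> N g * N h" by (simp add: c_def)
  have "N c * N m \<le> N g * N h * t" using \<open>N c \<le> N g * N h\<close> m(1) t0 by (intro mult_mono) auto
  hence "nrm n E \<le> N g * N h * t" using E by linarith
  from nrm_diff_le[OF Dbr this] show "nrm n (\<kappa> (comm G g h) - br (\<kappa> g) (\<kappa> h)) \<le> N g * N h * t"
    by (simp add: c c_def[symmetric] algebra_simps)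
qed

text \<open>The element \<open>comm G y z \<otimes> z\<close> differs from \<open>z\<close> only in
  second order, so the leading term is the double bracket and all errors are of order 4.\<close>

lemma double_commutator_estimate:
  assumes x: "x \<in> H" "N x \<le> t" and y: "y \<in> H" "N y \<le> t" and z: "z \<in> H" "N z \<le> t" and t: "0 \<le> t" "t \<le> 1"
  defines "q \<equiv> comm G (comm G x y) (comm G y z \<otimes> z)"
  shows "q \<in> H" "N q \<le> t ^ 3" "nrm n (\<kappa> q - br (br (\<kappa> x) (\<kappa> y)) (\<kappa> z)) \<le> t ^ 4"
proof -
  define a where "a = comm G x y"
  define d where "d = comm G y z"
  define z' where "z' = d \<otimes> z"
  have H: "a \<in> H" "d \<in> H" "z' \<in> H" using x y z by (simp_all add: a_def d_def z'_def comm_H H_closed)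
  have tt: "t * t \<le> t" using t mult_le_t by simp
  have a: "N a \<le> t * t"
    using commutator_estimate(1)[OF x(1) y(1) x(2) y(2)] mult_mono[OF x(2) y(2)] t by (simp add: a_def)
  have a': "nrm n (\<kappa> a - br (\<kappa> x) (\<kappa> y)) \<le> t ^ 3"
    using commutator_estimate(2)[OF x(1) y(1) x(2) y(2)] mult_right_mono[OF mult_mono[OF x(2) y(2)], of t] t
    by (simp add: a_def power3_eq_cube)
  have d: "N d \<le> t * t"
    using commutator_estimate(1)[OF y(1) z(1) y(2) z(2)] mult_mono[OF y(2) z(2)] t by (simp add: d_def)
  have z't: "N z' \<le> t" unfolding z'_def using N_mult_le[OF H(2) z(1), of t] d tt z(2) by linarith
  have z'z: "nrm n (\<kappa> z' - \<kappa> z) \<le> t * t"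
  proof -
    have "N d * N z \<le> N d * 1" using N_less[OF z(1)] by (intro mult_left_mono) auto
    hence "nrm n (\<kappa> z' - (\<kappa> d + \<kappa> z)) \<le> t * t"
      using \<kappa>_mult1[OF H(2) z(1)] d by (simp add: z'_def)
    from nrm_add_le[OF this d] show ?thesis by (simp add: algebra_simps)
  qed
  show qH: "q \<in> H" unfolding q_def using H by (simp add: comm_H a_def d_def z'_def)
  have q: "q = comm G a z'" by (simp add: q_def a_def d_def z'_def)
  have at: "N a \<le> t" using a tt by linarith
  have az: "N a * N z' \<le> t ^ 3" using mult_mono[OF a z't] t by (simp add: power3_eq_cube)
  show "N q \<le> t ^ 3" unfolding q using commutator_estimate(1)[OF H(1,3) at z't] az by linarith
  have "nrm n (\<kappa> q - br (\<kappa> a) (\<kappa> z')) \<le> t ^ 4"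
    unfolding q using commutator_estimate(2)[OF H(1,3) at z't] mult_right_mono[OF az, of t] t
    by (simp add: power_Suc2[symmetric] del: power_Suc) 
  moreover have "nrm n (br (\<kappa> a - br (\<kappa> x) (\<kappa> y)) (\<kappa> z')) \<le> t ^ 4"
    using br_le'[OF a' z't] by (simp add: power_Suc2[symmetric] del: power_Suc)
  moreover have "nrm n (br (br (\<kappa> x) (\<kappa> y)) (\<kappa> z' - \<kappa> z)) \<le> t ^ 4"
    using br_le'[OF br_le'[OF x(2) y(2)] z'z] by (simp add: power4_eq_xxxx mult.assoc)
  ultimately have "nrm n ((\<kappa> q - br (\<kappa> a) (\<kappa> z')) + (br (\<kappa> a - br (\<kappa> x) (\<kappa> y)) (\<kappa> z') +
      br (br (\<kappa> x) (\<kappa> y)) (\<kappa> z' - \<kappa> z))) \<le> t ^ 4" by (intro nrm_add_le)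
  thus "nrm n (\<kappa> q - br (br (\<kappa> x) (\<kappa> y)) (\<kappa> z)) \<le> t ^ 4" by (simp add: br_diff)
qed

text \<open>The three factors of the Hall-Witt identity are of third order, so their product has as
  coordinates the sum of theirs up to order 4. With arguments scaled by \<open>s\<close> the cyclic
  sum is thus of order 4 in \<open>v s\<close>, while it scales exactly with \<open>s ^ 3\<close>;
  hence it is 0.\<close>

theorem jacobi_cyclic:
  assumes x: "x \<in> coord_space n" and y: "y \<in> coord_space n" and z: "z \<in> coord_space n"
  shows "br (br x y) z + br (br y z) x + br (br z x) y = 0"
proof -
  define J where "J = br (br x y) z + br (br y z) x + br (br z x) y"
  define m where "m = max (nrm n x) (max (nrm n y) (nrm n z)) + 1"
  have m: "nrm n x \<le> m" "nrm n y \<le> m" "nrm n z \<le> m" by (auto simp: m_def)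
  have "0 \<le> max (nrm n x) (max (nrm n y) (nrm n z))" by (simp add: le_max_iff_disj)
  hence m0: "0 < m" unfolding m_def by linarith
  note m = m m0
  have scaled: "v s ^ 3 * nrm n J \<le> (v s * m) ^ 4" if s: "v s * m < 1" for s
  proof -
    define t where "t = v s * m"
    have t: "0 \<le> t" "t \<le> 1" using s m(4) by (auto simp: t_def)
    have "\<exists>g\<in>H. \<kappa> g = vscale s u" if "u \<in> coord_space n" "nrm n u \<le> m" for u
    proof (rule ex_\<kappa>)
      have "v s * nrm n u \<le> v s * m" using that by (intro mult_left_mono) auto
      thus "nrm n (vscale s u) < 1" using s by simp
    qed (use that in \<open>simp add: coord_space_vscale\<close>)
    then obtain gx gy gz where g: "gx \<in> H" "\<kappa> gx = vscale s x" "gy \<in> H" "\<kappa> gy = vscale s y" "gz \<in> H" "\<kappa> gz = vscale s z"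
      using x y z m by metis
    have gt: "N gx \<le> t" "N gy \<le> t" "N gz \<le> t" using m g by (auto simp: t_def intro!: mult_left_mono)
    define q1 q2 q3 where "q1 = comm G (comm G gx gy) (comm G gy gz \<otimes> gz)"
      and "q2 = comm G (comm G gy gz) (comm G gz gx \<otimes> gx)" and "q3 = comm G (comm G gz gx) (comm G gx gy \<otimes> gy)"
    note e1 = double_commutator_estimate[OF g(1) gt(1) g(3) gt(2) g(5) gt(3) t, folded q1_def]
    note e2 = double_commutator_estimate[OF g(3) gt(2) g(5) gt(3) g(1) gt(1) t, folded q2_def]
    note e3 = double_commutator_estimate[OF g(5) gt(3) g(1) gt(1) g(3) gt(2) t, folded q3_def]
    have one: "q1 \<otimes> q2 \<otimes> q3 = \<one>"
      unfolding q1_def q2_def q3_def using g H_carrier by (intro Hall_Witt) auto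
    have t34: "t ^ 3 * t ^ 3 \<le> t ^ 4" unfolding power_add[symmetric] using t by (intro power_decreasing) auto
    have p: "nrm n (\<kappa> (q \<otimes> q') - (\<kappa> q + \<kappa> q')) \<le> t ^ 4" if "q \<in> H" "q' \<in> H" "N q \<le> t ^ 3" "N q' \<le> t ^ 3" for q q'
      using \<kappa>_mult1[OF that(1,2)] mult_mono[OF that(3,4)] t t34 by simp
    have 12: "N (q1 \<otimes> q2) \<le> t ^ 3" using e1 e2 by (intro N_mult_le) auto
    have "nrm n (\<kappa> (q1 \<otimes> q2) - (\<kappa> q1 + \<kappa> q2)) \<le> t ^ 4" using e1 e2 by (intro p) auto
    moreover have "nrm n (\<kappa> (q1 \<otimes> q2 \<otimes> q3) - (\<kappa> (q1 \<otimes> q2) + \<kappa> q3)) \<le> t ^ 4"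
      using e1 e2 e3 12 by (intro p) (auto simp: H_closed)
    ultimately have "nrm n ((\<kappa> (q1 \<otimes> q2) - (\<kappa> q1 + \<kappa> q2)) + (\<kappa> (q1 \<otimes> q2 \<otimes> q3) - (\<kappa> (q1 \<otimes> q2) + \<kappa> q3))) \<le> t ^ 4"
      by (rule nrm_add_le)
    moreover have "(\<kappa> (q1 \<otimes> q2) - (\<kappa> q1 + \<kappa> q2)) + (\<kappa> (q1 \<otimes> q2 \<otimes> q3) - (\<kappa> (q1 \<otimes> q2) + \<kappa> q3)) =
        - (\<kappa> q1 + (\<kappa> q2 + \<kappa> q3))"
      by (simp add: one \<kappa>_one fun_eq_iff vec_apply)
    ultimately have "nrm n (- (\<kappa> q1 + (\<kappa> q2 + \<kappa> q3))) \<le> t ^ 4" by simp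
    hence 1: "nrm n (\<kappa> q1 + (\<kappa> q2 + \<kappa> q3)) \<le> t ^ 4" by (simp only: nrm_minus)
    have trip: "br (br (vscale s a) (vscale s b')) (vscale s c) = vscale (s ^ 3) (br (br a b') c)" for a b' c
      by (simp add: br_linear power3_eq_cube mult.assoc)
    have "nrm n ((\<kappa> q1 - br (br (\<kappa> gx) (\<kappa> gy)) (\<kappa> gz)) + ((\<kappa> q2 - br (br (\<kappa> gy) (\<kappa> gz)) (\<kappa> gx)) +
        (\<kappa> q3 - br (br (\<kappa> gz) (\<kappa> gx)) (\<kappa> gy)))) \<le> t ^ 4" using e1 e2 e3 by (intro nrm_add_le)
    from nrm_diff_le[OF 1 this] have "nrm n (vscale (s ^ 3) J) \<le> t ^ 4"
      unfolding g trip by (simp add: J_def vscale.scale_right_distrib algebra_simps)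
    thus ?thesis by (simp add: power t_def)
  qed
  have "nrm n J \<le> 0"
  proof (rule ccontr)
    assume "\<not> ?thesis"
    hence J: "0 < nrm n J" by simp
    have "0 < min (1 / m) (nrm n J / m ^ 4)" using J m(4) by simp
    from ex_small[OF this] obtain s where s: "s \<noteq> 0" "v s < 1 / m" "v s < nrm n J / m ^ 4" by auto
    have s1: "v s * m < 1" "v s * m ^ 4 < nrm n J" using s(2,3) m(4) by (simp_all add: pos_less_divide_eq)
    have "v s ^ 3 * nrm n J \<le> v s ^ 3 * (v s * m ^ 4)"
      using scaled[OF s1(1)] by (simp add: power_mult_distrib power4_eq_xxxx power3_eq_cube mult_ac)
    hence "nrm n J \<le> v s * m ^ 4" using s(1) by (simp add: mult_le_cancel_left_pos)
    thus False using s1(2) by linarith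
  qed
  hence "nrm n J = 0" using nrm_nonneg[of n J] by linarith
  thus ?thesis unfolding J_def[symmetric] by (subst (asm) nrm_eq_0) (simp_all add: J_def br_coord coord_space_add)
qed

lemma jacobi_derivation:
  assumes "x \<in> coord_space n" "y \<in> coord_space n" "z \<in> coord_space n"
  shows "br x (br y z) = br (br x y) z + br y (br x z)"
proof -
  have "br (br x y) z + br (br y z) x + br (br z x) y = 0" using assms by (rule jacobi_cyclic)
  moreover have "br (br y z) x = - br x (br y z)" by (rule br_anti)
  moreover have "br (br z x) y = br y (br x z)" using br_anti[of z x] br_anti[of "br x z" y] by (simp add: br_minus)
  ultimately show ?thesis by (simp add: algebra_simps add_eq_0_iff)
qed

text \<open>An endomorphism preserves commutators, hence its linear part preserves the bracket.\<close>

theorem br_equivariant: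
  assumes hom: "\<And>g h. g \<in> carrier G \<Longrightarrow> h \<in> carrier G \<Longrightarrow> \<alpha> (g \<otimes> h) = \<alpha> g \<otimes> \<alpha> h"
    and closed: "\<And>g. g \<in> carrier G \<Longrightarrow> \<alpha> g \<in> carrier G"
    and approx: "\<And>e. 0 < e \<Longrightarrow> \<exists>d>0. \<forall>g\<in>H. N g < d \<longrightarrow> \<alpha> g \<in> H \<and> nrm n (\<kappa> (\<alpha> g) - mat_app n M (\<kappa> g)) \<le> e * N g"
    and x: "x \<in> coord_space n" and y: "y \<in> coord_space n"
  shows "mat_app n M (br x y) = br (mat_app n M x) (mat_app n M y)"
proof -
  interpret \<alpha>: group_hom G G \<alpha> by unfold_locales (auto simp: hom_def hom closed)
  obtain Cf where Cf: "0 \<le> Cf" "\<And>x. nrm n (mat_app n M x) \<le> Cf * nrm n x" using mat_app_bounded by blast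
  define E where "E = mat_app n M (br x y) - br (mat_app n M x) (mat_app n M y)"
  define m where "m = max (nrm n x) (nrm n y) + 1"
  have m: "nrm n x \<le> m" "nrm n y \<le> m" "1 \<le> m" by (auto simp: m_def le_max_iff_disj)
  define K where "K = (Cf + 1) * (Cf + 1) * (Cf + 1) * m * m * m"
  have K: "0 < K" using Cf(1) m(3) by (simp add: K_def)
  have key: "nrm n E \<le> e * K" if e: "0 < e" "e \<le> 1" for e
  proof -
    obtain d where d: "d > 0" "\<And>g. g \<in> H \<Longrightarrow> N g < d \<Longrightarrow> \<alpha> g \<in> H \<and> nrm n (\<kappa> (\<alpha> g) - mat_app n M (\<kappa> g)) \<le> e * N g"
      using approx[OF e(1)] by blast
    \<comment> \<open>The scale \<open>t = v s * m\<close> is made smaller than 1, than the radius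
      \<open>d\<close> and than \<open>e\<close>; the last makes the third-order errors of the
      commutators at most \<open>e * (t * t)\<close>.\<close>
    have "0 < min (min (1 / m) (d / m)) (e / m)" using d(1) m(3) e by simp
    from ex_small[OF this] obtain s where s: "s \<noteq> 0" "v s < 1 / m" "v s < d / m" "v s < e / m" by auto
    define t where "t = v s * m"
    have t: "0 < t" "t < 1" "t < d" "t < e" using s m(3) by (auto simp: t_def pos_less_divide_eq)
    have small: "nrm n (vscale s u) \<le> t" if "nrm n u \<le> m" for u
      using that by (auto simp: t_def intro!: mult_left_mono)
    obtain g h where g: "g \<in> H" "\<kappa> g = vscale s x" and h: "h \<in> H" "\<kappa> h = vscale s y"
      using ex_\<kappa>[of "vscale s x"] ex_\<kappa>[of "vscale s y"] small m t(2) x y coord_space_vscale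
      by (metis le_less_trans)
    have Ng: "N g \<le> t" "N h \<le> t" using small m g h by auto
    define c where "c = comm G g h"
    have cH: "c \<in> H" using g h by (simp add: c_def comm_H)
    have tt: "t * t \<le> t" using t mult_le_t by simp
    have Nc: "N c \<le> t * t" "nrm n (\<kappa> c - br (\<kappa> g) (\<kappa> h)) \<le> t * t * t"
      using order_trans[OF commutator_estimate(1)[OF g(1) h(1) Ng] mult_mono[OF Ng]]
        order_trans[OF commutator_estimate(2)[OF g(1) h(1) Ng] mult_right_mono[OF mult_mono[OF Ng], of t]] t
      by (auto simp: c_def)
    define c1 where "c1 = Cf + 1"
    have c1: "1 \<le> c1" "Cf \<le> c1" using Cf(1) by (auto simp: c1_def)
    have ac: "\<alpha> c = comm G (\<alpha> g) (\<alpha> h)"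
      unfolding c_def comm_def using g h by (simp add: hom H_carrier)
    have \<alpha>g: "\<alpha> g \<in> H" "nrm n (\<kappa> (\<alpha> g) - mat_app n M (\<kappa> g)) \<le> e * t"
      using d(2)[OF g(1)] Ng t order_trans[OF _ mult_left_mono[OF Ng(1), of e]] e by auto
    have \<alpha>h: "\<alpha> h \<in> H" "nrm n (\<kappa> (\<alpha> h) - mat_app n M (\<kappa> h)) \<le> e * t"
      using d(2)[OF h(1)] Ng t order_trans[OF _ mult_left_mono[OF Ng(2), of e]] e by auto
    have "N c < d" using Nc(1) tt t by linarith
    hence \<alpha>c: "nrm n (\<kappa> (\<alpha> c) - mat_app n M (\<kappa> c)) \<le> e * (t * t)"
      using d(2)[OF cH] order_trans[OF _ mult_left_mono[OF Nc(1), of e]] e by auto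
    have Mg: "nrm n (mat_app n M (\<kappa> g)) \<le> c1 * t" "nrm n (mat_app n M (\<kappa> h)) \<le> c1 * t"
      using Cf(2)[of "\<kappa> g"] Cf(2)[of "\<kappa> h"] mult_mono[OF c1(2) Ng(1)] mult_mono[OF c1(2) Ng(2)] c1 by auto
    have et: "e * t \<le> c1 * t" using e c1 t by (intro mult_right_mono) auto
    have N\<alpha>: "N (\<alpha> g) \<le> c1 * t" "N (\<alpha> h) \<le> c1 * t"
      using nrm_add_le[OF order_trans[OF \<alpha>g(2) et] Mg(1)] nrm_add_le[OF order_trans[OF \<alpha>h(2) et] Mg(2)] by simp_all
    \<comment> \<open>A common bound for the five error terms that follow. After division by
      \<open>v s * v s\<close> it becomes a multiple of \<open>e\<close>.\<close>
    define Z where "Z = c1 * c1 * c1 * (e * (t * t))"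
    have c11: "1 \<le> c1 * c1" "1 \<le> c1 * c1 * c1" using c1 mult_mono[of 1 c1 1 c1] mult_mono[of 1 "c1 * c1" 1 c1] by auto
    have ett: "0 \<le> e * (t * t)" using e t by simp
    have ettZ: "e * (t * t) \<le> Z" using mult_right_mono[OF c11(2) ett] by (simp add: Z_def)
    have tte: "t * t * t \<le> e * (t * t)" using t by (simp add: mult_right_mono mult.commute)
    have c1Z: "c1 * (e * (t * t)) \<le> Z"
      using mult_right_mono[OF c11(1), of "c1 * (e * (t * t))"] c1 ett by (simp add: Z_def mult_ac)
    have 1: "nrm n (\<kappa> (\<alpha> c) - mat_app n M (\<kappa> c)) \<le> Z" using \<alpha>c ettZ by linarith
    have 2: "nrm n (mat_app n M (\<kappa> c - br (\<kappa> g) (\<kappa> h))) \<le> Z"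
    proof -
      have "Cf * nrm n (\<kappa> c - br (\<kappa> g) (\<kappa> h)) \<le> c1 * (e * (t * t))"
        using Nc(2) tte c1 by (intro mult_mono) auto
      thus ?thesis using Cf(2)[of "\<kappa> c - br (\<kappa> g) (\<kappa> h)"] c1Z by linarith
    qed
    have 3: "nrm n (\<kappa> (\<alpha> c) - br (\<kappa> (\<alpha> g)) (\<kappa> (\<alpha> h))) \<le> Z"
    proof -
      have "N (\<alpha> g) * N (\<alpha> h) * (c1 * t) \<le> c1 * t * (c1 * t) * (c1 * t)"
        using N\<alpha> c1 t by (intro mult_mono) auto
      also have "\<dots> = c1 * c1 * c1 * (t * t * t)" by (simp add: mult_ac)
      also have "\<dots> \<le> Z" unfolding Z_def using tte c1 by (intro mult_left_mono) auto
      finally show ?thesis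
        using commutator_estimate(2)[OF \<alpha>g(1) \<alpha>h(1) N\<alpha>] unfolding ac by linarith
    qed
    have 4: "nrm n (br (\<kappa> (\<alpha> g) - mat_app n M (\<kappa> g)) (\<kappa> (\<alpha> h))) \<le> Z"
      using br_le'[OF \<alpha>g(2) N\<alpha>(2)] c1Z by (simp add: mult_ac)
    have 5: "nrm n (br (mat_app n M (\<kappa> g)) (\<kappa> (\<alpha> h) - mat_app n M (\<kappa> h))) \<le> Z"
      using br_le'[OF Mg(1) \<alpha>h(2)] c1Z by (simp add: mult_ac)
    have "nrm n ((\<kappa> (\<alpha> c) - br (\<kappa> (\<alpha> g)) (\<kappa> (\<alpha> h))) + (br (\<kappa> (\<alpha> g) - mat_app n M (\<kappa> g)) (\<kappa> (\<alpha> h)) +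
        br (mat_app n M (\<kappa> g)) (\<kappa> (\<alpha> h) - mat_app n M (\<kappa> h)))) \<le> Z"
      using 3 4 5 by (intro nrm_add_le)
    hence A: "nrm n (\<kappa> (\<alpha> c) - br (mat_app n M (\<kappa> g)) (mat_app n M (\<kappa> h))) \<le> Z" by (simp add: br_diff)
    have "nrm n ((\<kappa> (\<alpha> c) - mat_app n M (\<kappa> c)) + mat_app n M (\<kappa> c - br (\<kappa> g) (\<kappa> h))) \<le> Z"
      using 1 2 by (rule nrm_add_le)
    hence "nrm n (\<kappa> (\<alpha> c) - mat_app n M (br (\<kappa> g) (\<kappa> h))) \<le> Z" by (simp add: mat_app.diff)
    from nrm_diff_le[OF A this] have "nrm n (mat_app n M (br (\<kappa> g) (\<kappa> h)) - br (mat_app n M (\<kappa> g)) (mat_app n M (\<kappa> h))) \<le> Z"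
      by simp
    also have "mat_app n M (br (\<kappa> g) (\<kappa> h)) - br (mat_app n M (\<kappa> g)) (mat_app n M (\<kappa> h)) = vscale (s * s) E"
      by (simp add: g h br_linear mat_app.scale E_def vscale.scale_right_diff_distrib)
    finally have "v s * v s * nrm n E \<le> v s * v s * (c1 * c1 * c1 * e * m * m)"
      by (simp add: mult Z_def t_def mult_ac)
    hence "nrm n E \<le> c1 * c1 * c1 * e * m * m" using s(1) by (simp add: mult_le_cancel_left_pos)
    also have "\<dots> \<le> c1 * c1 * c1 * e * m * m * m" using mult_left_mono[OF m(3), of "c1 * c1 * c1 * e * m * m"] c1 e m(3) by simp
    finally show ?thesis by (simp add: K_def c1_def mult_ac)
  qed
  have "nrm n E \<le> 0"
  proof (rule ccontr)
    assume "\<not> ?thesis"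
    hence E: "0 < nrm n E" by simp
    define e where "e = min 1 (nrm n E / (2 * K))"
    have e: "0 < e" "e \<le> 1" using E K by (auto simp: e_def)
    have "e * K \<le> nrm n E / (2 * K) * K" using K by (intro mult_right_mono) (auto simp: e_def)
    hence "e * K \<le> nrm n E / 2" using K by simp
    thus False using key[OF e] E by linarith
  qed
  hence "nrm n E = 0" using nrm_nonneg[of n E] by linarith
  moreover have "E \<in> coord_space n" by (simp add: E_def br_coord coord_space_diff)
  ultimately show ?thesis by (simp add: nrm_eq_0 E_def)
qed

end

section \<open>The chain rule\<close>

context lf
begin

lemma differential_coord:
  fixes f :: "(nat \<Rightarrow> 'k) \<Rightarrow> nat \<Rightarrow> 'k"
  assumes "analytic_between n m f U" "p \<in> U" "y \<in> coord_space n"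
  shows "differential f p y \<in> coord_space m"
  using differential_limit(2)[OF assms] by (auto simp: coord_space_def)

lemma differential_eq_mat_app:
  fixes f :: "(nat \<Rightarrow> 'k) \<Rightarrow> nat \<Rightarrow> 'k"
  assumes "analytic_between n n f U" "p \<in> U" "y \<in> coord_space n"
  shows "differential f p y = mat_app n (jac f p) y"
  using differential_limit(2,3)[OF assms] by (auto simp: mat_app_def)

lemma analytic_Lipschitz:
  fixes f :: "(nat \<Rightarrow> 'k) \<Rightarrow> nat \<Rightarrow> 'k"
  assumes "analytic_between n m f U" "p \<in> U"
  shows "\<exists>d L. 0 < d \<and> 0 \<le> L \<and> (\<forall>h\<in>coord_space n. \<forall>h'\<in>coord_space n. nrm n h \<le> d \<longrightarrow> nrm n h' \<le> d \<longrightarrow>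
     nrm m (f (p + h) - f (p + h')) \<le> L * nrm n (h - h'))"
proof -
  obtain d C where d: "0 < d" "0 \<le> C" and
    est: "\<And>t h h' i. 0 < t \<Longrightarrow> t \<le> d \<Longrightarrow> h \<in> coord_space n \<Longrightarrow> h' \<in> coord_space n \<Longrightarrow> nrm n h \<le> t \<Longrightarrow> nrm n h' \<le> t \<Longrightarrow> i < m \<Longrightarrow>
      v (f (p + h) i - f (p + h') i - (\<Sum>j<n. jac f p i j * (h j - h' j))) \<le> C * t * nrm n (h - h')"
    using differential_limit(4)[OF assms, of 0] by auto
  define q where "q = Max (insert 0 ((\<lambda>(i, j). v (jac f p i j)) ` ({..<m} \<times> {..<n})))"
  have q0: "0 \<le> q" unfolding q_def by (intro Max_ge) auto
  have q: "v (jac f p i j) \<le> q" if "i < m" "j < n" for i j unfolding q_def using that by (intro Max_ge) auto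
  define L where "L = C * d + q"
  have L: "0 \<le> L" "C * d \<le> L" "q \<le> L" using d q0 by (auto simp: L_def)
  have "nrm m (f (p + h) - f (p + h')) \<le> L * nrm n (h - h')"
    if h: "h \<in> coord_space n" "h' \<in> coord_space n" "nrm n h \<le> d" "nrm n h' \<le> d" for h h'
  proof -
    have "v (f (p + h) i - f (p + h') i) \<le> L * nrm n (h - h')" if i: "i < m" for i
    proof -
      have "v (\<Sum>j<n. jac f p i j * (h j - h' j)) \<le> q * nrm n (h - h')"
      proof (rule sum_le)
        fix j assume "j \<in> {..<n}"
        hence j: "j < n" by simp
        have "v (h j - h' j) \<le> nrm n (h - h')" using le_nrm[OF j, of "h - h'"] by (simp add: vec_apply)
        thus "v (jac f p i j * (h j - h' j)) \<le> q * nrm n (h - h')"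
          unfolding mult by (rule mult_mono[OF q[OF i j]]) (auto simp: q0)
      qed (simp add: q0)
      also have "\<dots> \<le> L * nrm n (h - h')" using L by (intro mult_right_mono) auto
      finally have 1: "v (\<Sum>j<n. jac f p i j * (h j - h' j)) \<le> L * nrm n (h - h')" .
      have 2: "v (f (p + h) i - f (p + h') i - (\<Sum>j<n. jac f p i j * (h j - h' j))) \<le> L * nrm n (h - h')"
        using est[OF d(1) order_refl h i] mult_right_mono[OF L(2), of "nrm n (h - h')"] by simp
      show ?thesis
        using ultra[of "f (p + h) i - f (p + h') i - (\<Sum>j<n. jac f p i j * (h j - h' j))" "\<Sum>j<n. jac f p i j * (h j - h' j)"] 1 2
        by simp
    qed
    thus ?thesis using L by (auto simp: nrm_le_iff vec_apply)
  qed
  thus ?thesis using d L by blast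
qed

lemma analytic_derivative:
  fixes f :: "(nat \<Rightarrow> 'k) \<Rightarrow> nat \<Rightarrow> 'k"
  assumes "analytic_between n m f U" "p \<in> U"
  shows "\<exists>d C. 0 < d \<and> 0 \<le> C \<and> (\<forall>h\<in>coord_space n. nrm n h \<le> d \<longrightarrow> p + h \<in> U \<and>
     nrm m (f (p + h) - f p - differential f p h) \<le> C * (nrm n h * nrm n h))"
proof -
  obtain d C where d: "0 < d" "0 \<le> C" and U: "\<And>h. h \<in> coord_space n \<Longrightarrow> nrm n h \<le> d \<Longrightarrow> p + h \<in> U" and
    est: "\<And>t h h' i. 0 < t \<Longrightarrow> t \<le> d \<Longrightarrow> h \<in> coord_space n \<Longrightarrow> h' \<in> coord_space n \<Longrightarrow> nrm n h \<le> t \<Longrightarrow> nrm n h' \<le> t \<Longrightarrow> i < m \<Longrightarrow>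
      v (f (p + h) i - f (p + h') i - (\<Sum>j<n. jac f p i j * (h j - h' j))) \<le> C * t * nrm n (h - h')"
    using differential_limit(4)[OF assms, of 0] by auto
  have "nrm m (f (p + h) - f p - differential f p h) \<le> C * (nrm n h * nrm n h)"
    if h: "h \<in> coord_space n" "nrm n h \<le> d" for h
  proof (cases "h = 0")
    case True
    have "differential f p 0 i = 0" for i
      using differential_limit(2,3)[OF assms, of 0 i] by (cases "i < m") (auto simp: vec_apply)
    thus ?thesis using True by (auto simp: nrm_le_iff vec_apply)
  next
    case False
    hence "0 < nrm n h" using nrm_eq_0[OF h(1)] nrm_nonneg[of n h] by linarith
    hence "v (f (p + h) i - f (p + 0) i - (\<Sum>j<n. jac f p i j * (h j - 0 j))) \<le> C * nrm n h * nrm n (h - 0)" if "i < m" for i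
      using h by (intro est that) auto
    thus ?thesis using d differential_limit(3)[OF assms h(1)] by (auto simp: nrm_le_iff vec_apply mult.assoc)
  qed
  thus ?thesis using d U by blast
qed

end

lemma (in lfw) analytic_strict_diff:
  fixes f :: "(nat \<Rightarrow> 'k) \<Rightarrow> nat \<Rightarrow> 'k"
  assumes f: "analytic_between n n f U" "p \<in> U" and fp: "f p = p"
  shows "strict_diff n (jac f p) (\<lambda>h. f (p + h) - p)"
proof -
  have p: "p \<in> coord_space n" using f by (auto simp: analytic_between_def dest: openin_imp_subset)
  obtain d C where d: "0 < d" "0 \<le> C" and U: "\<And>h. h \<in> coord_space n \<Longrightarrow> nrm n h \<le> d \<Longrightarrow> p + h \<in> U" and
    est: "\<And>t h h' i. 0 < t \<Longrightarrow> t \<le> d \<Longrightarrow> h \<in> coord_space n \<Longrightarrow> h' \<in> coord_space n \<Longrightarrow> nrm n h \<le> t \<Longrightarrow> nrm n h' \<le> t \<Longrightarrow> i < n \<Longrightarrow>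
      v (f (p + h) i - f (p + h') i - (\<Sum>j<n. jac f p i j * (h j - h' j))) \<le> C * t * nrm n (h - h')"
    using differential_limit(4)[OF f, of 0] by auto
  show ?thesis
    unfolding strict_diff_def
  proof (intro conjI allI impI)
    show "f (p + 0) - p = 0" by (simp add: fp)
    fix e :: real assume e: "0 < e"
    define t where "t = min d (e / (C + 1))"
    have C1: "0 < C + 1" using d(2) by linarith
    have t: "0 < t" "t \<le> d" using d e C1 by (auto simp: t_def)
    have "C * t \<le> (C + 1) * (e / (C + 1))" using d t by (intro mult_mono) (auto simp: t_def)
    hence Ct: "C * t \<le> e" using C1 by simp
    show "\<exists>d>0. \<forall>x\<in>coord_space n. \<forall>y\<in>coord_space n. nrm n x < d \<longrightarrow> nrm n y < d \<longrightarrow>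
       f (p + x) - p \<in> coord_space n \<and> nrm n (f (p + x) - p - (f (p + y) - p) - mat_app n (jac f p) (x - y)) \<le> e * nrm n (x - y)"
    proof (intro exI[of _ t] conjI ballI impI)
      fix x y assume x: "x \<in> coord_space n" "y \<in> coord_space n" "nrm n x < t" "nrm n y < t"
      have "f (p + x) \<in> coord_space n" using f(1) U[OF x(1)] x(3) t by (auto simp: analytic_between_def)
      thus "f (p + x) - p \<in> coord_space n" using p by (rule coord_space_diff)
      have "v (f (p + x) i - f (p + y) i - (\<Sum>j<n. jac f p i j * (x j - y j))) \<le> e * nrm n (x - y)" if "i < n" for i
        using est[OF t x(1,2) _ _ that] x(3,4) mult_right_mono[OF Ct, of "nrm n (x - y)"] by simp
      thus "nrm n (f (p + x) - p - (f (p + y) - p) - mat_app n (jac f p) (x - y)) \<le> e * nrm n (x - y)"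
        using e by (auto simp: nrm_le_iff vec_apply mat_app_def)
    qed (rule t(1))
  qed
qed

context lf
begin

text \<open>The function \<open>h\<close> agrees with the composition near \<open>p\<close>, because
  compositions of chart expressions agree only where the intermediate point lies in the chart. The
  image under \<open>f\<close> of the line in direction \<open>y\<close> deviates from the line in
  direction \<open>z\<close> to second order in \<open>v s\<close>, and the Lipschitz bound for
  \<open>g\<close> keeps this negligible after division by \<open>s\<close>.\<close>

lemma differential_chain:
  fixes f g h :: "(nat \<Rightarrow> 'k) \<Rightarrow> nat \<Rightarrow> 'k"
  assumes f: "analytic_between n m f U" "p \<in> U" and g: "analytic_between m l g V" "f p \<in> V"
    and h: "0 < e" "\<And>x. x \<in> coord_space n \<Longrightarrow> nrm n (x - p) < e \<Longrightarrow> h x = g (f x)" and y: "y \<in> coord_space n"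
  shows "differential h p y = differential g (f p) (differential f p y)"
proof
  fix i
  have p: "p \<in> coord_space n" using f by (auto simp: analytic_between_def dest: openin_imp_subset)
  define z where "z = differential f p y"
  have z: "z \<in> coord_space m" unfolding z_def by (rule differential_coord[OF f y])
  have fU: "f ` U \<subseteq> coord_space m" and gV: "g ` V \<subseteq> coord_space l" using f g by (auto simp: analytic_between_def)
  obtain d1 C where d1: "0 < d1" "0 \<le> C" "\<And>h. h \<in> coord_space n \<Longrightarrow> nrm n h \<le> d1 \<Longrightarrow> p + h \<in> U \<and>
     nrm m (f (p + h) - f p - differential f p h) \<le> C * (nrm n h * nrm n h)" using analytic_derivative[OF f] by blast
  obtain d2 L where d2: "0 < d2" "0 \<le> L" "\<And>k k'. k \<in> coord_space m \<Longrightarrow> k' \<in> coord_space m \<Longrightarrow> nrm m k \<le> d2 \<Longrightarrow> nrm m k' \<le> d2 \<Longrightarrow>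
     nrm l (g (f p + k) - g (f p + k')) \<le> L * nrm m (k - k')" using analytic_Lipschitz[OF g] by blast
  obtain d3 where d3: "0 < d3" "\<And>k. k \<in> coord_space m \<Longrightarrow> nrm m k \<le> d3 \<Longrightarrow> f p + k \<in> V"
    using analytic_derivative[OF g] by blast
  have lim: "((\<lambda>s. (g (\<lambda>j. f p j + s * z j) i - g (f p) i) / s) \<longlongrightarrow> differential g (f p) z i) (at 0)"
    by (rule differential_limit(1)[OF g z])
  \<comment> \<open>Collects the constants: once \<open>v s * K\<close> is below the radii, all
    points stay in the balls and the deviation is at most \<open>v s * (v s * K)\<close>. The 1
    gives \<open>v s < 1\<close>.\<close>
  define K where "K = nrm n y + nrm m z + C * (nrm n y * nrm n y) + L * C * (nrm n y * nrm n y) + 1"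
  have KK: "0 < K" "nrm n y \<le> K" "nrm m z \<le> K" "C * (nrm n y * nrm n y) \<le> K" "L * C * (nrm n y * nrm n y) \<le> K"
    using d1(2) d2(2) by (auto simp: K_def add_nonneg_pos add_nonneg_nonneg intro!: add_nonneg_pos)
  define r where "r = min (min (min 1 e) (min d1 d2)) d3 / K"
  have r: "0 < r" using h(1) d1 d2 d3 KK by (simp add: r_def)
  have key: "h (\<lambda>j. p j + s * y j) i - h p i = g (\<lambda>j. f p j + s * z j) i - g (f p) i + (h (\<lambda>j. p j + s * y j) i - g (\<lambda>j. f p j + s * z j) i)
    \<and> v (h (\<lambda>j. p j + s * y j) i - g (\<lambda>j. f p j + s * z j) i) \<le> v s * (v s * K)" if s: "s \<noteq> 0" "v s < r" for s
  proof
    have sK: "v s * K < 1" "v s * K < e" "v s * K < d1" "v s * K < d2" "v s * K < d3"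
      using s(2) KK(1) by (auto simp: r_def pos_less_divide_eq)
    have sb: "v s * q \<le> v s * K" if "q \<le> K" for q using that by (intro mult_left_mono) auto
    have v1: "v s < 1" if "1 \<le> K" using sK(1) mult_left_mono[OF that, of "v s"] by simp
    have "1 \<le> K" using d1(2) d2(2) by (auto simp: K_def)
    hence v1: "v s < 1" by (rule v1)
    have ps: "(\<lambda>j. p j + s * y j) = p + vscale s y" "(\<lambda>j. f p j + s * z j) = f p + vscale s z"
      by (auto simp: vec_apply)
    have sy: "vscale s y \<in> coord_space n" "nrm n (vscale s y) \<le> v s * K" using y sb KK(2) by (auto simp: coord_space_vscale)
    have sz: "vscale s z \<in> coord_space m" "nrm m (vscale s z) \<le> v s * K" using z sb KK(3) by (auto simp: coord_space_vscale)
    have hx: "h (p + vscale s y) = g (f (p + vscale s y))"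
      using sy sK(2) p by (intro h(2) coord_space_add) auto
    have hp: "h p = g (f p)" using h(1) p by (intro h(2)) auto
    show "h (\<lambda>j. p j + s * y j) i - h p i = g (\<lambda>j. f p j + s * z j) i - g (f p) i + (h (\<lambda>j. p j + s * y j) i - g (\<lambda>j. f p j + s * z j) i)"
      by (simp add: hp)
    have U: "p + vscale s y \<in> U" using d1(3)[OF sy(1)] sy(2) sK(3) by simp
    define k where "k = f (p + vscale s y) - f p"
    have k: "k \<in> coord_space m" unfolding k_def using fU U f(2) by (intro coord_space_diff) auto
    have dz: "differential f p (vscale s y) = vscale s z"
    proof
      fix j show "differential f p (vscale s y) j = vscale s z j"
        using differential_limit(2,3)[OF f sy(1), of j] differential_limit(2,3)[OF f y, of j]
        by (cases "j < m") (auto simp: z_def vec_apply sum_distrib_left mult_ac)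
    qed
    have "nrm m (k - vscale s z) \<le> C * (nrm n (vscale s y) * nrm n (vscale s y))"
      using d1(3)[OF sy(1)] sy(2) sK(3) by (simp add: k_def dz)
    hence kz: "nrm m (k - vscale s z) \<le> v s * (v s * (C * (nrm n y * nrm n y)))" by (simp add: mult_ac)
    have "v s * (v s * (C * (nrm n y * nrm n y))) \<le> 1 * (v s * K)"
      using v1 sb[OF KK(4)] KK(4) d1(2) by (intro mult_mono) auto
    hence "nrm m (k - vscale s z) \<le> v s * K" using kz by linarith
    from nrm_add_le[OF this sz(2)] have kK: "nrm m k \<le> v s * K" by simp
    have "nrm l (g (f p + k) - g (f p + vscale s z)) \<le> L * nrm m (k - vscale s z)"
      using k sz kK sK(4) by (intro d2(3)) auto
    also have "\<dots> \<le> L * (v s * (v s * (C * (nrm n y * nrm n y))))" using kz d2(2) by (rule mult_left_mono)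
    also have "\<dots> = v s * (v s * (L * C * (nrm n y * nrm n y)))" by (simp add: mult_ac)
    also have "\<dots> \<le> v s * (v s * K)" using KK(5) by (intro mult_left_mono) auto
    finally have le: "nrm l (g (f p + k) - g (f p + vscale s z)) \<le> v s * (v s * K)" .
    have fk: "f (p + vscale s y) = f p + k" by (simp add: k_def)
    show "v (h (\<lambda>j. p j + s * y j) i - g (\<lambda>j. f p j + s * z j) i) \<le> v s * (v s * K)"
    proof (cases "i < l")
      case True
      thus ?thesis using le_nrm[OF True, of "g (f p + k) - g (f p + vscale s z)"] le
        by (simp add: ps hx fk vec_apply)
    next
      case False
      have "f p + k \<in> V" "f p + vscale s z \<in> V" using d3(2) k sz kK sK(5) by auto
      hence "g (f p + k) i = 0" "g (f p + vscale s z) i = 0" using gV False by (auto simp: coord_space_def image_subset_iff)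
      thus ?thesis using KK(1) by (simp add: ps hx fk)
    qed
  qed
  have "((\<lambda>s. (h (\<lambda>j. p j + s * y j) i - h p i) / s) \<longlongrightarrow> differential g (f p) z i) (at 0)"
    unfolding tendsto_iff_v
  proof (intro allI impI)
    fix \<epsilon> :: real assume \<epsilon>: "0 < \<epsilon>"
    have "eventually (\<lambda>s. v ((g (\<lambda>j. f p j + s * z j) i - g (f p) i) / s - differential g (f p) z i) < \<epsilon>) (at 0)"
      using lim \<epsilon> by (simp add: tendsto_iff_v)
    moreover have "eventually (\<lambda>s. s \<noteq> 0 \<and> v s < min r (\<epsilon> / K)) (at 0)"
      unfolding eventually_at_0 using r \<epsilon> KK(1) by (intro exI[of _ "min r (\<epsilon> / K)"]) auto
    ultimately show "eventually (\<lambda>s. v ((h (\<lambda>j. p j + s * y j) i - h p i) / s - differential g (f p) z i) < \<epsilon>) (at 0)"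
    proof eventually_elim
      case (elim s)
      define a where "a = g (\<lambda>j. f p j + s * z j) i - g (f p) i"
      define c where "c = h (\<lambda>j. p j + s * y j) i - g (\<lambda>j. f p j + s * z j) i"
      have eq: "h (\<lambda>j. p j + s * y j) i - h p i = a + c" and c: "v c \<le> v s * (v s * K)"
        using key[of s] elim by (auto simp: a_def c_def)
      have "v (c / s) \<le> v s * K" using c elim by (simp add: divide pos_divide_le_eq mult_ac)
      also have "\<dots> < \<epsilon>" using elim KK(1) by (simp add: pos_less_divide_eq)
      finally have "v (c / s) < \<epsilon>" .
      moreover have "v (a / s - differential g (f p) z i) < \<epsilon>" using elim by (simp add: a_def)
      moreover have "(a + c) / s - differential g (f p) z i = (a / s - differential g (f p) z i) + c / s"
        by (simp add: add_divide_distrib)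
      hence "v ((a + c) / s - differential g (f p) z i) \<le> max (v (a / s - differential g (f p) z i)) (v (c / s))"
        using ultra by metis
      ultimately show ?case unfolding eq by linarith
    qed
  qed
  thus "differential h p y i = differential g (f p) (differential f p y) i"
    unfolding differential_def[of h] z_def by (intro tendsto_Lim) auto
qed

lemma differential_id:
  fixes h :: "(nat \<Rightarrow> 'k) \<Rightarrow> nat \<Rightarrow> 'k"
  assumes "p \<in> coord_space n" "y \<in> coord_space n" "0 < e"
    "\<And>x. x \<in> coord_space n \<Longrightarrow> nrm n (x - p) < e \<Longrightarrow> h x = x"
  shows "differential h p y = y"
proof
  fix i
  have n1: "0 < nrm n y + 1" by (simp add: add_nonneg_pos)
  have "((\<lambda>s. (h (\<lambda>j. p j + s * y j) i - h p i) / s) \<longlongrightarrow> y i) (at 0)"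
  proof (rule tendsto_eventually)
    show "eventually (\<lambda>s. (h (\<lambda>j. p j + s * y j) i - h p i) / s = y i) (at 0)"
      unfolding eventually_at_0
    proof (intro exI[of _ "e / (nrm n y + 1)"] conjI allI impI)
      show "0 < e / (nrm n y + 1)" using assms(3) n1 by simp
      fix s assume s: "s \<noteq> 0 \<and> v s < e / (nrm n y + 1)"
      hence "v s * (nrm n y + 1) < e" using n1 by (simp add: pos_less_divide_eq)
      moreover have "v s * nrm n y \<le> v s * (nrm n y + 1)" by (intro mult_left_mono) auto
      ultimately have "nrm n (vscale s y) < e" by simp
      hence "h (p + vscale s y) = p + vscale s y" using assms by (intro assms(4) coord_space_add coord_space_vscale) auto
      moreover have "(\<lambda>j. p j + s * y j) = p + vscale s y" by (auto simp: vec_apply)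
      moreover have "h p = p" using assms by (intro assms(4)) auto
      ultimately show "(h (\<lambda>j. p j + s * y j) i - h p i) / s = y i" using s by (simp add: vec_apply)
    qed
  qed
  thus "differential h p y i = y i" unfolding differential_def by (intro tendsto_Lim) auto
qed

lemma differential_zero_vector: "differential f p (0 :: nat \<Rightarrow> 'k) = 0"
proof
  fix i
  have "((\<lambda>s::'k. (f (\<lambda>j. p j + s * 0 j) i - f p i) / s) \<longlongrightarrow> 0) (at 0)" by (simp add: vec_apply)
  thus "differential f p 0 i = 0 i" unfolding differential_def by (subst tendsto_Lim) (auto simp: vec_apply)
qed

section \<open>Charts\<close>

lemma chart_props:
  assumes A: "analytic_manifold n T A" and c: "c \<in> A"
  shows "openin T (fst c)" "inj_on (snd c) (fst c)"
    "g \<in> fst c \<Longrightarrow> chart_inv c (snd c g) = g" "g \<in> fst c \<Longrightarrow> snd c g \<in> coord_space n"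
    "x \<in> snd c ` fst c \<Longrightarrow> snd c (chart_inv c x) = x" "x \<in> snd c ` fst c \<Longrightarrow> chart_inv c x \<in> fst c"
proof -
  have *: "openin T (fst c)" "openin (coord_top n) (snd c ` fst c)"
    "homeomorphic_map (subtopology T (fst c)) (top_of_set (snd c ` fst c)) (snd c)"
    using A c by (auto simp: analytic_manifold_def)
  show "openin T (fst c)" by (rule *(1))
  have ts: "topspace (subtopology T (fst c)) = fst c" using openin_subset[OF *(1)] by auto
  show inj: "inj_on (snd c) (fst c)" using *(3) ts by (metis homeomorphic_imp_injective_map)
  show "g \<in> fst c \<Longrightarrow> chart_inv c (snd c g) = g" using inj by (simp add: chart_inv_def)
  show "g \<in> fst c \<Longrightarrow> snd c g \<in> coord_space n" using openin_imp_subset[OF *(2)] by auto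
  show "x \<in> snd c ` fst c \<Longrightarrow> snd c (chart_inv c x) = x" "x \<in> snd c ` fst c \<Longrightarrow> chart_inv c x \<in> fst c"
    by (simp_all add: chart_inv_def f_inv_into_f inv_into_into)
qed

lemma chart_nbhd:
  assumes A: "analytic_manifold n T A" and c: "c \<in> A" and S: "openin T S" "g \<in> S" "g \<in> fst c"
  shows "\<exists>e>0. \<forall>x\<in>coord_space n. nrm n (x - snd c g) < e \<longrightarrow> x \<in> snd c ` fst c \<and> chart_inv c x \<in> S"
proof -
  have *: "openin T (fst c)" "openin (coord_top n) (snd c ` fst c)"
    "homeomorphic_map (subtopology T (fst c)) (top_of_set (snd c ` fst c)) (snd c)"
    using A c by (auto simp: analytic_manifold_def)
  have "openin (subtopology T (fst c)) (fst c \<inter> S)" using S(1) by (auto simp: openin_subtopology)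
  hence "openin (top_of_set (snd c ` fst c)) (snd c ` (fst c \<inter> S))"
    using homeomorphic_imp_open_map[OF *(3)] by (auto simp: open_map_def)
  hence "openin (coord_top n) (snd c ` (fst c \<inter> S))" using *(2) by (rule openin_trans)
  then obtain W where W: "open W" "snd c ` (fst c \<inter> S) = coord_space n \<inter> W" by (auto simp: openin_open)
  have "snd c g \<in> snd c ` (fst c \<inter> S)" using S by blast
  hence "snd c g \<in> W" "snd c g \<in> coord_space n" using W(2) by auto
  then obtain e where e: "e > 0" "\<And>x. x \<in> coord_space n \<Longrightarrow> nrm n (x - snd c g) < e \<Longrightarrow> x \<in> W"
    using open_contains_coord_ball[OF W(1)] by blast
  have "x \<in> snd c ` fst c \<and> chart_inv c x \<in> S" if "x \<in> coord_space n" "nrm n (x - snd c g) < e" for x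
  proof -
    have "x \<in> snd c ` (fst c \<inter> S)" using e(2)[OF that] that(1) W(2) by blast
    then obtain q where "q \<in> fst c" "q \<in> S" "x = snd c q" by blast
    thus ?thesis using chart_props(3)[OF A c] by auto
  qed
  thus ?thesis using e(1) by blast
qed

lemma chart_ball_open:
  assumes A: "analytic_manifold n T A" and c: "c \<in> A"
  shows "openin T {g \<in> fst c. nrm n (snd c g - q) < e}"
proof -
  have *: "openin T (fst c)"
    "homeomorphic_map (subtopology T (fst c)) (top_of_set (snd c ` fst c)) (snd c)"
    using A c by (auto simp: analytic_manifold_def)
  have "continuous_map (subtopology T (fst c)) (top_of_set (snd c ` fst c)) (snd c)"
    using *(2) by (rule homeomorphic_imp_continuous_map)
  moreover have "openin (top_of_set (snd c ` fst c)) (snd c ` fst c \<inter> {x. nrm n (x - q) < e})"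
    using open_coord_ball by (simp add: openin_open_Int)
  ultimately have "openin (subtopology T (fst c)) {g \<in> topspace (subtopology T (fst c)). snd c g \<in> snd c ` fst c \<inter> {x. nrm n (x - q) < e}}"
    by (rule openin_continuous_map_preimage)
  moreover have "{g \<in> topspace (subtopology T (fst c)). snd c g \<in> snd c ` fst c \<inter> {x. nrm n (x - q) < e}} = {g \<in> fst c. nrm n (snd c g - q) < e}"
    using openin_subset[OF *(1)] by auto
  ultimately have "openin (subtopology T (fst c)) {g \<in> fst c. nrm n (snd c g - q) < e}" by simp
  thus ?thesis using *(1) by (rule openin_trans_full)
qed

end

section \<open>Expansiveness in terms of two-sided orbits\<close>

lemma int_iterate_mem:
  assumes "bij_betw f S S" "t \<in> S" shows "int_iterate S f k t \<in> S"
proof -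
  have "f x \<in> S" "inv_into S f x \<in> S" if "x \<in> S" for x
    using assms(1) that by (auto simp: bij_betw_def inv_into_into)
  hence "(f ^^ j) t \<in> S" "(inv_into S f ^^ j) t \<in> S" for j using assms(2) by (induction j) auto
  thus ?thesis by (simp add: int_iterate_def)
qed

lemma int_iterate_step:
  assumes b: "bij_betw f S S" and t: "t \<in> S" shows "int_iterate S f (k + 1) t = f (int_iterate S f k t)"
proof (cases "0 \<le> k")
  case True
  hence "nat (k + 1) = Suc (nat k)" by simp
  thus ?thesis using True by (simp add: int_iterate_def)
next
  case False
  define j where "j = nat (- k - 1)"
  have k: "nat (- k) = Suc j" using False by (simp add: j_def)
  have "(inv_into S f ^^ j) t \<in> S" using t b by (induction j) (auto simp: bij_betw_def inv_into_into)
  hence "f (int_iterate S f k t) = (inv_into S f ^^ j) t"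
    using False b by (simp add: int_iterate_def k bij_betw_def f_inv_into_f)
  also have "\<dots> = int_iterate S f (k + 1) t"
  proof (cases "k = -1")
    case True thus ?thesis by (simp add: int_iterate_def j_def)
  next
    case k1: False
    hence "nat (- (k + 1)) = j" by (simp add: j_def)
    thus ?thesis using False k1 by (simp add: int_iterate_def)
  qed
  finally show ?thesis by simp
qed

lemma int_iterate_orbit:
  assumes b: "bij_betw f S S" and c: "\<And>k::int. c k \<in> S" "\<And>k. c (k + 1) = f (c k)"
  shows "int_iterate S f k (c j) = c (j + k)"
proof (induction k rule: int_bi_induct)
  case base thus ?case by (simp add: int_iterate_def)
next
  case (step1 k)
  have "c (j + (k + 1)) = f (c (j + k))" using c(2)[of "j + k"] by (simp add: add.assoc)
  thus ?case using int_iterate_step[OF b c(1)] step1 by simp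
next
  case (step2 k)
  have "c (j + (k + 1)) = f (c (j + k))" using c(2)[of "j + k"] by (simp add: add.assoc)
  hence "f (int_iterate S f k (c j)) = f (c (j + k))" using int_iterate_step[OF b c(1), of k] step2 by simp
  thus ?case using b int_iterate_mem[OF b c(1)] c(1) by (auto simp: bij_betw_def inj_on_def)
qed

text \<open>A point lies in the image of \<open>U\<close> under the k-th iterate if and only if its
  iterate at time \<open>- k\<close> lies in \<open>U\<close>. Two-sided orbits mention no inverse
  map and can be transported through charts.\<close>

lemma Inter_int_iterate:
  assumes b: "bij_betw f S S" and U: "U \<subseteq> S"
  shows "(\<Inter>k::int. int_iterate S f k ` U) = {t. \<exists>c. c 0 = t \<and> (\<forall>k::int. c k \<in> U \<and> c (k + 1) = f (c k))}"
proof (intro equalityI subsetI)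
  fix t assume t: "t \<in> (\<Inter>k::int. int_iterate S f k ` U)"
  have tS: "t \<in> S" using t U by (auto simp: int_iterate_def dest!: spec[of _ 0])
  define c where "c = (\<lambda>k. int_iterate S f k t)"
  have c: "c k \<in> S" "c (k + 1) = f (c k)" for k
    unfolding c_def using int_iterate_mem[OF b tS] int_iterate_step[OF b tS] by auto
  have "c k \<in> U" for k
  proof -
    obtain u where u: "u \<in> U" "t = int_iterate S f (- k) u" using t by blast
    define d where "d = (\<lambda>i. int_iterate S f i u)"
    have uS: "u \<in> S" using u(1) U by blast
    have d: "d i \<in> S" "d (i + 1) = f (d i)" for i
      unfolding d_def using int_iterate_mem[OF b uS] int_iterate_step[OF b uS] by auto
    have "c k = int_iterate S f k (d (- k))" by (simp add: c_def d_def u(2))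
    also have "\<dots> = d 0" using int_iterate_orbit[of f S d, OF b d, of k "- k"] by simp
    also have "\<dots> = u" by (simp add: d_def int_iterate_def)
    finally show ?thesis using u(1) by simp
  qed
  moreover have "c 0 = t" by (simp add: c_def int_iterate_def)
  ultimately show "t \<in> {t. \<exists>c. c 0 = t \<and> (\<forall>k::int. c k \<in> U \<and> c (k + 1) = f (c k))}" using c(2) by blast
next
  fix t assume "t \<in> {t. \<exists>c. c 0 = t \<and> (\<forall>k::int. c k \<in> U \<and> c (k + 1) = f (c k))}"
  then obtain c where c: "c 0 = t" "\<And>k::int. c k \<in> U" "\<And>k. c (k + 1) = f (c k)" by blast
  have cS: "c k \<in> S" for k using c(2) U by blast
  show "t \<in> (\<Inter>k::int. int_iterate S f k ` U)"
  proof
    fix k :: int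
    have "t = int_iterate S f k (c (- k))" using int_iterate_orbit[of f S c, OF b cS c(3), of k "- k"] c(1) by simp
    thus "t \<in> int_iterate S f k ` U" using c(2) by blast
  qed
qed

lemma expansive_iff_orbits:
  assumes b: "bij_betw f (carrier G) (carrier G)" and one: "\<one>\<^bsub>G\<^esub> \<in> carrier G" "f \<one>\<^bsub>G\<^esub> = \<one>\<^bsub>G\<^esub>"
  shows "expansive G T f \<longleftrightarrow> (\<exists>U\<subseteq>carrier G. (\<exists>V. openin T V \<and> \<one>\<^bsub>G\<^esub> \<in> V \<and> V \<subseteq> U) \<and>
     (\<forall>c. (\<forall>k::int. c k \<in> U \<and> c (k + 1) = f (c k)) \<longrightarrow> c 0 = \<one>\<^bsub>G\<^esub>))"
proof -
  have eq: "(\<Inter>k::int. int_iterate (carrier G) f k ` U) = {\<one>\<^bsub>G\<^esub>} \<longleftrightarrow>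
     (\<forall>c. (\<forall>k::int. c k \<in> U \<and> c (k + 1) = f (c k)) \<longrightarrow> c 0 = \<one>\<^bsub>G\<^esub>)"
    if U: "U \<subseteq> carrier G" "\<one>\<^bsub>G\<^esub> \<in> U" for U
  proof -
    have "\<exists>c. c 0 = \<one>\<^bsub>G\<^esub> \<and> (\<forall>k::int. c k \<in> U \<and> c (k + 1) = f (c k))"
      using U(2) one by (intro exI[of _ "\<lambda>_. \<one>\<^bsub>G\<^esub>"]) auto
    thus ?thesis unfolding Inter_int_iterate[OF b U(1)] by blast
  qed
  have "(U \<subseteq> carrier G \<and> (\<exists>V. openin T V \<and> \<one>\<^bsub>G\<^esub> \<in> V \<and> V \<subseteq> U) \<and>
       (\<Inter>k::int. int_iterate (carrier G) f k ` U) = {\<one>\<^bsub>G\<^esub>}) \<longleftrightarrow>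
     (U \<subseteq> carrier G \<and> (\<exists>V. openin T V \<and> \<one>\<^bsub>G\<^esub> \<in> V \<and> V \<subseteq> U) \<and>
       (\<forall>c. (\<forall>k::int. c k \<in> U \<and> c (k + 1) = f (c k)) \<longrightarrow> c 0 = \<one>\<^bsub>G\<^esub>))" for U
    by (intro conj_cong refl eq) auto
  thus ?thesis unfolding expansive_def by (rule arg_cong[of _ _ Ex, OF ext])
qed

section \<open>The Lie algebra in the coordinates of a chart\<close>

locale lie_setup = lfw v w + Group.group G
  for v :: "'k::local_field \<Rightarrow> real" and w :: "'k alg_closure \<Rightarrow> real" and G :: "('g, 'm) monoid_scheme" (structure) +
  fixes n :: nat and T :: "'g topology" and A :: "('g, 'k) chart set" and \<alpha> :: "'g \<Rightarrow> 'g"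
  assumes lie: "lie_group G n T A" and aut: "analytic_automorphism G n T A \<alpha>"
begin

lemma manifold: "analytic_manifold n T A" and topspace_T: "topspace T = carrier G"
  using lie by (auto simp: lie_group_def)

text \<open>The chart used by \<^const>\<open>tangent_map\<close> at the identity.\<close>

definition c0 :: "('g, 'k) chart" where "c0 = (SOME c. c \<in> charts_at A \<one>)"
definition \<phi> :: "'g \<Rightarrow> nat \<Rightarrow> 'k" where "\<phi> = snd c0"
definition \<psi> :: "(nat \<Rightarrow> 'k) \<Rightarrow> 'g" where "\<psi> = chart_inv c0"
definition D0 :: "'g set" where "D0 = fst c0"
definition p :: "nat \<Rightarrow> 'k" where "p = \<phi> \<one>"

lemma c0_at: "c0 \<in> charts_at A \<one>"
proof -
  have "\<one> \<in> (\<Union>c\<in>A. fst c)" using manifold topspace_T by (auto simp: analytic_manifold_def)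
  hence "\<exists>c. c \<in> charts_at A \<one>" by (auto simp: charts_at_def)
  thus ?thesis unfolding c0_def by (rule someI_ex)
qed

lemma c0: "c0 \<in> A" "\<one> \<in> D0"
  using c0_at by (auto simp: charts_at_def D0_def)

lemma \<psi>\<phi>: "g \<in> D0 \<Longrightarrow> \<psi> (\<phi> g) = g" and \<phi>_coord: "g \<in> D0 \<Longrightarrow> \<phi> g \<in> coord_space n"
  and \<phi>\<psi>: "x \<in> \<phi> ` D0 \<Longrightarrow> \<phi> (\<psi> x) = x" and \<psi>_D0: "x \<in> \<phi> ` D0 \<Longrightarrow> \<psi> x \<in> D0"
  using chart_props[OF manifold c0(1)] by (simp_all add: \<phi>_def \<psi>_def D0_def)

lemma D0_carrier: "D0 \<subseteq> carrier G"
  using openin_subset[OF chart_props(1)[OF manifold c0(1)]] topspace_T by (simp add: D0_def)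

lemma p_coord: "p \<in> coord_space n" and \<psi>_p: "\<psi> p = \<one>"
  using c0(2) by (simp_all add: p_def \<phi>_coord \<psi>\<phi>)

lemma nbhd:
  assumes "openin T S" "\<one> \<in> S"
  shows "\<exists>e>0. \<forall>x\<in>coord_space n. nrm n (x - p) < e \<longrightarrow> x \<in> \<phi> ` D0 \<and> \<psi> x \<in> S \<inter> D0"
proof -
  obtain e where e: "e > 0" "\<forall>x\<in>coord_space n. nrm n (x - p) < e \<longrightarrow> x \<in> \<phi> ` D0 \<and> \<psi> x \<in> S"
    using chart_nbhd[OF manifold c0(1) assms] c0(2) unfolding \<phi>_def \<psi>_def D0_def p_def by blast
  thus ?thesis using \<psi>_D0 by blast
qed

lemma aut_props: "\<alpha> \<in> hom G G" "bij_betw \<alpha> (carrier G) (carrier G)" "\<alpha> \<one> = \<one>"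
  "inv_into (carrier G) \<alpha> \<one> = \<one>"
proof -
  show h: "\<alpha> \<in> hom G G" and b: "bij_betw \<alpha> (carrier G) (carrier G)" using aut by (auto simp: analytic_automorphism_def iso_def)
  show one: "\<alpha> \<one> = \<one>" using h by (rule hom_one[OF _ is_group is_group])
  show "inv_into (carrier G) \<alpha> \<one> = \<one>" using b one by (intro inv_into_f_eq) (auto simp: bij_betw_def)
qed

lemma chart_rep:
  assumes F: "analytic_map n T A n T A F" "F \<one> = \<one>" and d: "d \<in> charts_at A \<one>"
  shows "analytic_between n n (snd d \<circ> F \<circ> \<psi>) (\<phi> ` (D0 \<inter> F -` fst d))" "p \<in> \<phi> ` (D0 \<inter> F -` fst d)"
  using F d c0 by (auto simp: analytic_map_def charts_at_def \<phi>_def \<psi>_def D0_def p_def)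

lemma chart_rep_dom:
  assumes F: "analytic_map n T A n T A F" "F \<one> = \<one>" and d: "d \<in> charts_at A \<one>"
  shows "\<exists>e>0. \<forall>x\<in>coord_space n. nrm n (x - p) < e \<longrightarrow> x \<in> \<phi> ` D0 \<and> \<psi> x \<in> D0 \<and> F (\<psi> x) \<in> fst d"
proof -
  have "openin (coord_top n) (\<phi> ` (D0 \<inter> F -` fst d))"
    using chart_rep(1)[OF assms] by (simp add: analytic_between_def)
  then obtain W where W: "open W" "\<phi> ` (D0 \<inter> F -` fst d) = coord_space n \<inter> W" by (auto simp: openin_open)
  have "p \<in> W" using chart_rep(2)[OF assms] W(2) by blast
  then obtain e where e: "e > 0" "\<And>x. x \<in> coord_space n \<Longrightarrow> nrm n (x - p) < e \<Longrightarrow> x \<in> W"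
    using open_contains_coord_ball[OF W(1) _ p_coord] by blast
  have "x \<in> \<phi> ` D0 \<and> \<psi> x \<in> D0 \<and> F (\<psi> x) \<in> fst d" if "x \<in> coord_space n" "nrm n (x - p) < e" for x
  proof -
    have "x \<in> \<phi> ` (D0 \<inter> F -` fst d)" using e(2)[OF that] that(1) W(2) by blast
    then obtain g where "g \<in> D0" "F g \<in> fst d" "x = \<phi> g" by blast
    thus ?thesis by (simp add: \<psi>\<phi>)
  qed
  thus ?thesis using e(1) by blast
qed

text \<open>Makes the chart changes at the identity a special case of the lemmas on chart
  expressions of maps.\<close>

lemma id_analytic: "analytic_map n T A n T A (\<lambda>x. x)"
  using manifold unfolding analytic_map_def analytic_manifold_def
  by (simp add: vimage_def o_def Int_def) 

text \<open>The derivative at the identity of the change of coordinates from \<open>c0\<close> to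
  \<open>d\<close>.\<close>

definition tr :: "('g, 'k) chart \<Rightarrow> nat \<Rightarrow> nat \<Rightarrow> 'k" where
  "tr d = jac (snd d \<circ> \<psi>) p"

definition lin :: "('g \<Rightarrow> 'g) \<Rightarrow> nat \<Rightarrow> nat \<Rightarrow> 'k" where
  "lin F = jac (\<phi> \<circ> F \<circ> \<psi>) p"

lemma tr_rep:
  assumes "d \<in> charts_at A \<one>"
  shows "analytic_between n n (snd d \<circ> \<psi>) (\<phi> ` (D0 \<inter> fst d))" "p \<in> \<phi> ` (D0 \<inter> fst d)"
  using chart_rep[OF id_analytic _ assms] by (simp_all add: vimage_def o_def Int_def)

lemma tr_c0: "y \<in> coord_space n \<Longrightarrow> mat_app n (tr c0) y = y"
proof -
  assume y: "y \<in> coord_space n"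
  obtain e where e: "e > 0" "\<forall>x\<in>coord_space n. nrm n (x - p) < e \<longrightarrow> x \<in> \<phi> ` D0 \<and> \<psi> x \<in> D0 \<and> \<psi> x \<in> fst c0"
    using chart_rep_dom[OF id_analytic _ c0_at] by auto
  have "differential (snd c0 \<circ> \<psi>) p y = y"
    using e \<phi>\<psi> by (intro differential_id[OF p_coord y e(1)]) (auto simp: \<phi>_def)
  thus ?thesis using differential_eq_mat_app[OF tr_rep[OF c0_at] y] by (simp add: tr_def)
qed

lemma chain_at_one:
  assumes F: "analytic_map n T A n T A F" "F \<one> = \<one>" and d: "d \<in> charts_at A \<one>" and y: "y \<in> coord_space n"
  shows "differential (snd d \<circ> F \<circ> \<psi>) p y = mat_app n (tr d) (mat_app n (lin F) y)"
proof -
  obtain e where e: "e > 0" "\<forall>x\<in>coord_space n. nrm n (x - p) < e \<longrightarrow> x \<in> \<phi> ` D0 \<and> \<psi> x \<in> D0 \<and> F (\<psi> x) \<in> fst c0"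
    using chart_rep_dom[OF F c0_at] by blast
  have Fp: "(\<phi> \<circ> F \<circ> \<psi>) p = p" using F(2) by (simp add: \<psi>_p p_def[symmetric])
  have rep: "analytic_between n n (\<phi> \<circ> F \<circ> \<psi>) (\<phi> ` (D0 \<inter> F -` fst c0))" "p \<in> \<phi> ` (D0 \<inter> F -` fst c0)"
    using chart_rep[OF F c0_at] by (simp_all add: \<phi>_def)
  have "differential (snd d \<circ> F \<circ> \<psi>) p y = differential (snd d \<circ> \<psi>) ((\<phi> \<circ> F \<circ> \<psi>) p) (differential (\<phi> \<circ> F \<circ> \<psi>) p y)"
  proof (rule differential_chain[OF rep tr_rep(1)[OF d] _ e(1) _ y])
    show "(\<phi> \<circ> F \<circ> \<psi>) p \<in> \<phi> ` (D0 \<inter> fst d)" unfolding Fp by (rule tr_rep(2)[OF d])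
    fix x assume "x \<in> coord_space n" "nrm n (x - p) < e"
    hence "F (\<psi> x) \<in> D0" using e(2) by (auto simp: D0_def)
    thus "(snd d \<circ> F \<circ> \<psi>) x = (snd d \<circ> \<psi>) ((\<phi> \<circ> F \<circ> \<psi>) x)" by (simp add: \<psi>\<phi>)
  qed
  also have "differential (\<phi> \<circ> F \<circ> \<psi>) p y = mat_app n (lin F) y"
    unfolding lin_def by (rule differential_eq_mat_app[OF rep y])
  also have "differential (snd d \<circ> \<psi>) ((\<phi> \<circ> F \<circ> \<psi>) p) (mat_app n (lin F) y) = mat_app n (tr d) (mat_app n (lin F) y)"
    unfolding Fp tr_def by (rule differential_eq_mat_app[OF tr_rep[OF d]]) simp
  finally show ?thesis .
qed

lemma lin_inverse:
  assumes F: "analytic_map n T A n T A F" "F \<one> = \<one>" and F': "analytic_map n T A n T A F'" "F' \<one> = \<one>"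
    and FF': "\<And>g. g \<in> carrier G \<Longrightarrow> F' (F g) = g" and y: "y \<in> coord_space n"
  shows "mat_app n (lin F') (mat_app n (lin F) y) = y"
proof -
  obtain e where e: "e > 0" "\<forall>x\<in>coord_space n. nrm n (x - p) < e \<longrightarrow> x \<in> \<phi> ` D0 \<and> \<psi> x \<in> D0 \<and> F (\<psi> x) \<in> fst c0"
    using chart_rep_dom[OF F c0_at] by blast
  have Fp: "(\<phi> \<circ> F \<circ> \<psi>) p = p" using F(2) by (simp add: \<psi>_p p_def[symmetric])
  have rep: "analytic_between n n (\<phi> \<circ> F \<circ> \<psi>) (\<phi> ` (D0 \<inter> F -` fst c0))" "p \<in> \<phi> ` (D0 \<inter> F -` fst c0)"
    using chart_rep[OF F c0_at] by (simp_all add: \<phi>_def)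
  have rep': "analytic_between n n (\<phi> \<circ> F' \<circ> \<psi>) (\<phi> ` (D0 \<inter> F' -` fst c0))" "p \<in> \<phi> ` (D0 \<inter> F' -` fst c0)"
    using chart_rep[OF F' c0_at] by (simp_all add: \<phi>_def)
  have "differential (\<lambda>x. x) p y = differential (\<phi> \<circ> F' \<circ> \<psi>) ((\<phi> \<circ> F \<circ> \<psi>) p) (differential (\<phi> \<circ> F \<circ> \<psi>) p y)"
  proof (rule differential_chain[OF rep rep'(1) _ e(1) _ y])
    show "(\<phi> \<circ> F \<circ> \<psi>) p \<in> \<phi> ` (D0 \<inter> F' -` fst c0)" unfolding Fp by (rule rep'(2))
    fix x assume "x \<in> coord_space n" "nrm n (x - p) < e"
    hence x: "F (\<psi> x) \<in> D0" "x \<in> \<phi> ` D0" "\<psi> x \<in> carrier G" using e(2) D0_carrier by (auto simp: D0_def)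
    thus "x = (\<phi> \<circ> F' \<circ> \<psi>) ((\<phi> \<circ> F \<circ> \<psi>) x)" by (simp add: \<psi>\<phi> FF' \<phi>\<psi>)
  qed
  moreover have "differential (\<lambda>x. x) p y = y" by (rule differential_id[OF p_coord y, of 1]) auto
  ultimately show ?thesis
    using differential_eq_mat_app[OF rep y] differential_eq_mat_app[OF rep', of "mat_app n (lin F) y"] unfolding Fp
    by (simp add: lin_def)
qed

lemma aut_analytic: "analytic_map n T A n T A \<alpha>" "analytic_map n T A n T A (inv_into (carrier G) \<alpha>)"
  using aut by (auto simp: analytic_automorphism_def)

definition M :: "nat \<Rightarrow> nat \<Rightarrow> 'k" where "M = lin \<alpha>"
definition M' :: "nat \<Rightarrow> nat \<Rightarrow> 'k" where "M' = lin (inv_into (carrier G) \<alpha>)"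

lemma M_inverse: "y \<in> coord_space n \<Longrightarrow> mat_app n M' (mat_app n M y) = y"
  "y \<in> coord_space n \<Longrightarrow> mat_app n M (mat_app n M' y) = y"
  unfolding M_def M'_def using aut_props
  by (auto intro!: lin_inverse aut_analytic simp: bij_betw_def f_inv_into_f)

text \<open>The inverse of reading off the coordinates in \<open>c0\<close>: a single coordinate
  vector determines the whole compatible family.\<close>

definition Emb :: "(nat \<Rightarrow> 'k) \<Rightarrow> ('g, 'k) tangent" where
  "Emb y = (\<lambda>d. if d \<in> charts_at A \<one> then mat_app n (tr d) y else 0)"

abbreviation L :: "('g, 'k) tangent set" where "L \<equiv> lie_algebra G n A"

lemma Emb_c0: "y \<in> coord_space n \<Longrightarrow> Emb y c0 = y"
  by (simp add: Emb_def c0_at tr_c0)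

lemma Emb_linear: "Emb (x + y) = Emb x + Emb y" "Emb (vscale a x) = tangent_scale a (Emb x)" "Emb 0 = 0"
  by (auto simp: Emb_def tangent_scale_def fun_eq_iff vec_apply mat_app.add mat_app.scale)

text \<open>Compatibility of the components in \<open>c\<close> and \<open>d\<close> is the chain
  rule for passing from \<open>c0\<close> to \<open>d\<close> by way of \<open>c\<close>.\<close>

lemma Emb_in_L: "y \<in> coord_space n \<Longrightarrow> Emb y \<in> L"
proof -
  assume y: "y \<in> coord_space n"
  have eq: "mat_app n (tr d) y = differential (snd d \<circ> chart_inv c) (snd c \<one>) (mat_app n (tr c) y)"
    if c: "c \<in> charts_at A \<one>" and d: "d \<in> charts_at A \<one>" for c d
  proof -
    have cA: "c \<in> A" "\<one> \<in> fst c" "d \<in> A" "\<one> \<in> fst d" using c d by (auto simp: charts_at_def)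
    have rep: "analytic_between n n (snd d \<circ> chart_inv c) (snd c ` (fst c \<inter> fst d))"
      using manifold cA by (auto simp: analytic_manifold_def)
    obtain e where e: "e > 0" "\<forall>x\<in>coord_space n. nrm n (x - p) < e \<longrightarrow> x \<in> \<phi> ` D0 \<and> \<psi> x \<in> D0 \<and> \<psi> x \<in> fst c"
      using chart_rep_dom[OF id_analytic _ c] by auto
    have cp: "(snd c \<circ> \<psi>) p = snd c \<one>" by (simp add: \<psi>_p)
    have "differential (snd d \<circ> \<psi>) p y = differential (snd d \<circ> chart_inv c) ((snd c \<circ> \<psi>) p) (differential (snd c \<circ> \<psi>) p y)"
    proof (rule differential_chain[OF tr_rep[OF c] rep _ e(1) _ y])
      show "(snd c \<circ> \<psi>) p \<in> snd c ` (fst c \<inter> fst d)" unfolding cp using cA by blast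
      fix x assume "x \<in> coord_space n" "nrm n (x - p) < e"
      hence "\<psi> x \<in> fst c" using e(2) by blast
      thus "(snd d \<circ> \<psi>) x = (snd d \<circ> chart_inv c) ((snd c \<circ> \<psi>) x)"
        using chart_props(3)[OF manifold cA(1)] by simp
    qed
    thus ?thesis unfolding cp using differential_eq_mat_app[OF tr_rep[OF c] y] differential_eq_mat_app[OF tr_rep[OF d] y]
      by (simp add: tr_def)
  qed
  show ?thesis unfolding lie_algebra_def tangent_space_def
  proof (intro CollectI conjI allI ballI impI)
    fix c d assume cd: "c \<in> charts_at A \<one>" "d \<in> charts_at A \<one>"
    show "Emb y d = differential (snd d \<circ> chart_inv c) (snd c \<one>) (Emb y c)"
      using eq[OF cd] unfolding Emb_def if_P[OF cd(1)] if_P[OF cd(2)] .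
  qed (simp_all add: Emb_def)
qed

lemma L_coord: "t \<in> L \<Longrightarrow> t c0 \<in> coord_space n" and Emb_surj: "t \<in> L \<Longrightarrow> Emb (t c0) = t"
proof -
  assume t: "t \<in> L"
  have tr: "t d = differential (snd d \<circ> chart_inv c0) (snd c0 \<one>) (t c0)" if "d \<in> charts_at A \<one>" for d
    using t c0_at that unfolding lie_algebra_def tangent_space_def by blast
  show c: "t c0 \<in> coord_space n" using t c0_at unfolding lie_algebra_def tangent_space_def by blast
  have "Emb (t c0) d = t d" for d
  proof (cases "d \<in> charts_at A \<one>")
    case True
    have "t d = differential (snd d \<circ> chart_inv c0) (snd c0 \<one>) (t c0)"
      by (rule tr[OF True])
    also have "\<dots> = differential (snd d \<circ> \<psi>) p (t c0)" by (simp add: \<psi>_def p_def \<phi>_def)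
    also have "\<dots> = mat_app n (tr d) (t c0)" unfolding tr_def by (rule differential_eq_mat_app[OF tr_rep[OF True] c])
    finally show ?thesis using True by (simp add: Emb_def)
  next
    case False
    moreover have "t d = 0" using t False unfolding lie_algebra_def tangent_space_def by blast
    ultimately show ?thesis by (simp add: Emb_def)
  qed
  thus "Emb (t c0) = t" by blast
qed

abbreviation \<beta> :: "('g, 'k) tangent \<Rightarrow> ('g, 'k) tangent" where "\<beta> \<equiv> lie_map G A \<alpha>"

lemma \<beta>_eq: "t c0 \<in> coord_space n \<Longrightarrow> \<beta> t = Emb (mat_app n M (t c0))"
proof
  fix d
  assume t: "t c0 \<in> coord_space n"
  have "\<beta> t d = (if d \<in> charts_at A \<one> then differential (snd d \<circ> \<alpha> \<circ> \<psi>) p (t c0) else 0)"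
    by (simp add: lie_map_def tangent_map_def aut_props Let_def c0_def[symmetric] \<psi>_def p_def \<phi>_def)
  thus "\<beta> t d = Emb (mat_app n M (t c0)) d"
    using chain_at_one[OF aut_analytic(1) aut_props(3) _ t] by (simp add: Emb_def M_def)
qed

lemma \<beta>_Emb: "y \<in> coord_space n \<Longrightarrow> \<beta> (Emb y) = Emb (mat_app n M y)"
  by (simp add: \<beta>_eq Emb_c0)

lemma zero_in_L: "0 \<in> L"
  using Emb_in_L[of 0] by (simp add: Emb_linear)

lemma bij_\<beta>: "bij_betw \<beta> L L"
proof (rule bij_betwI)
  show "\<beta> \<in> L \<rightarrow> L" by (auto simp: \<beta>_eq L_coord intro!: Emb_in_L)
  show "(\<lambda>t. Emb (mat_app n M' (t c0))) \<in> L \<rightarrow> L" by (auto intro!: Emb_in_L)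
  show "Emb (mat_app n M' (\<beta> t c0)) = t" if "t \<in> L" for t
    using that by (simp add: \<beta>_eq L_coord Emb_c0 M_inverse Emb_surj)
  show "\<beta> (Emb (mat_app n M' (t c0))) = t" if "t \<in> L" for t
    using that by (simp add: \<beta>_Emb L_coord M_inverse Emb_surj)
qed

lemma \<beta>_zero: "\<beta> 0 = 0"
  using \<beta>_Emb[of 0] by (simp add: Emb_linear mat_app.zero)

lemma strict_diff_aut: "strict_diff n M (\<lambda>h. (\<phi> \<circ> \<alpha> \<circ> \<psi>) (p + h) - p)"
proof -
  have rep: "analytic_between n n (\<phi> \<circ> \<alpha> \<circ> \<psi>) (\<phi> ` (D0 \<inter> \<alpha> -` fst c0))" "p \<in> \<phi> ` (D0 \<inter> \<alpha> -` fst c0)"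
    using chart_rep[OF aut_analytic(1) aut_props(3) c0_at] by (simp_all add: \<phi>_def)
  show ?thesis unfolding M_def lin_def
    by (rule analytic_strict_diff[OF rep]) (simp add: \<psi>_p aut_props p_def[symmetric])
qed

theorem expansive_group_iff: "expansive G T \<alpha> \<longleftrightarrow> 1 \<notin> R n M"
proof -
  define f where "f = (\<lambda>h. (\<phi> \<circ> \<alpha> \<circ> \<psi>) (p + h) - p)"
  have sd: "strict_diff n M f" unfolding f_def by (rule strict_diff_aut)
  note iff = expansive_iff_orbits[OF aut_props(2) one_closed aut_props(3)]
  show ?thesis
  proof
    assume R: "1 \<notin> R n M"
    obtain d where d: "d > 0" "\<forall>x. (\<forall>k::int. x k \<in> coord_space n \<and> nrm n (x k) < d \<and> x (k + 1) = f (x k)) \<longrightarrow> (\<forall>k. x k = 0)"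
      using expansive_near_fixed_point[OF sd R] by blast
    define U where "U = {g \<in> D0. nrm n (\<phi> g - p) < d}"
    have "openin T U" unfolding U_def D0_def \<phi>_def by (rule chart_ball_open[OF manifold c0(1)])
    moreover have "\<one> \<in> U" using c0(2) d(1) by (simp add: U_def p_def)
    moreover have "c 0 = \<one>" if c: "\<forall>k::int. c k \<in> U \<and> c (k + 1) = \<alpha> (c k)" for c
    proof -
      define x where "x = (\<lambda>k. \<phi> (c k) - p)"
      have cD: "c k \<in> D0" for k using c by (auto simp: U_def)
      have "x k \<in> coord_space n \<and> nrm n (x k) < d \<and> x (k + 1) = f (x k)" for k
        using c cD[of k] \<phi>_coord[OF cD[of k]] p_coord by (auto simp: x_def f_def \<psi>\<phi> U_def coord_space_diff)
      hence "x 0 = 0" using d(2) by blast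
      hence "\<phi> (c 0) = p" by (simp add: x_def)
      thus ?thesis using \<psi>\<phi>[OF cD[of 0]] \<psi>_p by simp
    qed
    ultimately show "expansive G T \<alpha>" unfolding iff using D0_carrier
      by (intro exI[of _ U]) (auto simp: U_def)
  next
    assume ex: "expansive G T \<alpha>"
    show "1 \<notin> R n M"
    proof
      assume R: "1 \<in> R n M"
      obtain U V where UV: "openin T V" "\<one> \<in> V" "V \<subseteq> U"
        "\<And>c. (\<forall>k::int. c k \<in> U \<and> c (k + 1) = \<alpha> (c k)) \<Longrightarrow> c 0 = \<one>" using ex unfolding iff by blast
      obtain e where e: "e > 0" "\<forall>x\<in>coord_space n. nrm n (x - p) < e \<longrightarrow> x \<in> \<phi> ` D0 \<and> \<psi> x \<in> V \<inter> D0"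
        using nbhd[OF UV(1,2)] by blast
      obtain e' where e': "e' > 0" "\<forall>x\<in>coord_space n. nrm n (x - p) < e' \<longrightarrow> x \<in> \<phi> ` D0 \<and> \<psi> x \<in> D0 \<and> \<alpha> (\<psi> x) \<in> fst c0"
        using chart_rep_dom[OF aut_analytic(1) aut_props(3) c0_at] by blast
      \<comment> \<open>Radius \<open>e\<close> keeps the orbit inside \<open>V\<close>, and
        \<open>e'\<close> keeps its image under \<alpha> in the chart domain, where the recursion
        for \<open>f\<close> can be read as one for \<alpha>.\<close>
      have "0 < min e e'" using e(1) e'(1) by simp
      from small_orbits_near_fixed_point[OF M_inverse(1) sd R this]
      obtain x where x: "\<And>k::int. x k \<in> coord_space n" "\<And>k. nrm n (x k) < min e e'" "\<And>k. x (k + 1) = f (x k)" "x 0 \<noteq> 0" by blast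
      define c where "c = (\<lambda>k. \<psi> (p + x k))"
      have px: "p + x k \<in> coord_space n" "nrm n (p + x k - p) < e" "nrm n (p + x k - p) < e'" for k
        using x(1,2)[of k] p_coord by (auto simp: coord_space_add)
      have "c k \<in> U \<and> c (k + 1) = \<alpha> (c k)" for k
      proof
        show "c k \<in> U" using e(2) px[of k] UV(3) by (auto simp: c_def)
        have "\<alpha> (c k) \<in> D0" using e'(2) px[of k] by (auto simp: c_def D0_def)
        thus "c (k + 1) = \<alpha> (c k)" by (simp add: c_def x(3) f_def \<psi>\<phi>)
      qed
      hence "c 0 = \<one>" using UV(4) by blast
      moreover have "p + x 0 \<in> \<phi> ` D0" using e(2) px[of 0] by blast
      hence "\<phi> (c 0) = p + x 0" by (simp add: c_def \<phi>\<psi>)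
      ultimately show False using x(4) by (simp add: p_def)
    qed
  qed
qed

text \<open>Neighbourhoods of 0 in \<open>L\<close> refer to the product topology over all charts;
  continuity pulls them back to balls in the coordinates of \<open>c0\<close>.\<close>

lemma continuous_Emb: "continuous_on UNIV Emb"
proof (intro continuous_on_coordinatewise_then_product)
  fix d i
  show "continuous_on UNIV (\<lambda>y. Emb y d i)"
  proof (cases "d \<in> charts_at A \<one> \<and> i < n")
    case True
    hence "Emb y d i = (\<Sum>j<n. tr d i j * y j)" for y by (simp add: Emb_def mat_app_def)
    thus ?thesis by (auto intro!: continuous_on_sum continuous_on_mult' continuous_on_product_coordinates)
  next
    case False
    hence "Emb y d i = 0" for y by (auto simp: Emb_def mat_app_def vec_apply)
    thus ?thesis by simp
  qed
qed

theorem expansive_algebra_iff: "expansive (additive_group L) (top_of_set L) \<beta> \<longleftrightarrow> 1 \<notin> R n M"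
proof -
  have carrier: "carrier (additive_group L) = L" and one: "\<one>\<^bsub>additive_group L\<^esub> = 0" by (simp_all add: additive_group_def)
  note iff = expansive_iff_orbits[of \<beta> "additive_group L", unfolded carrier one, OF bij_\<beta> zero_in_L \<beta>_zero]
  show ?thesis
  proof
    assume R: "1 \<notin> R n M"
    obtain d where d: "d > 0" "\<forall>x. (\<forall>k::int. x k \<in> coord_space n \<and> nrm n (x k) < d \<and> x (k + 1) = mat_app n M (x k)) \<longrightarrow> (\<forall>k. x k = 0)"
      using expansive_near_fixed_point[OF strict_diff_mat_app R] by blast
    define U where "U = L \<inter> {t. t c0 \<in> {y. nrm n (y - 0) < d}}"
    have "openin (top_of_set L) U" unfolding U_def by (intro openin_open_Int open_coord_preimage open_coord_ball)
    moreover have "0 \<in> U" using zero_in_L d(1) by (simp add: U_def vec_apply)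
    moreover have "c 0 = 0" if c: "\<forall>k::int. c k \<in> U \<and> c (k + 1) = \<beta> (c k)" for c
    proof -
      define x where "x = (\<lambda>k. c k c0)"
      have cL: "c k \<in> L" "nrm n (x k) < d" for k using c by (auto simp: U_def x_def)
      have "x k \<in> coord_space n \<and> nrm n (x k) < d \<and> x (k + 1) = mat_app n M (x k)" for k
        using c cL by (simp add: x_def L_coord \<beta>_eq Emb_c0)
      hence "x 0 = 0" using d(2) by blast
      thus ?thesis using Emb_surj[OF cL(1)[of 0]] by (simp add: x_def Emb_linear)
    qed
    ultimately show "expansive (additive_group L) (top_of_set L) \<beta>" unfolding iff
      by (intro exI[of _ U]) (auto simp: U_def)
  next
    assume ex: "expansive (additive_group L) (top_of_set L) \<beta>"
    show "1 \<notin> R n M"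
    proof
      assume R: "1 \<in> R n M"
      obtain U V where UV: "openin (top_of_set L) V" "0 \<in> V" "V \<subseteq> U"
        "\<And>c. (\<forall>k::int. c k \<in> U \<and> c (k + 1) = \<beta> (c k)) \<Longrightarrow> c 0 = 0" using ex unfolding iff by blast
      obtain W where W: "open W" "V = L \<inter> W" using UV(1) by (auto simp: openin_open)
      have "open (Emb -` W)" using open_vimage[OF W(1) continuous_Emb] .
      moreover have "0 \<in> Emb -` W" using UV(2) W(2) by (simp add: Emb_linear)
      ultimately obtain e where e: "e > 0" "\<forall>x\<in>coord_space n. nrm n (x - 0) < e \<longrightarrow> x \<in> Emb -` W"
        using open_contains_coord_ball[of "Emb -` W" 0 n] by auto
      from small_orbits_near_fixed_point[OF M_inverse(1) strict_diff_mat_app R e(1)]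
      obtain x where x: "\<And>k::int. x k \<in> coord_space n" "\<And>k. nrm n (x k) < e" "\<And>k. x (k + 1) = mat_app n M (x k)" "x 0 \<noteq> 0" by blast
      define c where "c = (\<lambda>k. Emb (x k))"
      have "c k \<in> U \<and> c (k + 1) = \<beta> (c k)" for k
      proof
        have "Emb (x k) \<in> W" using e(2) x(1,2)[of k] by simp
        thus "c k \<in> U" using Emb_in_L[OF x(1)] W(2) UV(3) by (auto simp: c_def)
        show "c (k + 1) = \<beta> (c k)" by (simp add: c_def x(3) \<beta>_Emb x(1))
      qed
      hence "c 0 = 0" using UV(4) by blast
      hence "Emb (x 0) c0 = 0" by (simp add: c_def vec_apply)
      thus False using x(1,4) by (simp add: Emb_c0)
    qed
  qed
qed

end

section \<open>Characteristic polynomials of linear maps\<close>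

context vector_space
begin

text \<open>The rule for applying a matrix to a coordinate vector, with a basis for the source and
  one for the target. For the identity map it is the change of basis.\<close>

lemma ordered_basis_representation:
  assumes b: "ordered_basis scale V n b" and c: "ordered_basis scale V m c"
    and f: "\<And>x. x \<in> V \<Longrightarrow> f x \<in> V" "\<And>x y. x \<in> V \<Longrightarrow> y \<in> V \<Longrightarrow> f (x + y) = f x + f y"
      "\<And>a x. x \<in> V \<Longrightarrow> f (scale a x) = scale a (f x)" and x: "x \<in> V"
  shows "representation (c ` {..<m}) (f x) u =
    (\<Sum>l<n. representation (c ` {..<m}) (f (b l)) u * representation (b ` {..<n}) x (b l))"
proof -
  have ind: "independent (b ` {..<n})" "independent (c ` {..<m})" "inj_on b {..<n}"
    and sp: "span (b ` {..<n}) = V" "span (c ` {..<m}) = V"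
    using b c by (auto simp: ordered_basis_def)
  have V: "subspace V" using subspace_span sp by metis
  have bV: "b l \<in> V" if "l < n" for l using span_base[of "b l" "b ` {..<n}"] that sp(1) by auto
  define r where "r = representation (b ` {..<n}) x"
  have "x = (\<Sum>y\<in>b ` {..<n}. scale (r y) y)"
    unfolding r_def using sum_representation_eq[OF ind(1), of x "b ` {..<n}"] x sp by simp
  also have "\<dots> = (\<Sum>l<n. scale (r (b l)) (b l))" by (rule sum.reindex_cong[OF ind(3)]) auto
  finally have xs: "x = (\<Sum>l<n. scale (r (b l)) (b l))" .
  have f0: "f 0 = 0" using f(3)[of 0 0] subspace_0[OF V] by simp
  have "(\<Sum>l<k. scale (r (b l)) (b l)) \<in> V \<and> f (\<Sum>l<k. scale (r (b l)) (b l)) = (\<Sum>l<k. scale (r (b l)) (f (b l)))"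
    if "k \<le> n" for k using that
  proof (induction k)
    case 0 thus ?case by (simp add: f0 subspace_0[OF V])
  next
    case (Suc k)
    thus ?case using bV[of k] by (auto simp: f subspace_add[OF V] subspace_scale[OF V])
  qed
  hence "f x = (\<Sum>l<n. scale (r (b l)) (f (b l)))" using xs by auto
  hence "representation (c ` {..<m}) (f x) u = (\<Sum>l<n. r (b l) * representation (c ` {..<m}) (f (b l)) u)"
    using bV f(1) subspace_scale[OF V] representation_sum[OF ind(2), unfolded sp(2), of "{..<n}" "\<lambda>l. scale (r (b l)) (f (b l))"]
    by (simp add: representation_scale[OF ind(2), unfolded sp(2)])
  thus ?thesis by (simp add: r_def mult.commute)
qed

text \<open>The definite description in \<open>linear_char_poly\<close> is met because any two bases
  give similar matrices, conjugate by the base changes \<open>Q\<close> and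
  \<open>P\<close>.\<close>

lemma linear_char_poly_eq:
  assumes b: "ordered_basis scale V n b"
    and f: "\<And>x. x \<in> V \<Longrightarrow> f x \<in> V" "\<And>x y. x \<in> V \<Longrightarrow> y \<in> V \<Longrightarrow> f (x + y) = f x + f y"
      "\<And>a x. x \<in> V \<Longrightarrow> f (scale a x) = scale a (f x)"
  shows "linear_char_poly scale V f = char_poly (matrix_wrt scale n b f)"
  unfolding linear_char_poly_def
proof (rule the_equality)
  fix q assume "\<exists>m c. ordered_basis scale V m c \<and> q = char_poly (matrix_wrt scale m c f)"
  then obtain m c where c: "ordered_basis scale V m c" and q: "q = char_poly (matrix_wrt scale m c f)" by blast
  have ind: "independent (b ` {..<n})" "independent (c ` {..<m})" "inj_on b {..<n}" "inj_on c {..<m}"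
    and sp: "span (b ` {..<n}) = V" "span (c ` {..<m}) = V"
    using b c by (auto simp: ordered_basis_def)
  have "span (b ` {..<n}) = span V" "span (c ` {..<m}) = span V" using sp span_span by metis+
  hence "card (b ` {..<n}) = card (c ` {..<m})" using dim_eq_card ind(1,2) by metis
  hence m: "m = n" using ind(3,4) by (simp add: card_image)
  have V: "b l \<in> V" "c l \<in> V" if "l < n" for l
    using span_base[of "b l" "b ` {..<n}"] span_base[of "c l" "c ` {..<m}"] that sp unfolding m by auto
  define Q where "Q = mat n n (\<lambda>(i, j). representation (c ` {..<n}) (b j) (c i))"
  define P where "P = mat n n (\<lambda>(i, j). representation (b ` {..<n}) (c j) (b i))"
  note rep = ordered_basis_representation
  have bb: "representation (b ` {..<n}) (b j) (b i) = (if i = j then 1 else 0)" if "i < n" "j < n" for i j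
    using that ind(1,3) by (auto simp: representation_basis inj_on_def)
  have cc: "representation (c ` {..<n}) (c j) (c i) = (if i = j then 1 else 0)" if "i < n" "j < n" for i j
    using that ind(2,4) by (auto simp: m representation_basis inj_on_def)
  have "similar_mat (matrix_wrt scale n c f) (matrix_wrt scale n b f)"
  proof (rule similar_matI)
    show "{matrix_wrt scale n c f, matrix_wrt scale n b f, Q, P} \<subseteq> carrier_mat n n"
      by (auto simp: matrix_wrt_def P_def Q_def)
    show "Q * P = 1\<^sub>m n"
    proof (rule eq_matI)
      fix i j assume "i < dim_row (1\<^sub>m n)" "j < dim_col (1\<^sub>m n)"
      hence ij: "i < n" "j < n" by auto
      have "(Q * P) $$ (i, j) = (\<Sum>l<n. representation (c ` {..<n}) (b l) (c i) * representation (b ` {..<n}) (c j) (b l))"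
        using ij by (simp add: Q_def P_def scalar_prod_def atLeast0LessThan)
      also have "\<dots> = representation (c ` {..<n}) (c j) (c i)"
        using rep[OF b c[unfolded m], of "\<lambda>x. x" "c j"] V(2)[OF ij(2)] by simp
      finally show "(Q * P) $$ (i, j) = 1\<^sub>m n $$ (i, j)" using ij by (simp add: cc)
    qed (auto simp: Q_def P_def)
    show "P * Q = 1\<^sub>m n"
    proof (rule eq_matI)
      fix i j assume "i < dim_row (1\<^sub>m n)" "j < dim_col (1\<^sub>m n)"
      hence ij: "i < n" "j < n" by auto
      have "(P * Q) $$ (i, j) = (\<Sum>l<n. representation (b ` {..<n}) (c l) (b i) * representation (c ` {..<n}) (b j) (c l))"
        using ij by (simp add: Q_def P_def scalar_prod_def atLeast0LessThan)
      also have "\<dots> = representation (b ` {..<n}) (b j) (b i)"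
        using rep[OF c[unfolded m] b, of "\<lambda>x. x" "b j"] V(1)[OF ij(2)] by simp
      finally show "(P * Q) $$ (i, j) = 1\<^sub>m n $$ (i, j)" using ij by (simp add: bb)
    qed (auto simp: Q_def P_def)
    show "matrix_wrt scale n c f = Q * matrix_wrt scale n b f * P"
    proof (rule eq_matI)
      fix i j assume "i < dim_row (Q * matrix_wrt scale n b f * P)" "j < dim_col (Q * matrix_wrt scale n b f * P)"
      hence ij: "i < n" "j < n" by (auto simp: Q_def P_def)
      have QA: "(Q * matrix_wrt scale n b f) $$ (i, l) = representation (c ` {..<n}) (f (b l)) (c i)" if l: "l < n" for l
      proof -
        have "(Q * matrix_wrt scale n b f) $$ (i, l) =
            (\<Sum>k<n. representation (c ` {..<n}) (b k) (c i) * representation (b ` {..<n}) (f (b l)) (b k))"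
          using ij l by (simp add: Q_def matrix_wrt_def scalar_prod_def atLeast0LessThan)
        also have "\<dots> = representation (c ` {..<n}) (f (b l)) (c i)"
          using rep[OF b c[unfolded m], of "\<lambda>x. x" "f (b l)"] f(1)[OF V(1)[OF l]] by simp
        finally show ?thesis .
      qed
      have "(Q * matrix_wrt scale n b f * P) $$ (i, j) = (\<Sum>l<n. (Q * matrix_wrt scale n b f) $$ (i, l) * P $$ (l, j))"
        using ij by (simp add: scalar_prod_def atLeast0LessThan P_def Q_def matrix_wrt_def del: index_mult_mat) (simp add: scalar_prod_def atLeast0LessThan)
      also have "\<dots> = (\<Sum>l<n. representation (c ` {..<n}) (f (b l)) (c i) * representation (b ` {..<n}) (c j) (b l))"
        using ij by (intro sum.cong refl) (simp add: QA P_def)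
      also have "\<dots> = representation (c ` {..<n}) (f (c j)) (c i)"
        using rep[OF b c[unfolded m] f] V(2)[OF ij(2)] by simp
      finally show "matrix_wrt scale n c f $$ (i, j) = (Q * matrix_wrt scale n b f * P) $$ (i, j)"
        using ij by (simp add: matrix_wrt_def)
    qed (auto simp: matrix_wrt_def Q_def P_def)
  qed
  thus "q = char_poly (matrix_wrt scale n b f)" unfolding q m by (rule char_poly_similar)
qed (use b in blast)

end

interpretation tangent: vector_space tangent_scale by (rule vector_space_tangent_scale)

context lie_setup
begin

lemma Emb_sum: "Emb (\<Sum>i\<in>I. x i) = (\<Sum>i\<in>I. Emb (x i))"
  by (induction I rule: infinite_finite_induct) (auto simp: Emb_linear)

lemma tangent_c0: "(t + t') c0 = t c0 + t' c0" "(tangent_scale a t) c0 = vscale a (t c0)" "(0 :: ('g, 'k) tangent) c0 = 0"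
  by (auto simp: tangent_scale_def vec_apply)

lemma subspace_L: "tangent.subspace L"
proof (rule tangent.subspaceI)
  fix t t' and a :: 'k
  show "0 \<in> L" by (rule zero_in_L)
  assume t: "t \<in> L"
  have "Emb (vscale a (t c0)) \<in> L" using t by (intro Emb_in_L coord_space_vscale L_coord)
  thus "tangent_scale a t \<in> L" using t by (simp add: Emb_linear Emb_surj)
  assume t': "t' \<in> L"
  have "Emb (t c0 + t' c0) \<in> L" using t t' by (intro Emb_in_L coord_space_add L_coord)
  thus "t + t' \<in> L" using t t' by (simp add: Emb_linear Emb_surj)
qed

definition bas :: "nat \<Rightarrow> ('g, 'k) tangent" where "bas i = Emb (unit_coord i)"

lemma bas_c0: "i < n \<Longrightarrow> bas i c0 = unit_coord i"
  by (simp add: bas_def Emb_c0 coord_space_unit)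

lemma inj_bas: "inj_on bas {..<n}"
proof (rule inj_onI)
  fix i j assume "i \<in> {..<n}" "j \<in> {..<n}" "bas i = bas j"
  hence "unit_coord i i = (unit_coord j i :: 'k)" using bas_c0[of i] bas_c0[of j] by simp
  thus "i = j" by (simp add: unit_coord_def split: if_splits)
qed

lemma bas_in_L: "i < n \<Longrightarrow> bas i \<in> L"
  by (simp add: bas_def Emb_in_L coord_space_unit)

lemma bas_expand: "t \<in> L \<Longrightarrow> t = (\<Sum>i<n. tangent_scale (t c0 i) (bas i))"
proof -
  assume t: "t \<in> L"
  have "t c0 = (\<Sum>i<n. vscale (t c0 i) (unit_coord i))" by (rule coord_space_expand[OF L_coord[OF t]])
  hence "Emb (t c0) = Emb (\<Sum>i<n. vscale (t c0 i) (unit_coord i))" by simp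
  thus ?thesis using t by (simp add: Emb_sum Emb_linear Emb_surj bas_def)
qed

lemma sum_bas_c0: "(\<Sum>i<n. tangent_scale (a i) (bas i)) c0 j = (if j < n then a j else 0)"
proof -
  have "(\<Sum>i<n. tangent_scale (a i) (bas i)) c0 j = (\<Sum>i<n. a i * unit_coord i j)"
    by (simp add: sum_fun_apply tangent_scale_def bas_c0)
  thus ?thesis by (auto simp: unit_coord_def if_distrib cong: if_cong)
qed

lemma ordered_basis_L: "ordered_basis tangent_scale L n bas"
  unfolding ordered_basis_def
proof (intro conjI)
  show "tangent.span (bas ` {..<n}) = L"
  proof
    show "tangent.span (bas ` {..<n}) \<subseteq> L" using bas_in_L by (intro tangent.span_minimal subspace_L) auto
    show "L \<subseteq> tangent.span (bas ` {..<n})"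
    proof
      fix t assume "t \<in> L"
      thus "t \<in> tangent.span (bas ` {..<n})"
        by (subst bas_expand, assumption) (intro tangent.span_sum tangent.span_scale tangent.span_base imageI)
    qed
  qed
  show "\<not> tangent.dependent (bas ` {..<n})"
  proof (rule tangent.independent_if_scalars_zero)
    fix f x assume s: "(\<Sum>x\<in>bas ` {..<n}. tangent_scale (f x) x) = 0" and x: "x \<in> bas ` {..<n}"
    obtain j where j: "j < n" "x = bas j" using x by blast
    have "(\<Sum>i<n. tangent_scale (f (bas i)) (bas i)) = 0" using s by (simp add: sum.reindex[OF inj_bas])
    hence "(\<Sum>i<n. tangent_scale (f (bas i)) (bas i)) c0 j = 0" by (simp add: vec_apply)
    thus "f x = 0" using j by (simp add: sum_bas_c0)
  qed simp
qed (rule inj_bas)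

lemma representation_bas:
  assumes t: "t \<in> L" and i: "i < n" shows "tangent.representation (bas ` {..<n}) t (bas i) = t c0 i"
proof -
  have ind: "tangent.independent (bas ` {..<n})" and sp: "tangent.span (bas ` {..<n}) = L"
    using ordered_basis_L by (auto simp: ordered_basis_def)
  define r where "r = tangent.representation (bas ` {..<n}) t"
  have "t = (\<Sum>y\<in>bas ` {..<n}. tangent_scale (r y) y)"
    unfolding r_def using tangent.sum_representation_eq[OF ind, of t "bas ` {..<n}"] t sp by simp
  also have "\<dots> = (\<Sum>l<n. tangent_scale (r (bas l)) (bas l))" by (simp add: sum.reindex[OF inj_bas])
  finally have eq: "t = (\<Sum>l<n. tangent_scale (r (bas l)) (bas l))" .
  have "t c0 i = r (bas i)" by (subst eq) (simp add: sum_bas_c0 i)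
  thus ?thesis by (simp add: r_def)
qed

lemma \<beta>_in_L: "t \<in> L \<Longrightarrow> \<beta> t \<in> L"
  using bij_\<beta> by (auto simp: bij_betw_def)

lemma root_abs_values_eq: "root_abs_values w tangent_scale L \<beta> = R n M"
proof -
  have "linear_char_poly tangent_scale L \<beta> = char_poly (matrix_wrt tangent_scale n bas \<beta>)"
  proof (rule tangent.linear_char_poly_eq[OF ordered_basis_L \<beta>_in_L])
    fix t t' a assume t: "t \<in> L"
    have "tangent_scale a t \<in> L" by (rule tangent.subspace_scale[OF subspace_L t])
    thus "\<beta> (tangent_scale a t) = tangent_scale a (\<beta> t)"
      using t by (simp add: \<beta>_eq L_coord tangent_c0 coord_space_vscale mat_app.scale Emb_linear)
    assume t': "t' \<in> L"
    thus "\<beta> (t + t') = \<beta> t + \<beta> t'"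
      using t by (simp add: \<beta>_eq L_coord tangent_c0 coord_space_add mat_app.add Emb_linear)
  qed
  also have "matrix_wrt tangent_scale n bas \<beta> = mat n n (\<lambda>(i, j). M i j)"
  proof (rule eq_matI)
    fix i j assume "i < dim_row (mat n n (\<lambda>(i, j). M i j))" "j < dim_col (mat n n (\<lambda>(i, j). M i j))"
    hence ij: "i < n" "j < n" by auto
    have "\<beta> (bas j) c0 = mat_app n M (unit_coord j)" using ij by (simp add: \<beta>_eq bas_c0 Emb_c0 coord_space_unit)
    hence "\<beta> (bas j) c0 i = M i j" using ij by (simp add: mat_app_unit)
    thus "matrix_wrt tangent_scale n bas \<beta> $$ (i, j) = mat n n (\<lambda>(i, j). M i j) $$ (i, j)"
      using ij representation_bas[OF \<beta>_in_L[OF bas_in_L[OF ij(2)]] ij(1)] by (simp add: matrix_wrt_def)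
  qed (auto simp: matrix_wrt_def)
  finally show ?thesis by (simp add: root_abs_values_def R_def roots_def)
qed

end

section \<open>The multiplication and the Lie bracket in coordinates\<close>

lemma append_coords_inject:
  assumes "x \<in> coord_space n" "x' \<in> coord_space n" "append_coords n x y = append_coords n x' y'"
  shows "x = x'" "y = y'"
proof -
  have e: "append_coords n x y i = append_coords n x' y' i" for i using assms(3) by simp
  show "x = x'"
  proof (rule coord_space_eqI[OF assms(1,2)])
    fix i assume "i < n" thus "x i = x' i" using e[of i] by (simp add: append_coords_def)
  qed
  show "y = y'"
  proof
    fix i show "y i = y' i" using e[of "i + n"] by (simp add: append_coords_def)
  qed
qed

lemma (in ultrametric) le_nrm_coord_space: "x \<in> coord_space n \<Longrightarrow> v (x i) \<le> nrm n x"
  by (cases "i < n") (auto simp: le_nrm coord_space_def)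

lemma (in ultrametric) v_le_0_iff: "v x \<le> 0 \<longleftrightarrow> x = 0"
  using nonneg[of x] zero_iff[of x] by linarith

lemma (in lf) tendsto_v_le:
  assumes "(f \<longlongrightarrow> l) F" "F \<noteq> bot" "eventually (\<lambda>s. v (f s - a) \<le> K) F"
  shows "v (l - a) \<le> K"
proof (rule ccontr)
  assume n: "\<not> v (l - a) \<le> K"
  have "\<exists>s. v (f s - a) \<le> K" using eventually_happens'[OF assms(2,3)] .
  hence "0 \<le> K" using nonneg order_trans by blast
  hence "0 < v (l - a)" using n by linarith
  hence "eventually (\<lambda>s. v (f s - l) < v (l - a)) F" using assms(1) unfolding tendsto_iff_v by blast
  hence "eventually (\<lambda>s. v (f s - a) \<le> K \<and> v (f s - l) < v (l - a)) F" using assms(3) by eventually_elim simp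
  then obtain s where s: "v (f s - a) \<le> K" "v (f s - l) < v (l - a)" using eventually_happens'[OF assms(2)] by blast
  have "l - a = (f s - a) - (f s - l)" by simp
  hence "v (l - a) \<le> max (v (f s - a)) (v (f s - l))" using ultra_diff by metis
  thus False using s n by linarith
qed

context lie_setup
begin

text \<open>The multiplication in the product chart of \<open>c0\<close> with itself. Together with
  \<open>Dmu\<close> it is spelled as in \<open>analytic_map\<close>, so that analyticity of the
  multiplication applies literally.\<close>

definition mu :: "(nat \<Rightarrow> 'k) \<Rightarrow> nat \<Rightarrow> 'k" where
  "mu = \<phi> \<circ> (\<lambda>(g, h). g \<otimes> h) \<circ> chart_inv (D0 \<times> D0, \<lambda>(g, h). append_coords n (\<phi> g) (\<phi> h))"

definition Dmu :: "(nat \<Rightarrow> 'k) set" where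
  "Dmu = (\<lambda>(g, h). append_coords n (\<phi> g) (\<phi> h)) ` (D0 \<times> D0 \<inter> (\<lambda>(g, h). g \<otimes> h) -` D0)"

lemma mu_analytic: "analytic_between (n + n) n mu Dmu"
proof -
  have 1: "(D0 \<times> D0, \<lambda>(g, h). append_coords n (\<phi> g) (\<phi> h)) \<in> product_atlas n A A"
    unfolding product_atlas_def D0_def \<phi>_def by (rule image_eqI[of _ _ "(c0, c0)"]) (auto simp: c0(1))
  have "analytic_map (n + n) (prod_topology T T) (product_atlas n A A) n T A (\<lambda>(x, y). x \<otimes> y)"
    using lie by (simp add: lie_group_def)
  from this[unfolded analytic_map_def, THEN conjunct2, rule_format, OF 1 c0(1)]
  show ?thesis by (simp add: mu_def Dmu_def \<phi>_def D0_def)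
qed

lemma mu_eq: "g \<in> D0 \<Longrightarrow> h \<in> D0 \<Longrightarrow> mu (append_coords n (\<phi> g) (\<phi> h)) = \<phi> (g \<otimes> h)"
proof -
  assume gh: "g \<in> D0" "h \<in> D0"
  have "inj_on (\<lambda>(g, h). append_coords n (\<phi> g) (\<phi> h)) (D0 \<times> D0)"
  proof (rule inj_onI, clarify)
    fix a a' c c' assume D: "a \<in> D0" "a' \<in> D0" "c \<in> D0" "c' \<in> D0"
      and e: "append_coords n (\<phi> a) (\<phi> a') = append_coords n (\<phi> c) (\<phi> c')"
    have "\<phi> a = \<phi> c" "\<phi> a' = \<phi> c'" using append_coords_inject[OF \<phi>_coord[OF D(1)] \<phi>_coord[OF D(3)] e] by auto
    thus "a = c \<and> a' = c'" using D \<psi>\<phi> by metis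
  qed
  from inv_into_f_f[OF this, of "(g, h)"] gh
  have "chart_inv (D0 \<times> D0, \<lambda>(g, h). append_coords n (\<phi> g) (\<phi> h)) (append_coords n (\<phi> g) (\<phi> h)) = (g, h)"
    by (simp add: chart_inv_def)
  thus ?thesis by (simp add: mu_def)
qed

lemma Dmu_D:
  assumes "append_coords n x y \<in> Dmu" "x \<in> coord_space n"
  shows "x \<in> \<phi> ` D0" "y \<in> \<phi> ` D0" "\<psi> x \<otimes> \<psi> y \<in> D0" "mu (append_coords n x y) = \<phi> (\<psi> x \<otimes> \<psi> y)"
proof -
  obtain g h where gh: "g \<in> D0" "h \<in> D0" "g \<otimes> h \<in> D0" "append_coords n x y = append_coords n (\<phi> g) (\<phi> h)"
    using assms(1) by (auto simp: Dmu_def)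
  have xy: "x = \<phi> g" "y = \<phi> h" using append_coords_inject[OF assms(2) \<phi>_coord[OF gh(1)] gh(4)] by auto
  show "x \<in> \<phi> ` D0" "y \<in> \<phi> ` D0" "\<psi> x \<otimes> \<psi> y \<in> D0" "mu (append_coords n x y) = \<phi> (\<psi> x \<otimes> \<psi> y)"
    using gh by (simp_all add: xy \<psi>\<phi> mu_eq)
qed

lemma Dmu_one: "g \<in> D0 \<Longrightarrow> append_coords n (\<phi> g) p \<in> Dmu"
  using c0(2) D0_carrier unfolding Dmu_def p_def by (intro image_eqI[of _ _ "(g, \<one>)"]) auto

text \<open>The mixed second difference of \<open>mu\<close> at the identity simplifies, because
  products with the identity contribute just \<open>p + x\<close>, \<open>p + y\<close> and
  \<open>p\<close>. The coefficients of its bilinear part are the family \<open>b\<close>.\<close>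

lemma mult_estimate:
  "\<exists>d C b. 0 < d \<and> 0 \<le> C \<and> (\<forall>x y. x \<in> coord_space n \<longrightarrow> y \<in> coord_space n \<longrightarrow> nrm n x \<le> d \<longrightarrow> nrm n y \<le> d \<longrightarrow>
     p + x \<in> \<phi> ` D0 \<and> \<psi> (p + x) \<otimes> \<psi> (p + y) \<in> D0 \<and>
     nrm n (\<phi> (\<psi> (p + x) \<otimes> \<psi> (p + y)) - p - x - y - bil_form n b x y) \<le> C * nrm n x * nrm n y * max (nrm n x) (nrm n y))"
proof -
  obtain d C b where d: "0 < d" "0 \<le> C" and est: "\<And>x y. x \<in> coord_space n \<Longrightarrow> y \<in> coord_space n \<Longrightarrow> nrm n x \<le> d \<Longrightarrow> nrm n y \<le> d \<Longrightarrow>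
      append_coords n (p + x) (p + y) \<in> Dmu \<and>
      (\<forall>i<n. v (mu (append_coords n (p + x) (p + y)) i - mu (append_coords n (p + x) p) i
        - mu (append_coords n p (p + y)) i + mu (append_coords n p p) i - (\<Sum>l<n. \<Sum>j<n. b i l j * (x l * y j)))
        \<le> C * nrm n x * nrm n y * max (nrm n x) (nrm n y))"
    using analytic_mixed_difference[OF mu_analytic Dmu_one[OF c0(2)[unfolded p_def[symmetric]], folded p_def] p_coord p_coord] by blast
  have "p + x \<in> \<phi> ` D0 \<and> \<psi> (p + x) \<otimes> \<psi> (p + y) \<in> D0 \<and>
     nrm n (\<phi> (\<psi> (p + x) \<otimes> \<psi> (p + y)) - p - x - y - bil_form n b x y) \<le> C * nrm n x * nrm n y * max (nrm n x) (nrm n y)"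
    if x: "x \<in> coord_space n" "y \<in> coord_space n" "nrm n x \<le> d" "nrm n y \<le> d" for x y
  proof -
    have px: "p + x \<in> coord_space n" using x(1) p_coord by (rule coord_space_add[rotated])
    note D = Dmu_D[OF conjunct1[OF est[OF x]] px]
    have carr: "\<psi> (p + x) \<in> carrier G" "\<psi> (p + y) \<in> carrier G" using D \<psi>_D0 D0_carrier by blast+
    have "mu (append_coords n (p + x) p) = p + x" "mu (append_coords n p (p + y)) = p + y" "mu (append_coords n p p) = p"
      using mu_eq[OF \<psi>_D0[OF D(1)] c0(2)] mu_eq[OF c0(2) \<psi>_D0[OF D(2)]] mu_eq[OF c0(2) c0(2)] D(1,2) carr
      by (simp_all add: p_def[symmetric] \<phi>\<psi>)
    hence "v ((\<phi> (\<psi> (p + x) \<otimes> \<psi> (p + y)) - p - x - y - bil_form n b x y) i) \<le> C * nrm n x * nrm n y * max (nrm n x) (nrm n y)"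
      if "i < n" for i
      using conjunct2[OF est[OF x], rule_format, OF that] that D(4) by (simp add: vec_apply bil_form_def algebra_simps)
    moreover have "0 \<le> C * nrm n x * nrm n y * max (nrm n x) (nrm n y)" using d(2) by (simp add: le_max_iff_disj)
    ultimately have "nrm n (\<phi> (\<psi> (p + x) \<otimes> \<psi> (p + y)) - p - x - y - bil_form n b x y) \<le> C * nrm n x * nrm n y * max (nrm n x) (nrm n y)"
      unfolding nrm_le_iff by blast
    thus ?thesis using D(1,3) by blast
  qed
  thus ?thesis using d by blast
qed

text \<open>The left translation by \<open>g\<close> is differentiated as \<open>mu\<close> at the
  point with the coordinates of \<open>g\<close> and of the identity, in a direction that varies
  only the second argument.\<close>

lemma translation_limit:
  assumes g: "g \<in> D0" and y: "y \<in> coord_space n"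
  shows "((\<lambda>s. (\<phi> (g \<otimes> \<psi> (\<lambda>j. p j + s * y j)) i - \<phi> g i) / s) \<longlongrightarrow> differential (\<phi> \<circ> (\<lambda>h. g \<otimes> h) \<circ> \<psi>) p y i) (at 0)"
proof -
  define P where "P = append_coords n (\<phi> g) p"
  define Y where "Y = append_coords n 0 y"
  have P: "P \<in> Dmu" unfolding P_def by (rule Dmu_one[OF g])
  have Y: "Y \<in> coord_space (n + n)" using y by (auto simp: Y_def append_coords_def coord_space_def)
  obtain d where d: "0 < d" "\<And>h. h \<in> coord_space (n + n) \<Longrightarrow> nrm (n + n) h \<le> d \<Longrightarrow> P + h \<in> Dmu"
    using analytic_derivative[OF mu_analytic P] by blast
  have PY: "(\<lambda>j. P j + s * Y j) = append_coords n (\<phi> g) (\<lambda>j. p j + s * y j)" for s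
    by (auto simp: P_def Y_def append_coords_def vec_apply)
  have n1: "0 < nrm (n + n) Y + 1" by (simp add: add_nonneg_pos)
  have g1: "g \<in> carrier G" using g D0_carrier by blast
  have "eventually (\<lambda>s. (mu (\<lambda>j. P j + s * Y j) i - mu P i) / s = (\<phi> (g \<otimes> \<psi> (\<lambda>j. p j + s * y j)) i - \<phi> g i) / s) (at 0)"
    unfolding eventually_at_0
  proof (intro exI[of _ "d / (nrm (n + n) Y + 1)"] conjI allI impI)
    show "0 < d / (nrm (n + n) Y + 1)" using d(1) n1 by simp
    fix s assume s: "s \<noteq> 0 \<and> v s < d / (nrm (n + n) Y + 1)"
    hence "v s * (nrm (n + n) Y + 1) < d" using n1 by (simp add: pos_less_divide_eq)
    moreover have "v s * nrm (n + n) Y \<le> v s * (nrm (n + n) Y + 1)" by (intro mult_left_mono) auto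
    ultimately have "nrm (n + n) (vscale s Y) \<le> d" by simp
    hence "P + vscale s Y \<in> Dmu" using Y by (intro d(2) coord_space_vscale)
    moreover have "P + vscale s Y = (\<lambda>j. P j + s * Y j)" by (auto simp: vec_apply)
    ultimately have "append_coords n (\<phi> g) (\<lambda>j. p j + s * y j) \<in> Dmu" by (simp add: PY)
    note D = Dmu_D[OF this \<phi>_coord[OF g]]
    have "mu P = \<phi> g" using mu_eq[OF g c0(2)] g1 by (simp add: P_def p_def)
    thus "(mu (\<lambda>j. P j + s * Y j) i - mu P i) / s = (\<phi> (g \<otimes> \<psi> (\<lambda>j. p j + s * y j)) i - \<phi> g i) / s"
      unfolding PY D(4) using g by (simp add: \<psi>\<phi>)
  qed
  from tendsto_cong[THEN iffD1, OF this differential_limit(1)[OF mu_analytic P Y]]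
  have lim: "((\<lambda>s. (\<phi> (g \<otimes> \<psi> (\<lambda>j. p j + s * y j)) i - \<phi> g i) / s) \<longlongrightarrow> differential mu P Y i) (at 0)" .
  have "differential (\<phi> \<circ> (\<lambda>h. g \<otimes> h) \<circ> \<psi>) p y i = differential mu P Y i"
    unfolding differential_def[of _ p] using lim g1 by (intro tendsto_Lim) (auto simp: \<psi>_p)
  thus ?thesis using lim by simp
qed

lemma left_invariant_field_in_chart:
  assumes "u \<in> \<phi> ` D0"
  shows "vector_field_in_chart (left_invariant_field G A t) c0 u = differential (\<phi> \<circ> (\<lambda>h. \<psi> u \<otimes> h) \<circ> \<psi>) p (t c0)"
proof -
  have "\<psi> u \<in> D0" using assms by (rule \<psi>_D0)
  hence "c0 \<in> charts_at A (\<psi> u \<otimes> \<one>)" using D0_carrier c0(1) by (auto simp: charts_at_def D0_def)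
  thus ?thesis
    by (simp add: vector_field_in_chart_def left_invariant_field_def tangent_map_def Let_def c0_def[symmetric] \<psi>_def[symmetric] \<phi>_def[symmetric] p_def[symmetric])
qed

end

locale lie_product = lie_setup v w G n T A \<alpha>
  for v :: "'k::local_field \<Rightarrow> real" and w :: "'k alg_closure \<Rightarrow> real" and G :: "('g, 'm) monoid_scheme" (structure)
    and n :: nat and T :: "'g topology" and A :: "('g, 'k) chart set" and \<alpha> :: "'g \<Rightarrow> 'g" +
  fixes d C :: real and b :: "nat \<Rightarrow> nat \<Rightarrow> nat \<Rightarrow> 'k"
  assumes d: "0 < d" and C: "0 \<le> C"
    and prod_D0: "x \<in> coord_space n \<Longrightarrow> y \<in> coord_space n \<Longrightarrow> nrm n x \<le> d \<Longrightarrow> nrm n y \<le> d \<Longrightarrow>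
       p + x \<in> \<phi> ` D0 \<and> \<psi> (p + x) \<otimes> \<psi> (p + y) \<in> D0"
    and prod_le: "x \<in> coord_space n \<Longrightarrow> y \<in> coord_space n \<Longrightarrow> nrm n x \<le> d \<Longrightarrow> nrm n y \<le> d \<Longrightarrow>
       nrm n (\<phi> (\<psi> (p + x) \<otimes> \<psi> (p + y)) - p - x - y - bil_form n b x y) \<le> C * nrm n x * nrm n y * max (nrm n x) (nrm n y)"
begin

lemma ball_D0: "x \<in> coord_space n \<Longrightarrow> nrm n x \<le> d \<Longrightarrow> p + x \<in> \<phi> ` D0"
  using prod_D0[of x 0] d by simp

text \<open>The product estimate for the arguments \<open>x\<close> and \<open>vscale s y\<close>,
  divided by \<open>s\<close>, has an error quadratic in \<open>x\<close>. The limit gives the left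
  invariant field at \<open>p + x\<close> up to this error.\<close>

lemma field_estimate:
  assumes x: "x \<in> coord_space n" "nrm n x \<le> d" and y: "y \<in> coord_space n"
  shows "v (differential (\<phi> \<circ> (\<lambda>h. \<psi> (p + x) \<otimes> h) \<circ> \<psi>) p y i - (y i + bil_form n b x y i)) \<le> C * nrm n x * nrm n x * nrm n y"
proof (rule tendsto_v_le[OF translation_limit[OF \<psi>_D0[OF ball_D0[OF x]] y]])
  \<comment> \<open>Besides staying in the ball, \<open>vscale s y\<close> is kept no longer than
    \<open>x\<close>, so that the maximum in the product estimate is \<open>nrm n x\<close>. If
    \<open>x\<close> has norm 0, the error bound is 0 anyway, and 1 is a placeholder.\<close>
  define r where "r = min d (if nrm n x = 0 then 1 else nrm n x) / (nrm n y + 1)"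
  have n1: "0 < nrm n y + 1" by (simp add: add_nonneg_pos)
  have r: "0 < r" using d n1 by (auto simp: r_def less_le)
  show "eventually (\<lambda>s. v ((\<phi> (\<psi> (p + x) \<otimes> \<psi> (\<lambda>j. p j + s * y j)) i - \<phi> (\<psi> (p + x)) i) / s - (y i + bil_form n b x y i))
      \<le> C * nrm n x * nrm n x * nrm n y) (at 0)"
    unfolding eventually_at_0
  proof (intro exI[of _ r] conjI allI impI)
    fix s assume s: "s \<noteq> 0 \<and> v s < r"
    hence s1: "v s * (nrm n y + 1) < min d (if nrm n x = 0 then 1 else nrm n x)" using n1 by (simp add: r_def pos_less_divide_eq)
    have "v s * nrm n y \<le> v s * (nrm n y + 1)" by (intro mult_left_mono) auto
    hence sy: "nrm n (vscale s y) \<le> d" "nrm n x \<noteq> 0 \<Longrightarrow> nrm n (vscale s y) \<le> nrm n x" using s1 by (auto split: if_splits)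
    have syc: "vscale s y \<in> coord_space n" using y by (rule coord_space_vscale)
    define E where "E = \<phi> (\<psi> (p + x) \<otimes> \<psi> (p + vscale s y)) - p - x - vscale s y - bil_form n b x (vscale s y)"
    have PD: "\<psi> (p + x) \<otimes> \<psi> (p + vscale s y) \<in> D0" using prod_D0[OF x(1) syc x(2) sy(1)] by blast
    have E: "E \<in> coord_space n" unfolding E_def
      by (intro coord_space_diff \<phi>_coord PD p_coord x syc coord_space_bil_form)
    have "nrm n E \<le> C * nrm n x * nrm n (vscale s y) * max (nrm n x) (nrm n (vscale s y))"
      unfolding E_def by (rule prod_le[OF x(1) syc x(2) sy(1)])
    also have "\<dots> \<le> C * nrm n x * nrm n (vscale s y) * nrm n x"
    proof (cases "nrm n x = 0")
      case False
      show ?thesis using sy(2)[OF False] C by (intro mult_left_mono) auto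
    qed simp
    finally have "nrm n E \<le> v s * (C * nrm n x * nrm n x * nrm n y)" by (simp add: mult_ac)
    hence Ei: "v (E i) \<le> v s * (C * nrm n x * nrm n x * nrm n y)" using le_nrm_coord_space[OF E] order_trans by blast
    have ps: "(\<lambda>j. p j + s * y j) = p + vscale s y" by (auto simp: vec_apply)
    have s0: "s \<noteq> 0" using s by simp
    have "(\<phi> (\<psi> (p + x) \<otimes> \<psi> (p + vscale s y)) i - \<phi> (\<psi> (p + x)) i) / s - (y i + bil_form n b x y i) = E i / s"
      using s0 \<phi>\<psi>[OF ball_D0[OF x]] by (simp add: E_def vec_apply bil_form_linear field_simps)
    moreover have "v (E i / s) \<le> C * nrm n x * nrm n x * nrm n y"
      using Ei s0 by (simp add: divide pos_divide_le_eq mult_ac)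
    ultimately show "v ((\<phi> (\<psi> (p + x) \<otimes> \<psi> (\<lambda>j. p j + s * y j)) i - \<phi> (\<psi> (p + x)) i) / s - (y i + bil_form n b x y i))
      \<le> C * nrm n x * nrm n x * nrm n y" unfolding ps by simp
  qed (rule r)
qed simp

lemma field_at_one:
  "t c0 \<in> coord_space n \<Longrightarrow> left_invariant_field G A t \<one> c0 = t c0"
proof
  fix i assume t: "t c0 \<in> coord_space n"
  have "v (differential (\<phi> \<circ> (\<lambda>h. \<psi> (p + 0) \<otimes> h) \<circ> \<psi>) p (t c0) i - (t c0 i + bil_form n b 0 (t c0) i)) \<le> 0"
    using field_estimate[of 0 "t c0" i] t d by (simp add: L_coord)
  hence "differential (\<phi> \<circ> (\<lambda>h. \<psi> p \<otimes> h) \<circ> \<psi>) p (t c0) i = t c0 i" by (simp add: vec_apply v_le_0_iff)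
  moreover have "vector_field_in_chart (left_invariant_field G A t) c0 p = left_invariant_field G A t \<one> c0"
    by (simp add: vector_field_in_chart_def \<psi>_def[symmetric] \<psi>_p)
  moreover have "p \<in> \<phi> ` D0" using c0(2) by (simp add: p_def)
  ultimately show "left_invariant_field G A t \<one> c0 i = t c0 i" using left_invariant_field_in_chart[of p t] by simp
qed

text \<open>Only the part of the field that is linear in the displacement contributes, the remainder
  being quadratic.\<close>

lemma differential_field:
  assumes t: "t c0 \<in> coord_space n" and x: "x \<in> coord_space n"
  shows "differential (vector_field_in_chart (left_invariant_field G A t) c0) p x = bil_form n b x (t c0)"
proof
  fix i
  define W where "W = vector_field_in_chart (left_invariant_field G A t) c0"
  define y where "y = t c0"
  have y: "y \<in> coord_space n" using t by (simp add: y_def)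
  have W: "v (W (p + h) i - (y i + bil_form n b h y i)) \<le> C * nrm n h * nrm n h * nrm n y"
    if "h \<in> coord_space n" "nrm n h \<le> d" for h
    unfolding W_def left_invariant_field_in_chart[OF ball_D0[OF that]] y_def[symmetric] by (rule field_estimate[OF that y])
  have "v (W (p + 0) i - (y i + bil_form n b 0 y i)) \<le> 0" using W[of 0] d by simp
  hence Wp: "W p i = y i" by (simp add: vec_apply v_le_0_iff)
  define K where "K = nrm n x + C * nrm n x * nrm n x * nrm n y + 1"
  have K: "0 < K" "nrm n x \<le> K" "C * nrm n x * nrm n x * nrm n y \<le> K"
    using C by (auto simp: K_def add_nonneg_pos add_nonneg_nonneg)
  have "((\<lambda>s. (W (\<lambda>j. p j + s * x j) i - W p i) / s) \<longlongrightarrow> bil_form n b x y i) (at 0)"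
    unfolding tendsto_iff_v eventually_at_0
  proof (intro allI impI)
    fix e :: real assume e: "0 < e"
    show "\<exists>r>0. \<forall>s. s \<noteq> 0 \<and> v s < r \<longrightarrow> v ((W (\<lambda>j. p j + s * x j) i - W p i) / s - bil_form n b x y i) < e"
    proof (intro exI[of _ "min d e / K"] conjI allI impI)
      show "0 < min d e / K" using d e K by simp
      fix s assume s: "s \<noteq> 0 \<and> v s < min d e / K"
      hence sK: "v s * K < d" "v s * K < e" and s0: "s \<noteq> 0" using K(1) by (auto simp: pos_less_divide_eq)
      have "v s * nrm n x \<le> v s * K" using K(2) by (intro mult_left_mono) auto
      hence "nrm n (vscale s x) \<le> d" using sK by simp
      from W[OF coord_space_vscale[OF x] this]
      have "v (W (p + vscale s x) i - (y i + s * bil_form n b x y i)) \<le> v s * (v s * (C * nrm n x * nrm n x * nrm n y))"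
        by (simp add: bil_form_linear vec_apply mult_ac)
      also have "\<dots> \<le> v s * (v s * K)" using K(3) by (intro mult_left_mono) auto
      finally have "v (W (p + vscale s x) i - (y i + s * bil_form n b x y i)) / v s \<le> v s * K"
        using s0 by (simp add: pos_divide_le_eq mult_ac)
      hence "v ((W (p + vscale s x) i - (y i + s * bil_form n b x y i)) / s) \<le> v s * K" by (simp add: divide)
      moreover have "(W (p + vscale s x) i - (y i + s * bil_form n b x y i)) / s = (W (p + vscale s x) i - W p i) / s - bil_form n b x y i"
        using s0 by (simp add: Wp field_simps)
      moreover have "(\<lambda>j. p j + s * x j) = p + vscale s x" by (auto simp: vec_apply)
      ultimately show "v ((W (\<lambda>j. p j + s * x j) i - W p i) / s - bil_form n b x y i) < e" using sK(2) by simp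
    qed
  qed
  thus "differential (vector_field_in_chart (left_invariant_field G A t) c0) p x i = bil_form n b x (t c0) i"
    unfolding differential_def W_def y_def by (intro tendsto_Lim) auto
qed

lemma lie_bracket_c0:
  assumes "t c0 \<in> coord_space n" "t' c0 \<in> coord_space n"
  shows "lie_bracket G A t t' c0 = bil_form n b (t c0) (t' c0) - bil_form n b (t' c0) (t c0)"
  using assms by (simp add: lie_bracket_def vector_field_bracket_def c0_at field_at_one \<phi>_def[symmetric] p_def[symmetric] differential_field L_coord)

end

text \<open>Brackets are computed only in the chart \<open>c0\<close>. A vector with zero
  coordinates there generates the zero field, which makes the bracket vanish in every chart and ends
  the lower central series.\<close>

lemma (in lie_setup) lie_bracket_zero:
  assumes "t' c0 = 0" shows "lie_bracket G A t t' = 0"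
proof -
  have "left_invariant_field G A t' g = 0" for g
    by (auto simp: left_invariant_field_def tangent_map_def c0_def[symmetric] assms differential_zero_vector zero_fun_apply fun_eq_iff Let_def)
  hence 0: "left_invariant_field G A t' = 0" by (auto intro!: ext[of "left_invariant_field G A t'" 0] simp: zero_fun_apply)
  have "differential (vector_field_in_chart 0 c) q x = 0" for c :: "('g, 'k) chart" and q x
  proof
    fix i
    have "Lim (at 0) (\<lambda>s::'k. 0) = (0::'k)" by (intro tendsto_Lim) auto
    thus "differential (vector_field_in_chart 0 c) q x i = 0 i"
      by (simp add: differential_def vector_field_in_chart_def vec_apply)
  qed
  thus ?thesis
    by (intro ext[of "lie_bracket G A t t'" 0])
      (simp add: lie_bracket_def vector_field_bracket_def 0 differential_zero_vector zero_fun_apply)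
qed

section \<open>Rescaling to the unit ball\<close>

text \<open>Continuity of the inversion gives this rough bound. It allows the product estimate to be
  applied to an element and its inverse, which then yields the sharp size.\<close>

lemma (in lie_setup) inv_estimate:
  assumes "0 < d"
  shows "\<exists>e>0. \<forall>x\<in>coord_space n. nrm n x < e \<longrightarrow> inv (\<psi> (p + x)) \<in> D0 \<and> nrm n (\<phi> (inv (\<psi> (p + x))) - p) < d"
proof -
  define S where "S = {g \<in> D0. nrm n (\<phi> g - p) < d}"
  have S: "openin T S" unfolding S_def D0_def \<phi>_def by (rule chart_ball_open[OF manifold c0(1)])
  have "continuous_map T T (\<lambda>x. inv x)" using lie by (simp add: lie_group_def analytic_map_def)
  hence "openin T {g \<in> topspace T. inv g \<in> S}" using S by (rule openin_continuous_map_preimage)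
  moreover have "\<one> \<in> {g \<in> topspace T. inv g \<in> S}" using c0(2) assms by (simp add: S_def topspace_T p_def)
  ultimately obtain e where e: "e > 0" "\<forall>x\<in>coord_space n. nrm n (x - p) < e \<longrightarrow> x \<in> \<phi> ` D0 \<and> \<psi> x \<in> {g \<in> topspace T. inv g \<in> S} \<inter> D0"
    using nbhd by blast
  have "inv (\<psi> (p + x)) \<in> S" if "x \<in> coord_space n" "nrm n x < e" for x
    using e(2)[rule_format, of "p + x"] that p_coord by (simp add: coord_space_add)
  thus ?thesis using e(1) unfolding S_def by blast
qed

text \<open>The scale \<open>s\<close> is so small that the rescaled structure constants are at most
  1, that the cubic error of the product has constant at most 1, and that inverses of elements of
  the ball of radius \<open>v s\<close> are within reach of the product estimate.\<close>

locale lie_scaled = lie_product v w G n T A \<alpha> d C b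
  for v :: "'k::local_field \<Rightarrow> real" and w :: "'k alg_closure \<Rightarrow> real" and G :: "('g, 'm) monoid_scheme" (structure)
    and n :: nat and T :: "'g topology" and A :: "('g, 'k) chart set" and \<alpha> :: "'g \<Rightarrow> 'g"
    and d C :: real and b :: "nat \<Rightarrow> nat \<Rightarrow> nat \<Rightarrow> 'k" +
  fixes s :: 'k
  assumes s0: "s \<noteq> 0" and s_le: "v s \<le> d" "C * d * v s < 1"
    and s_b: "i < n \<Longrightarrow> l < n \<Longrightarrow> j < n \<Longrightarrow> v (s * b i l j) \<le> 1"
    and s_inv: "x \<in> coord_space n \<Longrightarrow> nrm n x < v s \<Longrightarrow> inv (\<psi> (p + x)) \<in> D0 \<and> nrm n (\<phi> (inv (\<psi> (p + x))) - p) < d"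
begin

definition H :: "'g set" where "H = {g \<in> D0. nrm n (\<phi> g - p) < v s}"
definition \<kappa> :: "'g \<Rightarrow> nat \<Rightarrow> 'k" where "\<kappa> g = vscale (inverse s) (\<phi> g - p)"
text \<open>Cut off outside the range so that the bound by 1 holds for all indices.\<close>

definition b1 :: "nat \<Rightarrow> nat \<Rightarrow> nat \<Rightarrow> 'k" where "b1 = (\<lambda>i l j. if i < n \<and> l < n \<and> j < n then s * b i l j else 0)"

lemma b1_le: "v (b1 i l j) \<le> 1"
  by (simp add: b1_def s_b)

lemma bil_form_b1: "bil_form n b1 x y = vscale s (bil_form n b x y)"
  by (auto simp: bil_form_def b1_def vec_apply sum_distrib_left mult_ac)

lemma bil_form_b1_le: "nrm n (bil_form n b1 x y) \<le> nrm n x * nrm n y"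
  using bil_form_le[of b1 1 n x y] b1_le by simp

lemma s_pos: "0 < v s"
  using s0 by simp

lemma nrm_\<kappa>: "nrm n (\<phi> g - p) = v s * nrm n (\<kappa> g)"
  using s_pos by (simp add: \<kappa>_def inverse)

lemma \<kappa>_less: "g \<in> H \<Longrightarrow> nrm n (\<kappa> g) < 1"
  using s_pos by (simp add: H_def nrm_\<kappa>)

lemma \<phi>_\<kappa>: "\<phi> g = p + vscale s (\<kappa> g)"
  using s0 by (auto simp: \<kappa>_def vec_apply)

lemma \<kappa>_coord: "g \<in> D0 \<Longrightarrow> \<kappa> g \<in> coord_space n"
  unfolding \<kappa>_def by (intro coord_space_vscale coord_space_diff \<phi>_coord p_coord)

lemma H_D0: "g \<in> H \<Longrightarrow> g \<in> D0" and H_carrier: "g \<in> H \<Longrightarrow> g \<in> carrier G"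
  using D0_carrier by (auto simp: H_def)

lemma \<psi>_\<kappa>: "g \<in> H \<Longrightarrow> \<psi> (p + vscale s (\<kappa> g)) = g"
  by (simp add: \<phi>_\<kappa>[symmetric] \<psi>\<phi> H_D0)

lemma \<kappa>_small:
  assumes "g \<in> H"
  shows "vscale s (\<kappa> g) \<in> coord_space n" "nrm n (vscale s (\<kappa> g)) < v s" "nrm n (vscale s (\<kappa> g)) \<le> d"
proof -
  show "vscale s (\<kappa> g) \<in> coord_space n" by (intro coord_space_vscale \<kappa>_coord H_D0 assms)
  show 1: "nrm n (vscale s (\<kappa> g)) < v s" using assms by (simp add: H_def nrm_\<kappa>)
  show "nrm n (vscale s (\<kappa> g)) \<le> d" using 1 s_le(1) by linarith
qed

lemma \<kappa>_mult:
  assumes g: "g \<in> H" and h: "h \<in> H"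
  shows "g \<otimes> h \<in> H" "nrm n (\<kappa> (g \<otimes> h) - \<kappa> g - \<kappa> h - bil_form n b1 (\<kappa> g) (\<kappa> h))
      \<le> nrm n (\<kappa> g) * nrm n (\<kappa> h) * max (nrm n (\<kappa> g)) (nrm n (\<kappa> h))"
proof -
  note sm = \<kappa>_small(1)[OF g] \<kappa>_small(1)[OF h] \<kappa>_small(3)[OF g] \<kappa>_small(3)[OF h]
  have D: "g \<otimes> h \<in> D0" using prod_D0[OF sm] by (simp add: \<psi>_\<kappa> g h)
  define E where "E = \<kappa> (g \<otimes> h) - \<kappa> g - \<kappa> h - bil_form n b1 (\<kappa> g) (\<kappa> h)"
  have "\<phi> (g \<otimes> h) - p - vscale s (\<kappa> g) - vscale s (\<kappa> h) - bil_form n b (vscale s (\<kappa> g)) (vscale s (\<kappa> h)) = vscale s E"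
    by (simp add: E_def \<phi>_\<kappa>[of "g \<otimes> h"] bil_form_linear bil_form_b1 vscale.scale_right_diff_distrib)
  with prod_le[OF sm] have "v s * nrm n E \<le> C * (v s * nrm n (\<kappa> g)) * (v s * nrm n (\<kappa> h)) * max (v s * nrm n (\<kappa> g)) (v s * nrm n (\<kappa> h))"
    by (simp add: \<psi>_\<kappa> g h)
  also have "max (v s * nrm n (\<kappa> g)) (v s * nrm n (\<kappa> h)) = v s * max (nrm n (\<kappa> g)) (nrm n (\<kappa> h))"
    using s_pos by (simp add: max_def)
  also have "C * (v s * nrm n (\<kappa> g)) * (v s * nrm n (\<kappa> h)) * (v s * max (nrm n (\<kappa> g)) (nrm n (\<kappa> h))) =
      v s * ((C * v s * v s) * (nrm n (\<kappa> g) * nrm n (\<kappa> h) * max (nrm n (\<kappa> g)) (nrm n (\<kappa> h))))" by (simp add: mult_ac)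
  finally have "nrm n E \<le> (C * v s * v s) * (nrm n (\<kappa> g) * nrm n (\<kappa> h) * max (nrm n (\<kappa> g)) (nrm n (\<kappa> h)))"
    using s_pos by simp
  also have "\<dots> \<le> 1 * (nrm n (\<kappa> g) * nrm n (\<kappa> h) * max (nrm n (\<kappa> g)) (nrm n (\<kappa> h)))"
  proof (rule mult_right_mono)
    have "C * v s * v s \<le> C * d * v s" using C s_le by (intro mult_right_mono mult_left_mono) auto
    thus "C * v s * v s \<le> 1" using s_le by simp
  qed (simp add: le_max_iff_disj)
  finally show E: "nrm n (\<kappa> (g \<otimes> h) - \<kappa> g - \<kappa> h - bil_form n b1 (\<kappa> g) (\<kappa> h))
      \<le> nrm n (\<kappa> g) * nrm n (\<kappa> h) * max (nrm n (\<kappa> g)) (nrm n (\<kappa> h))" by (simp add: E_def)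
  define t where "t = max (nrm n (\<kappa> g)) (nrm n (\<kappa> h))"
  have t: "0 \<le> t" "t < 1" "nrm n (\<kappa> g) \<le> t" "nrm n (\<kappa> h) \<le> t" using \<kappa>_less[OF g] \<kappa>_less[OF h] by (auto simp: t_def le_max_iff_disj)
  have tt: "t * t \<le> t" using t mult_right_mono[of t 1 t] by simp
  have gh: "nrm n (\<kappa> g) * nrm n (\<kappa> h) \<le> t * t" using t by (intro mult_mono) auto
  have "nrm n (\<kappa> g) * nrm n (\<kappa> h) * t \<le> t * t" using gh t mult_mono[OF gh, of t 1] by simp
  hence "nrm n (\<kappa> (g \<otimes> h) - \<kappa> g - \<kappa> h - bil_form n b1 (\<kappa> g) (\<kappa> h)) \<le> t" using E tt by (simp add: t_def)
  moreover have "nrm n (bil_form n b1 (\<kappa> g) (\<kappa> h)) \<le> t" using bil_form_b1_le[of "\<kappa> g" "\<kappa> h"] gh tt by linarith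
  ultimately have "nrm n ((\<kappa> (g \<otimes> h) - \<kappa> g - \<kappa> h - bil_form n b1 (\<kappa> g) (\<kappa> h)) + bil_form n b1 (\<kappa> g) (\<kappa> h) + \<kappa> h + \<kappa> g) \<le> t"
    using t by (intro nrm_add_le)
  hence "nrm n (\<kappa> (g \<otimes> h)) \<le> t" by simp
  hence "nrm n (\<kappa> (g \<otimes> h)) < 1" using t by simp
  thus "g \<otimes> h \<in> H" using D s_pos by (simp add: H_def nrm_\<kappa>)
qed

lemma \<kappa>_one: "\<kappa> \<one> = 0" and one_H: "\<one> \<in> H"
  using c0(2) s_pos by (simp_all add: \<kappa>_def H_def p_def[symmetric])

text \<open>With \<open>y\<close> the coordinates of the inverse, both the error term and the
  bilinear term of the product estimate at \<open>x\<close> and \<open>y\<close> are strictly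
  smaller than \<open>y\<close> unless \<open>y = 0\<close>. Then so is \<open>x + y\<close>, which
  forces \<open>x\<close> and \<open>y\<close> to have equal norm.\<close>

lemma inv_H:
  assumes g: "g \<in> H" shows "inv g \<in> H"
proof -
  define x where "x = vscale s (\<kappa> g)"
  define y where "y = \<phi> (inv g) - p"
  note x = \<kappa>_small[OF g, folded x_def]
  have px: "\<psi> (p + x) = g" unfolding x_def by (rule \<psi>_\<kappa>[OF g])
  have D: "inv g \<in> D0" and yd: "nrm n y < d" using s_inv[OF x(1,2)] by (simp_all add: px y_def)
  have y: "y \<in> coord_space n" unfolding y_def by (intro coord_space_diff \<phi>_coord D p_coord)
  have py: "\<psi> (p + y) = inv g" using D by (simp add: y_def \<psi>\<phi>)
  have "nrm n y < v s"
  proof (cases "y = 0")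
    case False
    hence y0: "0 < nrm n y" using nrm_eq_0[OF y] nrm_nonneg[of n y] by linarith
    have "nrm n (- x - y - bil_form n b x y) \<le> C * nrm n x * nrm n y * max (nrm n x) (nrm n y)"
      using prod_le[OF x(1) y x(3)] yd H_carrier[OF g] c0(2) by (simp add: px py p_def[symmetric])
    also have "\<dots> \<le> C * nrm n x * nrm n y * d" using C x(3) yd by (intro mult_left_mono) auto
    also have "\<dots> = (C * d * nrm n x) * nrm n y" by simp
    also have "\<dots> < 1 * nrm n y"
    proof (rule mult_strict_right_mono[OF _ y0])
      have "C * d * nrm n x \<le> C * d * v s" using C d x(2) by (intro mult_left_mono) auto
      thus "C * d * nrm n x < 1" using s_le by simp
    qed
    finally have 1: "nrm n (- x - y - bil_form n b x y) < nrm n y" by simp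
    have "v s * nrm n (bil_form n b x y) \<le> nrm n x * nrm n y" using bil_form_b1_le[of x y] by (simp add: bil_form_b1)
    also have "\<dots> < v s * nrm n y" using x(2) y0 by (intro mult_strict_right_mono)
    finally have 2: "nrm n (bil_form n b x y) < nrm n y" using s_pos by simp
    have "nrm n ((- x - y - bil_form n b x y) + bil_form n b x y) \<le> max (nrm n (- x - y - bil_form n b x y)) (nrm n (bil_form n b x y))"
      by (rule nrm_add)
    hence "nrm n (- x - y) < nrm n y" using 1 2 by simp
    hence "nrm n (- x) = nrm n y" by (rule nrm_diff_eq_of_less)
    thus ?thesis using x(2) by simp
  qed (simp add: s0)
  thus ?thesis using D by (simp add: H_def y_def)
qed

lemma bij_\<kappa>: "bij_betw \<kappa> H {h \<in> coord_space n. nrm n h < 1}"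
proof (rule bij_betwI[where g = "\<lambda>h. \<psi> (p + vscale s h)"])
  show "\<kappa> \<in> H \<rightarrow> {h \<in> coord_space n. nrm n h < 1}" using \<kappa>_less \<kappa>_coord H_D0 by auto
  have *: "p + vscale s h \<in> \<phi> ` D0 \<and> nrm n (vscale s h) < v s" if "h \<in> coord_space n" "nrm n h < 1" for h
  proof -
    have "v s * nrm n h < v s * 1" using that(2) s_pos by (rule mult_strict_left_mono)
    thus ?thesis using that(1) s_le by (auto intro!: ball_D0 coord_space_vscale)
  qed
  show "(\<lambda>h. \<psi> (p + vscale s h)) \<in> {h \<in> coord_space n. nrm n h < 1} \<rightarrow> H"
    using * by (auto simp: H_def \<phi>\<psi> \<psi>_D0)
  show "\<psi> (p + vscale s (\<kappa> g)) = g" if "g \<in> H" for g using that by (rule \<psi>_\<kappa>)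
  show "\<kappa> (\<psi> (p + vscale s h)) = h" if "h \<in> {h \<in> coord_space n. nrm n h < 1}" for h
    using * that s0 by (auto simp: \<kappa>_def \<phi>\<psi> vec_apply)
qed

sublocale LL: local_lie v G n H \<kappa> b1
proof (intro local_lie.intro local_lie_axioms.intro lf_axioms is_group)
  show "subgroup H G"
    by (rule subgroupI) (use H_carrier one_H inv_H \<kappa>_mult(1) in auto)
  show "bij_betw \<kappa> H {h \<in> coord_space n. nrm n h < 1}" by (rule bij_\<kappa>)
  show "\<kappa> \<one> = 0" by (rule \<kappa>_one)
  show "v (b1 i l j) \<le> 1" for i l j by (rule b1_le)
  show "nrm n (\<kappa> (g \<otimes> h) - \<kappa> g - \<kappa> h - bil_form n b1 (\<kappa> g) (\<kappa> h))
         \<le> nrm n (\<kappa> g) * nrm n (\<kappa> h) * max (nrm n (\<kappa> g)) (nrm n (\<kappa> h))" if "g \<in> H" "h \<in> H" for g h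
    by (rule \<kappa>_mult(2)[OF that])
qed

lemma LL_br_eq: "LL.br x y = vscale s (bil_form n b x y - bil_form n b y x)"
  by (simp add: LL.br_def bil_form_b1 vscale.scale_right_diff_distrib)

lemma M_br:
  assumes "x \<in> coord_space n" "y \<in> coord_space n"
  shows "mat_app n M (LL.br x y) = LL.br (mat_app n M x) (mat_app n M y)"
proof (rule LL.br_equivariant[OF _ _ _ assms])
  show "\<alpha> (g \<otimes> h) = \<alpha> g \<otimes> \<alpha> h" if "g \<in> carrier G" "h \<in> carrier G" for g h
    using aut_props(1) that by (simp add: hom_def)
  show "\<alpha> g \<in> carrier G" if "g \<in> carrier G" for g
    using aut_props(1) that by (auto simp: hom_def)
  fix e :: real assume e: "0 < e"
  obtain Cf where Cf: "0 \<le> Cf" "\<And>x. nrm n (mat_app n M x) \<le> Cf * nrm n x" using mat_app_bounded by blast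
  obtain r where r: "r > 0" "\<forall>x\<in>coord_space n. \<forall>y\<in>coord_space n. nrm n x < r \<longrightarrow> nrm n y < r \<longrightarrow>
     (\<phi> \<circ> \<alpha> \<circ> \<psi>) (p + x) - p \<in> coord_space n \<and> nrm n (((\<phi> \<circ> \<alpha> \<circ> \<psi>) (p + x) - p) - ((\<phi> \<circ> \<alpha> \<circ> \<psi>) (p + y) - p) - mat_app n M (x - y)) \<le> e * nrm n (x - y)"
    using strict_diff_aut e unfolding strict_diff_def by meson
  obtain r' where r': "r' > 0" "\<forall>x\<in>coord_space n. nrm n (x - p) < r' \<longrightarrow> x \<in> \<phi> ` D0 \<and> \<psi> x \<in> D0 \<and> \<alpha> (\<psi> x) \<in> fst c0"
    using chart_rep_dom[OF aut_analytic(1) aut_props(3) c0_at] by blast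
  \<comment> \<open>The first two radii concern strict differentiability and the domain of the
    chart; the third keeps the image of \<open>g\<close> in the unit ball.\<close>
  define \<delta> where "\<delta> = min (min (r / v s) (r' / v s)) (1 / (Cf + e))"
  have Ce: "0 < Cf + e" using Cf(1) e by linarith
  have "\<alpha> g \<in> H \<and> nrm n (\<kappa> (\<alpha> g) - mat_app n M (\<kappa> g)) \<le> e * nrm n (\<kappa> g)" if g: "g \<in> H" "nrm n (\<kappa> g) < \<delta>" for g
  proof -
    define x where "x = vscale s (\<kappa> g)"
    note x = \<kappa>_small[OF g(1), folded x_def]
    have px: "\<psi> (p + x) = g" unfolding x_def by (rule \<psi>_\<kappa>[OF g(1)])
    have \<delta>: "nrm n x < r" "nrm n x < r'" "(Cf + e) * nrm n (\<kappa> g) < 1"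
      using g(2) s_pos Ce by (simp_all add: \<delta>_def x_def pos_less_divide_eq mult_ac)
    have D: "\<alpha> g \<in> D0" using r'(2)[rule_format, of "p + x"] x(1) \<delta>(2) p_coord by (simp add: coord_space_add px D0_def)
    have "nrm n ((\<phi> (\<alpha> g) - p) - mat_app n M x) \<le> e * nrm n x"
      using r(2)[rule_format, of x 0] x(1) \<delta>(1) r(1) by (simp add: px \<psi>_p aut_props p_def[symmetric])
    moreover have "(\<phi> (\<alpha> g) - p) - mat_app n M x = vscale s (\<kappa> (\<alpha> g) - mat_app n M (\<kappa> g))"
      by (simp add: \<phi>_\<kappa>[of "\<alpha> g"] x_def mat_app.scale vscale.scale_right_diff_distrib)
    ultimately have "v s * nrm n (\<kappa> (\<alpha> g) - mat_app n M (\<kappa> g)) \<le> v s * (e * nrm n (\<kappa> g))" by (simp add: x_def mult_ac)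
    hence est: "nrm n (\<kappa> (\<alpha> g) - mat_app n M (\<kappa> g)) \<le> e * nrm n (\<kappa> g)" using s_pos by simp
    have "e * nrm n (\<kappa> g) \<le> (Cf + e) * nrm n (\<kappa> g)" "Cf * nrm n (\<kappa> g) \<le> (Cf + e) * nrm n (\<kappa> g)"
      using e Cf(1) by (auto intro!: mult_right_mono)
    hence "nrm n ((\<kappa> (\<alpha> g) - mat_app n M (\<kappa> g)) + mat_app n M (\<kappa> g)) \<le> (Cf + e) * nrm n (\<kappa> g)"
      using est Cf(2)[of "\<kappa> g"] by (intro nrm_add_le) linarith+
    hence "nrm n (\<kappa> (\<alpha> g)) < 1" using \<delta>(3) by simp
    hence "\<alpha> g \<in> H" using D s_pos by (simp add: H_def nrm_\<kappa>)
    thus ?thesis using est by blast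
  qed
  moreover have "0 < \<delta>" using r(1) r'(1) s_pos Ce by (simp add: \<delta>_def)
  ultimately show "\<exists>d>0. \<forall>g\<in>H. nrm n (\<kappa> g) < d \<longrightarrow> \<alpha> g \<in> H \<and> nrm n (\<kappa> (\<alpha> g) - mat_app n M (\<kappa> g)) \<le> e * nrm n (\<kappa> g)"
    by blast
qed

section \<open>Nilpotency\<close>

text \<open>The scaling is undone, so that this is the Lie bracket of \<open>L\<close> in the
  coordinates of \<open>c0\<close>.\<close>

definition cbr :: "(nat \<Rightarrow> 'k) \<Rightarrow> (nat \<Rightarrow> 'k) \<Rightarrow> nat \<Rightarrow> 'k" where
  "cbr x y = vscale (inverse s) (LL.br x y)"

lemma lie_bracket_cbr: "t c0 \<in> coord_space n \<Longrightarrow> t' c0 \<in> coord_space n \<Longrightarrow> lie_bracket G A t t' c0 = cbr (t c0) (t' c0)"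
  using s0 by (simp add: lie_bracket_c0 cbr_def LL_br_eq)

sublocale CB: lie_bracket_space vscale "coord_space n :: (nat \<Rightarrow> 'k) set" cbr "unit_coord ` {..<n}"
proof unfold_locales
  show "vscale.subspace (coord_space n :: (nat \<Rightarrow> 'k) set)" by (rule subspace_coord_space)
  show "(coord_space n :: (nat \<Rightarrow> 'k) set) \<subseteq> vscale.span (unit_coord ` {..<n})"
  proof
    fix x :: "nat \<Rightarrow> 'k" assume "x \<in> coord_space n"
    from coord_space_expand[OF this] show "x \<in> vscale.span (unit_coord ` {..<n})"
      by (metis (no_types, lifting) vscale.span_sum vscale.span_scale vscale.span_base imageI)
  qed
  show "cbr x y \<in> coord_space n" for x y unfolding cbr_def by (intro coord_space_vscale LL.br_coord)
  show "cbr (x + x') y = cbr x y + cbr x' y" "cbr x (y + y') = cbr x y + cbr x y'" for x x' y y'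
    by (simp_all add: cbr_def LL.br_linear vscale.scale_right_distrib)
  show "cbr (vscale a x) y = vscale a (cbr x y)" "cbr x (vscale a y) = vscale a (cbr x y)" for a x y
    by (simp_all add: cbr_def LL.br_linear mult.commute)
  show "cbr x x = 0" for x by (simp add: cbr_def LL.br_self)
  show "cbr x y = - cbr y x" for x y
    unfolding cbr_def LL.br_anti[of x y] by (rule vscale.scale_minus_right)
  show "cbr x (cbr y z) = cbr (cbr x y) z + cbr y (cbr x z)"
    if "x \<in> coord_space n" "y \<in> coord_space n" "z \<in> coord_space n" for x y z
    using LL.jacobi_derivation[OF that] by (simp add: cbr_def LL.br_linear vscale.scale_right_distrib[symmetric])
qed simp

lemma cbr_growth:
  assumes "x \<in> growth n M \<rho>" "y \<in> growth n M \<sigma>" shows "cbr x y \<in> growth n M (\<rho> * \<sigma>)"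
proof -
  obtain c B where c: "c 0 = x" "\<forall>k::int. c (k + 1) = mat_app n M (c k)" "\<And>k. nrm n (c k) \<le> B * \<rho> powi k"
    using assms(1) by (auto simp: growth_def)
  obtain c' B' where c': "c' 0 = y" "\<forall>k::int. c' (k + 1) = mat_app n M (c' k)" "\<And>k. nrm n (c' k) \<le> B' * \<sigma> powi k"
    using assms(2) by (auto simp: growth_def)
  have "cbr (c (k + 1)) (c' (k + 1)) = mat_app n M (cbr (c k) (c' k))" for k
    using c(2) c'(2) M_br[OF orbit_in_coord_space[OF c(2)] orbit_in_coord_space[OF c'(2)]]
    by (simp add: cbr_def mat_app.scale)
  moreover have "nrm n (cbr (c k) (c' k)) \<le> (v (inverse s) * B * B') * (\<rho> * \<sigma>) powi k" for k
  proof -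
    have "nrm n (LL.br (c k) (c' k)) \<le> (B * \<rho> powi k) * (B' * \<sigma> powi k)" using c(3) c'(3) by (rule LL.br_le')
    hence "v (inverse s) * nrm n (LL.br (c k) (c' k)) \<le> v (inverse s) * ((B * \<rho> powi k) * (B' * \<sigma> powi k))"
      by (rule mult_left_mono) simp
    thus ?thesis by (simp add: cbr_def power_int_mult_distrib mult_ac)
  qed
  ultimately show ?thesis unfolding growth_def
    by (intro CollectI exI[of _ "\<lambda>k. cbr (c k) (c' k)"] exI[of _ "v (inverse s) * B * B'"]) (simp add: c(1) c'(1))
qed

lemma cbr_power_growth:
  assumes "x \<in> growth n M \<rho>" "y \<in> growth n M \<sigma>" shows "(cbr x ^^ k) y \<in> growth n M (\<rho> ^ k * \<sigma>)"
proof (induction k)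
  case (Suc k)
  show ?case using cbr_growth[OF assms(1) Suc] by (simp add: mult.assoc)
qed (simp add: assms(2))

lemma cbr_power_sum: "(cbr x ^^ k) (\<Sum>i\<in>I. f i) = (\<Sum>i\<in>I. (cbr x ^^ k) (f i))"
proof -
  interpret linear_op "cbr x" by unfold_locales (simp_all add: cbr_def LL.br_linear vscale.scale_right_distrib mult.commute)
  show ?thesis by (induction k) (simp_all add: sum)
qed

lemma coordinates_nilpotent:
  assumes R: "1 \<notin> R n M"
  shows "\<exists>k. lower_central_series vscale (coord_space n) cbr k = {0}"
proof (rule CB.lower_central_series_vanishes)
  let ?W = "\<Union>\<rho>\<in>{0<..}. growth n M \<rho>"
  show "?W \<subseteq> coord_space n" using growth_subset by blast
  show "vscale.span ?W = coord_space n"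
  proof
    show "vscale.span ?W \<subseteq> coord_space n"
      using growth_subset by (intro vscale.span_minimal subspace_coord_space) blast
    show "coord_space n \<subseteq> vscale.span ?W"
    proof
      fix x :: "nat \<Rightarrow> 'k" assume "x \<in> coord_space n"
      then obtain y where y: "x = (\<Sum>\<rho>\<in>R n M. y \<rho>)" "\<forall>\<rho>\<in>R n M. y \<rho> \<in> growth n M \<rho>"
        using growth_decomposition[OF M_inverse(1)] by blast
      have "y \<rho> \<in> vscale.span ?W" if \<rho>: "\<rho> \<in> R n M" for \<rho>
      proof (rule vscale.span_base)
        show "y \<rho> \<in> ?W" using y(2) \<rho> R_pos[OF M_inverse(1) \<rho>] by auto
      qed
      thus "x \<in> vscale.span ?W" unfolding y(1) by (rule vscale.span_sum)
    qed
  qed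
  show "cbr x y \<in> ?W" if xy: "x \<in> ?W" "y \<in> ?W" for x y
  proof -
    obtain \<rho> \<sigma> where "0 < \<rho>" "x \<in> growth n M \<rho>" "0 < \<sigma>" "y \<in> growth n M \<sigma>" using xy by auto
    thus ?thesis using cbr_growth[of x \<rho> y \<sigma>] by (auto intro!: bexI[of _ "\<rho> * \<sigma>"])
  qed
  fix x assume "x \<in> ?W"
  then obtain \<rho> where \<rho>: "0 < \<rho>" "x \<in> growth n M \<rho>" by auto
  show "CB.ad_nilpotent x"
  proof (cases "\<rho> = 1")
    case True
    have "(0::real) < 1" by simp
    from growth_trivial[OF this R] \<rho>(2) True have "x = 0" by simp
    have "cbr 0 y = 0" for y using LL.br_linear(3)[of 0 0 y] by (simp add: cbr_def)
    thus ?thesis unfolding CB.ad_nilpotent_def \<open>x = 0\<close> by (intro exI[of _ 1]) simp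
  next
    case False
    \<comment> \<open>For \<rho> different from 1 the numbers \<open>\<rho> ^ k * \<sigma>\<close>
      are distinct, so only finitely many of them meet the finite set of realised rates. One
      \<open>k\<close> is then taken for all \<sigma>.\<close>
    have "finite {k. \<rho> ^ k * \<sigma> \<in> R n M}" if \<sigma>: "\<sigma> \<in> R n M" for \<sigma>
    proof (rule finite_subset[OF _ finite_vimageI[OF finite_R]])
      show "{k. \<rho> ^ k * \<sigma> \<in> R n M} \<subseteq> (\<lambda>k. \<rho> ^ k * \<sigma>) -` R n M" by auto
      have "0 < \<sigma>" by (rule R_pos[OF M_inverse(1) \<sigma>])
      moreover have "i = j" if "\<rho> ^ i = \<rho> ^ j" for i j
      proof -
        have "real i * ln \<rho> = real j * ln \<rho>" using \<rho>(1) that by (metis ln_realpow)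
        thus ?thesis using False \<rho>(1) by simp
      qed
      ultimately show "inj (\<lambda>k. \<rho> ^ k * \<sigma>)" by (auto simp: inj_def)
    qed
    hence "finite (\<Union>\<sigma>\<in>R n M. {k. \<rho> ^ k * \<sigma> \<in> R n M})" by simp
    then obtain k where k: "k \<notin> (\<Union>\<sigma>\<in>R n M. {k. \<rho> ^ k * \<sigma> \<in> R n M})" by (metis ex_new_if_finite infinite_UNIV_nat)
    have "(cbr x ^^ k) y = 0" if y: "y \<in> coord_space n" for y
    proof -
      obtain z where z: "y = (\<Sum>\<sigma>\<in>R n M. z \<sigma>)" "\<forall>\<sigma>\<in>R n M. z \<sigma> \<in> growth n M \<sigma>"
        using growth_decomposition[OF M_inverse(1) y] by blast
      have "(cbr x ^^ k) (z \<sigma>) = 0" if \<sigma>: "\<sigma> \<in> R n M" for \<sigma>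
      proof (rule growth_trivial)
        show "(cbr x ^^ k) (z \<sigma>) \<in> growth n M (\<rho> ^ k * \<sigma>)" using z(2) \<sigma> \<rho>(2) cbr_power_growth by blast
        show "0 < \<rho> ^ k * \<sigma>" using \<rho>(1) R_pos[OF M_inverse(1) \<sigma>] by simp
        show "\<rho> ^ k * \<sigma> \<notin> R n M" using k \<sigma> by blast
      qed
      thus ?thesis unfolding z(1) cbr_power_sum by (rule sum.neutral[OF ballI])
    qed
    thus ?thesis unfolding CB.ad_nilpotent_def by blast
  qed
qed

text \<open>Reading off the coordinates in \<open>c0\<close> carries brackets to \<open>cbr\<close>,
  and preimages of subspaces are subspaces, so each term lies in the preimage of the corresponding
  term of the coordinate series.\<close>

lemma lower_central_series_c0:
  "lower_central_series tangent_scale L (lie_bracket G A) k \<subseteq>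
     {t. t c0 \<in> lower_central_series vscale (coord_space n) cbr k}"
proof (induction k)
  case 0 thus ?case by (auto simp: L_coord)
next
  case (Suc k)
  have sub: "lower_central_series vscale (coord_space n) cbr k \<subseteq> coord_space n"
  proof (cases k)
    case (Suc j)
    show ?thesis unfolding Suc lower_central_series.simps
      by (rule vscale.span_minimal[OF _ subspace_coord_space]) (auto simp: cbr_def intro!: coord_space_vscale LL.br_coord)
  qed simp
  show ?case unfolding lower_central_series.simps
  proof (rule tangent.span_minimal)
    let ?S = "vscale.span {cbr x y | x y. x \<in> coord_space n \<and> y \<in> lower_central_series vscale (coord_space n) cbr k}"
    show "tangent.subspace {t. t c0 \<in> ?S}"
      by (rule tangent.subspaceI) (auto simp: tangent_c0 vscale.span_zero vscale.span_add vscale.span_scale)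
    show "{lie_bracket G A x y | x y. x \<in> L \<and> y \<in> lower_central_series tangent_scale L (lie_bracket G A) k} \<subseteq> {t. t c0 \<in> ?S}"
    proof clarify
      fix x y assume x: "x \<in> L" and y: "y \<in> lower_central_series tangent_scale L (lie_bracket G A) k"
      have y0: "y c0 \<in> lower_central_series vscale (coord_space n) cbr k" using Suc y by blast
      have "y c0 \<in> coord_space n" using y0 sub by blast
      hence "lie_bracket G A x y c0 = cbr (x c0) (y c0)" using lie_bracket_cbr[of x y] L_coord[OF x] by simp
      thus "lie_bracket G A x y c0 \<in> ?S" using L_coord[OF x] y0 by (auto intro: vscale.span_base)
    qed
  qed
qed

end

theorem (in lie_setup) nilpotent_if_expansive:
  assumes R: "1 \<notin> R n M" shows "nilpotent_lie_algebra tangent_scale L (lie_bracket G A)"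
proof -
  obtain d C b where d: "0 < d" "0 \<le> C" and est: "\<And>x y. x \<in> coord_space n \<Longrightarrow> y \<in> coord_space n \<Longrightarrow> nrm n x \<le> d \<Longrightarrow> nrm n y \<le> d \<Longrightarrow>
     p + x \<in> \<phi> ` D0 \<and> \<psi> (p + x) \<otimes> \<psi> (p + y) \<in> D0 \<and>
     nrm n (\<phi> (\<psi> (p + x) \<otimes> \<psi> (p + y)) - p - x - y - bil_form n b x y) \<le> C * nrm n x * nrm n y * max (nrm n x) (nrm n y)"
    using mult_estimate by blast
  obtain e where e: "e > 0" "\<forall>x\<in>coord_space n. nrm n x < e \<longrightarrow> inv (\<psi> (p + x)) \<in> D0 \<and> nrm n (\<phi> (inv (\<psi> (p + x))) - p) < d"
    using inv_estimate[OF d(1)] by blast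
  define K where "K = Max (insert 0 ((\<lambda>(i, l, j). v (b i l j)) ` ({..<n} \<times> {..<n} \<times> {..<n})))"
  have K0: "0 \<le> K" unfolding K_def by (rule Max_ge) auto
  have K: "v (b i l j) \<le> K" if "i < n" "l < n" "j < n" for i l j
    unfolding K_def using that by (intro Max_ge) (auto intro!: image_eqI[of _ _ "(i, l, j)"])
  have K1: "0 < K + 1" "0 < C * d + 1" using K0 d by (simp_all add: add_nonneg_pos)
  have "0 < min (min d e) (min (1 / (K + 1)) (1 / (C * d + 1)))" using d e K1 by simp
  \<comment> \<open>The bounds serve, in turn, the radius of the product estimate, the radius for
    inverses, the structure constants and the error constant.\<close>
  from ex_small[OF this] obtain s where s: "s \<noteq> 0" "v s < d" "v s < e" "v s < 1 / (K + 1)" "v s < 1 / (C * d + 1)" by auto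
  interpret S: lie_scaled v w G n T A \<alpha> d C b s
  proof (intro lie_scaled.intro lie_product.intro lie_product_axioms.intro lie_scaled_axioms.intro lie_setup_axioms)
    have "v s * (C * d + 1) < 1" using s(5) K1 by (simp add: pos_less_divide_eq)
    moreover have "v s * (C * d + 1) = C * d * v s + v s" by (simp add: algebra_simps)
    ultimately show "C * d * v s < 1" using nonneg[of s] by linarith
    show "v (s * b i l j) \<le> 1" if "i < n" "l < n" "j < n" for i l j
    proof -
      have "v s * v (b i l j) \<le> v s * (K + 1)" using K[OF that] by (intro mult_left_mono) auto
      also have "\<dots> < 1" using s(4) K1 by (simp add: pos_less_divide_eq)
      finally show ?thesis by (simp add: mult)
    qed
    show "v s \<le> d" using s(2) by simp
  qed (use d est e(2) s in auto)
  obtain k where k: "lower_central_series vscale (coord_space n) S.cbr k = {0}" using S.coordinates_nilpotent[OF R] by blast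
  \<comment> \<open>One step after the \<open>k\<close>-th: the elements of the \<open>k\<close>-th
    term are known to have coordinates 0 in \<open>c0\<close>, and brackets with them vanish by
    \<open>lie_bracket_zero\<close>.\<close>
  have "lower_central_series tangent_scale L (lie_bracket G A) (Suc k) = {0}"
    unfolding lower_central_series.simps
  proof
    show "tangent.span {lie_bracket G A x y | x y. x \<in> L \<and> y \<in> lower_central_series tangent_scale L (lie_bracket G A) k} \<subseteq> {0}"
    proof (rule tangent.span_minimal)
      show "{lie_bracket G A x y | x y. x \<in> L \<and> y \<in> lower_central_series tangent_scale L (lie_bracket G A) k} \<subseteq> {0}"
        using S.lower_central_series_c0[of k] k lie_bracket_zero by blast
    qed (rule tangent.subspace_single_0)
  qed (simp add: tangent.span_zero)
  thus ?thesis unfolding nilpotent_lie_algebra_def by blast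
qed

theorem proposition7p1:
  fixes v :: "'k::local_field \<Rightarrow> real"
    and w :: "'k alg_closure \<Rightarrow> real"
    and G :: "('g, 'm) monoid_scheme"
    and n :: nat
    and T :: "'g topology"
    and A :: "('g, 'k) chart set"
    and \<alpha> :: "'g \<Rightarrow> 'g"
  assumes "absolute_value v" and "defines_topology v"
    and "absolute_value w" and "\<forall>x. w (to_ac x) = v x"
    and "lie_group G n T A"
    and "analytic_automorphism G n T A \<alpha>"
  shows "(let L = lie_algebra G n A; \<beta> = lie_map G A \<alpha> in
           (expansive G T \<alpha> \<longleftrightarrow> expansive (additive_group L) (top_of_set L) \<beta>) \<and>
           (expansive (additive_group L) (top_of_set L) \<beta> \<longleftrightarrow>
              1 \<notin> root_abs_values w tangent_scale L \<beta>) \<and>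
           (expansive G T \<alpha> \<longrightarrow> nilpotent_lie_algebra tangent_scale L (lie_bracket G A)))"
proof -
  interpret Group.group G using assms(5) by (simp add: lie_group_def)
  interpret lie_setup v w G n T A \<alpha> by unfold_locales (use assms in auto)
  show ?thesis
    unfolding Let_def using expansive_group_iff expansive_algebra_iff root_abs_values_eq nilpotent_if_expansive by simp
qed

end
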